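(* Let $h_0=1$, $h_{n+1}=4h_n+2^{n+1}$, $F_n=\{0,\dots,h_n-1\}$ and $C_{n+1}=\{0,h_n,2h_n+2^{n+1},3h_n+2^{n+1}\}$ for $n\ge0$, subsets of $G=\mathbb Z$, and let $(X,T)$ be the topological $(C,F)$-action of $\mathbb Z$ associated with $(C_n,F_{n-1})_{n\ge1}$. Let $(Y,O)$, $Y=\varprojlim\mathbb Z/2^n\mathbb Z$, be the 2-adic odometer, $\nu$ the Haar measure on $Y$, and let $\pi:X\to Y$ be the equivariant map whose $k$-th coordinate at $x=(f_n,c_{n+1},c_{n+2},\dots)\in X_n$ is $\lim_{m\to\infty}(f_n+c_{n+1}+\cdots+c_m)+2^k\mathbb Z$. For each finitary AT-flow $V$, there exists a $(C,F)$-measure $\mu$ on $X$ such that (i) $\mu$ is quasi-invariant under $T$ and hence the nonsingular system $(X,\mu,T)$ is of rank one, (ii) the associated flow of the system $(X,\mu,T)$ is isomorphic to $V$, (iii) $\mu\circ\pi^{-1}\sim\nu$, i.e. the 2-adic probability preserving odometer $(Y,\nu,O)$ is a factor of $(X,\mu,T)$, (iv) $(Y,\nu,O)$ is the maximal odometer factor of $(X,\mu,T)$, and (v) the factor mapping $\pi$ is uncountable-to-one (mod 0); hence, $(X,\mu,T)$ is not an odometer. In particular, for each $\lambda\in[0,1]$, there is a $(C,F)$-measure $\mu$ on $X$ such that $(X,\mu,T)$ is of Krieger type $III_\lambda$ and satisfies (i), (iii)–(v).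
   Context: **$(C,F)$-space, action and measures ($G=\mathbb Z$).** $X_n=F_n\times C_{n+1}\times C_{n+2}\times\cdots$ is embedded into $X_{n+1}$ by $(f_n,c_{n+1},c_{n+2},\dots)\mapsto(f_n+c_{n+1},c_{n+2},\dots)$ and $X$ is the inductive limit (increasing union). For $g\in\mathbb Z$, $X^g=\bigcup_n\{(f_n,c_{n+1},\dots)\in X_n: g+f_n\in F_n\}$; $T_gx=(g+f_n,c_{n+1},\dots)$ for $x\in X^{\mathbb Z}:=\bigcap_gX^g$, with $n$ large enough that $x=(f_n,c_{n+1},\dots)\in X_n$ and $g+f_n\in F_n$. A $(C,F)$-measure is a Borel measure $\mu$ on $X$ with $\mu([f]_n)=\nu_n(f)$ for $f\in F_n$, $n\ge0$ ($[f]_n$ = points of $X_n$ with first coordinate $f$), where $\nu_0(0)=1$, $\nu_n$ is a fully supported finite measure on $F_n$ and $\kappa_n$ a fully supported probability on $C_n$ with $\nu_{n+1}(f+c)=\nu_n(f)\kappa_{n+1}(c)$ and $\prod_n\max_{c\in C_n}\kappa_n(c)=0$. Quasi-invariance under $T$ includes $\mu(X\setminus X^{\mathbb Z})=0$. **Rank one.** A free nonsingular $G$-action $T$ on a $\sigma$-finite standard non-atomic space $(X,\mu)$ is of rank one if there are finite sets $\{1_G\}=F_0\subset F_1\subset\cdots$ in $G$ and measurable sets $B_0\supset B_1\supset\cdots$ of positive finite measure such that for each $n$ the sets $T_fB_n$, $f\in F_n$, are disjoint and each $\frac{d\mu\circ T_f}{d\mu}$, $f\in F_n$, is constant on $B_n$;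 the partitions $\xi_n=\{T_fB_n: f\in F_n\}$ of $\bigsqcup_{f\in F_n}T_fB_n$ satisfy that each element of $\xi_n$ is a union of elements of $\xi_{n+1}$, and $\bigvee_n\xi_n$ is the partition into points (mod 0); and for a.e. $x$ the orbit of $x$ is $\bigcup_n\{T_gx: g\in F_nf^{-1}\}$, the union being over $n$ with $x\in T_fB_n$, $f\in F_n$. **Odometers.** The 2-adic odometer: $1\in\mathbb Z$ acts on $Y=\varprojlim\mathbb Z/2^n\mathbb Z$ by translation by $(1+2^n\mathbb Z)_n$. More generally, a nonsingular $\mathbb Z$-odometer is $\varprojlim\mathbb Z/\Gamma_n$ for a strictly decreasing sequence of finite-index subgroups with trivial intersection, with the translation action and a quasi-invariant measure. Maximal odometer factor: every nonsingular odometer factor of $(X,\mu,T)$ is a factor of it. $\pi$ is uncountable-to-one (mod 0) if the conditional measures on the fibres $\pi^{-1}(y)$ (in the disintegration over $Y$ of a probability equivalent to $\mu$) are non-atomic for a.e. $y$. **Associated flow, Krieger type.** Let $\mathcal R$ be a countable Borel equivalence relation on a standard $\sigma$-finite space $(Z,\gamma)$, nonsingular and ergodic, with Radon–Nikodym cocycle $\rho_\gamma$, where $\rho_\gamma(\theta z,z)=\frac{d\gamma\circ\theta}{d\gamma}(z)$ for $\theta$ in the full group of $\mathcal R$. On $(Z\times\mathbb R,\gamma\otimes\mathrm{Leb})$ let $(z,t)\sim(z',t')$ iff $(z,z')\in\mathcal R$ and $t'=t-\log\rho_\gamma(z,z')$. The associated flow of $\mathcal R$ is the action of $\mathbb R$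 by translations along the second coordinate restricted to the $\sigma$-algebra of $\sim$-invariant sets. The associated flow of an ergodic nonsingular action is that of its orbit equivalence relation. The action is of type $II$ if the flow is transitive and aperiodic; of type $III_\lambda$, $0<\lambda<1$, if the flow is transitive and periodic with least positive period $-\log\lambda$; of type $III_1$ if the flow is the trivial flow on a singleton; of type $III_0$ otherwise. **Finitary AT-flow.** An ergodic nonsingular flow isomorphic to the associated flow of the tail equivalence relation on a probability space $\bigotimes_{n\ge1}(A_n,\alpha_n)$ with $\#A_n=2$, $\alpha_n$ a fully supported probability on $A_n$ and $\bigotimes_n\alpha_n$ non-atomic. *)

theory Defs
  imports "HOL-Probability.Probability" "HOL-Algebra.Elementary_Groups"
begin

section \<open>Measure spaces\<close>

definition standard_borel :: "'a measure \<Rightarrow> bool" where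
  "standard_borel M \<longleftrightarrow>
    (\<exists>\<tau>. topspace \<tau> = space M \<and> completely_metrizable_space \<tau> \<and> second_countable \<tau> \<and>
         sets M = sigma_sets (space M) {U. openin \<tau> U})"

definition nonatomic :: "'a measure \<Rightarrow> bool" where
  "nonatomic M \<longleftrightarrow>
    (\<forall>A\<in>sets M. emeasure M A > 0 \<longrightarrow>
       (\<exists>B\<in>sets M. B \<subseteq> A \<and> emeasure M B > 0 \<and> emeasure M (A - B) > 0))"

definition measure_equivalent :: "'a measure \<Rightarrow> 'a measure \<Rightarrow> bool" where
  "measure_equivalent M N \<longleftrightarrow> sets M = sets N \<and> null_sets M = null_sets N"

definition eq_mod_null :: "'a measure \<Rightarrow> 'a set \<Rightarrow> 'a set \<Rightarrow> bool" where
  "eq_mod_null M A B \<longleftrightarrow> (A - B) \<union> (B - A) \<in> null_sets M"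

section \<open>Nonsingular actions of the integers\<close>

definition nonsingular_action :: "'a measure \<Rightarrow> (int \<Rightarrow> 'a \<Rightarrow> 'a) \<Rightarrow> bool" where
  "nonsingular_action M T \<longleftrightarrow>
    (\<forall>g. T g \<in> measurable M M) \<and>
    (\<forall>x\<in>space M. T 0 x = x) \<and>
    (\<forall>g h. \<forall>x\<in>space M. T (g + h) x = T g (T h x)) \<and>
    (\<forall>g. \<forall>A\<in>sets M. emeasure M (T g -` A \<inter> space M) = 0 \<longleftrightarrow> emeasure M A = 0)"

definition free_action :: "'a measure \<Rightarrow> (int \<Rightarrow> 'a \<Rightarrow> 'a) \<Rightarrow> bool" where
  "free_action M T \<longleftrightarrow> (AE x in M. \<forall>g. g \<noteq> 0 \<longrightarrow> T g x \<noteq> x)"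

text \<open>The derivative of \<open>A \<mapsto> M (T f ` A)\<close>, that is of the image of \<open>M\<close> under \<open>T (- f)\<close>.\<close>

definition action_deriv :: "'a measure \<Rightarrow> (int \<Rightarrow> 'a \<Rightarrow> 'a) \<Rightarrow> int \<Rightarrow> 'a \<Rightarrow> ennreal" where
  "action_deriv M T f = RN_deriv M (distr M M (T (- f)))"

definition rank_one :: "'a measure \<Rightarrow> (int \<Rightarrow> 'a \<Rightarrow> 'a) \<Rightarrow> bool" where
  "rank_one M T \<longleftrightarrow>
    standard_borel M \<and> sigma_finite_measure M \<and> nonatomic M \<and>
    nonsingular_action M T \<and> free_action M T \<and>
    (\<exists>(F :: nat \<Rightarrow> int set) (B :: nat \<Rightarrow> 'a set).
      F 0 = {0} \<and>
      (\<forall>n. finite (F n) \<and> F n \<subseteq> F (Suc n)) \<and>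
      (\<forall>n. B n \<in> sets M \<and> B (Suc n) \<subseteq> B n \<and> 0 < emeasure M (B n) \<and> emeasure M (B n) < \<infinity>) \<and>
      (\<forall>n. disjoint_family_on (\<lambda>f. T f ` B n) (F n)) \<and>
      (\<forall>n. \<forall>f\<in>F n. \<exists>r. AE x in M. x \<in> B n \<longrightarrow> action_deriv M T f x = r) \<and>
      (\<forall>n. \<forall>f\<in>F n. \<exists>S\<subseteq>F (Suc n). T f ` B n = (\<Union>s\<in>S. T s ` B (Suc n))) \<and>
      (\<exists>N\<in>null_sets M. \<forall>x\<in>space M - N. \<forall>y\<in>space M - N. x \<noteq> y \<longrightarrow>
         (\<exists>n. \<exists>f\<in>F n. x \<in> T f ` B n \<and> y \<notin> T f ` B n)) \<and>
      (AE x in M. range (\<lambda>g. T g x) =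
         (\<Union>n. \<Union>f\<in>{f\<in>F n. x \<in> T f ` B n}. (\<lambda>g. T (g - f) x) ` F n)))"

definition factor_map ::
  "'a measure \<Rightarrow> (int \<Rightarrow> 'a \<Rightarrow> 'a) \<Rightarrow> 'b measure \<Rightarrow> (int \<Rightarrow> 'b \<Rightarrow> 'b) \<Rightarrow> ('a \<Rightarrow> 'b) \<Rightarrow> bool" where
  "factor_map M T N S p \<longleftrightarrow>
    p \<in> measurable M N \<and>
    (AE x in M. \<forall>g. p (T g x) = S g (p x)) \<and>
    measure_equivalent (distr M N p) N"

definition is_factor ::
  "'a measure \<Rightarrow> (int \<Rightarrow> 'a \<Rightarrow> 'a) \<Rightarrow> 'b measure \<Rightarrow> (int \<Rightarrow> 'b \<Rightarrow> 'b) \<Rightarrow> bool" where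
  "is_factor M T N S \<longleftrightarrow> (\<exists>p. factor_map M T N S p)"

definition isomorphic_systems ::
  "'a measure \<Rightarrow> (int \<Rightarrow> 'a \<Rightarrow> 'a) \<Rightarrow> 'b measure \<Rightarrow> (int \<Rightarrow> 'b \<Rightarrow> 'b) \<Rightarrow> bool" where
  "isomorphic_systems M T N S \<longleftrightarrow>
    (\<exists>p q. factor_map M T N S p \<and> factor_map N S M T q \<and>
       (AE x in M. q (p x) = x) \<and> (AE y in N. p (q y) = y))"

definition disintegration ::
  "'a measure \<Rightarrow> 'b measure \<Rightarrow> ('a \<Rightarrow> 'b) \<Rightarrow> ('b \<Rightarrow> 'a measure) \<Rightarrow> bool" where
  "disintegration P N p K \<longleftrightarrow>
    K \<in> measurable N (prob_algebra P) \<and>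
    (\<forall>A\<in>sets P. emeasure P A = (\<integral>\<^sup>+y. emeasure (K y) A \<partial>(distr P N p))) \<and>
    (AE y in distr P N p. AE x in K y. p x = y)"

text \<open>The choice of the probability \<open>P\<close> in the class of \<open>M\<close> and of the disintegration is
  immaterial: another choice replaces almost every \<open>K y\<close> by an equivalent measure.\<close>

definition uncountable_to_one :: "'a measure \<Rightarrow> 'b measure \<Rightarrow> ('a \<Rightarrow> 'b) \<Rightarrow> bool" where
  "uncountable_to_one M N p \<longleftrightarrow>
    (\<exists>P K. prob_space P \<and> measure_equivalent P M \<and> disintegration P N p K \<and>
       (AE y in distr P N p. nonatomic (K y)))"

section \<open>Odometers\<close>

text \<open>A point of the inverse limit of the quotients of the integers by \<open>\<Gamma> n\<close> is the sequence of
  its coordinates, each of which is a coset; the condition \<open>y (Suc n) \<subseteq> y n\<close> says that the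
  projection onto the \<open>n\<close>-th quotient maps \<open>y (Suc n)\<close> to \<open>y n\<close>.\<close>

definition odometer_seq :: "(nat \<Rightarrow> int set) \<Rightarrow> bool" where
  "odometer_seq \<Gamma> \<longleftrightarrow>
    (\<forall>n. subgroup (\<Gamma> n) integer_group \<and> finite (rcosets\<^bsub>integer_group\<^esub> (\<Gamma> n)) \<and>
         \<Gamma> (Suc n) \<subset> \<Gamma> n) \<and>
    (\<Inter>n. \<Gamma> n) = {0}"

definition odometer_space :: "(nat \<Rightarrow> int set) \<Rightarrow> (nat \<Rightarrow> int set) set" where
  "odometer_space \<Gamma> =
    {y. \<forall>n. y n \<in> rcosets\<^bsub>integer_group\<^esub> (\<Gamma> n) \<and> y (Suc n) \<subseteq> y n}"

definition odometer_borel :: "(nat \<Rightarrow> int set) \<Rightarrow> (nat \<Rightarrow> int set) measure" where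
  "odometer_borel \<Gamma> =
    restrict_space (\<Pi>\<^sub>M n\<in>UNIV. count_space (rcosets\<^bsub>integer_group\<^esub> (\<Gamma> n))) (odometer_space \<Gamma>)"

definition odometer_add :: "(nat \<Rightarrow> int set) \<Rightarrow> (nat \<Rightarrow> int set) \<Rightarrow> nat \<Rightarrow> int set" where
  "odometer_add y z = (\<lambda>n. y n <#>\<^bsub>integer_group\<^esub> z n)"

definition odometer_act :: "(nat \<Rightarrow> int set) \<Rightarrow> int \<Rightarrow> (nat \<Rightarrow> int set) \<Rightarrow> nat \<Rightarrow> int set" where
  "odometer_act \<Gamma> g y = odometer_add (\<lambda>n. \<Gamma> n #>\<^bsub>integer_group\<^esub> g) y"

definition haar_measure :: "(nat \<Rightarrow> int set) \<Rightarrow> (nat \<Rightarrow> int set) measure \<Rightarrow> bool" where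
  "haar_measure \<Gamma> \<nu> \<longleftrightarrow>
    prob_space \<nu> \<and> sets \<nu> = sets (odometer_borel \<Gamma>) \<and>
    (\<forall>z\<in>odometer_space \<Gamma>. distr \<nu> \<nu> (odometer_add z) = \<nu>)"

definition nonsingular_odometer :: "(nat \<Rightarrow> int set) \<Rightarrow> (nat \<Rightarrow> int set) measure \<Rightarrow> bool" where
  "nonsingular_odometer \<Gamma> \<eta> \<longleftrightarrow>
    odometer_seq \<Gamma> \<and> sets \<eta> = sets (odometer_borel \<Gamma>) \<and> sigma_finite_measure \<eta> \<and>
    nonsingular_action \<eta> (odometer_act \<Gamma>)"

definition maximal_odometer_factor ::
  "'a measure \<Rightarrow> (int \<Rightarrow> 'a \<Rightarrow> 'a) \<Rightarrow> (nat \<Rightarrow> int set) \<Rightarrow> (nat \<Rightarrow> int set) measure \<Rightarrow> bool" where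
  "maximal_odometer_factor M T \<Gamma> \<nu> \<longleftrightarrow>
    nonsingular_odometer \<Gamma> \<nu> \<and> is_factor M T \<nu> (odometer_act \<Gamma>) \<and>
    (\<forall>\<Delta> \<eta>. nonsingular_odometer \<Delta> \<eta> \<longrightarrow> is_factor M T \<eta> (odometer_act \<Delta>) \<longrightarrow>
       is_factor \<nu> (odometer_act \<Gamma>) \<eta> (odometer_act \<Delta>))"

definition is_odometer :: "'a measure \<Rightarrow> (int \<Rightarrow> 'a \<Rightarrow> 'a) \<Rightarrow> bool" where
  "is_odometer M T \<longleftrightarrow>
    (\<exists>\<Delta> \<eta>. nonsingular_odometer \<Delta> \<eta> \<and> isomorphic_systems M T \<eta> (odometer_act \<Delta>))"

section \<open>Flows\<close>

definition nonsingular_flow :: "'a measure \<Rightarrow> (real \<Rightarrow> 'a \<Rightarrow> 'a) \<Rightarrow> bool" where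
  "nonsingular_flow M V \<longleftrightarrow>
    standard_borel M \<and> sigma_finite_measure M \<and>
    (\<lambda>(t, x). V t x) \<in> measurable (borel \<Otimes>\<^sub>M M) M \<and>
    (\<forall>x\<in>space M. V 0 x = x) \<and>
    (\<forall>s t. \<forall>x\<in>space M. V (s + t) x = V s (V t x)) \<and>
    (\<forall>t. \<forall>A\<in>sets M. emeasure M (V t -` A \<inter> space M) = 0 \<longleftrightarrow> emeasure M A = 0)"

definition ergodic_flow :: "'a measure \<Rightarrow> (real \<Rightarrow> 'a \<Rightarrow> 'a) \<Rightarrow> bool" where
  "ergodic_flow M V \<longleftrightarrow>
    (\<forall>A\<in>sets M. (\<forall>t. eq_mod_null M (V t -` A \<inter> space M) A) \<longrightarrow>
       emeasure M A = 0 \<or> emeasure M (space M - A) = 0)"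

definition transitive_flow :: "'a measure \<Rightarrow> (real \<Rightarrow> 'a \<Rightarrow> 'a) \<Rightarrow> bool" where
  "transitive_flow M V \<longleftrightarrow> (\<exists>x\<in>space M. AE y in M. \<exists>t. y = V t x)"

definition flow_period :: "'a measure \<Rightarrow> (real \<Rightarrow> 'a \<Rightarrow> 'a) \<Rightarrow> real \<Rightarrow> bool" where
  "flow_period M V p \<longleftrightarrow> p > 0 \<and> (AE x in M. V p x = x)"

text \<open>Isomorphism is expressed by an equivariant isomorphism \<open>\<Phi>\<close> of the Boolean \<open>\<sigma>\<close>-algebras of
  measurable sets modulo null sets, so that it makes sense for flows that are given on a
  \<open>\<sigma>\<close>-algebra that does not separate points. Between standard spaces it is equivalent to
  isomorphism by point maps (mod 0). Only the null sets of the measures enter.\<close>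

definition isomorphic_flows ::
  "'a measure \<Rightarrow> (real \<Rightarrow> 'a \<Rightarrow> 'a) \<Rightarrow> 'b measure \<Rightarrow> (real \<Rightarrow> 'b \<Rightarrow> 'b) \<Rightarrow> bool" where
  "isomorphic_flows M V N W \<longleftrightarrow>
    (\<exists>\<Phi> :: 'a set \<Rightarrow> 'b set.
      (\<forall>A\<in>sets M. \<Phi> A \<in> sets N) \<and>
      (\<forall>A\<in>sets M. \<forall>B\<in>sets M. eq_mod_null M A B \<longleftrightarrow> eq_mod_null N (\<Phi> A) (\<Phi> B)) \<and>
      (\<forall>B\<in>sets N. \<exists>A\<in>sets M. eq_mod_null N (\<Phi> A) B) \<and>
      (\<forall>A\<in>sets M. eq_mod_null N (\<Phi> (space M - A)) (space N - \<Phi> A)) \<and>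
      (\<forall>A :: nat \<Rightarrow> 'a set. range A \<subseteq> sets M \<longrightarrow> eq_mod_null N (\<Phi> (\<Union>i. A i)) (\<Union>i. \<Phi> (A i))) \<and>
      (\<forall>t. \<forall>A\<in>sets M.
         eq_mod_null N (\<Phi> (V t -` A \<inter> space M)) (W t -` \<Phi> A \<inter> space N)))"

section \<open>Countable equivalence relations, associated flow, Krieger type\<close>

definition ergodic_nonsingular_relation :: "'z measure \<Rightarrow> ('z \<times> 'z) set \<Rightarrow> bool" where
  "ergodic_nonsingular_relation \<gamma> R \<longleftrightarrow>
    standard_borel \<gamma> \<and> sigma_finite_measure \<gamma> \<and>
    equiv (space \<gamma>) R \<and> R \<in> sets (\<gamma> \<Otimes>\<^sub>M \<gamma>) \<and> (\<forall>z\<in>space \<gamma>. countable (R `` {z})) \<and>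
    (\<forall>A\<in>null_sets \<gamma>. R `` A \<in> null_sets \<gamma>) \<and>
    (\<forall>A\<in>sets \<gamma>. R `` A \<subseteq> A \<longrightarrow> emeasure \<gamma> A = 0 \<or> emeasure \<gamma> (space \<gamma> - A) = 0)"

definition full_group :: "'z measure \<Rightarrow> ('z \<times> 'z) set \<Rightarrow> ('z \<Rightarrow> 'z) set" where
  "full_group \<gamma> R =
    {\<theta>. bij_betw \<theta> (space \<gamma>) (space \<gamma>) \<and> \<theta> \<in> measurable \<gamma> \<gamma> \<and>
        the_inv_into (space \<gamma>) \<theta> \<in> measurable \<gamma> \<gamma> \<and> (\<forall>z\<in>space \<gamma>. (\<theta> z, z) \<in> R)}"

text \<open>The measure \<open>A \<mapsto> \<gamma> (\<theta> ` A)\<close> is the image of \<open>\<gamma>\<close> under the inverse of \<open>\<theta>\<close>. The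
  Radon-Nikodym cocycle is unique up to a null set, hence it is characterized by a predicate.\<close>

definition rn_cocycle :: "'z measure \<Rightarrow> ('z \<times> 'z) set \<Rightarrow> ('z \<Rightarrow> 'z \<Rightarrow> real) \<Rightarrow> bool" where
  "rn_cocycle \<gamma> R \<rho> \<longleftrightarrow>
    (\<lambda>(x, y). \<rho> x y) \<in> borel_measurable (restrict_space (\<gamma> \<Otimes>\<^sub>M \<gamma>) R) \<and>
    (\<forall>(x, y)\<in>R. \<rho> x y > 0) \<and>
    (\<forall>x y z. (x, y) \<in> R \<longrightarrow> (y, z) \<in> R \<longrightarrow> \<rho> x z = \<rho> x y * \<rho> y z) \<and>
    (\<forall>\<theta>\<in>full_group \<gamma> R. AE z in \<gamma>.
       RN_deriv \<gamma> (distr \<gamma> \<gamma> (the_inv_into (space \<gamma>) \<theta>)) z = ennreal (\<rho> (\<theta> z) z))"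

definition skew_relation :: "('z \<times> 'z) set \<Rightarrow> ('z \<Rightarrow> 'z \<Rightarrow> real) \<Rightarrow> (('z \<times> real) \<times> ('z \<times> real)) set" where
  "skew_relation R \<rho> = {((z, t), (z', t')). (z, z') \<in> R \<and> t' = t - ln (\<rho> z z')}"

definition skew_invariant_space ::
  "'z measure \<Rightarrow> ('z \<times> 'z) set \<Rightarrow> ('z \<Rightarrow> 'z \<Rightarrow> real) \<Rightarrow> ('z \<times> real) measure" where
  "skew_invariant_space \<gamma> R \<rho> =
    measure_of (space \<gamma> \<times> UNIV)
      {A \<in> sets (\<gamma> \<Otimes>\<^sub>M lborel). skew_relation R \<rho> `` A \<subseteq> A}
      (emeasure (\<gamma> \<Otimes>\<^sub>M lborel))"

definition is_associated_flow ::
  "'z measure \<Rightarrow> ('z \<times> 'z) set \<Rightarrow> 'v measure \<Rightarrow> (real \<Rightarrow> 'v \<Rightarrow> 'v) \<Rightarrow> bool" where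
  "is_associated_flow \<gamma> R M V \<longleftrightarrow>
    ergodic_nonsingular_relation \<gamma> R \<and>
    (\<exists>\<rho>. rn_cocycle \<gamma> R \<rho> \<and>
       isomorphic_flows (skew_invariant_space \<gamma> R \<rho>) (\<lambda>s (z, t). (z, t + s)) M V)"

definition orbit_relation :: "'a measure \<Rightarrow> (int \<Rightarrow> 'a \<Rightarrow> 'a) \<Rightarrow> ('a \<times> 'a) set" where
  "orbit_relation M T = {(x, y). x \<in> space M \<and> y \<in> space M \<and> (\<exists>g. y = T g x)}"

text \<open>The types are defined through point realizations of the associated flow. It is no
  restriction to take these on sets of reals, as every standard Borel space is isomorphic to a
  Borel subset of the real line.\<close>

definition type_II :: "'z measure \<Rightarrow> ('z \<times> 'z) set \<Rightarrow> bool" where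
  "type_II \<gamma> R \<longleftrightarrow>
    (\<exists>(M :: real measure) V. nonsingular_flow M V \<and> is_associated_flow \<gamma> R M V \<and>
       transitive_flow M V \<and> (\<nexists>p. flow_period M V p))"

definition type_III_proper :: "'z measure \<Rightarrow> ('z \<times> 'z) set \<Rightarrow> real \<Rightarrow> bool" where
  "type_III_proper \<gamma> R l \<longleftrightarrow> 0 < l \<and> l < 1 \<and>
    (\<exists>(M :: real measure) V. nonsingular_flow M V \<and> is_associated_flow \<gamma> R M V \<and>
       transitive_flow M V \<and> flow_period M V (- ln l) \<and>
       (\<forall>p. flow_period M V p \<longrightarrow> - ln l \<le> p))"

definition type_III_one :: "'z measure \<Rightarrow> ('z \<times> 'z) set \<Rightarrow> bool" where
  "type_III_one \<gamma> R \<longleftrightarrow>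
    (\<exists>(M :: real measure) V. nonsingular_flow M V \<and> is_associated_flow \<gamma> R M V \<and>
       (\<exists>x. space M = {x}))"

definition type_III_zero :: "'z measure \<Rightarrow> ('z \<times> 'z) set \<Rightarrow> bool" where
  "type_III_zero \<gamma> R \<longleftrightarrow>
    ergodic_nonsingular_relation \<gamma> R \<and>
    \<not> type_II \<gamma> R \<and> (\<nexists>l. type_III_proper \<gamma> R l) \<and> \<not> type_III_one \<gamma> R"

definition krieger_type_III :: "'a measure \<Rightarrow> (int \<Rightarrow> 'a \<Rightarrow> 'a) \<Rightarrow> real \<Rightarrow> bool" where
  "krieger_type_III M T l \<longleftrightarrow>
    nonsingular_action M T \<and>
    (if l = 0 then type_III_zero M (orbit_relation M T)
     else if l = 1 then type_III_one M (orbit_relation M T)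
     else type_III_proper M (orbit_relation M T) l)"

definition tail_relation :: "((nat \<Rightarrow> 'b) \<times> (nat \<Rightarrow> 'b)) set" where
  "tail_relation = {(x, y). \<exists>N. \<forall>n\<ge>N. x n = y n}"

text \<open>Every two-point set is modelled by \<open>bool\<close>; the factors are numbered from \<open>0\<close>.\<close>

definition finitary_AT_flow :: "'v measure \<Rightarrow> (real \<Rightarrow> 'v \<Rightarrow> 'v) \<Rightarrow> bool" where
  "finitary_AT_flow M V \<longleftrightarrow>
    nonsingular_flow M V \<and> ergodic_flow M V \<and>
    (\<exists>\<alpha> :: nat \<Rightarrow> bool pmf.
       (\<forall>n. set_pmf (\<alpha> n) = UNIV) \<and>
       nonatomic (\<Pi>\<^sub>M n\<in>UNIV. measure_pmf (\<alpha> n)) \<and>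
       is_associated_flow (\<Pi>\<^sub>M n\<in>UNIV. measure_pmf (\<alpha> n)) tail_relation M V)"

section \<open>The \<open>(C,F)\<close>-construction for the integers\<close>

text \<open>The triple \<open>(n, f, c)\<close> stands for the point \<open>(f, c (n+1), c (n+2), \<dots>)\<close> of \<open>X\<^sub>n\<close>. The
  value \<open>C 0\<close> is never used. The inductive limit is the quotient of the disjoint union of the
  \<open>X\<^sub>n\<close> that identifies two points when their images in some \<open>X\<^sub>N\<close> coincide.\<close>

type_synonym cf_rep = "nat \<times> int \<times> (nat \<Rightarrow> int)"

definition cf_reps :: "(nat \<Rightarrow> int set) \<Rightarrow> (nat \<Rightarrow> int set) \<Rightarrow> cf_rep set" where
  "cf_reps F C = {(n, f, c). f \<in> F n \<and> c \<in> (\<Pi>\<^sub>E k\<in>{n<..}. C k)}"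

definition cf_embed :: "cf_rep \<Rightarrow> cf_rep" where
  "cf_embed = (\<lambda>(n, f, c). (Suc n, f + c (Suc n), restrict c {Suc n<..}))"

definition cf_rel :: "(nat \<Rightarrow> int set) \<Rightarrow> (nat \<Rightarrow> int set) \<Rightarrow> (cf_rep \<times> cf_rep) set" where
  "cf_rel F C = {(p, q). p \<in> cf_reps F C \<and> q \<in> cf_reps F C \<and>
                         (\<exists>i j. (cf_embed ^^ i) p = (cf_embed ^^ j) q)}"

definition cf_space :: "(nat \<Rightarrow> int set) \<Rightarrow> (nat \<Rightarrow> int set) \<Rightarrow> cf_rep set set" where
  "cf_space F C = cf_reps F C // cf_rel F C"

definition cf_point :: "(nat \<Rightarrow> int set) \<Rightarrow> (nat \<Rightarrow> int set) \<Rightarrow> nat \<Rightarrow> int \<Rightarrow> (nat \<Rightarrow> int) \<Rightarrow> cf_rep set" where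
  "cf_point F C n f c = cf_rel F C `` {(n, f, c)}"

definition cf_cylinder :: "(nat \<Rightarrow> int set) \<Rightarrow> (nat \<Rightarrow> int set) \<Rightarrow> nat \<Rightarrow> int \<Rightarrow> cf_rep set set" where
  "cf_cylinder F C n f = cf_point F C n f ` (\<Pi>\<^sub>E k\<in>{n<..}. C k)"

text \<open>The topology is the inductive limit of the product topologies of the \<open>X\<^sub>n\<close>.\<close>

definition cf_open :: "(nat \<Rightarrow> int set) \<Rightarrow> (nat \<Rightarrow> int set) \<Rightarrow> cf_rep set set \<Rightarrow> bool" where
  "cf_open F C U \<longleftrightarrow> U \<subseteq> cf_space F C \<and>
    (\<forall>n. openin
      (prod_topology (discrete_topology (F n))
                     (product_topology (\<lambda>k. discrete_topology (C k)) {n<..}))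
      {(f, c). f \<in> F n \<and> c \<in> (\<Pi>\<^sub>E k\<in>{n<..}. C k) \<and> cf_point F C n f c \<in> U})"

definition cf_borel :: "(nat \<Rightarrow> int set) \<Rightarrow> (nat \<Rightarrow> int set) \<Rightarrow> cf_rep set measure" where
  "cf_borel F C = sigma (cf_space F C) {U. cf_open F C U}"

definition cf_dom :: "(nat \<Rightarrow> int set) \<Rightarrow> (nat \<Rightarrow> int set) \<Rightarrow> int \<Rightarrow> cf_rep set set" where
  "cf_dom F C g = {x \<in> cf_space F C. \<exists>(n, f, c)\<in>x. g + f \<in> F n}"

definition cf_global :: "(nat \<Rightarrow> int set) \<Rightarrow> (nat \<Rightarrow> int set) \<Rightarrow> cf_rep set set" where
  "cf_global F C = (\<Inter>g. cf_dom F C g)"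

definition cf_act :: "(nat \<Rightarrow> int set) \<Rightarrow> (nat \<Rightarrow> int set) \<Rightarrow> int \<Rightarrow> cf_rep set \<Rightarrow> cf_rep set" where
  "cf_act F C g x =
    (THE y. \<exists>n f c. (n, f, c) \<in> x \<and> g + f \<in> F n \<and> y = cf_point F C n (g + f) c)"

definition cf_measure :: "(nat \<Rightarrow> int set) \<Rightarrow> (nat \<Rightarrow> int set) \<Rightarrow> cf_rep set measure \<Rightarrow> bool" where
  "cf_measure F C \<mu> \<longleftrightarrow>
    sets \<mu> = sets (cf_borel F C) \<and>
    (\<exists>(\<nu> :: nat \<Rightarrow> int \<Rightarrow> real) (\<kappa> :: nat \<Rightarrow> int \<Rightarrow> real).
      \<nu> 0 0 = 1 \<and>
      (\<forall>n. \<forall>f\<in>F n. \<nu> n f > 0) \<and>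
      (\<forall>n\<ge>1. (\<forall>c\<in>C n. \<kappa> n c > 0) \<and> (\<Sum>c\<in>C n. \<kappa> n c) = 1) \<and>
      (\<forall>n. \<forall>f\<in>F n. \<forall>c\<in>C (Suc n). \<nu> (Suc n) (f + c) = \<nu> n f * \<kappa> (Suc n) c) \<and>
      (\<lambda>N. \<Prod>n=1..N. Max (\<kappa> n ` C n)) \<longlonglongrightarrow> 0 \<and>
      (\<forall>n. \<forall>f\<in>F n. emeasure \<mu> (cf_cylinder F C n f) = ennreal (\<nu> n f)))"

text \<open>The part of \<open>(X, \<mu>)\<close> on which all the partial maps \<open>T\<^sub>g\<close> are defined; it carries the
  nonsingular system \<open>(X, \<mu>, T)\<close>.\<close>

definition cf_system :: "(nat \<Rightarrow> int set) \<Rightarrow> (nat \<Rightarrow> int set) \<Rightarrow> cf_rep set measure \<Rightarrow> cf_rep set measure" where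
  "cf_system F C \<mu> = restrict_space \<mu> (cf_global F C)"

definition cf_quasi_invariant :: "(nat \<Rightarrow> int set) \<Rightarrow> (nat \<Rightarrow> int set) \<Rightarrow> cf_rep set measure \<Rightarrow> bool" where
  "cf_quasi_invariant F C \<mu> \<longleftrightarrow>
    cf_space F C - cf_global F C \<in> null_sets \<mu> \<and>
    nonsingular_action (cf_system F C \<mu>) (cf_act F C)"

text \<open>The limit of a sequence of cosets in a discrete quotient is its eventual value. The
  definition is used when the sequence of partial sums is eventually constant modulo every
  \<open>\<Gamma> k\<close>.\<close>

definition cf_odometer_map :: "(nat \<Rightarrow> int set) \<Rightarrow> cf_rep set \<Rightarrow> nat \<Rightarrow> int set" where
  "cf_odometer_map \<Gamma> x =
    (\<lambda>k. THE a. \<exists>(n, f, c)\<in>x.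
       \<forall>\<^sub>F m in sequentially. \<Gamma> k #>\<^bsub>integer_group\<^esub> (f + (\<Sum>i\<in>{n<..m}. c i)) = a)"

end

theory Submission
 imports Defs
begin

text \<open>
 Every point of \<open>X\<close> is coded by two sequences of bits \<open>(a, b)\<close>, since an element of
 \<open>C (n + 1)\<close> is \<open>a h n + b (2 h n + 2 ^ (n + 1))\<close>. The measure makes the \<open>a\<close>-bits fair and
 gives the \<open>b\<close>-bits the law \<open>\<alpha>\<close>; spacer levels are weighted by the bits \<open>b\<close> they determine,
 so that the Radon-Nikodym cocycle of \<open>T\<close> is the tail cocycle evaluated at \<open>b\<close>. By the
 zero-one law in \<open>a\<close>, the associated flow is that of the tail relation of \<open>\<alpha>\<close>. Modulo
 \<open>2 ^ (n + 1)\<close> only \<open>a n 2 ^ n\<close> is added at stage \<open>n\<close>, so the fair bits are a function of the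
 odometer point and of \<open>b\<close>, and the fibres of \<open>\<pi>\<close> carry the non-atomic law of \<open>b\<close>. If
 \<open>h i \<notin> \<Delta> n\<close> for infinitely many \<open>i\<close>, flipping \<open>a i\<close> would move a set of positive measure off
 itself for all these \<open>i\<close>, which is impossible as flips preserve the law; hence an odometer
 factor only sees powers of \<open>2\<close> and, by ergodicity, factors through \<open>\<pi>\<close> up to a translation.
 Constant, two-periodic and block sequences \<open>\<alpha>\<close> give the types with \<open>0 < l < 1\<close>, \<open>l = 1\<close> and \<open>l = 0\<close>.
\<close>

text \<open>The heights are \<open>h n = 2 ^ n * (2 ^ (n + 1) - 1)\<close>, while
  \<open>2 * h n + 2 ^ (n + 1)\<close> is \<open>4 ^ (n + 1)\<close>. So \<open>b n\<close> enters
  far above the binary place that \<open>a n\<close> decides, and for each fixed \<open>b\<close>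
  the passage from \<open>a\<close> to the odometer point carries coin tossing to Haar measure.
  Hence the odometer point is not merely distributed like Haar measure but independent of
  \<open>b\<close>; this is what lets the flow, a matter of \<open>b\<close>, be prescribed without
  disturbing the odometer. The spacers stand in the middle of the four copies. Points with
  \<open>a n ~= b n\<close> lie in the two inner copies and have room \<open>h n\<close> on both
  sides; as this happens infinitely often, almost every point has a full orbit. The same spacers
  give \<open>h (n + 1) - 4 * h n = 2 ^ (n + 1)\<close>, the source of the powers of 2 in odometer
  factors. For type III_0 it has to be excluded that any associated flow is transitive. The blocks
  are built so that the flow rotates circles of length \<open>2 ^ m * ln 2\<close> for all
  \<open>m\<close> at once; a single orbit would fix the positions on all these circles, and fixing
  them leaves only a null set.\<close>

section \<open>General facts on measures and standard Borel spaces\<close>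

lemma nonatomicI:
 assumes small: "!!e. e > 0 ==> EX A :: nat => 'a set. range A \<subseteq> sets M & space M \<subseteq> (\<Union>i. A i) &
   (ALL i. emeasure M (A i) < ennreal e)"
 shows "nonatomic M"
 unfolding nonatomic_def
proof (intro ballI impI)
 fix D assume D: "D : sets M" "emeasure M D > 0"
 \<comment> \<open>The mass of \<open>D\<close> may be infinite, so a finite lower bound is
   taken.\<close>
 obtain e :: real where e: "e > 0" "ennreal e <= emeasure M D"
 proof (cases "emeasure M D")
  case (real r)
  thus ?thesis using that[of r] D by (simp add: ennreal_less_zero_iff)
 next
  case top
  thus ?thesis using that[of 1] by simp
 qed
 obtain A :: "nat => 'a set" where A: "range A \<subseteq> sets M" "space M \<subseteq> (\<Union>i. A i)" "!!i. emeasure M (A i) < ennreal e"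
  using small[OF e(1)] by blast
 have "EX i. emeasure M (D Int A i) > 0"
 proof (rule ccontr)
  assume "\<not> ?thesis"
  hence "!!i. D Int A i : null_sets M"
   using A(1) D(1) by (intro null_setsI) (auto simp: zero_less_iff_neq_zero)
  hence "(\<Union>i. D Int A i) : null_sets M" by blast
  moreover have "D = (\<Union>i. D Int A i)" using A(2) sets.sets_into_space[OF D(1)] by auto
  ultimately show False using D(2) by (metis null_setsD1 less_irrefl)
 qed
 then obtain i where i: "emeasure M (D Int A i) > 0" by blast
 have Ai: "A i : sets M" using A(1) by auto
 have "emeasure M (D - D Int A i) > 0"
 proof (rule ccontr)
  assume "\<not> ?thesis"
  hence z: "emeasure M (D - D Int A i) = 0" by (simp add: zero_less_iff_neq_zero)
  have "emeasure M D = emeasure M ((D Int A i) Un (D - D Int A i))" by (simp add: Un_absorb1)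
  also have "... <= emeasure M (D Int A i) + emeasure M (D - D Int A i)"
   using D Ai by (intro emeasure_subadditive) auto
  also have "... <= emeasure M (A i)" using z Ai by (simp add: emeasure_mono)
  also have "... < emeasure M D" using A(3)[of i] e(2) by simp
  finally show False by simp
 qed
 thus "EX B:sets M. B \<subseteq> D & 0 < emeasure M B & 0 < emeasure M (D - B)"
  using i D Ai by (intro bexI[of _ "D Int A i"]) auto
qed

text \<open>Induction over the generated sigma-algebra. A countable union is first cut off at a
  finite stage, at the price of half of the error.\<close>

lemma algebra_approx:
 assumes fin: "finite_measure M" and alg: "algebra (space M) \<A>"
  and gen: "sets M = sigma_sets (space M) \<A>" and D: "D : sets M" and "e > 0"
 shows "EX A:\<A>. measure M ((D - A) Un (A - D)) < e"
proof -
 interpret finite_measure M by fact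
 interpret algebra "space M" \<A> by fact
 have A_sets: "A : \<A> ==> A : sets M" for A unfolding gen by (rule sigma_sets.Basic)
 have "D : sigma_sets (space M) \<A>" using D gen by simp
 thus ?thesis using \<open>e > 0\<close>
 proof (induction D arbitrary: e)
  case (Basic a)
  thus ?case by (intro bexI[of _ a]) auto
 next
  case Empty
  thus ?case by (intro bexI[of _ "{}"]) auto
 next
  case (Compl a)
  then obtain A where A: "A : \<A>" "measure M ((a - A) Un (A - a)) < e" by blast
  have "a \<subseteq> space M" using Compl.hyps gen sets.sets_into_space by blast
  hence "((space M - a) - (space M - A)) Un ((space M - A) - (space M - a)) = (a - A) Un (A - a)"
   using A_sets[OF A(1)] sets.sets_into_space by blast
  thus ?case using A by (intro bexI[of _ "space M - A"]) auto
 next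
  case (Union a)
  have as: "a i : sets M" for i using Union.hyps gen by simp
  have "(%n. measure M (\<Union>i<n. a i)) \<longlonglongrightarrow> measure M (\<Union>n. \<Union>i<n. a i)"
   using as by (intro finite_Lim_measure_incseq) (auto simp: incseq_def intro: less_le_trans)
  moreover have "(\<Union>n. \<Union>i<n. a i) = (\<Union>i. a i)" by auto
  ultimately have "(%n. measure M (\<Union>i<n. a i)) \<longlonglongrightarrow> measure M (\<Union>i. a i)" by simp
  hence "\<forall>\<^sub>F n in sequentially. measure M (\<Union>i. a i) - e / 2 < measure M (\<Union>i<n. a i)"
   using Union.prems by (intro order_tendstoD(1)) auto
  then obtain N where N: "measure M (\<Union>i. a i) - e / 2 < measure M (\<Union>i<N. a i)"
   by (auto simp: eventually_sequentially)
  \<comment> \<open>The other half is shared among \<open>N\<close> sets; \<open>N + 1\<close> keeps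
    the quotient meaningful for \<open>N = 0\<close>.\<close>
  define d where "d = e / (2 * (real N + 1))"
  have d: "d > 0" using Union.prems by (simp add: d_def)
  then obtain A where A: "!!i. A i : \<A>" "!!i. measure M ((a i - A i) Un (A i - a i)) < d"
   using Union.IH by metis
  let ?A = "\<Union>i<N. A i"
  have AN: "?A : \<A>" using A(1) by (intro finite_UN) auto
  have "((\<Union>i. a i) - ?A) Un (?A - (\<Union>i. a i)) \<subseteq> ((\<Union>i. a i) - (\<Union>i<N. a i)) Un (\<Union>i<N. (a i - A i) Un (A i - a i))"
   by auto
  hence "measure M (((\<Union>i. a i) - ?A) Un (?A - (\<Union>i. a i)))
    <= measure M (((\<Union>i. a i) - (\<Union>i<N. a i)) Un (\<Union>i<N. (a i - A i) Un (A i - a i)))"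
   using as A_sets[OF A(1)] by (intro finite_measure_mono) auto
  also have "... <= measure M ((\<Union>i. a i) - (\<Union>i<N. a i)) + measure M (\<Union>i<N. (a i - A i) Un (A i - a i))"
   using as A_sets[OF A(1)] by (intro measure_Un_le) auto
  also have "measure M ((\<Union>i. a i) - (\<Union>i<N. a i)) = measure M (\<Union>i. a i) - measure M (\<Union>i<N. a i)"
   using as by (intro finite_measure_Diff) auto
  also have "measure M (\<Union>i<N. (a i - A i) Un (A i - a i)) <= (\<Sum>i<N. measure M ((a i - A i) Un (A i - a i)))"
   using as A_sets[OF A(1)] by (intro finite_measure_subadditive_finite) auto
  also have "... <= (\<Sum>i<N. d)" using A(2) by (intro sum_mono) (simp add: less_imp_le)
  also have "... <= e / 2" using Union.prems by (simp add: d_def field_simps)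
  finally show ?case using N AN by (intro bexI[of _ ?A]) auto
 qed
qed

text \<open>Made for measures that are only known locally, on cylinders where the action is a shift
  of levels. The cover is made disjoint and the pieces are summed.\<close>

lemma measure_eqI_countable_cover:
 assumes sets: "sets M = sets N" and I: "countable I" and A: "!!i. i : I ==> A i : sets M"
  and cover: "space M \<subseteq> (\<Union>i\<in>I. A i)"
  and eq: "!!i B. i : I ==> B : sets M ==> B \<subseteq> A i ==> emeasure M B = emeasure N B"
 shows "M = N"
proof (rule measure_eqI[OF sets])
 fix X assume X: "X : sets M"
 \<comment> \<open>Enumerates the cover by the naturals and pads it with empty sets.\<close>
 define A' where "A' n = (if n : to_nat_on I ` I then A (from_nat_into I n) else {})" for n
 have A'1: "A' n : sets M" for n using A I by (auto simp: A'_def)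
 have A'2: "emeasure M B = emeasure N B" if "B : sets M" "B \<subseteq> A' n" for B n
  using that eq I by (auto simp: A'_def split: if_splits)
 have cov: "space M \<subseteq> (\<Union>n. A' n)"
 proof
  fix x assume "x : space M"
  then obtain i where "i : I" "x : A i" using cover by auto
  hence "x : A' (to_nat_on I i)" using I by (auto simp: A'_def)
  thus "x : (\<Union>n. A' n)" by auto
 qed
 have X_eq: "X = (\<Union>n. X Int disjointed A' n)"
  using cov sets.sets_into_space[OF X] by (auto simp: UN_disjointed_eq simp flip: Int_UN_distrib)
 have dis: "disjoint_family (%n. X Int disjointed A' n)"
  using disjoint_family_disjointed[of A'] by (auto simp: disjoint_family_on_def)
 have m: "X Int disjointed A' n : sets M" for n
  using X A'1 by (intro sets.Int sets.range_disjointed_sets[THEN range_subsetD]) auto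
 have "emeasure M X = (\<Sum>n. emeasure M (X Int disjointed A' n))"
  using m dis by (subst X_eq, intro suminf_emeasure[symmetric]) auto
 also have "... = (\<Sum>n. emeasure N (X Int disjointed A' n))"
  using m disjointed_subset[of A'] by (intro suminf_cong A'2) auto
 also have "... = emeasure N X"
  using m dis sets by (subst (2) X_eq, intro suminf_emeasure) auto
 finally show "emeasure M X = emeasure N X" .
qed

text \<open>A G-delta subset of a Polish space is completely metrizable, and generating a
  sigma-algebra commutes with preimages. So the topology pulled back along the injection is the
  required one.\<close>

lemma standard_borelI:
 fixes f :: "'a => 'b :: polish_space"
 assumes inj: "inj_on f (space M)" and gd: "gdelta_in euclidean (f ` space M)"
  and sets: "sets M = {f -` B Int space M | B. B : sets borel}"
 shows "standard_borel M"
proof -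
 define \<tau> where "\<tau> = pullback_topology (space M) f euclidean"
 let ?\<sigma> = "subtopology euclidean (f ` space M)"
 define g where "g = inv_into (space M) f"
 have top: "topspace \<tau> = space M" by (simp add: \<tau>_def topspace_pullback_topology)
 have c1: "continuous_map \<tau> ?\<sigma> f"
  unfolding continuous_map_in_subtopology
  using continuous_map_pullback[of euclidean euclidean id "space M" f] top by (auto simp: \<tau>_def)
 have "continuous_map ?\<sigma> euclidean (f \<circ> g)"
 proof (rule continuous_map_eq)
  show "continuous_map ?\<sigma> euclidean id" by (simp add: continuous_map_from_subtopology)
 qed (auto simp: g_def f_inv_into_f)
 hence c2: "continuous_map ?\<sigma> \<tau> g"
  unfolding \<tau>_def by (intro continuous_map_pullback') (auto simp: g_def inv_into_into)
 have "homeomorphic_maps \<tau> ?\<sigma> f g"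
  unfolding homeomorphic_maps_def using c1 c2 top inj by (auto simp: g_def f_inv_into_f)
 hence h: "\<tau> homeomorphic_space ?\<sigma>" unfolding homeomorphic_space_def by blast
 have "completely_metrizable_space ?\<sigma>"
  by (intro completely_metrizable_space_gdelta_in completely_metrizable_space_euclidean gd)
 hence 1: "completely_metrizable_space \<tau>" using homeomorphic_completely_metrizable_space[OF h] by simp
 have sce: "second_countable (euclidean :: 'b topology)"
 proof -
  obtain B :: "'b set set" where B: "countable B" "topological_basis B" using ex_countable_basis by blast
  have "EX V:B. x : V & V \<subseteq> U" if "open U" "x : U" for U x
   using topological_basisE[OF B(2) that] by blast
  thus ?thesis unfolding second_countable_def
   using B(1) topological_basis_open[OF B(2)] by (intro exI[of _ B]) simp
 qed
 hence 2: "second_countable \<tau>"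
  using homeomorphic_space_second_countability[OF h] second_countable_subtopology[OF sce, of "f ` space M"] by simp
 have "sets M = sigma_sets (space M) {f -` A Int space M | A. A : {S. open S}}"
  unfolding sets sets_borel by (rule sigma_sets_vimage_commute) auto
 also have "{f -` A Int space M | A. A : {S. open S}} = {U. openin \<tau> U}"
  by (auto simp: \<tau>_def openin_pullback_topology)
 finally show ?thesis unfolding standard_borel_def using top 1 2 by blast
qed

section \<open>Boolean isomorphism of flows\<close>

lemma eq_mod_null_iff_AE:
 assumes "A : sets M" "B : sets M"
 shows "eq_mod_null M A B \<longleftrightarrow> (AE x in M. x : A \<longleftrightarrow> x : B)"
proof -
 have "{x\<in>space M. \<not> (x : A \<longleftrightarrow> x : B)} = (A - B) Un (B - A)"
  using assms sets.sets_into_space by blast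
 moreover have "(A - B) Un (B - A) : sets M" using assms by auto
 ultimately show ?thesis
  unfolding eq_mod_null_def by (subst AE_iff_null) auto
qed

text \<open>Just what symmetry and transitivity of \<open>isomorphic_flows\<close> require. It is
  weaker than \<open>nonsingular_flow\<close> and so also covers
  \<open>skew_invariant_space\<close>, whose sigma-algebra need not separate points.\<close>

definition flow_ok :: "'a measure => (real => 'a => 'a) => bool" where
 "flow_ok M V \<longleftrightarrow> (ALL t. ALL A:sets M. V t -` A Int space M : sets M &
   (A : null_sets M --> V t -` A Int space M : null_sets M))"

lemma flow_ok_eq_mod:
 assumes "flow_ok M V" "A : sets M" "B : sets M" "eq_mod_null M A B"
 shows "eq_mod_null M (V t -` A Int space M) (V t -` B Int space M)"
proof -
 have "V t -` ((A - B) Un (B - A)) Int space M : null_sets M"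
  using assms unfolding flow_ok_def eq_mod_null_def by blast
 moreover have "V t -` ((A - B) Un (B - A)) Int space M =
   (V t -` A Int space M - V t -` B Int space M) Un (V t -` B Int space M - V t -` A Int space M)" by auto
 ultimately show ?thesis unfolding eq_mod_null_def by simp
qed

lemma eq_mod_null_refl [simp]: "eq_mod_null M A A"
 by (simp add: eq_mod_null_def)

lemma eq_mod_null_sym: "eq_mod_null M A B ==> eq_mod_null M B A"
 by (simp add: eq_mod_null_def Un_commute)

lemma eq_mod_null_trans:
 assumes "eq_mod_null M A B" "eq_mod_null M B C"
 shows "eq_mod_null M A C"
proof -
 let ?D = "%A B. (A - B) Un (B - A)"
 have "E : null_sets M ==> E' : null_sets M ==> ?D E E' : null_sets M" for E E'
  by (intro null_sets.Un null_set_Diff) auto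
 hence "?D (?D A B) (?D B C) : null_sets M"
  using assms unfolding eq_mod_null_def by blast
 moreover have "?D (?D A B) (?D B C) = ?D A C" by auto
 ultimately show ?thesis unfolding eq_mod_null_def by simp
qed

lemma eq_mod_null_compl:
 assumes "A : sets M" "B : sets M" "eq_mod_null M A B"
 shows "eq_mod_null M (space M - A) (space M - B)"
 using assms by (auto simp: eq_mod_null_iff_AE sets.compl_sets elim!: AE_mp intro!: AE_I2)

lemma eq_mod_null_UN:
 fixes A B :: "nat => 'a set"
 assumes "range A \<subseteq> sets M" "range B \<subseteq> sets M" "!!i. eq_mod_null M (A i) (B i)"
 shows "eq_mod_null M (\<Union>i. A i) (\<Union>i. B i)"
proof -
 have "AE x in M. ALL i. x : A i \<longleftrightarrow> x : B i"
  using assms by (subst AE_all_countable) (auto simp: eq_mod_null_iff_AE range_subsetD)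
 hence "AE x in M. x : (\<Union>i. A i) \<longleftrightarrow> x : (\<Union>i. B i)"
  by (rule AE_mp) (auto intro!: AE_I2)
 thus ?thesis using assms by (subst eq_mod_null_iff_AE) auto
qed

text \<open>The body of \<open>isomorphic_flows\<close> with its witness exposed, so that the
  clauses can be quoted for a given \<Phi>.\<close>

definition flow_iso ::
 "'a measure => (real => 'a => 'a) => 'b measure => (real => 'b => 'b) => ('a set => 'b set) => bool" where
 "flow_iso M V N W \<Phi> \<longleftrightarrow>
   (ALL A:sets M. \<Phi> A : sets N) &
   (ALL A:sets M. ALL B:sets M. eq_mod_null M A B \<longleftrightarrow> eq_mod_null N (\<Phi> A) (\<Phi> B)) &
   (ALL B:sets N. EX A:sets M. eq_mod_null N (\<Phi> A) B) &
   (ALL A:sets M. eq_mod_null N (\<Phi> (space M - A)) (space N - \<Phi> A)) &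
   (ALL A :: nat => 'a set. range A \<subseteq> sets M --> eq_mod_null N (\<Phi> (\<Union>i. A i)) (\<Union>i. \<Phi> (A i))) &
   (ALL t. ALL A:sets M.
     eq_mod_null N (\<Phi> (V t -` A Int space M)) (W t -` \<Phi> A Int space N))"

lemma isomorphic_flows_iff: "isomorphic_flows M V N W \<longleftrightarrow> (EX \<Phi>. flow_iso M V N W \<Phi>)"
 unfolding isomorphic_flows_def flow_iso_def ..

lemma flow_isoD:
 assumes "flow_iso M V N W \<Phi>"
 shows "A : sets M ==> \<Phi> A : sets N"
  and "A : sets M ==> B : sets M ==> eq_mod_null M A B \<longleftrightarrow> eq_mod_null N (\<Phi> A) (\<Phi> B)"
  and "C : sets N ==> EX A:sets M. eq_mod_null N (\<Phi> A) C"
  and "A : sets M ==> eq_mod_null N (\<Phi> (space M - A)) (space N - \<Phi> A)"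
  and "range E \<subseteq> sets M ==> eq_mod_null N (\<Phi> (\<Union>i::nat. E i)) (\<Union>i. \<Phi> (E i))"
  and "A : sets M ==> eq_mod_null N (\<Phi> (V t -` A Int space M)) (W t -` \<Phi> A Int space N)"
 using assms unfolding flow_iso_def by (elim conjE, simp)+

text \<open>The inverse picks, by choice, a set whose image under \<Phi> is \<open>B\<close> mod
  null. Injectivity of \<Phi> mod null reduces every clause to a computation of images under
  \<Phi>.\<close>

lemma isomorphic_flows_sym:
 assumes iso: "isomorphic_flows M V N W" and V: "flow_ok M V" and W: "flow_ok N W"
 shows "isomorphic_flows N W M V"
proof -
 obtain \<Phi> where \<Phi>: "flow_iso M V N W \<Phi>" using iso by (auto simp: isomorphic_flows_iff)
 note m = flow_isoD(1)[OF \<Phi>] and i = flow_isoD(2)[OF \<Phi>] and s = flow_isoD(3)[OF \<Phi>]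
  and c = flow_isoD(4)[OF \<Phi>] and u = flow_isoD(5)[OF \<Phi>] and e = flow_isoD(6)[OF \<Phi>]
 obtain \<Psi> where \<Psi>: "!!B. B : sets N ==> \<Psi> B : sets M & eq_mod_null N (\<Phi> (\<Psi> B)) B"
  using s by metis
 have key: "eq_mod_null M (\<Psi> B) A" if "A : sets M" "B : sets N" "eq_mod_null N (\<Phi> A) B" for A B
  using that \<Psi> i eq_mod_null_trans eq_mod_null_sym by metis
 have Vm: "V t -` A Int space M : sets M" if "A : sets M" for t A using V that by (auto simp: flow_ok_def)
 have Wm: "W t -` A Int space N : sets N" if "A : sets N" for t A using W that by (auto simp: flow_ok_def)
 show ?thesis unfolding isomorphic_flows_def
 proof (intro exI[of _ \<Psi>] conjI ballI allI impI)
  show "\<Psi> A : sets M" if "A : sets N" for A using \<Psi> that by blast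
  show "eq_mod_null N A B \<longleftrightarrow> eq_mod_null M (\<Psi> A) (\<Psi> B)" if "A : sets N" "B : sets N" for A B
  proof -
   have "eq_mod_null M (\<Psi> A) (\<Psi> B) \<longleftrightarrow> eq_mod_null N (\<Phi> (\<Psi> A)) (\<Phi> (\<Psi> B))" using \<Psi> i that by blast
   also have "... \<longleftrightarrow> eq_mod_null N A B" using \<Psi>[OF that(1)] \<Psi>[OF that(2)] eq_mod_null_trans eq_mod_null_sym by metis
   finally show ?thesis by simp
  qed
  show "EX A:sets N. eq_mod_null M (\<Psi> A) B" if "B : sets M" for B
   using key[of B "\<Phi> B"] that m by auto
  show "eq_mod_null M (\<Psi> (space N - A)) (space M - \<Psi> A)" if "A : sets N" for A
  proof (rule key)
   show "eq_mod_null N (\<Phi> (space M - \<Psi> A)) (space N - A)"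
    using \<Psi>[OF that] that m by (intro eq_mod_null_trans[OF c eq_mod_null_compl]) auto
  qed (use that \<Psi> in auto)
  show "eq_mod_null M (\<Psi> (\<Union>i. A i)) (\<Union>i. \<Psi> (A i))" if A: "range A \<subseteq> sets N" for A :: "nat => _"
  proof (rule key)
   have "range (%i. \<Psi> (A i)) \<subseteq> sets M" using A \<Psi> by auto
   moreover have "eq_mod_null N (\<Union>i. \<Phi> (\<Psi> (A i))) (\<Union>i. A i)"
    using A \<Psi> m by (intro eq_mod_null_UN) (auto simp: range_subsetD)
   ultimately show "eq_mod_null N (\<Phi> (\<Union>i. \<Psi> (A i))) (\<Union>i. A i)"
    using u[of "%i. \<Psi> (A i)"] eq_mod_null_trans by blast
  qed (use A \<Psi> in auto)
  show "eq_mod_null M (\<Psi> (W t -` A Int space N)) (V t -` \<Psi> A Int space M)" if A: "A : sets N" for t A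
  proof (rule key)
   show "eq_mod_null N (\<Phi> (V t -` \<Psi> A Int space M)) (W t -` A Int space N)"
    using e[of "\<Psi> A" t] \<Psi>[OF A] flow_ok_eq_mod[OF W _ A, of "\<Phi> (\<Psi> A)" t] m eq_mod_null_trans by blast
  qed (use A \<Psi> Vm Wm in auto)
 qed
qed

lemma isomorphic_flows_trans:
 assumes iso1: "isomorphic_flows M V N W" and iso2: "isomorphic_flows N W K U"
  and V: "flow_ok M V" and W: "flow_ok N W"
 shows "isomorphic_flows M V K U"
proof -
 obtain \<Phi> where \<Phi>: "flow_iso M V N W \<Phi>" using iso1 by (auto simp: isomorphic_flows_iff)
 note m = flow_isoD(1)[OF \<Phi>] and i = flow_isoD(2)[OF \<Phi>] and s = flow_isoD(3)[OF \<Phi>]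
  and c = flow_isoD(4)[OF \<Phi>] and u = flow_isoD(5)[OF \<Phi>] and e = flow_isoD(6)[OF \<Phi>]
 obtain \<Psi> where \<Psi>: "flow_iso N W K U \<Psi>" using iso2 by (auto simp: isomorphic_flows_iff)
 note m' = flow_isoD(1)[OF \<Psi>] and i' = flow_isoD(2)[OF \<Psi>] and s' = flow_isoD(3)[OF \<Psi>]
  and c' = flow_isoD(4)[OF \<Psi>] and u' = flow_isoD(5)[OF \<Psi>] and e' = flow_isoD(6)[OF \<Psi>]
 have Vm: "V t -` A Int space M : sets M" if "A : sets M" for t A using V that by (auto simp: flow_ok_def)
 have Wm: "W t -` A Int space N : sets N" if "A : sets N" for t A using W that by (auto simp: flow_ok_def)
 have i'': "eq_mod_null K (\<Psi> A) C" if "A : sets N" "B : sets N" "eq_mod_null N A B" "eq_mod_null K (\<Psi> B) C" for A B C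
  using that i' eq_mod_null_trans by blast
 show ?thesis unfolding isomorphic_flows_def
 proof (intro exI[of _ "\<Psi> \<circ> \<Phi>"] conjI ballI allI impI; unfold comp_apply)
  show "\<Psi> (\<Phi> A) : sets K" if "A : sets M" for A using m m' that by blast
  show "eq_mod_null M A B \<longleftrightarrow> eq_mod_null K (\<Psi> (\<Phi> A)) (\<Psi> (\<Phi> B))" if "A : sets M" "B : sets M" for A B
   using i i' m that by blast
  show "EX A:sets M. eq_mod_null K (\<Psi> (\<Phi> A)) B" if "B : sets K" for B
   using s'[OF that] s m i'' by meson
  show "eq_mod_null K (\<Psi> (\<Phi> (space M - A))) (space K - \<Psi> (\<Phi> A))" if "A : sets M" for A
   using that by (intro i''[OF _ _ c c'] m sets.compl_sets) auto
  show "eq_mod_null K (\<Psi> (\<Phi> (\<Union>i. A i))) (\<Union>i. \<Psi> (\<Phi> (A i)))" if A: "range A \<subseteq> sets M" for A :: "nat => _"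
   using A m by (intro i''[OF _ _ u u'] sets.countable_UN) (auto intro!: m)
  show "eq_mod_null K (\<Psi> (\<Phi> (V t -` A Int space M))) (U t -` \<Psi> (\<Phi> A) Int space K)" if "A : sets M" for t A
   using that by (intro i''[OF _ _ e e'] m Vm Wm) auto
 qed
qed

text \<open>The source of all concrete isomorphisms below: an equivariant map on a conull invariant
  set that reflects null sets and reaches every measurable set mod null. The isomorphism takes
  preimages, so it runs from the target of \<open>q\<close> to its source.\<close>

lemma isomorphic_flows_pullback:
 assumes G: "G : sets M" "space M - G : null_sets M"
  and q: "!!A. A : sets N ==> q -` A Int G : sets M"
  and null: "!!A. A : sets N ==> q -` A Int G : null_sets M \<longleftrightarrow> A : null_sets N"
  and qsp: "!!x. x : G ==> q x : space N"
  and VG: "!!t x. x : space M ==> V t x : G \<longleftrightarrow> x : G"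
  and eqv: "!!t x. x : G ==> q (V t x) = W t (q x)"
  and surj: "!!B. B : sets M ==> EX A:sets N. eq_mod_null M (q -` A Int G) B"
 shows "isomorphic_flows N W M V"
 unfolding isomorphic_flows_def
proof (intro exI[of _ "%A. q -` A Int G"] conjI ballI allI impI)
 have GM: "G \<subseteq> space M" using G(1) sets.sets_into_space by blast
 show "q -` A Int G : sets M" if "A : sets N" for A using q that by blast
 show "eq_mod_null N A B = eq_mod_null M (q -` A Int G) (q -` B Int G)" if "A : sets N" "B : sets N" for A B
 proof -
  have "(q -` A Int G - q -` B Int G) Un (q -` B Int G - q -` A Int G) = q -` ((A - B) Un (B - A)) Int G" by auto
  thus ?thesis unfolding eq_mod_null_def using null[of "(A - B) Un (B - A)"] that by auto
 qed
 show "EX A:sets N. eq_mod_null M (q -` A Int G) B" if "B : sets M" for B using surj that by blast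
 show "eq_mod_null M (q -` (space N - A) Int G) (space M - q -` A Int G)" if "A : sets N" for A
 proof -
  have "(q -` (space N - A) Int G - (space M - q -` A Int G)) Un ((space M - q -` A Int G) - q -` (space N - A) Int G) = space M - G"
   using qsp GM by auto
  thus ?thesis unfolding eq_mod_null_def using G(2) by simp
 qed
 show "eq_mod_null M (q -` (\<Union>i. A i) Int G) (\<Union>i. q -` A i Int G)" for A :: "nat => _"
 proof -
  have "q -` (\<Union>i. A i) Int G = (\<Union>i. q -` A i Int G)" by auto
  thus ?thesis by simp
 qed
 show "eq_mod_null M (q -` (W t -` A Int space N) Int G) (V t -` (q -` A Int G) Int space M)" for t A
 proof -
  have "q -` (W t -` A Int space N) Int G = V t -` (q -` A Int G) Int space M"
   using eqv VG qsp GM by auto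
  thus ?thesis by simp
 qed
qed

lemma nonsingular_flow_ok: "nonsingular_flow M V ==> flow_ok M V"
proof -
 assume n: "nonsingular_flow M V"
 have mV: "(%(t, x). V t x) : measurable (borel \<Otimes>\<^sub>M M) M" using n by (simp add: nonsingular_flow_def)
 have "V t : measurable M M" for t
  using measurable_compose[OF measurable_Pair1'[of t borel M] mV] by simp
 thus "flow_ok M V" using n unfolding flow_ok_def nonsingular_flow_def
  by (auto intro!: null_setsI measurable_sets)
qed

section \<open>The skew product\<close>

text \<open>The algebraic half of \<open>rn_cocycle\<close>. Over an equivalence relation it already
  makes the skew relation symmetric.\<close>

definition pos_cocycle :: "('z \<times> 'z) set => ('z => 'z => real) => bool" where
 "pos_cocycle R \<rho> \<longleftrightarrow> (ALL (x, y):R. \<rho> x y > 0) &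
  (ALL x y z. (x, y) : R --> (y, z) : R --> \<rho> x z = \<rho> x y * \<rho> y z)"

lemma rn_pos_cocycle: "rn_cocycle \<gamma> R \<rho> ==> pos_cocycle R \<rho>"
 by (simp add: rn_cocycle_def pos_cocycle_def)

lemma pos_cocycleD:
 assumes "pos_cocycle R \<rho>"
 shows "(x, y) : R ==> \<rho> x y > 0" "(x, y) : R ==> (y, z) : R ==> \<rho> x z = \<rho> x y * \<rho> y z"
 using assms by (auto simp: pos_cocycle_def)

lemma pos_cocycle_refl:
 assumes "pos_cocycle R \<rho>" "(x, x) : R" shows "\<rho> x x = 1"
 using pos_cocycleD(1)[OF assms] pos_cocycleD(2)[OF assms(1) assms(2) assms(2)] by simp

lemma pos_cocycle_inverse:
 assumes "pos_cocycle R \<rho>" "(x, y) : R" "(y, x) : R" "(x, x) : R" shows "\<rho> y x = 1 / \<rho> x y"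
 using pos_cocycleD(1)[OF assms(1,2)] pos_cocycleD(2)[OF assms(1,2,3)] pos_cocycle_refl[OF assms(1,4)]
 by (simp add: field_simps)

lemma skew_relation_sym:
 assumes "equiv S R" "pos_cocycle R \<rho>" "(p, p') : skew_relation R \<rho>"
 shows "(p', p) : skew_relation R \<rho>"
proof -
 obtain z t z' t' where p: "p = (z, t)" "p' = (z', t')" "(z, z') : R" "t' = t - ln (\<rho> z z')"
  using assms(3) by (auto simp: skew_relation_def)
 have R: "(z', z) : R" "(z, z) : R"
  using assms(1) p(3) by (meson equivE symD, meson equivE symD transD)
 have "\<rho> z' z = 1 / \<rho> z z'" by (rule pos_cocycle_inverse[OF assms(2) p(3) R])
 moreover have "\<rho> z z' > 0" using pos_cocycleD(1)[OF assms(2) p(3)] .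
 ultimately show ?thesis using p R by (simp add: skew_relation_def ln_div)
qed

text \<open>\<open>measure_of\<close> yields the intended sets and values only if the invariant sets
  form a sigma-algebra. Closure under complements is the real point; it rests on the symmetry of the
  skew relation.\<close>

lemma skew_space:
 assumes R: "equiv (space \<gamma>) R" and \<rho>: "pos_cocycle R \<rho>"
 shows "space (skew_invariant_space \<gamma> R \<rho>) = space \<gamma> \<times> UNIV"
  and sets_skew: "sets (skew_invariant_space \<gamma> R \<rho>) =
    {A : sets (\<gamma> \<Otimes>\<^sub>M lborel). skew_relation R \<rho> `` A \<subseteq> A}" (is "_ = ?S")
  and null_sets_skew: "null_sets (skew_invariant_space \<gamma> R \<rho>) =
    {A : null_sets (\<gamma> \<Otimes>\<^sub>M lborel). skew_relation R \<rho> `` A \<subseteq> A}"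
proof -
 let ?X = "space \<gamma> \<times> (UNIV :: real set)"
 have sp: "space (\<gamma> \<Otimes>\<^sub>M lborel) = ?X" by (simp add: space_pair_measure)
 have sub: "?S \<subseteq> Pow ?X" using sets.sets_into_space[of _ "\<gamma> \<Otimes>\<^sub>M lborel"] sp by blast
 have R_sub: "R \<subseteq> space \<gamma> \<times> space \<gamma>" using R by (auto simp: equiv_def refl_on_def)
 have sig: "sigma_algebra ?X ?S"
  unfolding sigma_algebra_iff2
 proof (intro conjI ballI allI impI)
  fix s assume s: "s : ?S"
  have "?X - s : sets (\<gamma> \<Otimes>\<^sub>M lborel)" using s sets.compl_sets[of s "\<gamma> \<Otimes>\<^sub>M lborel"] sp by simp
  moreover have "skew_relation R \<rho> `` (?X - s) \<subseteq> ?X - s"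
  proof
   fix p' assume "p' : skew_relation R \<rho> `` (?X - s)"
   then obtain p where p: "p : ?X - s" "(p, p') : skew_relation R \<rho>" by auto
   have "p' : ?X" using p(2) R_sub by (auto simp: skew_relation_def)
   moreover have "p' ~: s" using skew_relation_sym[OF R \<rho> p(2)] p(1) s by auto
   ultimately show "p' : ?X - s" by simp
  qed
  ultimately show "?X - s : ?S" by simp
 qed (use sub in auto)
 interpret s: sigma_algebra ?X ?S by (rule sig)
 show "space (skew_invariant_space \<gamma> R \<rho>) = ?X"
  unfolding skew_invariant_space_def using sub by (rule space_measure_of)
 show sets: "sets (skew_invariant_space \<gamma> R \<rho>) = ?S"
  unfolding skew_invariant_space_def using s.sets_measure_of_eq .
 have em: "emeasure (skew_invariant_space \<gamma> R \<rho>) A = emeasure (\<gamma> \<Otimes>\<^sub>M lborel) A" if "A : ?S" for A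
  unfolding skew_invariant_space_def
 proof (rule emeasure_measure_of_sigma[OF sig _ _ that])
  show "positive ?S (emeasure (\<gamma> \<Otimes>\<^sub>M lborel))" by (simp add: positive_def)
  show "countably_additive ?S (emeasure (\<gamma> \<Otimes>\<^sub>M lborel))"
   by (auto simp: countably_additive_def intro!: suminf_emeasure)
 qed
 show "null_sets (skew_invariant_space \<gamma> R \<rho>) =
    {A : null_sets (\<gamma> \<Otimes>\<^sub>M lborel). skew_relation R \<rho> `` A \<subseteq> A}"
  unfolding null_sets_def sets using em by auto
qed

abbreviation shift_flow :: "real => 'z \<times> real => 'z \<times> real" where
 "shift_flow \<equiv> %s (z, t). (z, t + s)"

text \<open>By Fubini almost every section is Lebesgue null, and so are its translates.\<close>

lemma null_sets_shift:
 assumes "sigma_finite_measure \<gamma>" and A: "A : null_sets (\<gamma> \<Otimes>\<^sub>M lborel)"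
 shows "shift_flow s -` A Int space (\<gamma> \<Otimes>\<^sub>M lborel) : null_sets (\<gamma> \<Otimes>\<^sub>M lborel)"
proof -
 interpret sigma_finite_measure \<gamma> by fact
 interpret pair_sigma_finite \<gamma> lborel ..
 have m: "shift_flow s : measurable (\<gamma> \<Otimes>\<^sub>M lborel) (\<gamma> \<Otimes>\<^sub>M lborel)" by simp
 have "AE p in \<gamma> \<Otimes>\<^sub>M lborel. p ~: A" using A by (rule AE_not_in)
 hence "AE z in \<gamma>. AE t in lborel. (z, t) ~: A" by (rule AE_pair)
 hence "AE z in \<gamma>. AE t in lborel. (z, t + s) ~: A"
 proof eventually_elim
  case (elim z)
  hence "AE t in distr lborel borel (%t. s + t). (z, t) ~: A" by (subst lborel_distr_plus)
  hence "AE t in lborel. (z, s + t) ~: A" by (rule AE_distrD[rotated]) simp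
  thus "AE t in lborel. (z, t + s) ~: A" by (simp add: add.commute)
 qed
 hence "AE p in \<gamma> \<Otimes>\<^sub>M lborel. shift_flow s p ~: A"
 proof (intro AE_pair_measure)
  have "{x : space (\<gamma> \<Otimes>\<^sub>M lborel). shift_flow s x ~: A} = space (\<gamma> \<Otimes>\<^sub>M lborel) - (shift_flow s -` A Int space (\<gamma> \<Otimes>\<^sub>M lborel))" by auto
  thus "{x : space (\<gamma> \<Otimes>\<^sub>M lborel). shift_flow s x ~: A} : sets (\<gamma> \<Otimes>\<^sub>M lborel)"
   using sets.compl_sets[OF measurable_sets[OF m, of A]] A by (metis null_setsD2)
 qed simp
 moreover have D: "shift_flow s -` A Int space (\<gamma> \<Otimes>\<^sub>M lborel) : sets (\<gamma> \<Otimes>\<^sub>M lborel)"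
  using measurable_sets[OF m null_setsD2[OF A]] .
 ultimately show ?thesis
  unfolding AE_iff_null_sets[OF D] by (auto elim: AE_mp)
qed

lemma skew_flow_ok:
 assumes R: "equiv (space \<gamma>) R" and \<rho>: "pos_cocycle R \<rho>" and sf: "sigma_finite_measure \<gamma>"
 shows "flow_ok (skew_invariant_space \<gamma> R \<rho>) shift_flow"
 unfolding flow_ok_def
proof (intro allI ballI conjI impI)
 note sk = skew_space[OF R \<rho>] sets_skew[OF R \<rho>] null_sets_skew[OF R \<rho>]
 have sp: "space (\<gamma> \<Otimes>\<^sub>M lborel) = space \<gamma> \<times> (UNIV :: real set)" by (simp add: space_pair_measure)
 have R_sub: "R \<subseteq> space \<gamma> \<times> space \<gamma>" using R by (auto simp: equiv_def refl_on_def)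
 fix s A assume A: "A : sets (skew_invariant_space \<gamma> R \<rho>)"
 have m: "shift_flow s : measurable (\<gamma> \<Otimes>\<^sub>M lborel) (\<gamma> \<Otimes>\<^sub>M lborel)" by simp
 have inv: "skew_relation R \<rho> `` (shift_flow s -` A Int space \<gamma> \<times> UNIV) \<subseteq> shift_flow s -` A Int space \<gamma> \<times> UNIV"
 proof
  fix p' assume "p' : skew_relation R \<rho> `` (shift_flow s -` A Int space \<gamma> \<times> UNIV)"
  then obtain z t z' t' where *: "p' = (z', t')" "((z, t), (z', t')) : skew_relation R \<rho>" "(z, t + s) : A" "z : space \<gamma>"
   by (cases p') auto
  hence "((z, t + s), (z', t' + s)) : skew_relation R \<rho>" by (auto simp: skew_relation_def)
  moreover have "skew_relation R \<rho> `` A \<subseteq> A" using A by (simp add: sk)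
  ultimately have "(z', t' + s) : A" using *(3) by blast
  thus "p' : shift_flow s -` A Int space \<gamma> \<times> UNIV" using *(1,2) R_sub by (auto simp: skew_relation_def)
 qed
 show "shift_flow s -` A Int space (skew_invariant_space \<gamma> R \<rho>) : sets (skew_invariant_space \<gamma> R \<rho>)"
  using inv A measurable_sets[OF m, of A] by (simp add: sk sp)
 assume "A : null_sets (skew_invariant_space \<gamma> R \<rho>)"
 hence "shift_flow s -` A Int space \<gamma> \<times> UNIV : null_sets (\<gamma> \<Otimes>\<^sub>M lborel)"
  using null_sets_shift[OF sf, of A s] by (simp add: sk sp)
 thus "shift_flow s -` A Int space (skew_invariant_space \<gamma> R \<rho>) : null_sets (skew_invariant_space \<gamma> R \<rho>)"
  using inv by (simp add: sk)
qed

text \<open>It is enough that the two cocycles are Radon-Nikodym derivatives for countably many members of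
 the full group that generate the relation.\<close>

lemma rn_cocycles_isomorphic:
 fixes \<theta> :: "nat => 'z => 'z"
 assumes R: "equiv (space \<gamma>) R" and sf: "sigma_finite_measure \<gamma>"
  and \<theta>: "!!k. \<theta> k : full_group \<gamma> R" and gen: "!!x y. (x, y) : R ==> EX k. x = \<theta> k y"
  and c: "pos_cocycle R \<rho>" and c': "pos_cocycle R \<rho>'"
  and \<rho>: "(%(x, y). \<rho> x y) : borel_measurable (restrict_space (\<gamma> \<Otimes>\<^sub>M \<gamma>) R)"
  and \<rho>': "(%(x, y). \<rho>' x y) : borel_measurable (restrict_space (\<gamma> \<Otimes>\<^sub>M \<gamma>) R)"
  and rn: "!!k. AE z in \<gamma>. RN_deriv \<gamma> (distr \<gamma> \<gamma> (the_inv_into (space \<gamma>) (\<theta> k))) z = ennreal (\<rho> (\<theta> k z) z)"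
  and rn': "!!k. AE z in \<gamma>. RN_deriv \<gamma> (distr \<gamma> \<gamma> (the_inv_into (space \<gamma>) (\<theta> k))) z = ennreal (\<rho>' (\<theta> k z) z)"
 shows "isomorphic_flows (skew_invariant_space \<gamma> R \<rho>') shift_flow (skew_invariant_space \<gamma> R \<rho>) shift_flow"
proof -
 note sk = skew_space[OF R c] sets_skew[OF R c] null_sets_skew[OF R c]
  skew_space[OF R c'] sets_skew[OF R c'] null_sets_skew[OF R c']
 have sp: "space (\<gamma> \<Otimes>\<^sub>M lborel) = space \<gamma> \<times> (UNIV :: real set)" by (simp add: space_pair_measure)
 have R_sub: "R \<subseteq> space \<gamma> \<times> space \<gamma>" using R by (auto simp: equiv_def refl_on_def)
 have symR: "(x, y) : R ==> (y, x) : R" for x y using R by (meson equivE symD)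
 have transR: "(x, y) : R ==> (y, z) : R ==> (x, z) : R" for x y z using R by (meson equivE transD)
 have \<theta>m: "\<theta> k : measurable \<gamma> \<gamma>" and \<theta>R: "z : space \<gamma> ==> (\<theta> k z, z) : R" for k z
  using \<theta>[of k] by (auto simp: full_group_def)
 have m: "(%z. \<sigma> (\<theta> k z) z) : borel_measurable \<gamma>" if "(%(x, y). \<sigma> x y) : borel_measurable (restrict_space (\<gamma> \<Otimes>\<^sub>M \<gamma>) R)" for \<sigma> k
 proof -
  have "(%z. (\<theta> k z, z)) : measurable \<gamma> (restrict_space (\<gamma> \<Otimes>\<^sub>M \<gamma>) R)"
   using \<theta>R \<theta>m by (intro measurable_restrict_space2) auto
  from measurable_compose[OF this, of "%(x, y). \<sigma> x y" borel] that
  show ?thesis by simp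
 qed
 \<comment> \<open>The points at which both cocycles agree along all generators. It is conull: both
   are derivatives, hence equal almost everywhere for each of the countably many
   \<open>\<theta> k\<close>.\<close>
 define Gd where "Gd = {z\<in>space \<gamma>. ALL k. \<rho> (\<theta> k z) z = \<rho>' (\<theta> k z) z}"
 have Gd_sets: "Gd : sets \<gamma>"
  unfolding Gd_def using m[OF \<rho>] m[OF \<rho>'] by measurable
 have "AE z in \<gamma>. ALL k. \<rho> (\<theta> k z) z = \<rho>' (\<theta> k z) z"
  unfolding AE_all_countable
 proof
  fix k
  from rn[of k] rn'[of k] AE_space show "AE z in \<gamma>. \<rho> (\<theta> k z) z = \<rho>' (\<theta> k z) z"
  proof eventually_elim
   case (elim z)
   have "\<rho> (\<theta> k z) z > 0" "\<rho>' (\<theta> k z) z > 0"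
    using pos_cocycleD(1)[OF c \<theta>R[OF elim(3)]] pos_cocycleD(1)[OF c' \<theta>R[OF elim(3)]] by auto
   thus ?case using elim(1,2) by (simp add: ennreal_inj less_imp_le)
  qed
 qed
 hence "AE z in \<gamma>. z : Gd" by (rule AE_mp) (auto simp: Gd_def intro!: AE_I2)
 hence Gd_null: "space \<gamma> - Gd : null_sets \<gamma>"
  using Gd_sets by (subst AE_iff_null_sets) (auto elim!: AE_mp intro!: AE_I2)
 have agree: "\<rho> x z = \<rho>' x z" if "z : Gd" "(x, z) : R" for x z
  using gen[OF that(2)] that(1) by (auto simp: Gd_def)
 have agree': "\<rho> z x = \<rho>' z x" if "z : Gd" "(z, x) : R" for x z
  using agree[OF that(1) symR[OF that(2)]] pos_cocycle_inverse[OF c symR[OF that(2)] that(2)]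
   pos_cocycle_inverse[OF c' symR[OF that(2)] that(2)] transR symR that(2) by metis
 \<comment> \<open>The cocycle identity through \<open>z\<close> carries agreement from one point to
   its whole class.\<close>
 have Gd_inv: "z' : Gd" if "z : Gd" "(z, z') : R" for z z'
  unfolding Gd_def
 proof (intro CollectI conjI allI)
  show z': "z' : space \<gamma>" using that R_sub by auto
  fix k
  have k: "(\<theta> k z', z) : R" using transR[OF \<theta>R[OF z'] symR[OF that(2)]] .
  show "\<rho> (\<theta> k z') z' = \<rho>' (\<theta> k z') z'"
   using pos_cocycleD(2)[OF c k that(2)] pos_cocycleD(2)[OF c' k that(2)] agree[OF that(1) k] agree'[OF that] by simp
 qed
 let ?G = "Gd \<times> (UNIV :: real set)"
 have Gs: "?G : sets (\<gamma> \<Otimes>\<^sub>M lborel)" using Gd_sets by simp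
 have "space \<gamma> \<times> UNIV - ?G = (space \<gamma> - Gd) \<times> (UNIV :: real set)" by auto
 moreover have "(space \<gamma> - Gd) \<times> (UNIV :: real set) : null_sets (\<gamma> \<Otimes>\<^sub>M lborel)"
 proof -
  have "emeasure (\<gamma> \<Otimes>\<^sub>M lborel) ((space \<gamma> - Gd) \<times> (UNIV :: real set)) = emeasure \<gamma> (space \<gamma> - Gd) * emeasure lborel (UNIV :: real set)"
   using Gd_sets by (intro lborel.emeasure_pair_measure_Times) auto
  also have "... = 0" using Gd_null by auto
  finally show ?thesis using Gd_sets by (intro null_setsI) auto
 qed
 ultimately have Gn: "space \<gamma> \<times> UNIV - ?G : null_sets (\<gamma> \<Otimes>\<^sub>M lborel)" by simp
 have inv1: "skew_relation R \<sigma> `` (A Int ?G) \<subseteq> A Int ?G"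
  if "skew_relation R \<sigma>' `` A \<subseteq> A" "!!z x. z : Gd ==> (z, x) : R ==> \<sigma> z x = \<sigma>' z x" for A \<sigma> \<sigma>'
  using that Gd_inv by (fastforce simp: skew_relation_def)
 have inv2: "skew_relation R \<rho> `` (space \<gamma> \<times> UNIV - ?G) \<subseteq> space \<gamma> \<times> UNIV - ?G"
  using Gd_inv symR R_sub by (fastforce simp: skew_relation_def)
 have inv3: "skew_relation R \<rho> `` ?G \<subseteq> ?G"
  using Gd_inv by (fastforce simp: skew_relation_def)
 show ?thesis
 proof (rule isomorphic_flows_pullback[where q = id and G = ?G])
  show "?G : sets (skew_invariant_space \<gamma> R \<rho>)" using Gs inv3 by (simp add: sk)
  show "space (skew_invariant_space \<gamma> R \<rho>) - ?G : null_sets (skew_invariant_space \<gamma> R \<rho>)"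
   using Gn inv2 by (simp add: sk)
  fix A assume A: "A : sets (skew_invariant_space \<gamma> R \<rho>')"
  hence A1: "A : sets (\<gamma> \<Otimes>\<^sub>M lborel)" "skew_relation R \<rho>' `` A \<subseteq> A" by (auto simp: sk)
  have AG: "skew_relation R \<rho> `` (A Int ?G) \<subseteq> A Int ?G" using inv1[OF A1(2)] agree' by blast
  show "id -` A Int ?G : sets (skew_invariant_space \<gamma> R \<rho>)" using A1(1) Gs AG by (simp add: sk)
  have "A Int ?G : null_sets (\<gamma> \<Otimes>\<^sub>M lborel) \<longleftrightarrow> A : null_sets (\<gamma> \<Otimes>\<^sub>M lborel)"
  proof
   assume "A Int ?G : null_sets (\<gamma> \<Otimes>\<^sub>M lborel)"
   hence "A Int ?G Un (space \<gamma> \<times> UNIV - ?G) : null_sets (\<gamma> \<Otimes>\<^sub>M lborel)" using Gn by blast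
   moreover have "A \<subseteq> A Int ?G Un (space \<gamma> \<times> UNIV - ?G)" using sets.sets_into_space[OF A1(1)] sp by auto
   ultimately show "A : null_sets (\<gamma> \<Otimes>\<^sub>M lborel)" using A1(1) null_sets_subset by blast
  next
   assume "A : null_sets (\<gamma> \<Otimes>\<^sub>M lborel)"
   thus "A Int ?G : null_sets (\<gamma> \<Otimes>\<^sub>M lborel)" using Gs by (rule null_set_Int2)
  qed
  thus "(id -` A Int ?G : null_sets (skew_invariant_space \<gamma> R \<rho>)) = (A : null_sets (skew_invariant_space \<gamma> R \<rho>'))"
   using AG A1(2) by (simp add: sk)
 next
  fix B assume B: "B : sets (skew_invariant_space \<gamma> R \<rho>)"
  hence B1: "B : sets (\<gamma> \<Otimes>\<^sub>M lborel)" "skew_relation R \<rho> `` B \<subseteq> B" by (auto simp: sk)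
  have BG: "skew_relation R \<rho>' `` (B Int ?G) \<subseteq> B Int ?G" using inv1[OF B1(2)] agree' by metis
  have "B Int ?G : sets (skew_invariant_space \<gamma> R \<rho>')" using BG B1 Gs by (simp add: sk)
  moreover have "eq_mod_null (skew_invariant_space \<gamma> R \<rho>) (id -` (B Int ?G) Int ?G) B"
  proof -
   have d: "(id -` (B Int ?G) Int ?G - B) Un (B - id -` (B Int ?G) Int ?G) = B Int (space \<gamma> \<times> UNIV - ?G)"
    using sets.sets_into_space[OF B1(1)] sp by auto
   have "B Int (space \<gamma> \<times> UNIV - ?G) : null_sets (\<gamma> \<Otimes>\<^sub>M lborel)" using B1(1) Gn by (intro null_set_Int1)
   moreover have "skew_relation R \<rho> `` (B Int (space \<gamma> \<times> UNIV - ?G)) \<subseteq> B Int (space \<gamma> \<times> UNIV - ?G)"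
    using inv2 B1(2) by blast
   ultimately show ?thesis unfolding eq_mod_null_def d by (simp add: sk)
  qed
  ultimately show "EX A:sets (skew_invariant_space \<gamma> R \<rho>'). eq_mod_null (skew_invariant_space \<gamma> R \<rho>) (id -` A Int ?G) B"
   by blast
 next
  fix x assume "x : ?G"
  thus "id x : space (skew_invariant_space \<gamma> R \<rho>')" using sets.sets_into_space[OF Gd_sets] by (auto simp: sk)
 qed auto
qed

section \<open>Infinite products of two-point spaces\<close>

definition bern :: "(nat => bool pmf) => (nat => bool) measure" where
 "bern \<alpha> = (\<Pi>\<^sub>M n\<in>UNIV. measure_pmf (\<alpha> n))"

lemma space_bern [simp]: "space (bern \<alpha>) = UNIV"
 by (simp add: bern_def space_PiM PiE_UNIV_domain)

lemma prob_space_bern: "prob_space (bern \<alpha>)"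
 unfolding bern_def by (intro prob_space_PiM measure_pmf.prob_space_axioms)

lemma measurable_bern_component [measurable]: "(%b. b i) : measurable (bern \<alpha>) (count_space UNIV)"
proof -
 have "(%b. b i) : measurable (bern \<alpha>) (measure_pmf (\<alpha> i))"
  unfolding bern_def by (rule measurable_component_singleton) simp
 thus ?thesis by (simp cong: measurable_cong_sets)
qed

lemma measurable_bernI:
 assumes "!!i. (%x. f x i) : measurable M (count_space UNIV)"
 shows "f : measurable M (bern \<alpha>)"
 unfolding bern_def
proof (rule measurable_PiM_single')
 show "(%x. f x i) : measurable M (measure_pmf (\<alpha> i))" for i
  using assms[of i] by (simp cong: measurable_cong_sets)
qed (auto simp: PiE_UNIV_domain)

lemma measurable_bern_upd [measurable]: "(%b. b(i := d)) : measurable (bern \<alpha>) (bern \<beta>)"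
proof (rule measurable_bernI)
 show "(%b. (b(i := d)) j) : measurable (bern \<alpha>) (count_space UNIV)" for j by (cases "i = j") auto
qed

lemma bern_sets_upd: "D : sets (bern \<alpha>) ==> {b. b(i := d) : D} : sets (bern \<alpha>)"
 using measurable_sets[OF measurable_bern_upd[of i d \<alpha> \<alpha>], of D] by (simp add: vimage_def)

text \<open>Redrawing one coordinate independently preserves a product measure; the sum conditions
  on the new value. Most computations with \<open>bern\<close> are repeated uses of this
  formula.\<close>

lemma bern_resample:
 assumes "D : sets (bern \<alpha>)"
 shows "emeasure (bern \<alpha>) D = (\<Sum>d\<in>UNIV. ennreal (pmf (\<alpha> i) d) * emeasure (bern \<alpha>) {b. b(i := d) : D})"
proof -
 interpret prob_space "bern \<alpha>" by (rule prob_space_bern)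
 have m: "(%(x, X). X(i := x)) : measurable (measure_pmf (\<alpha> i) \<Otimes>\<^sub>M bern \<alpha>) (bern \<alpha>)"
 proof (rule measurable_bernI)
  fix j
  show "(%x. (case x of (x, X) => X(i := x)) j) : measurable (measure_pmf (\<alpha> i) \<Otimes>\<^sub>M bern \<alpha>) (count_space UNIV)"
  proof (cases "i = j")
   case True
   hence "(%x. (case x of (x, X) => X(i := x)) j) = (%x. fst x)" by auto
   moreover have "fst : measurable (measure_pmf (\<alpha> i) \<Otimes>\<^sub>M bern \<alpha>) (measure_pmf (\<alpha> i))" by (rule measurable_fst)
   ultimately show ?thesis by (simp cong: measurable_cong_sets)
  next
   case False
   hence "(%x. (case x of (x, X) => X(i := x)) j) = (%x. snd x j)" by auto
   thus ?thesis by simp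
  qed
 qed
 have "distr (measure_pmf (\<alpha> i) \<Otimes>\<^sub>M bern \<alpha>) (bern \<alpha>) (%(x, X). X(i := x)) = bern \<alpha>"
  using distr_pair_PiM_eq_PiM[of UNIV "%n. measure_pmf (\<alpha> n)" i]
  by (simp add: bern_def measure_pmf.prob_space_axioms)
 hence "emeasure (bern \<alpha>) D = emeasure (distr (measure_pmf (\<alpha> i) \<Otimes>\<^sub>M bern \<alpha>) (bern \<alpha>) (%(x, X). X(i := x))) D"
  by simp
 also have "... = emeasure (measure_pmf (\<alpha> i) \<Otimes>\<^sub>M bern \<alpha>) ((%(x, X). X(i := x)) -` D Int space (measure_pmf (\<alpha> i) \<Otimes>\<^sub>M bern \<alpha>))"
  using assms m by (rule emeasure_distr[rotated])
 also have "... = (\<integral>\<^sup>+x. emeasure (bern \<alpha>) (Pair x -` ((%(x, X). X(i := x)) -` D Int space (measure_pmf (\<alpha> i) \<Otimes>\<^sub>M bern \<alpha>))) \<partial>measure_pmf (\<alpha> i))"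
  using measurable_sets[OF m assms] by (rule emeasure_pair_measure_alt)
 also have "... = (\<integral>\<^sup>+x. emeasure (bern \<alpha>) {b. b(i := x) : D} \<partial>measure_pmf (\<alpha> i))"
  by (intro nn_integral_cong arg_cong[where f = "emeasure (bern \<alpha>)"]) (auto simp: space_pair_measure)
 finally show ?thesis
  by (simp add: nn_integral_measure_pmf nn_integral_count_space_finite)
qed

text \<open>The sigma-algebra of the first \<open>n\<close> bits in pointwise form. One implication
  is enough because its premise is symmetric.\<close>

definition dep :: "nat => (nat => bool) set => bool" where
 "dep n A \<longleftrightarrow> (ALL b b'. (ALL i<n. b i = b' i) --> b : A --> b' : A)"

lemma depD:
 assumes "dep n A" "!!i. i < n ==> b i = b' i"
 shows "b : A \<longleftrightarrow> b' : A"
proof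
 show "b : A ==> b' : A"
  using assms(1)[unfolded dep_def, THEN spec, THEN spec, of b b'] assms(2) by simp
 show "b' : A ==> b : A"
  using assms(1)[unfolded dep_def, THEN spec, THEN spec, of b' b] assms(2) by simp
qed

lemma dep_0: assumes "dep 0 A" shows "A = {} \<or> A = UNIV"
proof -
 have "b : A \<longleftrightarrow> b' : A" for b b' using depD[OF assms, of b b'] by simp
 thus ?thesis by blast
qed

lemma dep_upd: "dep (Suc n) A ==> dep n {b. b(n := d) : A}"
 unfolding dep_def mem_Collect_eq
proof (intro allI impI)
 fix b b' assume A: "ALL b b'. (ALL i<Suc n. b i = b' i) --> b : A --> b' : A" and b: "ALL i<n. b i = b' i" "b(n := d) : A"
 have "ALL i<Suc n. (b(n := d)) i = (b'(n := d)) i" using b(1) by (simp add: less_Suc_eq)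
 thus "b'(n := d) : A" using A b(2) by blast
qed

lemma dep_mono:
 assumes "dep m A" "m <= n" shows "dep n A"
 unfolding dep_def
proof (intro allI impI)
 fix b b' assume "ALL i<n. b i = b' i" "b : A"
 thus "b' : A" using depD[OF assms(1), of b b'] assms(2) by simp
qed

lemma dep_sets: "dep n A ==> A : sets (bern \<alpha>)"
proof (induction n arbitrary: A)
 case 0
 thus ?case using dep_0[of A] sets.top[of "bern \<alpha>"] by auto
next
 case (Suc n)
 have "A = (\<Union>d\<in>UNIV. (%b. b n) -` {d} Int space (bern \<alpha>) Int {b. b(n := d) : A})"
 proof (rule equalityI[OF subsetI subsetI])
  fix b assume "b : A"
  hence "b : (%b. b n) -` {b n} Int space (bern \<alpha>) Int {b'. b'(n := b n) : A}" by simp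
  thus "b : (\<Union>d\<in>UNIV. (%b. b n) -` {d} Int space (bern \<alpha>) Int {b. b(n := d) : A})" by (rule UN_I[OF UNIV_I])
 next
  fix b assume "b : (\<Union>d\<in>UNIV. (%b. b n) -` {d} Int space (bern \<alpha>) Int {b. b(n := d) : A})"
  then obtain d where "b n = d" "b(n := d) : A" by (elim UN_E) simp
  thus "b : A" by (simp only: fun_upd_idem)
 qed
 moreover have "(%b. b n) -` {d} Int space (bern \<alpha>) Int {b. b(n := d) : A} : sets (bern \<alpha>)" for d
  using Suc.IH[OF dep_upd[OF Suc.prems]] by (intro sets.Int measurable_sets[OF measurable_bern_component]) auto
 ultimately show ?case by (metis (no_types, lifting) finite sets.finite_UN)
qed

lemma algebra_dep: "algebra UNIV {A. EX n. dep n A}"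
 unfolding algebra_iff_Un
proof (intro conjI ballI)
 show "{} : {A. EX n. dep n A}" by (auto simp: dep_def)
 fix a assume a: "a : {A. EX n. dep n A}"
 then obtain n where n: "dep n a" by blast
 have "dep n (UNIV - a)"
  unfolding dep_def[of n "UNIV - a"] using depD[OF n] by (metis DiffE DiffI UNIV_I)
 thus "UNIV - a : {A. EX n. dep n A}" by blast
 fix b assume b: "b : {A. EX n. dep n A}"
 obtain n m where "dep n a" "dep m b" using a b by auto
 hence "dep (max n m) a" "dep (max n m) b" by (auto intro: dep_mono)
 hence "dep (max n m) (a Un b)" unfolding dep_def by blast
 thus "a Un b : {A. EX n. dep n A}" by blast
qed auto

lemma sets_bern_dep: "sets (bern \<alpha>) = sigma_sets UNIV {A. EX n. dep n A}"
proof
 have "sets (bern \<alpha>) = sigma_sets UNIV {{f. f i : A} | i A. True}"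
  unfolding bern_def sets_PiM_single by (simp add: PiE_UNIV_domain)
 also have "... \<subseteq> sigma_sets UNIV {A. EX n. dep n A}"
 proof (rule sigma_sets_mono, clarify)
  fix i :: nat and A :: "bool set"
  have "dep (Suc i) {f. f i : A}" by (auto simp: dep_def)
  thus "{f. f i : A} : sigma_sets UNIV {A. EX n. dep n A}" by blast
 qed
 finally show "sets (bern \<alpha>) \<subseteq> sigma_sets UNIV {A. EX n. dep n A}" .
 show "sigma_sets UNIV {A. EX n. dep n A} \<subseteq> sets (bern \<alpha>)"
  using sets.sigma_sets_subset[of "{A. EX n. dep n A}" "bern \<alpha>"] dep_sets by auto
qed

lemma bern_approx:
 assumes "D : sets (bern \<alpha>)" "e > 0"
 obtains n A where "dep n A" "measure (bern \<alpha>) ((D - A) Un (A - D)) < e"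
proof -
 interpret prob_space "bern \<alpha>" by (rule prob_space_bern)
 have "EX A:{A. EX n. dep n A}. measure (bern \<alpha>) ((D - A) Un (A - D)) < e"
  by (rule algebra_approx) (use assms in \<open>auto simp: finite_measure_axioms algebra_dep sets_bern_dep\<close>)
 thus ?thesis using that by blast
qed

text \<open>The sigma-algebra of the bits from \<open>n\<close> on, complementary to
  \<open>dep n\<close>.\<close>

definition indif :: "nat => (nat => bool) set => bool" where
 "indif n D \<longleftrightarrow> (ALL b b'. (ALL i>=n. b i = b' i) --> b : D --> b' : D)"

lemma indif_upd: "indif n D ==> i < n ==> {b. b(i := d) : D} = D"
proof -
 assume D: "indif n D" "i < n"
 have "b(i := d) : D \<longleftrightarrow> b : D" for b
  using D unfolding indif_def by (metis fun_upd_other not_le)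
 thus ?thesis by auto
qed

text \<open>Independence of past and future. Resampling the last bit that \<open>A\<close> sees
  leaves \<open>D\<close> alone and lowers the depth of \<open>A\<close> by one, while
  \<open>N\<close> stays fixed.\<close>

lemma bern_dep_indif:
 assumes "D : sets (bern \<alpha>)" "indif N D" "dep n A" "n <= N"
 shows "emeasure (bern \<alpha>) (A Int D) = emeasure (bern \<alpha>) A * emeasure (bern \<alpha>) D"
 using assms(3,4)
proof (induction n arbitrary: A)
 case 0
 interpret prob_space "bern \<alpha>" by (rule prob_space_bern)
 show ?case using dep_0[OF 0(1)] emeasure_space_1 by auto
next
 case (Suc n)
 have A: "A : sets (bern \<alpha>)" using Suc.prems dep_sets by blast
 have "emeasure (bern \<alpha>) (A Int D) = (\<Sum>d\<in>UNIV. ennreal (pmf (\<alpha> n) d) * emeasure (bern \<alpha>) {b. b(n := d) : A Int D})"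
  using A assms(1) by (intro bern_resample) auto
 also have "... = (\<Sum>d\<in>UNIV. ennreal (pmf (\<alpha> n) d) * (emeasure (bern \<alpha>) {b. b(n := d) : A} * emeasure (bern \<alpha>) D))"
 proof (intro sum.cong refl arg_cong2[where f = "(*)"])
  fix d
  have "{b. b(n := d) : A Int D} = {b. b(n := d) : A} Int D"
   using indif_upd[OF assms(2), of n d] Suc.prems by auto
  thus "emeasure (bern \<alpha>) {b. b(n := d) : A Int D} = emeasure (bern \<alpha>) {b. b(n := d) : A} * emeasure (bern \<alpha>) D"
   using Suc.IH[OF dep_upd[OF Suc.prems(1)]] Suc.prems(2) by simp
 qed
 also have "... = (\<Sum>d\<in>UNIV. ennreal (pmf (\<alpha> n) d) * emeasure (bern \<alpha>) {b. b(n := d) : A}) * emeasure (bern \<alpha>) D"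
  by (simp add: sum_distrib_right mult.assoc)
 also have "... = emeasure (bern \<alpha>) A * emeasure (bern \<alpha>) D"
  using bern_resample[OF A, of n] by simp
 finally show ?case .
qed

lemma bern_dep_indif_measure:
 assumes "D : sets (bern \<alpha>)" "indif n D" "dep n A"
 shows "measure (bern \<alpha>) (A Int D) = measure (bern \<alpha>) A * measure (bern \<alpha>) D"
 using bern_dep_indif[OF assms order_refl] by (simp add: measure_def enn2real_mult)

lemma bern_measure_diff_le:
 assumes "D : sets (bern \<alpha>)" "A : sets (bern \<alpha>)"
 shows "\<bar>measure (bern \<alpha>) D - measure (bern \<alpha>) A\<bar> <= measure (bern \<alpha>) ((D - A) Un (A - D))"
proof -
 interpret prob_space "bern \<alpha>" by (rule prob_space_bern)
 have "measure (bern \<alpha>) D <= measure (bern \<alpha>) A + measure (bern \<alpha>) ((D - A) Un (A - D))" if "D : sets (bern \<alpha>)" "A : sets (bern \<alpha>)" for A D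
 proof -
  have "measure (bern \<alpha>) D <= measure (bern \<alpha>) (A Un ((D - A) Un (A - D)))"
   using that by (intro finite_measure_mono) auto
  also have "... <= measure (bern \<alpha>) A + measure (bern \<alpha>) ((D - A) Un (A - D))"
   using that by (intro measure_Un_le) auto
  finally show ?thesis .
 qed
 from this[OF assms] this[OF assms(2,1)] show ?thesis by (simp add: Un_commute)
qed

text \<open>Both zero-one laws below end with a probability that is arbitrarily close to its own
  square.\<close>

lemma square_approx_zero_one:
 fixes p :: real
 assumes "!!e. e > 0 ==> \<bar>p - p * p\<bar> <= c * e" "c >= 0"
 shows "p = 0 \<or> p = 1"
proof (rule ccontr)
 assume "\<not> ?thesis"
 hence "p - p * p ~= 0" by (simp add: algebra_simps)
 hence pos: "\<bar>p - p * p\<bar> > 0" by simp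
 define e where "e = \<bar>p - p * p\<bar> / (2 * (c + 1))"
 have "e > 0" using pos assms(2) by (simp add: e_def)
 hence "\<bar>p - p * p\<bar> <= c * e" by (rule assms(1))
 also have "c * e = (c / (2 * (c + 1))) * \<bar>p - p * p\<bar>" by (simp add: e_def)
 also have "... < 1 * \<bar>p - p * p\<bar>" using pos assms(2) by (intro mult_strict_right_mono) auto
 finally show False by simp
qed

text \<open>Kolmogorov's argument: \<open>D\<close> is independent of each approximant from finitely
  many bits, hence of itself.\<close>

lemma bern_zero_one:
 assumes D: "D : sets (bern \<alpha>)" and inv: "!!b b'. (b, b') : tail_relation ==> b : D ==> b' : D"
 shows "measure (bern \<alpha>) D = 0 \<or> measure (bern \<alpha>) D = 1"
proof (rule square_approx_zero_one)
 interpret prob_space "bern \<alpha>" by (rule prob_space_bern)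
 fix e :: real assume "e > 0"
 then obtain n A where A: "dep n A" "measure (bern \<alpha>) ((D - A) Un (A - D)) < e"
  using bern_approx[OF D] by blast
 have As: "A : sets (bern \<alpha>)" using dep_sets[OF A(1)] .
 have "indif n D" unfolding indif_def
  using inv by (auto simp: tail_relation_def)
 hence eq: "measure (bern \<alpha>) (A Int D) = measure (bern \<alpha>) A * measure (bern \<alpha>) D"
  using bern_dep_indif_measure[OF D _ A(1)] by blast
 have 1: "\<bar>measure (bern \<alpha>) D - measure (bern \<alpha>) A\<bar> <= e"
  using bern_measure_diff_le[OF D As] A(2) by simp
 have "\<bar>measure (bern \<alpha>) D - measure (bern \<alpha>) (A Int D)\<bar> <= measure (bern \<alpha>) ((D - (A Int D)) Un ((A Int D) - D))"
  using As D by (intro bern_measure_diff_le) auto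
 also have "... <= measure (bern \<alpha>) ((D - A) Un (A - D))"
  using As D by (intro finite_measure_mono) auto
 finally have 2: "\<bar>measure (bern \<alpha>) D - measure (bern \<alpha>) (A Int D)\<bar> <= e" using A(2) by simp
 let ?p = "measure (bern \<alpha>) D" and ?q = "measure (bern \<alpha>) A"
 have "\<bar>?p - ?p * ?p\<bar> <= \<bar>?p - ?q * ?p\<bar> + \<bar>?q * ?p - ?p * ?p\<bar>" by simp
 also have "\<bar>?q * ?p - ?p * ?p\<bar> = \<bar>?p - ?q\<bar> * ?p" 
  by (simp add: abs_mult abs_minus_commute flip: left_diff_distrib)
 also have "... <= \<bar>?p - ?q\<bar> * 1" by (intro mult_left_mono) auto
 finally show "\<bar>?p - ?p * ?p\<bar> <= 2 * e" using 1 2 eq by simp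
qed simp

lemma bern_cylinder:
 "emeasure (bern \<alpha>) {b'. ALL i<n. b' i = b i} = (\<Prod>i<n. ennreal (pmf (\<alpha> i) (b i)))"
proof (induction n)
 case 0
 interpret prob_space "bern \<alpha>" by (rule prob_space_bern)
 show ?case using emeasure_space_1 by simp
next
 case (Suc n)
 have d: "dep n {b'. ALL i<n. b' i = b i}" "dep (Suc n) {b'. ALL i<Suc n. b' i = b i}" by (auto simp: dep_def)
 have "{b'. b'(n := d) : {b'. ALL i<Suc n. b' i = b i}} = (if d = b n then {b'. ALL i<n. b' i = b i} else {})" for d
  by (auto simp: less_Suc_eq)
 hence "emeasure (bern \<alpha>) {b'. ALL i<Suc n. b' i = b i} = (\<Sum>d\<in>UNIV. ennreal (pmf (\<alpha> n) d) * (if d = b n then emeasure (bern \<alpha>) {b'. ALL i<n. b' i = b i} else 0))"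
  by (subst bern_resample[OF dep_sets[OF d(2)], where i = n]) (auto intro!: sum.cong)
 also have "... = ennreal (pmf (\<alpha> n) (b n)) * emeasure (bern \<alpha>) {b'. ALL i<n. b' i = b i}"
  by (simp add: if_distrib sum.delta cong: if_cong)
 finally show ?case using Suc by (simp add: mult.commute)
qed

lemma finite_cylinders: "finite (range (%b :: nat => bool. {b'. ALL i<n. b' i = b i}))"
proof -
 have eq: "(%b :: nat => bool. {b'. ALL i<n. b' i = b i}) = (%S. {b'. ALL i<n. b' i = (i : S)}) \<circ> (%b. {i. i < n & b i})"
  by (rule ext) (auto simp: comp_def)
 have "range (%b :: nat => bool. {i. i < n & b i}) \<subseteq> Pow {..<n}" by auto
 hence "finite (range (%b :: nat => bool. {i. i < n & b i}))" by (rule finite_subset) simp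
 thus ?thesis unfolding eq image_comp[symmetric] by (rule finite_imageI)
qed

text \<open>The finitely many cylinders of length \<open>n\<close> cover the space, and each of them
  has small mass.\<close>

lemma nonatomic_bernI:
 assumes "!!e. e > 0 ==> EX n. ALL b. (\<Prod>i<n. pmf (\<alpha> i) (b i)) < e"
 shows "nonatomic (bern \<alpha>)"
proof (rule nonatomicI)
 fix e :: real assume "e > 0"
 then obtain n where n: "!!b. (\<Prod>i<n. pmf (\<alpha> i) (b i)) < e" using assms by blast
 let ?C = "%b :: nat => bool. {b'. ALL i<n. b' i = b i}"
 have ne: "range ?C ~= {}" "countable (range ?C)" using finite_cylinders[of n] by (auto intro: countable_finite)
 have r: "range (from_nat_into (range ?C)) = range ?C" using ne by (rule range_from_nat_into)
 have d: "dep n (?C b)" for b by (auto simp: dep_def)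
 let ?A = "from_nat_into (range ?C)"
 have 1: "range ?A \<subseteq> sets (bern \<alpha>)" unfolding r using dep_sets[OF d] by auto
 have 2: "space (bern \<alpha>) \<subseteq> (\<Union>i. ?A i)" unfolding r by auto
 have 3: "emeasure (bern \<alpha>) (?A i) < ennreal e" for i
 proof -
  have "?A i : range ?A" by (rule rangeI)
  hence "?A i : range ?C" by (simp only: r)
  then obtain b where "?A i = ?C b" by (rule rangeE)
  thus ?thesis using n[of b] \<open>e > 0\<close> by (simp add: bern_cylinder prod_ennreal prod_nonneg ennreal_lessI)
 qed
 show "EX A :: nat => (nat => bool) set. range A \<subseteq> sets (bern \<alpha>) & space (bern \<alpha>) \<subseteq> (\<Union>i. A i) &
   (ALL i. emeasure (bern \<alpha>) (A i) < ennreal e)"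
  by (rule exI[of _ ?A], rule conjI, rule 1, rule conjI, rule 2, rule allI, rule 3)
qed

text \<open>Every summand of the resampling formula vanishes, and its weight is positive.\<close>

lemma bern_upd_null:
 assumes "D : sets (bern \<alpha>)" "set_pmf (\<alpha> i) = UNIV" "emeasure (bern \<alpha>) D = 0"
 shows "emeasure (bern \<alpha>) {b. b(i := d) : D} = 0"
proof -
 have "(\<Sum>d\<in>UNIV. ennreal (pmf (\<alpha> i) d) * emeasure (bern \<alpha>) {b. b(i := d) : D}) = 0"
  using bern_resample[OF assms(1), of i] assms(3) by simp
 hence "ennreal (pmf (\<alpha> i) d) * emeasure (bern \<alpha>) {b. b(i := d) : D} = 0"
  by (simp add: sum_nonneg_eq_0_iff)
 moreover have "pmf (\<alpha> i) d > 0" using assms(2) by (simp add: pmf_positive_iff)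
 ultimately show ?thesis by (simp add: ennreal_eq_0_iff)
qed

section \<open>Fair flips\<close>

definition fair :: "nat => bool pmf" where "fair = (%_. bernoulli_pmf (1/2))"

definition flip :: "nat => (nat => bool) => nat => bool" where "flip i b = b(i := \<not> b i)"

lemma measurable_flip [measurable]: "flip i : measurable (bern \<alpha>) (bern \<beta>)"
proof (rule measurable_bernI)
 show "(%b. flip i b j) : measurable (bern \<alpha>) (count_space UNIV)" for j
  unfolding flip_def by (cases "i = j") auto
qed

lemma flip_sets: "D : sets (bern \<alpha>) ==> {b. flip i b : D} : sets (bern \<alpha>)"
 using measurable_sets[OF measurable_flip[of i \<alpha> \<alpha>], of D] by (simp add: vimage_def)

text \<open>Flipping exchanges the two terms of the resampling formula, which have equal
  weight.\<close>

lemma fair_flip: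
 assumes "D : sets (bern fair)"
 shows "measure (bern fair) {b. flip i b : D} = measure (bern fair) D"
proof -
 have 1: "{b. b(i := d) : {b. flip i b : D}} = {b. b(i := \<not> d) : D}" for d by (auto simp: flip_def)
 have "emeasure (bern fair) {b. flip i b : D} = (\<Sum>d\<in>UNIV. ennreal (pmf (fair i) d) * emeasure (bern fair) {b. b(i := \<not> d) : D})"
  by (subst bern_resample[OF flip_sets[OF assms], of _ i]) (simp only: 1)
 also have "... = emeasure (bern fair) D"
  by (subst bern_resample[OF assms, of i]) (simp add: UNIV_bool fair_def add.commute)
 finally show ?thesis by (simp add: measure_def)
qed

text \<open>A set is nearly determined by its first \<open>n\<close> bits, and flips of later bits
  do not see these. So \<open>D\<close> nearly coincides with its flip, which is impossible when the
  two are disjoint mod null and \<open>D\<close> has positive mass.\<close>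

lemma fair_flip_null:
 assumes D: "D : sets (bern fair)" and inf: "\<exists>\<^sub>\<infinity>i. measure (bern fair) (D Int {b. flip i b : D}) = 0"
 shows "measure (bern fair) D = 0"
proof (rule ccontr)
 interpret prob_space "bern fair" by (rule prob_space_bern)
 let ?m = "measure (bern fair)"
 assume "?m D ~= 0"
 \<comment> \<open>Half, because the error is counted twice: for \<open>D\<close> and for its
   flipped copy.\<close>
 hence "?m D / 2 > 0" using measure_nonneg[of "bern fair" D] by linarith
 then obtain n A where A: "dep n A" "?m ((D - A) Un (A - D)) < ?m D / 2"
  using bern_approx[OF D] by blast
 obtain i where i: "i >= n" "?m (D Int {b. flip i b : D}) = 0" using inf by (auto simp: INFM_nat_le)
 have As: "A : sets (bern fair)" using dep_sets[OF A(1)] .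
 have fA: "flip i b : A \<longleftrightarrow> b : A" for b
  using i(1) by (intro depD[OF A(1)]) (auto simp: flip_def)
 let ?S = "(D - A) Un (A - D)"
 have m1: "?S : sets (bern fair)" using D As by auto
 have m: "D Int {b. flip i b : D} : sets (bern fair)" "?S : sets (bern fair)" "{b. flip i b : ?S} : sets (bern fair)"
  by (fact sets.Int[OF D flip_sets[OF D]] m1 flip_sets[OF m1])+
 have "D \<subseteq> (D Int {b. flip i b : D}) Un ?S Un {b. flip i b : ?S}" using fA by auto
 hence "?m D <= ?m ((D Int {b. flip i b : D}) Un ?S Un {b. flip i b : ?S})"
  by (rule finite_measure_mono[OF _ sets.Un[OF sets.Un[OF m(1,2)] m(3)]])
 also have "... <= ?m ((D Int {b. flip i b : D}) Un ?S) + ?m {b. flip i b : ?S}"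
  by (rule measure_Un_le[OF sets.Un[OF m(1,2)] m(3)])
 also have "... <= ?m (D Int {b. flip i b : D}) + ?m ?S + ?m {b. flip i b : ?S}"
  by (rule add_right_mono[OF measure_Un_le[OF m(1,2)]])
 also have "?m {b. flip i b : ?S} = ?m ?S" by (rule fair_flip[OF m(2)])
 finally show False using A(2) i(2) by simp
qed

section \<open>Combinatorics of the \<open>(C,F)\<close>-space\<close>

text \<open>The fair bits \<open>a\<close> come first, the bits \<open>b\<close> second.\<close>

type_synonym bits = "(nat => bool) \<times> (nat => bool)"

definition agree :: "nat => bits => bits => bool" where
 "agree n w w' \<longleftrightarrow> (ALL i>=n. fst w i = fst w' i & snd w i = snd w' i)"

lemma agree_refl [simp]: "agree n w w"
 and agree_sym: "agree n w w' ==> agree n w' w"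
 and agree_trans: "agree n w w' ==> agree n w' w'' ==> agree n w w''"
 and agree_mono: "agree n w w' ==> n <= m ==> agree m w w'"
 by (auto simp: agree_def)

locale cf_example =
 fixes h :: "nat => int" and F C \<Gamma> :: "nat => int set"
 assumes h_0: "h 0 = 1"
  and h_Suc: "!!n. h (Suc n) = 4 * h n + 2 ^ (n + 1)"
  and F_eq: "!!n. F n = {0..h n - 1}"
  and C_Suc: "!!n. C (Suc n) = {0, h n, 2 * h n + 2 ^ (n + 1), 3 * h n + 2 ^ (n + 1)}"
  and \<Gamma>_eq: "!!k. \<Gamma> k = range (%z. 2 ^ k * z)"
begin

lemma h_eq: "h n = 2 ^ n * (2 ^ (n + 1) - 1)"
 by (induction n) (simp_all add: h_0 h_Suc algebra_simps)

lemma pow_pos: "(2::int) ^ n > 0" by simp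

lemma h_pos: "h n >= 1"
proof (induction n)
 case (Suc n)
 thus ?case using pow_pos[of "n + 1"] unfolding h_Suc of_nat_Suc by linarith
qed (simp add: h_0)

lemma zero_F: "0 : F n" using h_pos[of n] by (simp add: F_eq)

lemma finite_F: "finite (F n)" by (simp add: F_eq)

lemma F_0: "F 0 = {0}" by (auto simp: F_eq h_0)

text \<open>The element of \<open>C (n + 1)\<close> coded by two bits: \<open>y\<close> chooses
  between the pair of copies of \<open>F n\<close> before the spacers and the pair after them,
  \<open>x\<close> chooses within the pair.\<close>

definition dg :: "nat => bool => bool => int" where
 "dg n x y = (if x then h n else 0) + (if y then 2 * h n + 2 ^ (n + 1) else 0)"

lemma C_dg: "C (Suc n) = (%(x, y). dg n x y) ` UNIV"
proof -
 have U: "(UNIV :: (bool \<times> bool) set) = {(False, False), (True, False), (False, True), (True, True)}" by auto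
 show ?thesis unfolding U by (simp add: C_Suc dg_def)
qed

lemma dg_in_C: "dg n x y : C (Suc n)" unfolding C_dg by auto

text \<open>The four copies of \<open>F n\<close> follow each other with one gap of length
  \<open>2 ^ (n + 1)\<close> after the second, so they are disjoint.\<close>

lemma dg_unique:
 assumes "f : F n" "f' : F n" "f + dg n x y = f' + dg n x' y'"
 shows "f = f' & x = x' & y = y'"
proof -
 note p = pow_pos[of n]
 show ?thesis using assms p by (cases x; cases x'; cases y; cases y') (auto simp: dg_def F_eq)
qed

lemma dg_inj: "dg n x y = dg n x' y' \<longleftrightarrow> x = x' & y = y'"
 using dg_unique[of 0 n 0 x y x' y'] zero_F by auto

text \<open>A false \<open>y\<close> leaves the digit at most \<open>h n\<close>, a true one makes
  it exceed \<open>2 * h n\<close>; the threshold reads \<open>y\<close> without decoding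
  \<open>x\<close>.\<close>

lemma dg_bit: "dg n x y >= 2 * h n \<longleftrightarrow> y"
 using h_pos[of n] by (auto simp: dg_def)

lemma dg_F: "f : F n ==> f + dg n x y : F (Suc n)"
proof -
 assume f: "f : F n"
 note p = pow_pos[of n]
 show ?thesis using f h_pos[of n] by (cases x; cases y; auto simp: dg_def F_eq h_Suc; (insert p, linarith))
qed

text \<open>The digits with \<open>x ~= y\<close> select the two inner copies, which have room
  \<open>h n\<close> on either side. This is what puts almost every point into
  \<open>G\<close>.\<close>

lemma dg_middle:
 assumes "f : F n" "x ~= y" "\<bar>g\<bar> <= h n"
 shows "g + (f + dg n x y) : F (Suc n)"
proof -
 note p = pow_pos[of n]
 show ?thesis using assms h_pos[of n] by (cases x; cases y; auto simp: dg_def F_eq h_Suc; (insert p, linarith))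
qed

lemma h_mono: "n <= m ==> h n <= h m"
proof (induction m)
 case (Suc m)
 have "h m <= h (Suc m)" using h_pos[of m] by (simp add: h_Suc)
 thus ?case using Suc by (cases "n = Suc m") auto
qed simp

lemma F_mono: "n <= m ==> F n \<subseteq> F m"
 using h_mono[of n m] by (auto simp: F_eq)

lemma h_ge: "h n >= int n + 1"
proof (induction n)
 case (Suc n)
 thus ?case using pow_pos[of "n + 1"] unfolding h_Suc of_nat_Suc by linarith
qed (simp add: h_0)

lemma dg_dvd: "k <= n ==> 2 ^ k dvd dg n x y"
proof -
 assume k: "k <= n"
 have 1: "(2::int) ^ k dvd 2 ^ n" using k by (rule le_imp_power_dvd)
 have 2: "(2::int) ^ n dvd h n" by (simp add: h_eq)
 have 3: "(2::int) ^ n dvd 2 * h n + 2 ^ (n + 1)" using 2 by (intro dvd_add dvd_mult) auto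
 have "2 ^ n dvd dg n x y" unfolding dg_def using 2 3 by (intro dvd_add) auto
 with 1 show ?thesis by (rule dvd_trans)
qed

definition dsum :: "nat => nat => bits => int" where
 "dsum n m w = (\<Sum>i\<in>{n..<m}. dg i (fst w i) (snd w i))"

lemma dsum_self [simp]: "dsum n n w = 0" by (simp add: dsum_def)

lemma dsum_Suc: "n <= m ==> dsum n (Suc m) w = dsum n m w + dg m (fst w m) (snd w m)"
 by (simp add: dsum_def)

lemma dsum_split: "n <= m ==> m <= k ==> dsum n k w = dsum n m w + dsum m k w"
 by (simp add: dsum_def sum.atLeastLessThan_concat)

lemma dsum_cong: "(!!i. n <= i ==> i < m ==> fst w i = fst w' i & snd w i = snd w' i) ==> dsum n m w = dsum n m w'"
 unfolding dsum_def by (intro sum.cong) auto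

lemma dsum_F: "f : F n ==> n <= m ==> f + dsum n m w : F m"
proof (induction m)
 case (Suc m)
 show ?case
 proof (cases "n = Suc m")
  case False
  hence "n <= m" using Suc.prems by simp
  thus ?thesis using dg_F[OF Suc.IH[OF Suc.prems(1)], of "fst w m" "snd w m"] by (simp add: dsum_Suc add.assoc)
 qed (use Suc in simp)
qed simp

lemma dsum_unique:
 assumes "f : F n" "f' : F n" "n <= m" "f + dsum n m w = f' + dsum n m w'"
 shows "f = f' & (ALL i. n <= i & i < m --> fst w i = fst w' i & snd w i = snd w' i)"
 using assms(3,4)
proof (induction m)
 case (Suc m)
 show ?case
 proof (cases "n = Suc m")
  case False
  hence nm: "n <= m" using Suc.prems by simp
  have "f + dsum n m w = f' + dsum n m w' & fst w m = fst w' m & snd w m = snd w' m"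
   using Suc.prems(2) nm dsum_F[OF assms(1) nm, of w] dsum_F[OF assms(2) nm, of w']
   by (intro dg_unique) (auto simp: dsum_Suc add.assoc)
  thus ?thesis using Suc.IH[OF nm] by (auto simp: less_Suc_eq)
 qed (use Suc.prems in auto)
qed (use assms in auto)

text \<open>The index is shifted: coordinate \<open>k\<close> lies in \<open>C k\<close>, which is
  coded by the bits with index \<open>k - 1\<close>.\<close>

definition cc :: "nat => bits => nat => int" where
 "cc n w = restrict (%k. dg (k - 1) (fst w (k - 1)) (snd w (k - 1))) {n<..}"

lemma cc_PiE: "cc n w : (\<Pi>\<^sub>E k\<in>{n<..}. C k)"
proof -
 have "dg (k - 1) x y : C k" if "n < k" for k x y
  using dg_in_C[of "k - 1" x y] that by simp
 thus ?thesis by (auto simp: cc_def)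
qed

lemma cc_surj:
 assumes "c : (\<Pi>\<^sub>E k\<in>{n<..}. C k)" obtains w where "c = cc n w"
proof -
 have "EX x y. c (Suc k) = dg k x y" if "k >= n" for k
 proof -
  have "c (Suc k) : C (Suc k)" using PiE_mem[OF assms, of "Suc k"] that by simp
  thus ?thesis unfolding C_dg by auto
 qed
 then obtain X Y where XY: "!!k. k >= n ==> c (Suc k) = dg k (X k) (Y k)" by metis
 have "c = cc n (X, Y)"
 proof (rule PiE_ext[OF assms cc_PiE])
  fix k assume "k : {n<..}"
  thus "c k = cc n (X, Y) k" using XY[of "k - 1"] by (simp add: cc_def)
 qed
 thus ?thesis by (rule that)
qed

lemma cc_eq_iff: "cc n w = cc n w' \<longleftrightarrow> agree n w w'"
proof
 assume eq: "cc n w = cc n w'"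
 show "agree n w w'" unfolding agree_def
 proof (intro allI impI)
  fix i assume "n <= i"
  thus "fst w i = fst w' i & snd w i = snd w' i"
   using fun_cong[OF eq, of "Suc i"] by (simp add: cc_def dg_inj)
 qed
next
 assume "agree n w w'"
 thus "cc n w = cc n w'" unfolding cc_def
  by (intro restrict_ext) (auto simp: agree_def)
qed

lemma cf_embed_cc: "cf_embed (n, f, cc n w) = (Suc n, f + dg n (fst w n) (snd w n), cc (Suc n) w)"
 by (auto simp: cf_embed_def cc_def fun_eq_iff)

lemma cf_embed_pow: "(cf_embed ^^ k) (n, f, cc n w) = (n + k, f + dsum n (n + k) w, cc (n + k) w)"
 by (induction k) (simp_all add: cf_embed_cc dsum_Suc)

lemma cf_reps_iff: "(n, f, cc n w) : cf_reps F C \<longleftrightarrow> f : F n"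
 using cc_PiE by (auto simp: cf_reps_def)

lemma cf_reps_cases:
 assumes "p : cf_reps F C" obtains n f w where "p = (n, f, cc n w)" "f : F n"
proof -
 obtain n f c where p: "p = (n, f, c)" "f : F n" "c : (\<Pi>\<^sub>E k\<in>{n<..}. C k)"
  using assms by (auto simp: cf_reps_def)
 thus ?thesis using cc_surj[OF p(3)] that by metis
qed

lemma equiv_cf_rel: "equiv (cf_reps F C) (cf_rel F C)"
proof (rule equivI)
 show "cf_rel F C \<subseteq> cf_reps F C \<times> cf_reps F C" by (auto simp: cf_rel_def)
 show "refl_on (cf_reps F C) (cf_rel F C)"
  by (auto simp: refl_on_def cf_rel_def)
 show "sym (cf_rel F C)" unfolding cf_rel_def sym_def by (auto) metis+
 show "trans (cf_rel F C)"
 proof (rule transI)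
  fix p q r assume "(p, q) : cf_rel F C" "(q, r) : cf_rel F C"
  then obtain i j k l where 1: "p : cf_reps F C" "r : cf_reps F C"
   and 2: "(cf_embed ^^ i) p = (cf_embed ^^ j) q" "(cf_embed ^^ k) q = (cf_embed ^^ l) r"
   by (auto simp: cf_rel_def)
  have "(cf_embed ^^ (k + i)) p = (cf_embed ^^ k) ((cf_embed ^^ j) q)" using 2(1) by (simp add: funpow_add)
  also have "... = (cf_embed ^^ j) ((cf_embed ^^ k) q)" by (metis add.commute comp_apply funpow_add)
  also have "... = (cf_embed ^^ (j + l)) r" using 2(2) by (simp add: funpow_add)
  finally show "(p, r) : cf_rel F C" using 1 by (auto simp: cf_rel_def)
 qed
qed

definition pt :: "nat => int => bits => cf_rep set" where
 "pt n f w = cf_point F C n f (cc n w)"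

text \<open>Equal points meet at some late stage \<open>m\<close>; unique expansion at stage
  \<open>m\<close> then forces agreement already at stage \<open>n'\<close>. This gives the quotient
  by \<open>cf_rel\<close> an explicit normal form.\<close>

lemma pt_eq_iff:
 assumes "n <= n'" "f : F n" "f' : F n'"
 shows "pt n f w = pt n' f' w' \<longleftrightarrow> f' = f + dsum n n' w & agree n' w w'"
proof -
 have r: "(n, f, cc n w) : cf_reps F C" "(n', f', cc n' w') : cf_reps F C" using assms by (simp_all add: cf_reps_iff)
 have "pt n f w = pt n' f' w' \<longleftrightarrow> ((n, f, cc n w), (n', f', cc n' w')) : cf_rel F C"
  unfolding pt_def cf_point_def using eq_equiv_class_iff[OF equiv_cf_rel r] .
 also have "... \<longleftrightarrow> (EX i j. n + i = n' + j & f + dsum n (n + i) w = f' + dsum n' (n' + j) w' & cc (n + i) w = cc (n' + j) w')"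
  using r by (simp add: cf_rel_def cf_embed_pow)
 also have "... \<longleftrightarrow> f' = f + dsum n n' w & agree n' w w'"
 proof
  assume "EX i j. n + i = n' + j & f + dsum n (n + i) w = f' + dsum n' (n' + j) w' & cc (n + i) w = cc (n' + j) w'"
  then obtain m where m: "n' <= m" "f + dsum n m w = f' + dsum n' m w'" "cc m w = cc m w'"
   by (metis le_add1)
  have "f + dsum n n' w = f' & (ALL i. n' <= i & i < m --> fst w i = fst w' i & snd w i = snd w' i)"
   using m assms by (intro dsum_unique dsum_F) (auto simp: dsum_split[of n n' m w])
  moreover have "agree m w w'" using m(3) by (simp add: cc_eq_iff)
  ultimately show "f' = f + dsum n n' w & agree n' w w'" unfolding agree_def by (metis not_le)
 next
  assume "f' = f + dsum n n' w & agree n' w w'"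
  thus "EX i j. n + i = n' + j & f + dsum n (n + i) w = f' + dsum n' (n' + j) w' & cc (n + i) w = cc (n' + j) w'"
   using assms(1) by (intro exI[of _ "n' - n"] exI[of _ 0]) (auto simp: cc_eq_iff)
 qed
 finally show ?thesis .
qed

lemma pt_eq_same: "f : F n ==> f' : F n ==> pt n f w = pt n f' w' \<longleftrightarrow> f = f' & agree n w w'"
 using pt_eq_iff[of n n f f' w w'] by auto

lemma pt_lift: "f : F n ==> n <= m ==> pt n f w = pt m (f + dsum n m w) w"
 by (subst pt_eq_iff) (auto intro: dsum_F)

lemma cf_space_pt: "cf_space F C = {pt n f w | n f w. f : F n}"
proof (intro equalityI subsetI)
 fix x assume "x : cf_space F C"
 then obtain p where p: "p : cf_reps F C" "x = cf_rel F C `` {p}"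
  unfolding cf_space_def by (elim quotientE)
 from p(1) show "x : {pt n f w | n f w. f : F n}"
  by (elim cf_reps_cases) (auto simp: pt_def cf_point_def p(2))
next
 fix x assume "x : {pt n f w | n f w. f : F n}"
 then obtain n f w where x: "x = pt n f w" "f : F n" by auto
 thus "x : cf_space F C"
  unfolding cf_space_def by (auto simp: pt_def cf_point_def cf_reps_iff intro!: quotientI)
qed

lemma pt_space: "f : F n ==> pt n f w : cf_space F C"
 unfolding cf_space_pt by blast

lemma cf_space_cases:
 assumes "x : cf_space F C" obtains n f w where "x = pt n f w" "f : F n"
 using assms unfolding cf_space_pt by auto

lemma mem_pt_iff:
 assumes "f : F n"
 shows "(n', f', c') : pt n f w \<longleftrightarrow> f' : F n' & (EX w'. c' = cc n' w' & pt n' f' w' = pt n f w)"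
proof
 assume *: "(n', f', c') : pt n f w"
 hence "((n, f, cc n w), (n', f', c')) : cf_rel F C" by (simp add: pt_def cf_point_def)
 hence r: "(n', f', c') : cf_reps F C" and eq: "cf_rel F C `` {(n, f, cc n w)} = cf_rel F C `` {(n', f', c')}"
  using equiv_class_eq[OF equiv_cf_rel] by (auto simp: cf_rel_def)
 from r obtain w' where "c' = cc n' w'" "f' : F n'" by (auto elim!: cf_reps_cases)
 thus "f' : F n' & (EX w'. c' = cc n' w' & pt n' f' w' = pt n f w)"
  using eq unfolding pt_def cf_point_def by blast
next
 assume "f' : F n' & (EX w'. c' = cc n' w' & pt n' f' w' = pt n f w)"
 then obtain w' where w': "f' : F n'" "c' = cc n' w'" "pt n' f' w' = pt n f w" by auto
 have "(n', f', cc n' w') : pt n' f' w'"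
  unfolding pt_def cf_point_def by (rule equiv_class_self[OF equiv_cf_rel]) (simp add: cf_reps_iff w'(1))
 thus "(n', f', c') : pt n f w" unfolding w'(2) by (simp only: w'(3))
qed

section \<open>The action on the points with a full orbit\<close>

abbreviation T :: "int => cf_rep set => cf_rep set" where "T \<equiv> cf_act F C"
abbreviation G :: "cf_rep set set" where "G \<equiv> cf_global F C"

lemma shift_pt_eq:
 assumes "n <= m" "f : F n" "g + f : F n" "f' : F m" "g + f' : F m" "pt n f w = pt m f' w'"
 shows "pt n (g + f) w = pt m (g + f') w'"
 using assms pt_eq_iff[of n m f f' w w'] pt_eq_iff[of n m "g + f" "g + f'" w w'] by simp

text \<open>\<open>cf_act\<close> is a definite description. It is meaningful because shifting the
  level commutes with lifting a representative to a later stage.\<close>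

lemma T_pt:
 assumes "f : F n" "g + f : F n"
 shows "T g (pt n f w) = pt n (g + f) w"
 unfolding cf_act_def
proof (rule the_equality)
 have "(n, f, cc n w) : pt n f w" using assms mem_pt_iff by blast
 thus "EX m f' c. (m, f', c) : pt n f w & g + f' : F m & pt n (g + f) w = cf_point F C m (g + f') c"
  using assms by (intro exI[of _ n] exI[of _ f] exI[of _ "cc n w"]) (simp add: pt_def)
next
 fix y assume "EX m f' c. (m, f', c) : pt n f w & g + f' : F m & y = cf_point F C m (g + f') c"
 then obtain m f' c where y: "(m, f', c) : pt n f w" "g + f' : F m" "y = cf_point F C m (g + f') c" by blast
 then obtain w' where w': "f' : F m" "c = cc m w'" "pt m f' w' = pt n f w" using mem_pt_iff[OF assms(1)] by blast
 have "y = pt m (g + f') w'" using y w' by (simp add: pt_def)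
 also have "... = pt n (g + f) w"
 proof (cases "n <= m")
  case True
  show ?thesis using shift_pt_eq[OF True assms w'(1) y(2) w'(3)[symmetric]] by simp
 next
  case False
  thus ?thesis using shift_pt_eq[OF _ w'(1) y(2) assms w'(3)] by simp
 qed
 finally show "y = pt n (g + f) w" .
qed

lemma shift_F_lift:
 assumes "g + f : F n" "n <= m" shows "g + (f + dsum n m w) : F m"
 using dsum_F[OF assms, of w] by (simp add: add.assoc)

lemma pt_in_G_iff:
 assumes "f : F n"
 shows "pt n f w : G \<longleftrightarrow> (ALL g. EX m>=n. g + (f + dsum n m w) : F m)"
proof -
 have "pt n f w : cf_dom F C g \<longleftrightarrow> (EX m>=n. g + (f + dsum n m w) : F m)" for g
 proof
  assume "pt n f w : cf_dom F C g"
  then obtain k f' c where k: "(k, f', c) : pt n f w" "g + f' : F k" by (auto simp: cf_dom_def)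
  then obtain w' where w': "f' : F k" "pt k f' w' = pt n f w" using mem_pt_iff[OF assms] by blast
  show "EX m>=n. g + (f + dsum n m w) : F m"
  proof (cases "n <= k")
   case True
   thus ?thesis using w' k(2) pt_eq_iff[OF True assms w'(1), of w w'] by auto
  next
   case False
   hence "f = f' + dsum k n w'" using w' assms pt_eq_iff[of k n f' f w' w] by auto
   hence "g + f : F n" using shift_F_lift[OF k(2), of n w'] False by simp
   thus ?thesis by (intro exI[of _ n]) simp
  qed
 next
  assume "EX m>=n. g + (f + dsum n m w) : F m"
  then obtain m where m: "m >= n" "g + (f + dsum n m w) : F m" by blast
  have "(m, f + dsum n m w, cc m w) : pt n f w"
   using mem_pt_iff[OF assms] dsum_F[OF assms m(1)] pt_lift[OF assms m(1)] by metis
  thus "pt n f w : cf_dom F C g" using m(2) pt_space[OF assms] by (auto simp: cf_dom_def)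
 qed
 thus ?thesis by (simp add: cf_global_def)
qed

lemma G_space: "G \<subseteq> cf_space F C" by (auto simp: cf_global_def cf_dom_def)

lemma pt_G_shift:
 assumes "f : F n" "f' : F n" "pt n f w : G" shows "pt n f' w : G"
 unfolding pt_in_G_iff[OF assms(2)]
proof
 fix g
 obtain m where "m >= n" "(g + f' - f) + (f + dsum n m w) : F m"
  using assms(3) unfolding pt_in_G_iff[OF assms(1)] by blast
 thus "EX m>=n. g + (f' + dsum n m w) : F m" by (intro exI[of _ m]) (simp add: algebra_simps)
qed

text \<open>A point of \<open>G\<close> has late representatives with room \<open>K\<close> on both
  sides. Room for the two extreme shifts is enough, as \<open>F m\<close> is an interval, and room
  persists at later stages.\<close>

lemma G_rep:
 assumes "x : G"
 obtains n f w where "x = pt n f w" "N <= n" "!!g. \<bar>g\<bar> <= K ==> g + f : F n"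
proof -
 obtain n f w where x: "x = pt n f w" "f : F n" using assms G_space cf_space_cases by blast
 have G: "EX m>=n. g + (f + dsum n m w) : F m" for g using assms x pt_in_G_iff by blast
 obtain m1 where m1: "m1 >= n" "\<bar>K\<bar> + (f + dsum n m1 w) : F m1" using G by blast
 obtain m2 where m2: "m2 >= n" "- \<bar>K\<bar> + (f + dsum n m2 w) : F m2" using G by blast
 define m where "m = max (max m1 m2) N"
 have m: "n <= m" "m1 <= m" "m2 <= m" "N <= m" using m1 by (auto simp: m_def)
 have 1: "\<bar>K\<bar> + (f + dsum n m w) : F m"
  using shift_F_lift[OF m1(2) m(2), of w] dsum_split[of n m1 m w] m m1 by (simp add: add.assoc)
 have 2: "- \<bar>K\<bar> + (f + dsum n m w) : F m"
  using shift_F_lift[OF m2(2) m(3), of w] dsum_split[of n m2 m w] m m2 by (simp add: add.assoc)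
 show ?thesis
 proof (rule that)
  show "x = pt m (f + dsum n m w) w" using x pt_lift m by simp
  show "N <= m" by (rule m(4))
  fix g assume "\<bar>g\<bar> <= K" thus "g + (f + dsum n m w) : F m" using 1 2 by (auto simp: F_eq)
 qed
qed

lemma T_G: assumes "x : G" shows "T g x : G"
proof -
 obtain n f w where x: "x = pt n f w" "!!g'. \<bar>g'\<bar> <= \<bar>g\<bar> ==> g' + f : F n"
  using G_rep[OF assms, of 0 "\<bar>g\<bar>"] by blast
 have f: "f : F n" "g + f : F n" using x(2)[of 0] x(2)[of g] by simp_all
 show ?thesis using pt_G_shift[OF f] assms T_pt[OF f] x by simp
qed

lemma T_add: assumes "x : G" shows "T (g + g') x = T g (T g' x)"
proof -
 obtain n f w where x: "x = pt n f w" "!!k. \<bar>k\<bar> <= \<bar>g\<bar> + \<bar>g'\<bar> ==> k + f : F n"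
  using G_rep[OF assms, of 0 "\<bar>g\<bar> + \<bar>g'\<bar>"] by blast
 have f: "f : F n" "g' + f : F n" "(g + g') + f : F n" using x(2)[of 0] x(2)[of g'] x(2)[of "g + g'"] by simp_all
 show ?thesis using T_pt[OF f(1,2)] T_pt[OF f(1,3)] T_pt[OF f(2), of g w] f x by (simp add: add.assoc)
qed

lemma T_0: assumes "x : G" shows "T 0 x = x"
proof -
 obtain n f w where x: "x = pt n f w" "f : F n" using assms G_space cf_space_cases by blast
 thus ?thesis using T_pt[of f n 0 w] by simp
qed

lemma T_inv: "x : G ==> T (- g) (T g x) = x" "x : G ==> T g (T (- g) x) = x"
 using T_add[of x "- g" g] T_add[of x g "- g"] T_0 by simp_all

lemma T_free: assumes "x : G" "T g x = x" shows "g = 0"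
proof -
 obtain n f w where x: "x = pt n f w" "!!g'. \<bar>g'\<bar> <= \<bar>g\<bar> ==> g' + f : F n"
  using G_rep[OF assms(1), of 0 "\<bar>g\<bar>"] by blast
 have f: "f : F n" "g + f : F n" using x(2)[of 0] x(2)[of g] by simp_all
 show ?thesis using T_pt[OF f, of w] assms(2) pt_eq_same[OF f(2,1), of w w] x by simp
qed

section \<open>Cylinders, levels and the bits read off from them\<close>

abbreviation cyl :: "nat => int => cf_rep set set" where "cyl \<equiv> cf_cylinder F C"

lemma cyl_eq: "cyl n f = range (pt n f)"
proof (intro equalityI subsetI)
 fix x assume "x : cyl n f"
 then obtain c where "c : (\<Pi>\<^sub>E k\<in>{n<..}. C k)" "x = cf_point F C n f c" by (auto simp: cf_cylinder_def)
 thus "x : range (pt n f)" using cc_surj[of c n] by (metis pt_def rangeI)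
next
 fix x assume "x : range (pt n f)"
 thus "x : cyl n f" using cc_PiE by (auto simp: cf_cylinder_def pt_def)
qed

lemma pt_cyl [simp]: "pt n f w : cyl n f" by (simp add: cyl_eq)

lemma cyl_space: "f : F n ==> cyl n f \<subseteq> cf_space F C"
 unfolding cyl_eq using pt_space by auto

lemma pt_in_cyl:
 assumes "m <= n" "g : F m" "f : F n"
 shows "pt m g w : cyl n f \<longleftrightarrow> f = g + dsum m n w"
 using pt_eq_iff[OF assms] agree_refl[of n w] unfolding cyl_eq by blast

lemma cyl_disj: "f : F n ==> f' : F n ==> x : cyl n f ==> x : cyl n f' ==> f = f'"
 unfolding cyl_eq using pt_eq_same by blast

lemma cyl_Suc: "f : F n ==> cyl n f = (\<Union>x. \<Union>y. cyl (Suc n) (f + dg n x y))"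
proof (intro equalityI subsetI)
 fix z assume f: "f : F n" "z : cyl n f"
 then obtain w where "z = pt n f w" by (auto simp: cyl_eq)
 hence "z = pt (Suc n) (f + dg n (fst w n) (snd w n)) w" using pt_lift[OF f(1), of "Suc n" w] by (simp add: dsum_Suc)
 thus "z : (\<Union>x. \<Union>y. cyl (Suc n) (f + dg n x y))"
  by (intro UN_I[of "fst w n" UNIV] UN_I[of "snd w n" UNIV]) auto
next
 fix z assume f: "f : F n" and "z : (\<Union>x. \<Union>y. cyl (Suc n) (f + dg n x y))"
 then obtain x y w where z: "z = pt (Suc n) (f + dg n x y) w" by (auto simp: cyl_eq)
 define w' where "w' = ((fst w)(n := x), (snd w)(n := y))"
 have "agree (Suc n) w' w" by (auto simp: agree_def w'_def)
 hence "pt n f w' = z" unfolding z using f dg_F[OF f, of x y] by (subst pt_eq_iff) (auto simp: dsum_Suc w'_def)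
 thus "z : cyl n f" by auto
qed

text \<open>The default \<open>-1\<close> marks points outside the \<open>n\<close>-th tower and is
  never a level.\<close>

definition lev :: "nat => cf_rep set => int" where
 "lev n x = (if EX f:F n. x : cyl n f then THE f. f : F n & x : cyl n f else -1)"

lemma lev_cyl: "f : F n ==> x : cyl n f \<longleftrightarrow> lev n x = f"
proof -
 assume f: "f : F n"
 have 1: "lev n x = f'" if "f' : F n" "x : cyl n f'" for f'
  unfolding lev_def using that cyl_disj by (auto intro!: the_equality)
 have "f >= 0" using f by (simp add: F_eq)
 thus ?thesis using 1 f by (cases "EX f:F n. x : cyl n f") (auto simp: lev_def)
qed

lemma lev_range: "lev n x : insert (- 1) (F n)"
proof (cases "EX f:F n. x : cyl n f")
 case True
 then obtain f where "f : F n" "x : cyl n f" by (elim bexE)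
 thus ?thesis by (simp add: lev_cyl)
qed (simp add: lev_def)

lemma lev_pt: "f : F m ==> m <= n ==> lev n (pt m f w) = f + dsum m n w"
 using lev_cyl[OF dsum_F] pt_in_cyl dsum_F by blast

text \<open>The position at an earlier stage is already encoded in \<open>f\<close>.\<close>

lemma lev_pt_indep:
 assumes "f : F n" "i <= n" shows "lev i (pt n f w) = lev i (pt n f w')"
proof -
 have 1: "pt n f w' : cyl i f'" if f': "f' : F i" and c: "pt n f w : cyl i f'" for f' w w'
 proof -
  obtain v where v': "pt n f w = pt i f' v" using c unfolding cyl_eq by (rule rangeE)
  note v = v'[symmetric]
  have f: "f = f' + dsum i n v" using v pt_eq_iff[OF assms(2) f' assms(1)] by blast
  define v' where "v' = ((%j. if j < n then fst v j else fst w' j), (%j. if j < n then snd v j else snd w' j))"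
  have "dsum i n v' = dsum i n v" by (rule dsum_cong) (auto simp: v'_def)
  moreover have "agree n v' w'" by (auto simp: agree_def v'_def)
  ultimately have "pt i f' v' = pt n f w'" using f pt_eq_iff[OF assms(2) f' assms(1)] by simp
  thus ?thesis by (metis pt_cyl)
 qed
 hence "pt n f w' : cyl i f' \<longleftrightarrow> pt n f w : cyl i f'" if "f' : F i" for f' using that by blast
 thus ?thesis unfolding lev_def by (simp cong: bex_cong conj_cong)
qed

text \<open>The bit \<open>b i\<close> read off from the growth of the level, for every point of
  \<open>X\<close>: at stages before a point enters the tower its bits are False. This default is
  what fixes the weights of the spacer levels.\<close>

definition bt :: "cf_rep set => nat => bool" where
 "bt x i \<longleftrightarrow> lev i x >= 0 & lev (Suc i) x - lev i x >= 2 * h i"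

lemma bt_pt: assumes "f : F n" "i >= n" shows "bt (pt n f w) i = snd w i"
proof -
 have "f + dsum n i w : F i" by (rule dsum_F[OF assms])
 hence "f + dsum n i w >= 0" by (simp add: F_eq)
 thus ?thesis using assms by (simp add: bt_def lev_pt dsum_Suc dg_bit)
qed

lemma bt_pt_indep: assumes "f : F n" "i < n" shows "bt (pt n f w) i = bt (pt n f w') i"
 using lev_pt_indep[OF assms(1), of i w w'] lev_pt_indep[OF assms(1), of "Suc i" w w'] assms(2) by (simp add: bt_def)

section \<open>The map to the dyadic odometer\<close>

abbreviation co :: "nat => int => int set" where "co k z \<equiv> \<Gamma> k #>\<^bsub>integer_group\<^esub> z"

lemma co_eq: "co k z = {v. 2 ^ k dvd v - z}"
 unfolding r_coset_def \<Gamma>_eq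
proof (intro equalityI subsetI)
 fix v assume "v : {v. 2 ^ k dvd v - z}"
 then obtain c where "v - z = 2 ^ k * c" by (auto elim!: dvdE)
 hence "v = 2 ^ k * c + z" by simp
 thus "v : (\<Union>h\<in>range ((*) (2 ^ k)). {h \<otimes>\<^bsub>integer_group\<^esub> z})" by auto
qed auto

lemma co_eq_iff: "co k z = co k z' \<longleftrightarrow> 2 ^ k dvd z - z'"
proof
 assume "co k z = co k z'"
 moreover have "z : co k z" by (simp add: co_eq)
 ultimately show "2 ^ k dvd z - z'" by (simp add: co_eq)
next
 assume d: "2 ^ k dvd z - z'"
 have "2 ^ k dvd v - z \<longleftrightarrow> 2 ^ k dvd v - z'" for v
  using dvd_add_left_iff[OF d, of "v - z"] by simp
 thus "co k z = co k z'" by (simp add: co_eq)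
qed

lemma dsum_dvd: "k <= n ==> 2 ^ k dvd dsum n m w"
 unfolding dsum_def by (intro dvd_sum dg_dvd) auto

abbreviation \<pi> :: "cf_rep set => nat => int set" where "\<pi> \<equiv> cf_odometer_map \<Gamma>"

lemma sum_cc: "n <= m ==> (\<Sum>i\<in>{n<..m}. cc n w i) = dsum n m w"
proof (induction m)
 case (Suc m)
 show ?case
 proof (cases "n = Suc m")
  case False
  hence nm: "n <= m" using Suc.prems by simp
  hence "{n<..Suc m} = insert (Suc m) {n<..m}" by auto
  thus ?thesis using Suc.IH[OF nm] nm by (simp add: dsum_Suc cc_def)
 qed simp
qed simp

text \<open>From stage \<open>k\<close> on only multiples of \<open>2 ^ k\<close> are added, so the
  limit modulo \<open>2 ^ k\<close> is already visible in \<open>f\<close>.\<close>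

lemma \<pi>_pt: assumes "f : F n" "k <= n" shows "\<pi> (pt n f w) k = co k f"
 unfolding cf_odometer_map_def
proof (rule the_equality)
 have "(n, f, cc n w) : pt n f w" using assms mem_pt_iff by blast
 moreover have "\<forall>\<^sub>F m in sequentially. co k (f + (\<Sum>i\<in>{n<..m}. cc n w i)) = co k f"
  using eventually_ge_at_top[of n]
 proof eventually_elim
  case (elim m)
  thus ?case using dsum_dvd[OF assms(2), of m w] by (simp add: sum_cc co_eq_iff)
 qed
 ultimately show "EX (n, f', c):pt n f w. \<forall>\<^sub>F m in sequentially. co k (f' + (\<Sum>i\<in>{n<..m}. c i)) = co k f"
  by (intro bexI[of _ "(n, f, cc n w)"]) auto
next
 fix a assume "EX (n, f', c):pt n f w. \<forall>\<^sub>F m in sequentially. co k (f' + (\<Sum>i\<in>{n<..m}. c i)) = a"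
 then obtain n' f' c where *: "(n', f', c) : pt n f w" "\<forall>\<^sub>F m in sequentially. co k (f' + (\<Sum>i\<in>{n'<..m}. c i)) = a"
  by auto
 obtain w' where w': "f' : F n'" "c = cc n' w'" "pt n' f' w' = pt n f w" using *(1) mem_pt_iff[OF assms(1)] by blast
 from *(2) obtain M where M: "!!m. m >= M ==> co k (f' + (\<Sum>i\<in>{n'<..m}. c i)) = a"
  by (auto simp: eventually_sequentially)
 define m where "m = max M (max n n')"
 have m: "m >= M" "m >= n" "m >= n'" by (auto simp: m_def)
 have "f' + dsum n' m w' = lev m (pt n' f' w')" using lev_pt[OF w'(1) m(3)] by simp
 also have "... = f + dsum n m w" unfolding w'(3) using lev_pt[OF assms(1) m(2)] by simp
 finally have "a = co k (f + dsum n m w)" using M[OF m(1)] m w' by (simp add: sum_cc)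
 also have "... = co k f" using dsum_dvd[OF assms(2), of m w] by (simp add: co_eq_iff)
 finally show "a = co k f" .
qed

lemma \<pi>_pt': assumes "f : F n" "k <= m" "n <= m" shows "\<pi> (pt n f w) k = co k (f + dsum n m w)"
 using \<pi>_pt[OF dsum_F[OF assms(1,3)] assms(2), of w w] pt_lift[OF assms(1,3), of w] by simp

lemma co_add: "co k g <#>\<^bsub>integer_group\<^esub> co k f = co k (g + f)"
proof (intro equalityI subsetI)
 fix v assume "v : co k g <#>\<^bsub>integer_group\<^esub> co k f"
 then obtain p q where "v = p + q" "2 ^ k dvd p - g" "2 ^ k dvd q - f" by (auto simp: set_mult_def co_eq)
 thus "v : co k (g + f)" using dvd_add[of "2 ^ k" "p - g" "q - f"] by (simp add: co_eq algebra_simps)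
next
 fix v assume "v : co k (g + f)"
 hence "v - f : co k g" "f : co k f" by (simp_all add: co_eq algebra_simps)
 thus "v : co k g <#>\<^bsub>integer_group\<^esub> co k f"
  unfolding set_mult_def by (intro UN_I[of "v - f"] UN_I[of f]) simp_all
qed

lemma \<pi>_T: assumes "x : G" shows "\<pi> (T g x) = odometer_act \<Gamma> g (\<pi> x)"
proof
 fix k
 obtain n f w where x: "x = pt n f w" "k <= n" "!!g'. \<bar>g'\<bar> <= \<bar>g\<bar> ==> g' + f : F n"
  using G_rep[OF assms, of k "\<bar>g\<bar>"] by blast
 have f: "f : F n" "g + f : F n" using x(3)[of 0] x(3)[of g] by simp_all
 show "\<pi> (T g x) k = odometer_act \<Gamma> g (\<pi> x) k"
  using T_pt[OF f] \<pi>_pt[OF f(1) x(2)] \<pi>_pt[OF f(2) x(2)] x(1) by (simp add: odometer_act_def odometer_add_def co_add)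
qed

lemma rcosets_\<Gamma>: "rcosets\<^bsub>integer_group\<^esub> (\<Gamma> k) = range (co k)"
 by (auto simp: RCOSETS_def)

lemma \<pi>_space: assumes "x : cf_space F C" shows "\<pi> x : odometer_space \<Gamma>"
proof -
 obtain n f w where x: "x = pt n f w" "f : F n" using assms cf_space_cases by blast
 have "\<pi> x k = co k (f + dsum n (max n (Suc k)) w)" "\<pi> x (Suc k) = co (Suc k) (f + dsum n (max n (Suc k)) w)" for k
  using \<pi>_pt'[OF x(2)] x(1) by simp_all
 moreover have "co (Suc k) z \<subseteq> co k z" for k z
  unfolding co_eq by (auto intro: dvd_trans[OF le_imp_power_dvd[of k "Suc k" 2]])
 ultimately show ?thesis unfolding odometer_space_def rcosets_\<Gamma> by auto
qed

end

section \<open>Borel structure of the \<open>(C,F)\<close>-space\<close>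

context cf_example
begin

abbreviation X :: "cf_rep set set" where "X \<equiv> cf_space F C"
abbreviation XB :: "cf_rep set measure" where "XB \<equiv> cf_borel F C"

definition cyls :: "cf_rep set set set" where "cyls = {cyl n f | n f. f : F n}"

lemma countable_cyls: "countable cyls"
proof -
 have "cyls = (\<Union>n. cyl n ` F n)" unfolding cyls_def by blast
 thus ?thesis using finite_F by (simp add: countable_finite)
qed

lemma cyls_sub: "cyls \<subseteq> Pow X" using cyl_space by (auto simp: cyls_def)

lemma cyl_lift_sub:
 assumes "f : F n" "f' : F m" "m <= n" "pt n f w : cyl m f'" shows "cyl n f \<subseteq> cyl m f'"
proof
 fix x assume "x : cyl n f"
 then obtain w' where "x = pt n f w'" unfolding cyl_eq by (rule rangeE)
 thus "x : cyl m f'"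
  using assms(4) lev_pt_indep[OF assms(1,3), of w w'] by (simp add: lev_cyl[OF assms(2)])
qed

lemma pt_in_cyl_cong:
 assumes "f : F n" "f' : F m" "pt n f w : cyl m f'"
  and "!!i. n <= i ==> i < m ==> fst w i = fst w' i & snd w i = snd w' i"
 shows "pt n f w' : cyl m f'"
proof (cases "n <= m")
 case True
 thus ?thesis using assms dsum_cong[OF assms(4)] by (simp add: pt_in_cyl)
next
 case False
 thus ?thesis using cyl_lift_sub[OF assms(1,2) _ assms(3)] pt_cyl by auto
qed

text \<open>Whether a point given at stage \<open>m\<close> lies in the cylinder depends only on its
  coordinates with index at most \<open>n\<close>.\<close>

lemma cf_open_cyl: assumes f: "f : F n" shows "cf_open F C (cyl n f)"
 unfolding cf_open_def
proof (intro conjI allI)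
 show "cyl n f \<subseteq> X" using cyl_space[OF f] .
 fix m
 let ?P = "product_topology (%k. discrete_topology (C k)) {m<..}"
 let ?S = "{(g, c). g : F m & c : (\<Pi>\<^sub>E k\<in>{m<..}. C k) & cf_point F C m g c : cyl n f}"
 show "openin (prod_topology (discrete_topology (F m)) ?P) ?S"
  unfolding openin_prod_topology_alt
 proof (intro allI impI)
  fix g c assume "(g, c) : ?S"
  hence gc: "g : F m" "c : (\<Pi>\<^sub>E k\<in>{m<..}. C k)" "cf_point F C m g c : cyl n f" by auto
  obtain w where w: "c = cc m w" using cc_surj[OF gc(2)] .
  \<comment> \<open>A basic open box: coordinates up to \<open>n\<close> are frozen, the others are
    free.\<close>
  define W where "W k = (if k <= n then {c k} else C k)" for k
  have ck: "k : {m<..} ==> c k : C k" for k using PiE_mem[OF gc(2)] .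
  have V: "openin ?P (\<Pi>\<^sub>E k\<in>{m<..}. W k)"
   unfolding openin_PiE_gen
  proof (rule disjI2, intro conjI ballI)
   have "{k : {m<..}. W k ~= topspace (discrete_topology (C k))} \<subseteq> {..n}" by (auto simp: W_def)
   thus "finite {k : {m<..}. W k ~= topspace (discrete_topology (C k))}" by (rule finite_subset) simp
   show "openin (discrete_topology (C k)) (W k)" if "k : {m<..}" for k using ck[OF that] by (simp add: W_def)
  qed
  have sub: "{g} \<times> (\<Pi>\<^sub>E k\<in>{m<..}. W k) \<subseteq> ?S"
  proof clarify
   fix c' assume c': "c' : (\<Pi>\<^sub>E k\<in>{m<..}. W k)"
   have c'C: "c' : (\<Pi>\<^sub>E k\<in>{m<..}. C k)"
   proof (rule PiE_I)
    show "c' k : C k" if "k : {m<..}" for k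
     using PiE_mem[OF c' that] ck[OF that] by (auto simp: W_def split: if_splits)
    show "c' k = undefined" if "k ~: {m<..}" for k using PiE_arb[OF c' that] .
   qed
   obtain w' where w': "c' = cc m w'" using cc_surj[OF c'C] .
   have "fst w i = fst w' i & snd w i = snd w' i" if "m <= i" "i < n" for i
   proof -
    have "c' (Suc i) = c (Suc i)" using PiE_mem[OF c', of "Suc i"] that by (simp add: W_def)
    thus ?thesis using that by (simp add: w w' cc_def dg_inj)
   qed
   hence "pt m g w' : cyl n f"
    using pt_in_cyl_cong[OF gc(1) f, of w w'] gc(3) by (simp add: pt_def w)
   thus "g : F m & c' : (\<Pi>\<^sub>E k\<in>{m<..}. C k) & cf_point F C m g c' : cyl n f"
    using gc(1) c'C by (simp add: pt_def w')
  qed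
  have "c : (\<Pi>\<^sub>E k\<in>{m<..}. W k)"
  proof (rule PiE_I)
   show "c k : W k" if "k : {m<..}" for k using ck[OF that] by (auto simp: W_def)
   show "c k = undefined" if "k ~: {m<..}" for k using PiE_arb[OF gc(2) that] .
  qed
  thus "EX U V. openin (discrete_topology (F m)) U & openin ?P V & g : U & c : V & U \<times> V \<subseteq> ?S"
   using V sub gc(1) by (intro exI[of _ "{g}"] exI[of _ "\<Pi>\<^sub>E k\<in>{m<..}. W k"]) simp
 qed
qed

text \<open>A basic open box restricts finitely many coordinates; a cylinder beyond the last of
  these fits inside. Hence the countably many cylinders generate the Borel sets.\<close>

lemma cf_open_contains_cyl:
 assumes U: "cf_open F C U" and x: "x : U" shows "EX n. EX f:F n. x : cyl n f & cyl n f \<subseteq> U"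
proof -
 have "x : X" using U x by (auto simp: cf_open_def)
 then obtain n f w where xw: "x = pt n f w" "f : F n" by (rule cf_space_cases)
 let ?P = "product_topology (%k. discrete_topology (C k)) {n<..}"
 let ?S = "{(g, c). g : F n & c : (\<Pi>\<^sub>E k\<in>{n<..}. C k) & cf_point F C n g c : U}"
 have "openin (prod_topology (discrete_topology (F n)) ?P) ?S" using U by (simp add: cf_open_def)
 moreover have "(f, cc n w) : ?S" using xw x cc_PiE by (simp add: pt_def)
 ultimately have "EX U0 V. openin (discrete_topology (F n)) U0 & openin ?P V & f : U0 & cc n w : V & U0 \<times> V \<subseteq> ?S"
  by (rule openin_prod_topology_alt[THEN iffD1, THEN spec, THEN spec, THEN mp])
 then obtain U0 V where V: "openin ?P V" "f : U0" "cc n w : V" "U0 \<times> V \<subseteq> ?S"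
  by (elim exE conjE)
 obtain W where W: "finite {k : {n<..}. W k ~= topspace (discrete_topology (C k))}"
   "cc n w : Pi\<^sub>E {n<..} W" "Pi\<^sub>E {n<..} W \<subseteq> V"
  using openin_product_topology_alt[THEN iffD1, THEN bspec, OF V(1,3)] by (elim exE conjE)
 obtain N where N: "!!k. k : {k : {n<..}. W k ~= topspace (discrete_topology (C k))} ==> k <= N"
  using W(1) by (meson finite_nat_set_iff_bounded_le)
 define m where "m = max n N"
 have m: "n <= m" "N <= m" by (auto simp: m_def)
 let ?f = "f + dsum n m w"
 have fm: "?f : F m" using dsum_F[OF xw(2) m(1)] .
 have "cyl m ?f \<subseteq> U"
 proof
  fix y assume "y : cyl m ?f"
  then obtain w' where y: "y = pt m ?f w'" unfolding cyl_eq by (rule rangeE)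
  define v where "v = ((%i. if i < m then fst w i else fst w' i), (%i. if i < m then snd w i else snd w' i))"
  have "dsum n m v = dsum n m w" by (rule dsum_cong) (auto simp: v_def)
  moreover have "agree m v w'" by (auto simp: agree_def v_def)
  ultimately have yv: "y = pt n f v" using pt_eq_iff[OF m(1) xw(2) fm, of v w'] y by simp
  have "cc n v : Pi\<^sub>E {n<..} W"
  proof (rule PiE_I)
   fix k assume k: "k : {n<..}"
   show "cc n v k : W k"
   proof (cases "k <= m")
    case True
    hence "k - 1 < m" using k by auto
    hence "cc n v k = cc n w k" using k by (simp add: cc_def v_def)
    thus ?thesis using PiE_mem[OF W(2) k] by simp
   next
    case False
    hence "W k = C k" using N[of k] k m by force
    thus ?thesis using PiE_mem[OF cc_PiE k] by simp
   qed
  next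
   fix k assume "k ~: {n<..}"
   thus "cc n v k = undefined" by (simp add: cc_def)
  qed
  hence "(f, cc n v) : ?S" using V(2,4) W(3) by auto
  thus "y : U" by (simp add: yv pt_def)
 qed
 moreover have "x : cyl m ?f" using pt_lift[OF xw(2) m(1), of w] xw(1) by simp
 ultimately show ?thesis using fm by blast
qed

lemma space_XB [simp]: "space XB = X"
 unfolding cf_borel_def by (rule space_measure_of) (auto simp: cf_open_def)

lemma sets_XB: "sets XB = sigma_sets X cyls"
proof -
 have eq: "sets XB = sigma_sets X {U. cf_open F C U}"
  unfolding cf_borel_def by (rule sets_measure_of) (auto simp: cf_open_def)
 show ?thesis unfolding eq
 proof (intro equalityI sigma_sets_mono subsetI)
  fix U assume "U : {U. cf_open F C U}"
  hence U: "cf_open F C U" by simp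
  have "U = \<Union>{A\<in>cyls. A \<subseteq> U}"
   using cf_open_contains_cyl[OF U] unfolding cyls_def by blast
  moreover have "\<Union>{A\<in>cyls. A \<subseteq> U} : sigma_sets X cyls"
   by (intro sigma_sets_UNION countable_subset[OF _ countable_cyls]) auto
  ultimately show "U : sigma_sets X cyls" by simp
 next
  fix A assume "A : cyls"
  thus "A : sigma_sets X {U. cf_open F C U}" using cf_open_cyl by (auto simp: cyls_def)
 qed
qed

lemma cyl_sets [measurable]: "f : F n ==> cyl n f : sets XB"
 unfolding sets_XB by (rule sigma_sets.Basic) (auto simp: cyls_def)

lemma measurable_XB:
 assumes "!!x. x : space M ==> \<phi> x : X"
  and "!!n f. f : F n ==> {x\<in>space M. \<phi> x : cyl n f} : sets M"
 shows "\<phi> : measurable M XB"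
proof (rule measurable_sigma_sets[OF sets_XB cyls_sub])
 show "\<phi> : space M \<rightarrow> X" using assms(1) by auto
 fix A assume "A : cyls"
 then obtain n f where A: "A = cyl n f" "f : F n" by (auto simp: cyls_def)
 have "\<phi> -` A Int space M = {x\<in>space M. \<phi> x : cyl n f}" using A by auto
 thus "\<phi> -` A Int space M : sets M" using assms(2)[OF A(2)] by simp
qed

lemma lev_measurable [measurable]: "lev n : measurable XB (count_space UNIV)"
proof (rule measurable_count_space_eq_countable[THEN iffD2])
 show "countable (UNIV :: int set)" by simp
 show "lev n : space XB \<rightarrow> UNIV & (ALL a:UNIV. lev n -` {a} Int space XB : sets XB)"
 proof (intro conjI ballI)
  fix a
  consider "a : F n" | "a = - 1" | "a ~: insert (- 1) (F n)" by auto
  thus "lev n -` {a} Int space XB : sets XB"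
  proof cases
   case 1
   hence "lev n -` {a} Int space XB = cyl n a" using lev_cyl[OF 1] cyl_space[OF 1] by auto
   thus ?thesis using 1 by simp
  next
   case 2
   have "(-1) ~: F n" by (simp add: F_eq)
   hence "lev n x = - 1 \<longleftrightarrow> (ALL f:F n. x ~: cyl n f)" for x
    using lev_range[of n x] lev_cyl[of _ n x] by auto
   hence "lev n -` {a} Int space XB = X - (\<Union>f\<in>F n. cyl n f)" using 2 by auto
   thus ?thesis using finite_F sets.top[of XB] by (auto intro!: sets.Diff sets.finite_UN)
  next
   case 3
   hence "lev n -` {a} Int space XB = {}" using lev_range[of n] by auto
   thus ?thesis by simp
  qed
 qed auto
qed

lemma lev_real_measurable [measurable]: "(%x. real_of_int (lev n x)) : borel_measurable XB"
 using measurable_compose[OF lev_measurable, of real_of_int borel] by simp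

lemma dsum_real_measurable [measurable]:
 "(%w. real_of_int (dsum n m w)) : borel_measurable (bern \<alpha> \<Otimes>\<^sub>M bern \<beta>)"
proof -
 have 1: "Measurable.pred (bern \<alpha> \<Otimes>\<^sub>M bern \<beta>) (%w. fst w i)" "Measurable.pred (bern \<alpha> \<Otimes>\<^sub>M bern \<beta>) (%w. snd w i)" for i
  using measurable_compose[OF measurable_fst measurable_bern_component] measurable_compose[OF measurable_snd measurable_bern_component] by auto
 have "real_of_int (dsum n m w) = (\<Sum>i\<in>{n..<m}. (if fst w i then real_of_int (h i) else 0) + (if snd w i then real_of_int (2 * h i + 2 ^ (i + 1)) else 0))" for w
  by (simp add: dsum_def dg_def of_int_sum) (intro sum.cong; simp)
 thus ?thesis using 1 by (simp only:) measurable
qed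

lemma pt_measurable [measurable]:
 assumes f: "f : F n" shows "pt n f : measurable (bern \<alpha> \<Otimes>\<^sub>M bern \<beta>) XB"
proof (rule measurable_XB)
 show "pt n f w : X" for w using pt_space[OF f] .
 have sp: "space (bern \<alpha> \<Otimes>\<^sub>M bern \<beta>) = UNIV" by (simp add: space_pair_measure)
 fix m g assume g: "g : F m"
 show "{w\<in>space (bern \<alpha> \<Otimes>\<^sub>M bern \<beta>). pt n f w : cyl m g} : sets (bern \<alpha> \<Otimes>\<^sub>M bern \<beta>)"
 proof (cases "n <= m")
  case True
  have "{w\<in>space (bern \<alpha> \<Otimes>\<^sub>M bern \<beta>). pt n f w : cyl m g} = {w\<in>space (bern \<alpha> \<Otimes>\<^sub>M bern \<beta>). real_of_int (dsum n m w) = real_of_int (g - f)}"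
   using pt_in_cyl[OF True f g] by (auto simp del: of_int_diff)
  thus ?thesis by simp
 next
  case False
  hence "pt n f w : cyl m g \<longleftrightarrow> pt n f w' : cyl m g" for w w'
   using pt_in_cyl_cong[OF f g] by (meson le_less_trans less_le_trans nat_le_linear not_le)
  hence "{w\<in>space (bern \<alpha> \<Otimes>\<^sub>M bern \<beta>). pt n f w : cyl m g} = {} \<or>
    {w\<in>space (bern \<alpha> \<Otimes>\<^sub>M bern \<beta>). pt n f w : cyl m g} = space (bern \<alpha> \<Otimes>\<^sub>M bern \<beta>)" by auto
  thus ?thesis by (elim disjE) (simp_all only: sets.empty_sets sets.top)
 qed
qed

text \<open>Expresses membership in \<open>G\<close> by countably many conditions on the functions
  \<open>lev n\<close>, which makes it Borel and, later, G-delta.\<close>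

lemma G_lev: assumes "x : X" shows "x : G \<longleftrightarrow> (ALL g. EX n. lev n x : F n & g + lev n x : F n)"
proof -
 have "x : cf_dom F C g \<longleftrightarrow> (EX n. lev n x : F n & g + lev n x : F n)" for g
 proof
  assume "x : cf_dom F C g"
  then obtain n f c where n: "(n, f, c) : x" "g + f : F n" by (auto simp: cf_dom_def)
  obtain n' f' w' where x: "x = pt n' f' w'" "f' : F n'" using cf_space_cases[OF assms] .
  have "f : F n & (EX w. c = cc n w & pt n f w = pt n' f' w')"
   using n(1) unfolding x(1) mem_pt_iff[OF x(2)] .
  then obtain w where "f : F n" "pt n f w = x" unfolding x(1) by blast
  hence "f : F n" "lev n x = f" using lev_cyl[of f n x] pt_cyl[of n f w] by auto
  thus "EX n. lev n x : F n & g + lev n x : F n" using n(2) by blast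
 next
  assume "EX n. lev n x : F n & g + lev n x : F n"
  then obtain n where n: "lev n x : F n" "g + lev n x : F n" by blast
  hence "x : cyl n (lev n x)" by (simp add: lev_cyl)
  then obtain w where w: "x = pt n (lev n x) w" unfolding cyl_eq by (rule rangeE)
  have "(n, lev n x, cc n w) : pt n (lev n x) w" using mem_pt_iff[OF n(1)] n(1) by blast
  hence "(n, lev n x, cc n w) : x" using w by simp
  thus "x : cf_dom F C g" using n(2) assms unfolding cf_dom_def by blast
 qed
 thus ?thesis by (simp add: cf_global_def)
qed

lemma G_sets [measurable]: "G : sets XB"
proof -
 have "G = {x\<in>space XB. ALL g. EX n. lev n x : F n & g + lev n x : F n}"
  using G_lev G_space by auto
 moreover have "{x\<in>space XB. lev n x : F n & g + lev n x : F n} : sets XB" for n g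
 proof -
  have "{x\<in>space XB. lev n x : F n & g + lev n x : F n} = lev n -` (F n Int {f. g + f : F n}) Int space XB" by auto
  thus ?thesis using measurable_sets[OF lev_measurable, of "F n Int {f. g + f : F n}" n] by simp
 qed
 ultimately show ?thesis by (simp only:) (intro sets.sets_Collect_countable_All sets.sets_Collect_countable_Ex)
qed

lemma bt_measurable [measurable]: "bt : measurable XB (bern \<alpha>)"
proof (rule measurable_bernI)
 fix i
 have "bt x i \<longleftrightarrow> real_of_int (lev i x) >= 0 & real_of_int (lev (Suc i) x) - real_of_int (lev i x) >= real_of_int (2 * h i)" for x
  unfolding bt_def by (simp only: of_int_0_le_iff of_int_diff[symmetric] of_int_le_iff)
 thus "(%x. bt x i) : measurable XB (count_space UNIV)" by (simp only:) measurable
qed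

text \<open>\<open>T g x\<close> enters a cylinder iff \<open>x\<close> lies in one of countably
  many cylinders that are shifted into it by \<open>g\<close> as a whole.\<close>

lemma T_measurable:
 assumes "sets M = sets (restrict_space XB G)" shows "T g : measurable M M"
proof -
 have sp: "space M = G" using sets_eq_imp_space_eq[OF assms] G_space by (auto simp: space_restrict_space)
 have m: "T g : measurable (restrict_space XB G) XB"
 proof (rule measurable_XB)
  fix x assume "x : space (restrict_space XB G)"
  thus "T g x : X" using T_G G_space by (auto simp: space_restrict_space)
 next
  fix n f assume f: "f : F n"
  let ?J = "{(m, f'). m >= n & f' : F m & g + f' : F m & cyl m (g + f') \<subseteq> cyl n f}"
  have "x : G ==> T g x : cyl n f \<longleftrightarrow> (EX (m, f'):?J. x : cyl m f')" for x
  proof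
   assume x: "x : G" "T g x : cyl n f"
   obtain m f' w where r: "x = pt m f' w" "n <= m" "!!g'. \<bar>g'\<bar> <= \<bar>g\<bar> ==> g' + f' : F m"
    using G_rep[OF x(1), of n "\<bar>g\<bar>"] by blast
   have f': "f' : F m" "g + f' : F m" using r(3)[of 0] r(3)[of g] by simp_all
   have "pt m (g + f') w : cyl n f" using x(2) T_pt[OF f'] r(1) by simp
   hence "cyl m (g + f') \<subseteq> cyl n f" using cyl_lift_sub[OF f'(2) f r(2)] by blast
   thus "EX (m, f'):?J. x : cyl m f'" using r f' by (intro bexI[of _ "(m, f')"]) auto
  next
   assume "EX (m, f'):?J. x : cyl m f'"
   then obtain m f' where j: "f' : F m" "g + f' : F m" "cyl m (g + f') \<subseteq> cyl n f" "x : cyl m f'" by auto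
   obtain w where "x = pt m f' w" using j(4) unfolding cyl_eq by (rule rangeE)
   hence "T g x : cyl m (g + f')" using T_pt[OF j(1,2)] by simp
   thus "T g x : cyl n f" using j(3) by blast
  qed
  hence "{x : space (restrict_space XB G). T g x : cyl n f} = (\<Union>(m, f')\<in>?J. cyl m f') Int G"
   using G_space by (auto simp: space_restrict_space)
  moreover have "(\<Union>(m, f')\<in>?J. cyl m f') : sets XB"
   by (intro sets.countable_UN') auto
  ultimately show "{x : space (restrict_space XB G). T g x : cyl n f} : sets (restrict_space XB G)"
   by (auto simp: sets_restrict_space)
 qed
 have "T g : measurable (restrict_space XB G) (restrict_space XB G)"
  using m T_G by (intro measurable_restrict_space2) (auto simp: space_restrict_space)
 thus ?thesis using measurable_cong_sets[OF assms assms] by simp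
qed

lemma \<pi>_measurable: "\<pi> : measurable XB (odometer_borel \<Gamma>)"
 unfolding odometer_borel_def
proof (rule measurable_restrict_space2)
 show "\<pi> : space XB \<rightarrow> odometer_space \<Gamma>" using \<pi>_space by simp
 show "\<pi> : measurable XB (\<Pi>\<^sub>M n\<in>UNIV. count_space (rcosets\<^bsub>integer_group\<^esub> \<Gamma> n))"
 proof (rule measurable_PiM_single')
  show "\<pi> : space XB \<rightarrow> (\<Pi>\<^sub>E i\<in>UNIV. space (count_space (rcosets\<^bsub>integer_group\<^esub> \<Gamma> i)))"
   using \<pi>_space by (auto simp: odometer_space_def PiE_UNIV_domain)
  fix k
  have fin: "countable (range (co k))" by simp
  show "(%x. \<pi> x k) : measurable XB (count_space (rcosets\<^bsub>integer_group\<^esub> \<Gamma> k))"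
   unfolding rcosets_\<Gamma> measurable_count_space_eq_countable[OF fin]
  proof (intro conjI ballI)
   show "(%x. \<pi> x k) : space XB \<rightarrow> range (co k)"
    using \<pi>_space by (auto simp: odometer_space_def rcosets_\<Gamma>)
   fix a assume "a : range (co k)"
   let ?J = "{(n, f). k <= n & f : F n & co k f = a}"
   have "(%x. \<pi> x k) -` {a} Int space XB = (\<Union>(n, f)\<in>?J. cyl n f)"
   proof (intro equalityI subsetI)
    fix x assume x: "x : (%x. \<pi> x k) -` {a} Int space XB"
    hence "x : X" by simp
    then obtain n f w where r: "x = pt n f w" "f : F n" by (rule cf_space_cases)
    let ?m = "max n k"
    have r': "x = pt ?m (f + dsum n ?m w) w" "f + dsum n ?m w : F ?m"
     using pt_lift[OF r(2), of ?m w] r(1) dsum_F[OF r(2), of ?m w] by simp_all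
    have "co k (f + dsum n ?m w) = a" using \<pi>_pt[OF r'(2), of k w] r'(1) x by simp
    moreover have "x : cyl ?m (f + dsum n ?m w)" using r'(1) pt_cyl by metis
    ultimately show "x : (\<Union>(n, f)\<in>?J. cyl n f)"
     using r'(2) by (intro UN_I[of "(?m, f + dsum n ?m w)"]) auto
   next
    fix x assume "x : (\<Union>(n, f)\<in>?J. cyl n f)"
    then obtain n f where j: "k <= n" "f : F n" "co k f = a" "x : cyl n f" by auto
    obtain w where "x = pt n f w" using j(4) unfolding cyl_eq by (rule rangeE)
    thus "x : (%x. \<pi> x k) -` {a} Int space XB"
     using \<pi>_pt[OF j(2,1), of w] j(3) pt_space[OF j(2)] by simp
   qed
   moreover have "(\<Union>(n, f)\<in>?J. cyl n f) : sets XB"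
    by (intro sets.countable_UN') auto
   ultimately show "(%x. \<pi> x k) -` {a} Int space XB : sets XB" by simp
  qed
 qed
qed

text \<open>Coordinates in the Polish space of real sequences, by which \<open>G\<close> is shown to
  be standard Borel.\<close>

definition levr :: "cf_rep set => nat => real" where "levr x n = real_of_int (lev n x)"

lemma levr_inj: "inj_on levr X"
proof (rule inj_onI)
 fix x y assume xy: "x : X" "y : X" "levr x = levr y"
 have lev: "lev n x = lev n y" for n using fun_cong[OF xy(3), of n] by (simp add: levr_def)
 obtain n f w where x: "x = pt n f w" "f : F n" using cf_space_cases[OF xy(1)] .
 obtain n' f' w' where y: "y = pt n' f' w'" "f' : F n'" using cf_space_cases[OF xy(2)] .
 define N where "N = max n n'"
 have N: "n <= N" "n' <= N" by (auto simp: N_def)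
 let ?f = "f + dsum n N w" and ?f' = "f' + dsum n' N w'"
 have F: "?f : F N" "?f' : F N" using dsum_F x(2) y(2) N by auto
 have xN: "x = pt N ?f w" "y = pt N ?f' w'" using pt_lift x y N by auto
 have "?f + dsum N m w = ?f' + dsum N m w'" if "N <= m" for m
  using lev[of m] lev_pt[OF F(1) that, of w] lev_pt[OF F(2) that, of w'] xN by simp
 hence "?f = ?f' & (ALL i. N <= i & i < m --> fst w i = fst w' i & snd w i = snd w' i)" if "N <= m" for m
  using dsum_unique[OF F that, of w w'] that by simp
 hence "?f = ?f'" "!!i. N <= i ==> fst w i = fst w' i & snd w i = snd w' i"
  by (blast, metis le_SucI lessI)
 thus "x = y" using pt_eq_same[OF F] xN by (simp add: agree_def)
qed

text \<open>The possible levels at two consecutive stages. A point outside the \<open>n\<close>-th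
  tower either stays outside or enters as a spacer, so its next level is not of the form
  \<open>f + dg n x y\<close>.\<close>

definition lev_pairs :: "nat => (int \<times> int) set" where
 "lev_pairs n = {(-1, s) | s. s : insert (-1) (F (Suc n)) & (ALL f:F n. ALL x y. s ~= f + dg n x y)} \<union>
   (%(f, x, y). (f, f + dg n x y)) ` (F n \<times> UNIV \<times> UNIV)"

lemma finite_lev_pairs: "finite (lev_pairs n)"
proof -
 have "{(-1, s) | s. s : insert (-1) (F (Suc n)) & (ALL f:F n. ALL x y. s ~= f + dg n x y)} \<subseteq> {-1} \<times> insert (-1) (F (Suc n))" by auto
 moreover have "finite ({-1 :: int} \<times> insert (-1) (F (Suc n)))" using finite_F by simp
 ultimately have "finite {(-1 :: int, s) | s. s : insert (-1) (F (Suc n)) & (ALL f:F n. ALL x y. s ~= f + dg n x y)}" by (rule finite_subset)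
 thus ?thesis unfolding lev_pairs_def using finite_F by simp
qed

text \<open>A point is rebuilt from its first level inside a tower and the digits that follow;
  admissibility of the pairs supplies these digits.\<close>

lemma levr_image:
 "levr ` X = {v. (ALL n. (v n, v (Suc n)) : (%(p, q). (real_of_int p, real_of_int q)) ` lev_pairs n) & (EX n. v n > -1)}"
proof (intro equalityI subsetI)
 fix v assume "v : levr ` X"
 then obtain x where x: "x : X" "v = levr x" by auto
 have "(lev n x, lev (Suc n) x) : lev_pairs n" for n
 proof (cases "lev n x = -1")
  case True
  have "lev (Suc n) x ~= f + dg n a b" if f: "f : F n" for f a b
  proof
   assume "lev (Suc n) x = f + dg n a b"
   hence "x : cyl (Suc n) (f + dg n a b)" using lev_cyl[OF dg_F[OF f]] by simp
   hence "x : cyl n f" unfolding cyl_Suc[OF f] by blast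
   thus False using lev_cyl[OF f] True f by (simp add: F_eq)
  qed
  thus ?thesis using True lev_range[of "Suc n" x] unfolding lev_pairs_def by simp
 next
  case False
  hence f: "lev n x : F n" using lev_range[of n x] by simp
  hence "x : cyl n (lev n x)" by (simp add: lev_cyl)
  then obtain a b where "x : cyl (Suc n) (lev n x + dg n a b)" unfolding cyl_Suc[OF f] by blast
  hence "lev (Suc n) x = lev n x + dg n a b" using lev_cyl[OF dg_F[OF f]] by simp
  thus ?thesis unfolding lev_pairs_def using f by (intro UnI2 image_eqI[of _ _ "(lev n x, a, b)"]) auto
 qed
 moreover obtain n f w where "x = pt n f w" "f : F n" using cf_space_cases[OF x(1)] .
 hence "lev n x = f" "f >= 0" using lev_pt[of f n n w] by (auto simp: F_eq)
 hence "v n > -1" by (simp add: x(2) levr_def)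
 ultimately show "v : {v. (ALL n. (v n, v (Suc n)) : (%(p, q). (real_of_int p, real_of_int q)) ` lev_pairs n) & (EX n. v n > -1)}"
  unfolding x(2) levr_def by (auto intro: image_eqI[rotated])
next
 fix v :: "nat => real"
 assume "v : {v. (ALL n. (v n, v (Suc n)) : (%(p, q). (real_of_int p, real_of_int q)) ` lev_pairs n) & (EX n. v n > -1)}"
 hence v: "!!n. EX p q. (p, q) : lev_pairs n & v n = real_of_int p & v (Suc n) = real_of_int q" "EX n. v n > -1"
  by fastforce+
 \<comment> \<open>The stage at which the point enters the towers; all earlier levels are
   \<open>-1\<close>.\<close>
 define N where "N = (LEAST n. v n > -1)"
 have N: "v N > -1" "!!n. n < N ==> \<not> v n > -1" unfolding N_def using LeastI_ex[OF v(2)] not_less_Least by auto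
 define u where "u n = \<lfloor>v n\<rfloor>" for n
 have vu: "v n = real_of_int (u n)" for n using v(1)[of n] by (auto simp: u_def)
 have pair: "(u n, u (Suc n)) : lev_pairs n" for n using v(1)[of n] by (auto simp: u_def)
 have step: "EX a b. u (Suc n) = u n + dg n a b" if "u n ~= -1" for n
  using pair[of n] that unfolding lev_pairs_def by auto
 have uN: "u N ~= -1" using N(1) vu[of N] by simp
 have uF: "u n : insert (-1) (F n)" for n
  using pair[of n] unfolding lev_pairs_def by auto
 have uNF: "u N : F N" using uF[of N] uN by simp
 have um: "u n : F n" if "N <= n" for n using that
 proof (induction n rule: dec_induct)
  case base show ?case by (rule uNF)
 next
  case (step n)
  hence "u n ~= -1" by (auto simp: F_eq)
  then obtain a b where "u (Suc n) = u n + dg n a b" using \<open>!!n. u n ~= -1 ==> EX a b. u (Suc n) = u n + dg n a b\<close> by blast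
  thus ?case using dg_F step by simp
 qed
 have "ALL n. EX a b. N <= n --> u (Suc n) = u n + dg n a b"
 proof
  fix n show "EX a b. N <= n --> u (Suc n) = u n + dg n a b"
   using step[of n] um[of n] by (cases "N <= n") (auto simp: F_eq)
 qed
 then obtain a b where ab: "!!n. N <= n ==> u (Suc n) = u n + dg n (a n) (b n)" by metis
 let ?x = "pt N (u N) (a, b)"
 have un: "u n = u N + dsum N n (a, b)" if "N <= n" for n using that
 proof (induction n rule: dec_induct)
  case (step n)
  thus ?case using ab[of n] by (simp add: dsum_Suc)
 qed simp
 have xX: "?x : X" using pt_space[OF uNF] .
 have "levr ?x n = v n" for n
 proof (cases "N <= n")
  case True
  thus ?thesis using lev_pt[OF uNF True] un[OF True] by (simp add: levr_def vu)
 next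
  case False
  \<comment> \<open>Membership in a tower persists, so an earlier level would give
    \<open>u N\<close> the form \<open>f + dg k x y\<close>, which the pair at stage
    \<open>k = N - 1\<close> forbids.\<close>
  have "lev n ?x = -1"
  proof (rule ccontr)
   assume "lev n ?x ~= -1"
   hence l: "lev n ?x : F n" using lev_range[of n ?x] by simp
   have l': "lev k ?x : F k" if "n <= k" for k using that
   proof (induction k rule: dec_induct)
    case base show ?case by (rule l)
   next
    case (step k)
    hence "?x : cyl k (lev k ?x)" by (simp add: lev_cyl)
    then obtain a' b' where "?x : cyl (Suc k) (lev k ?x + dg k a' b')" unfolding cyl_Suc[OF step.IH] by blast
    thus ?case using lev_cyl[OF dg_F[OF step.IH]] dg_F[OF step.IH] by metis
   qed
   define k where "k = N - 1"
   have k: "N = Suc k" "n <= k" using False by (auto simp: k_def)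
   have "?x : cyl k (lev k ?x)" using l'[OF k(2)] by (simp add: lev_cyl)
   then obtain a' b' where "?x : cyl (Suc k) (lev k ?x + dg k a' b')" unfolding cyl_Suc[OF l'[OF k(2)]] by blast
   hence "lev N ?x = lev k ?x + dg k a' b'" using lev_cyl[OF dg_F[OF l'[OF k(2)]]] k(1) by simp
   hence "u (Suc k) = lev k ?x + dg k a' b'" using lev_pt[OF uNF, of N] k(1) by simp
   moreover have "u k = -1" using N(2)[of k] k uF[of k] vu[of k] by (auto simp: F_eq)
   hence "ALL f:F k. ALL x y. u (Suc k) ~= f + dg k x y"
    using pair[of k] unfolding lev_pairs_def by (auto simp: F_eq)
   ultimately show False using l'[OF k(2)] by blast
  qed
  moreover have "u n = -1" using N(2)[of n] False uF[of n] vu[of n] by (auto simp: F_eq)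
  ultimately show ?thesis by (simp add: levr_def vu)
 qed
 hence "levr ?x = v" by (rule ext)
 thus "v : levr ` X" using xX by blast
qed

text \<open>Each pair condition is closed, since it has finitely many solutions; entering a tower
  and admitting the shift by \<open>g\<close> are open. Countable intersections of such sets are
  G-delta.\<close>

lemma gdelta_levr_image: "gdelta_in euclidean (levr ` G)"
proof -
 have mz: "metrizable_space (euclidean :: (nat => real) topology)" by (rule metrizable_space_euclidean)
 let ?A = "%n. (%v :: nat => real. (v n, v (Suc n))) -` ((%(p, q). (real_of_int p, real_of_int q)) ` lev_pairs n)"
 \<comment> \<open>The coordinates of points in the image are integers, so an open interval of
   radius 1 expresses equality with \<open>f\<close>.\<close>
 let ?E = "%g. \<Union>n. \<Union>f\<in>{f\<in>F n. g + f : F n}. (%v :: nat => real. v n) -` {real_of_int f - 1 <..< real_of_int f + 1}"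
 have c: "continuous_on UNIV (%v :: nat => real. v n)" for n by (rule continuous_on_product_coordinates)
 have A: "gdelta_in euclidean (?A n)" for n
 proof -
  have "closed (?A n)"
   using finite_lev_pairs by (intro closed_vimage finite_imp_closed finite_imageI continuous_on_Pair c)
  thus ?thesis by (intro closed_imp_gdelta_in[OF mz]) simp
 qed
 have o: "open ((%v :: nat => real. v n) -` U)" if "open U" for n U
  using open_vimage[OF that c] .
 have E: "gdelta_in euclidean (?E g)" for g
  by (intro open_imp_gdelta_in) (auto intro!: open_UN o)
 have E0: "gdelta_in euclidean (\<Union>n. (%v :: nat => real. v n) -` {-1<..})"
  by (intro open_imp_gdelta_in) (auto intro!: open_UN o)
 have gs: "gdelta_in euclidean (\<Inter>(range ?A) Int (\<Union>n. (%v :: nat => real. v n) -` {-1<..}) Int \<Inter>(range ?E))"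
  by (intro gdelta_in_Int gdelta_in_Inter E0) (auto simp: A E simp del: UN_simps)
 have lX: "levr ` X = \<Inter>(range ?A) Int (\<Union>n. (%v :: nat => real. v n) -` {-1<..})"
  unfolding levr_image by auto
 have mem: "levr x : \<Inter>(range ?E) \<longleftrightarrow> x : G" if "x : X" for x
 proof -
  have "levr x : ?E g \<longleftrightarrow> (EX n. lev n x : F n & g + lev n x : F n)" for g
  proof
   assume "levr x : ?E g"
   then obtain n f where "f : F n" "g + f : F n" "real_of_int f - 1 < levr x n" "levr x n < real_of_int f + 1" by auto
   moreover from this have "lev n x = f" by (simp add: levr_def)
   ultimately show "EX n. lev n x : F n & g + lev n x : F n" by (intro exI[of _ n]) simp
  next
   assume "EX n. lev n x : F n & g + lev n x : F n"
   then obtain n where "lev n x : F n" "g + lev n x : F n" by blast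
   thus "levr x : ?E g" by (intro UN_I[of n UNIV] UN_I[of "lev n x"]) (auto simp: levr_def)
  qed
  thus ?thesis using G_lev[OF that] by auto
 qed
 have "levr ` G = levr ` X Int \<Inter>(range ?E)"
 proof (rule equalityI[OF subsetI subsetI])
  fix v assume "v : levr ` G"
  then obtain x where x: "v = levr x" "x : G" by (rule imageE)
  hence xX: "x : X" using G_space by blast
  thus "v : levr ` X Int \<Inter>(range ?E)" unfolding x(1) using mem[OF xX] x(2) by (simp only: Int_iff imageI)
 next
  fix v assume v: "v : levr ` X Int \<Inter>(range ?E)"
  then obtain x where x: "v = levr x" "x : X" by (elim IntE imageE)
  hence "x : G" using mem[OF x(2)] v by (simp only: Int_iff)
  thus "v : levr ` G" unfolding x(1) by (rule imageI)
 qed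
 thus ?thesis using gs unfolding lX by simp
qed

text \<open>The Borel sets of \<open>G\<close> are those pulled back by \<open>levr\<close>, as a
  cylinder is the preimage of one value of one coordinate.\<close>

lemma standard_borel_G:
 assumes sets: "sets M = sets (restrict_space XB G)" shows "standard_borel M"
proof -
 have sp: "space M = G" using sets_eq_imp_space_eq[OF sets] G_space by (auto simp: space_restrict_space)
 have lm: "levr : measurable XB borel"
  using lev_real_measurable by (intro measurable_coordinatewise_then_product) (simp add: levr_def)
 have lm': "levr : measurable (restrict_space XB G) borel" using lm by (rule measurable_restrict_space1)
 show ?thesis
 proof (rule standard_borelI)
  show "inj_on levr (space M)" using levr_inj G_space unfolding sp by (rule inj_on_subset)
  show "gdelta_in euclidean (levr ` space M)" unfolding sp by (rule gdelta_levr_image)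
  let ?V = "vimage_algebra G levr borel"
  have V: "sets ?V = {levr -` B Int G | B. B : sets borel}" by (rule sets_vimage_algebra2) auto
  have lV: "levr : measurable ?V borel" by (rule measurable_vimage_algebra1) auto
  have "(%x. x) : measurable ?V XB"
  proof (rule measurable_XB)
   show "x : X" if "x : space ?V" for x using that G_space by auto
   fix n f assume f: "f : F n"
   have "{x : space ?V. x : cyl n f} = levr -` ((%v. v n) -` {real_of_int f}) Int space ?V"
    by (simp add: set_eq_iff lev_cyl[OF f] levr_def conj_commute)
   moreover have "(%v :: nat => real. v n) -` {real_of_int f} : sets borel"
    using measurable_sets[OF borel_measurable_continuous_onI[OF continuous_on_product_coordinates], of "{real_of_int f}" n] by simp
   ultimately show "{x : space ?V. x : cyl n f} : sets ?V" using measurable_sets[OF lV] by simp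
  qed
  hence "A Int G : sets ?V" if "A : sets XB" for A
   using measurable_sets[of "%x. x" ?V XB A] that by simp
  hence "sets (restrict_space XB G) \<subseteq> sets ?V" by (auto simp: sets_restrict_space Int_commute)
  moreover have "sets ?V \<subseteq> sets (restrict_space XB G)"
   unfolding V using measurable_sets[OF lm'] G_space by (auto simp: space_restrict_space Int_absorb2)
  ultimately show "sets M = {levr -` B Int space M | B. B : sets borel}"
   unfolding sets sp V[symmetric] by simp
 qed
qed

end

section \<open>The measure\<close>

locale cf_bern = cf_example +
 fixes \<alpha> :: "nat => bool pmf"
 assumes \<alpha>_full: "!!n. set_pmf (\<alpha> n) = UNIV"
  and \<alpha>_nonatomic: "nonatomic (bern \<alpha>)"
begin

lemma pmf_\<alpha>_pos: "pmf (\<alpha> n) b > 0"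
 using \<alpha>_full[of n] by (simp add: pmf_positive_iff)

abbreviation PA :: "(nat => bool) measure" where "PA \<equiv> bern fair"
abbreviation PB :: "(nat => bool) measure" where "PB \<equiv> bern \<alpha>"
abbreviation P :: "bits measure" where "P \<equiv> PA \<Otimes>\<^sub>M PB"

sublocale PA: prob_space PA by (rule prob_space_bern)
sublocale PB: prob_space PB by (rule prob_space_bern)
sublocale P: pair_prob_space PA PB ..

lemma space_P: "space P = UNIV" by (simp add: space_pair_measure)

lemma P_sections:
 assumes "D : sets P"
 shows "emeasure P D = (\<integral>\<^sup>+a. emeasure PB {b. (a, b) : D} \<partial>PA)"
  and "emeasure P D = (\<integral>\<^sup>+b. emeasure PA {a. (a, b) : D} \<partial>PB)"
proof -
 show "emeasure P D = (\<integral>\<^sup>+a. emeasure PB {b. (a, b) : D} \<partial>PA)"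
  using PB.emeasure_pair_measure_alt[OF assms] unfolding vimage_def .
 show "emeasure P D = (\<integral>\<^sup>+b. emeasure PA {a. (a, b) : D} \<partial>PB)"
  using P.emeasure_pair_measure_alt2[OF assms] unfolding vimage_def .
qed

lemma P_section_sets:
 assumes "D : sets P" shows "{b. (a, b) : D} : sets PB" "{a. (a, b) : D} : sets PA"
proof -
 show "{b. (a, b) : D} : sets PB" using sets_Pair1[OF assms, of a] unfolding vimage_def .
 show "{a. (a, b) : D} : sets PA" using sets_Pair2[OF assms, of b] unfolding vimage_def .
qed

lemma P_null_iff:
 assumes "D : sets P"
 shows "emeasure P D = 0 \<longleftrightarrow> (AE b in PB. emeasure PA {a. (a, b) : D} = 0)"
proof -
 have "(%b. emeasure PA ((%a. (a, b)) -` D)) : borel_measurable PB"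
  using P.measurable_emeasure_Pair2[OF assms] .
 hence "(%b. emeasure PA {a. (a, b) : D}) : borel_measurable PB" by (simp add: vimage_def)
 thus ?thesis unfolding P_sections(2)[OF assms] by (rule nn_integral_0_iff_AE)
qed

definition upd :: "nat => bool => bool => bits => bits" where
 "upd i x y w = ((fst w)(i := x), (snd w)(i := y))"

lemma P_resample:
 assumes D: "D : sets P"
 shows "emeasure P D = (\<Sum>x\<in>UNIV. \<Sum>y\<in>UNIV. ennreal (pmf (\<alpha> i) y / 2) * emeasure P {w. upd i x y w : D})"
proof -
 have m1: "(%w. (fst w, (snd w)(i := y))) : measurable P P" for y
  using measurable_compose[OF measurable_snd measurable_bern_upd] by (intro measurable_Pair) auto
 have m2: "(%w. ((fst w)(i := x), snd w)) : measurable P P" for x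
  using measurable_compose[OF measurable_fst measurable_bern_upd] by (intro measurable_Pair) auto
 have s1: "{w. (fst w, (snd w)(i := y)) : E} : sets P" if "E : sets P" for y E
  using measurable_sets[OF m1[of y] that] by (simp add: vimage_def space_P)
 have s2: "{w. ((fst w)(i := x), snd w) : E} : sets P" if "E : sets P" for x E
  using measurable_sets[OF m2[of x] that] by (simp add: vimage_def space_P)
 have 1: "emeasure P D = (\<Sum>y\<in>UNIV. ennreal (pmf (\<alpha> i) y) * emeasure P {w. (fst w, (snd w)(i := y)) : D})" if D: "D : sets P" for D
 proof -
  have me: "(%a. emeasure PB {b. (a, b(i := y)) : D}) : borel_measurable PA" for y
   using PB.measurable_emeasure_Pair[OF s1[OF D, of y]] by (simp add: vimage_def)
  have "emeasure P D = (\<integral>\<^sup>+a. emeasure PB {b. (a, b) : D} \<partial>PA)" by (rule P_sections(1)[OF D])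
  also have "... = (\<integral>\<^sup>+a. (\<Sum>y\<in>UNIV. ennreal (pmf (\<alpha> i) y) * emeasure PB {b. (a, b(i := y)) : D}) \<partial>PA)"
   using bern_resample[OF P_section_sets(1)[OF D], where i = i] by simp
  also have "... = (\<Sum>y\<in>UNIV. ennreal (pmf (\<alpha> i) y) * (\<integral>\<^sup>+a. emeasure PB {b. (a, b(i := y)) : D} \<partial>PA))"
   using me by (subst nn_integral_sum) (auto simp: nn_integral_cmult)
  also have "... = (\<Sum>y\<in>UNIV. ennreal (pmf (\<alpha> i) y) * emeasure P {w. (fst w, (snd w)(i := y)) : D})"
   using P_sections(1)[OF s1[OF D]] by simp
  finally show ?thesis .
 qed
 have 2: "emeasure P D = (\<Sum>x\<in>UNIV. ennreal (1 / 2) * emeasure P {w. ((fst w)(i := x), snd w) : D})" if D: "D : sets P" for D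
 proof -
  have me: "(%b. emeasure PA {a. (a(i := x), b) : D}) : borel_measurable PB" for x
   using P.measurable_emeasure_Pair2[OF s2[OF D, of x]] by (simp add: vimage_def)
  have pf: "pmf (fair i) x = 1 / 2" for x by (cases x) (simp_all add: fair_def)
  have "emeasure P D = (\<integral>\<^sup>+b. emeasure PA {a. (a, b) : D} \<partial>PB)" by (rule P_sections(2)[OF D])
  also have "... = (\<integral>\<^sup>+b. (\<Sum>x\<in>UNIV. ennreal (1 / 2) * emeasure PA {a. (a(i := x), b) : D}) \<partial>PB)"
   using bern_resample[OF P_section_sets(2)[OF D], where i = i] by (simp add: pf)
  also have "... = (\<Sum>x\<in>UNIV. ennreal (1 / 2) * (\<integral>\<^sup>+b. emeasure PA {a. (a(i := x), b) : D} \<partial>PB))"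
   using me by (subst nn_integral_sum) (auto simp: nn_integral_cmult)
  also have "... = (\<Sum>x\<in>UNIV. ennreal (1 / 2) * emeasure P {w. ((fst w)(i := x), snd w) : D})"
   using P_sections(2)[OF s2[OF D]] by simp
  finally show ?thesis .
 qed
 have e: "ennreal (1 / 2) * (ennreal p * q) = ennreal (p / 2) * q" if "p >= 0" for p q
  by (subst mult.assoc[symmetric], subst ennreal_mult[symmetric]) (use that in auto)
 show ?thesis
  by (subst 2[OF D], subst 1[OF s2[OF D]])
   (simp only: sum_distrib_left e[OF pmf_nonneg] upd_def mem_Collect_eq fst_conv snd_conv)
qed

abbreviation w0 :: bits where "w0 \<equiv> (%_. False, %_. False)"

text \<open>The law of the bits that the level determines, with a factor 1/2 for each fair bit.
  Below stage \<open>n\<close> these bits depend on \<open>f\<close> only, so \<open>w0\<close> is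
  an arbitrary choice.\<close>

definition \<nu>w :: "nat => int => real" where
 "\<nu>w n f = (\<Prod>i<n. pmf (\<alpha> i) (bt (pt n f w0) i) / 2)"

lemma \<nu>w_pos: "\<nu>w n f > 0"
 unfolding \<nu>w_def by (intro prod_pos) (simp add: pmf_\<alpha>_pos)

lemma \<nu>w_le: "\<nu>w n f <= (1 / 2) ^ n"
proof -
 have "\<nu>w n f <= (\<Prod>i<n. 1 / 2)"
  unfolding \<nu>w_def by (intro prod_mono) (simp add: pmf_le_1)
 thus ?thesis by simp
qed

lemma \<nu>w_0: "\<nu>w 0 f = 1" by (simp add: \<nu>w_def)

lemma \<nu>w_eq: "f : F n ==> \<nu>w n f = (\<Prod>i<n. pmf (\<alpha> i) (bt (pt n f w) i) / 2)"
 unfolding \<nu>w_def by (intro prod.cong refl) (simp add: bt_pt_indep[of f n _ w0 w])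

lemma pt_upd: "f : F n ==> pt n f (upd n x y w) = pt (Suc n) (f + dg n x y) w"
 by (subst pt_eq_iff) (auto simp: dg_F dsum_Suc upd_def agree_def)

text \<open>The consistency rule of a (C,F)-measure, with \<kappa> the product of a fair coin and
  \<open>\<alpha> n\<close>.\<close>

lemma \<nu>w_Suc: assumes "f : F n" shows "\<nu>w (Suc n) (f + dg n x y) = \<nu>w n f * (pmf (\<alpha> n) y / 2)"
proof -
 have eq: "pt (Suc n) (f + dg n x y) w0 = pt n f (upd n x y w0)" using pt_upd[OF assms] by simp
 have "bt (pt n f (upd n x y w0)) n = y" using bt_pt[OF assms, of n] by (simp add: upd_def)
 thus ?thesis
  unfolding \<nu>w_def[of "Suc n"] eq using \<nu>w_eq[OF assms, of "upd n x y w0"] by simp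
qed

definition mc :: "nat => int => cf_rep set set => ennreal" where
 "mc n f D = ennreal (\<nu>w n f) * emeasure P {w. pt n f w : D}"

lemma pt_vimage: "f : F n ==> D : sets XB ==> {w. pt n f w : D} : sets P"
 using measurable_sets[OF pt_measurable[of f n fair \<alpha>], of D] by (simp add: vimage_def space_P)

lemma mc_split:
 assumes "f : F n" "D : sets XB"
 shows "mc n f D = (\<Sum>x\<in>UNIV. \<Sum>y\<in>UNIV. mc (Suc n) (f + dg n x y) D)"
proof -
 have e: "ennreal (\<nu>w n f) * (ennreal (pmf (\<alpha> n) y / 2) * q) = ennreal (\<nu>w (Suc n) (f + dg n x y)) * q" for x y q
  using \<nu>w_pos[of n f] by (subst mult.assoc[symmetric]) (simp add: \<nu>w_Suc[OF assms(1)] ennreal_mult[symmetric] less_imp_le)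
 show ?thesis unfolding mc_def
  by (subst P_resample[OF pt_vimage[OF assms], of n])
   (simp only: sum_distrib_left mem_Collect_eq pt_upd[OF assms(1)] e[symmetric])
qed

definition lvl :: "nat => cf_rep set set => ennreal" where "lvl n D = (\<Sum>f\<in>F n. mc n f D)"

text \<open>The levels inherited from stage \<open>n\<close>; the other levels of stage
  \<open>n + 1\<close> are its spacers.\<close>

definition Fdg :: "nat => int set" where "Fdg n = (%(f, x, y). f + dg n x y) ` (F n \<times> UNIV \<times> UNIV)"

lemma Fdg_sub: "Fdg n \<subseteq> F (Suc n)" using dg_F by (auto simp: Fdg_def)

lemma lvl_split:
 assumes "D : sets XB" shows "lvl n D = (\<Sum>g\<in>Fdg n. mc (Suc n) g D)"
proof -
 have inj: "inj_on (%(f, x, y). f + dg n x y) (F n \<times> UNIV \<times> UNIV)"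
 proof (rule inj_onI)
  fix p q assume pq: "p : F n \<times> UNIV \<times> UNIV" "q : F n \<times> UNIV \<times> UNIV"
   "(case p of (f, x, y) => f + dg n x y) = (case q of (f, x, y) => f + dg n x y)"
  obtain f x y f' x' y' where "p = (f, x, y)" "q = (f', x', y')" by (cases p, cases q)
  thus "p = q" using pq dg_unique[of f n f' x y x' y'] by simp
 qed
 have "lvl n D = (\<Sum>f\<in>F n. \<Sum>x\<in>UNIV. \<Sum>y\<in>UNIV. mc (Suc n) (f + dg n x y) D)"
  unfolding lvl_def using assms by (intro sum.cong refl mc_split) auto
 also have "... = (\<Sum>(f, x, y)\<in>F n \<times> UNIV \<times> UNIV. mc (Suc n) (f + dg n x y) D)"
  by (simp add: sum.cartesian_product split_def)
 also have "... = (\<Sum>g\<in>Fdg n. mc (Suc n) g D)"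
  unfolding Fdg_def by (subst sum.reindex[OF inj]) (simp add: split_def)
 finally show ?thesis .
qed

lemma lvl_Suc_le: "D : sets XB ==> lvl n D <= lvl (Suc n) D"
 unfolding lvl_split[of D n] lvl_def[of "Suc n"]
 using finite_F Fdg_sub by (intro sum_mono2) auto

lemma lvl_mono: "D : sets XB ==> n <= m ==> lvl n D <= lvl m D"
 by (rule lift_Suc_mono_le[of "%n. lvl n D"]) (auto intro: lvl_Suc_le)

text \<open>\<open>lvl n\<close> is the measure on \<open>X_n\<close>. It grows with
  \<open>n\<close>, as each stage adds the mass of its spacers, and \<open>X\<close> is the
  increasing union of the \<open>X_n\<close>.\<close>

definition \<mu> :: "cf_rep set measure" where "\<mu> = measure_of X (sets XB) (%D. SUP n. lvl n D)"

lemma sets_\<mu> [simp]: "sets \<mu> = sets XB"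
proof -
 have "sets XB \<subseteq> Pow X" using sets.space_closed[of XB] by simp
 hence "sets \<mu> = sigma_sets X (sets XB)" unfolding \<mu>_def by (rule sets_measure_of)
 thus ?thesis using sets.sigma_sets_eq[of XB] by simp
qed

lemma space_\<mu> [simp]: "space \<mu> = X"
 using sets_eq_imp_space_eq[OF sets_\<mu>] by simp

lemma mc_countably_additive:
 assumes "f : F n" "range A \<subseteq> sets XB" "disjoint_family A"
 shows "(\<Sum>i. mc n f (A i)) = mc n f (\<Union>i. A i)"
proof -
 have "(\<Sum>i. emeasure P {w. pt n f w : A i}) = emeasure P (\<Union>i. {w. pt n f w : A i})"
  using assms pt_vimage[OF assms(1)]
  by (intro suminf_emeasure) (auto simp: disjoint_family_on_def)
 moreover have "(\<Union>i. {w. pt n f w : A i}) = {w. pt n f w : (\<Union>i. A i)}" by auto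
 ultimately show ?thesis unfolding mc_def by simp
qed

lemma emeasure_\<mu>: assumes "D : sets XB" shows "emeasure \<mu> D = (SUP n. lvl n D)"
proof (rule emeasure_measure_of[OF \<mu>_def])
 show "sets XB \<subseteq> Pow X" using sets.space_closed[of XB] by simp
 show "D : sets \<mu>" using assms by simp
 show "positive (sets \<mu>) (%D. SUP n. lvl n D)" by (simp add: positive_def lvl_def mc_def)
 show "countably_additive (sets \<mu>) (%D. SUP n. lvl n D)"
  unfolding countably_additive_def
 proof (intro allI impI)
  fix A :: "nat => _" assume A: "range A \<subseteq> sets \<mu>" "disjoint_family A" "(\<Union>i. A i) : sets \<mu>"
  have "(\<Sum>i. SUP n. lvl n (A i)) = (SUP n. \<Sum>i. lvl n (A i))"
   using A lvl_mono by (intro ennreal_suminf_SUP_eq) (auto simp: incseq_def)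
  also have "... = (SUP n. lvl n (\<Union>i. A i))"
  proof (rule SUP_cong[OF refl])
   fix n
   have "(\<Sum>i. lvl n (A i)) = (\<Sum>f\<in>F n. \<Sum>i. mc n f (A i))"
    unfolding lvl_def by (rule suminf_sum) auto
   also have "... = (\<Sum>f\<in>F n. mc n f (\<Union>i. A i))"
    using A by (intro sum.cong refl mc_countably_additive) auto
   finally show "(\<Sum>i. lvl n (A i)) = lvl n (\<Union>i. A i)" by (simp add: lvl_def)
  qed
  finally show "(\<Sum>i. SUP n. lvl n (A i)) = (SUP n. lvl n (\<Union>i. A i))" .
 qed
qed

text \<open>Spacers of stages after \<open>n\<close> miss the cylinder, so \<open>lvl m D\<close> is
  constant from \<open>m = n\<close> on.\<close>

lemma emeasure_\<mu>_cyl: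
 assumes f: "f : F n" and D: "D : sets XB" "D \<subseteq> cyl n f"
 shows "emeasure \<mu> D = ennreal (\<nu>w n f) * emeasure P {w. pt n f w : D}"
proof -
 have outside: "mc m g D = 0" if g: "g : F m" "!!w. pt m g w ~: cyl n f" for m g
 proof -
  have emp: "{w. pt m g w : D} = {}" using g(2) D(2) by blast
  show ?thesis unfolding mc_def emp by simp
 qed
 have 0: "lvl n D = mc n f D"
 proof -
  have z: "mc n g D = 0" if "g : F n - {f}" for g
   using that pt_in_cyl[OF order_refl, of g n f] f by (intro outside) auto
  thus ?thesis unfolding lvl_def using f finite_F by (subst sum.remove[of _ f]) auto
 qed
 have 1: "lvl (n + k) D = mc n f D" for k
 proof (induction k)
  case (Suc k)
  have "lvl (Suc (n + k)) D = (\<Sum>g\<in>Fdg (n + k). mc (Suc (n + k)) g D)"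
   unfolding lvl_def
  proof (rule sum.mono_neutral_right)
   show "ALL g:F (Suc (n + k)) - Fdg (n + k). mc (Suc (n + k)) g D = 0"
   proof
    fix g assume g: "g : F (Suc (n + k)) - Fdg (n + k)"
    show "mc (Suc (n + k)) g D = 0"
    proof (rule outside)
     show "g : F (Suc (n + k))" using g by simp
     fix w show "pt (Suc (n + k)) g w ~: cyl n f"
     proof
      assume "pt (Suc (n + k)) g w : cyl n f"
      then obtain w' where w': "pt (Suc (n + k)) g w = pt n f w'" unfolding cyl_eq by (rule rangeE)
      have "pt n f w' = pt (Suc (n + k)) g w \<longleftrightarrow> g = f + dsum n (Suc (n + k)) w' & agree (Suc (n + k)) w' w"
       using g f by (intro pt_eq_iff) auto
      hence "g = f + dsum n (Suc (n + k)) w'" using w' by simp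
      hence "g = (f + dsum n (n + k) w') + dg (n + k) (fst w' (n + k)) (snd w' (n + k))" by (simp add: dsum_Suc)
      moreover have "f + dsum n (n + k) w' : F (n + k)" using f by (intro dsum_F) auto
      ultimately have "g : Fdg (n + k)" unfolding Fdg_def
       by (intro image_eqI[of _ _ "(f + dsum n (n + k) w', fst w' (n + k), snd w' (n + k))"]) auto
      thus False using g by simp
     qed
    qed
   qed
  qed (use finite_F Fdg_sub in auto)
  also have "... = lvl (n + k) D" by (rule lvl_split[OF D(1), symmetric])
  finally show ?case using Suc by simp
 qed (simp add: 0)
 have "(SUP m. lvl m D) = mc n f D"
 proof (rule antisym)
  show "(SUP m. lvl m D) <= mc n f D"
  proof (rule SUP_least)
   fix m
   have "lvl m D <= lvl (n + m) D" using lvl_mono[OF D(1)] by simp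
   thus "lvl m D <= mc n f D" by (simp add: 1)
  qed
  show "mc n f D <= (SUP m. lvl m D)" using 0 by (metis SUP_upper UNIV_I)
 qed
 thus ?thesis using emeasure_\<mu>[OF D(1)] by (simp add: mc_def)
qed

lemma emeasure_\<mu>_cylinder: assumes "f : F n" shows "emeasure \<mu> (cyl n f) = ennreal (\<nu>w n f)"
 using emeasure_\<mu>_cyl[OF assms cyl_sets[OF assms] order_refl] P.emeasure_space_1 by (simp add: space_P)

lemma \<mu>_null_iff:
 assumes "D : sets XB"
 shows "emeasure \<mu> D = 0 \<longleftrightarrow> (ALL n. ALL f:F n. emeasure P {w. pt n f w : D} = 0)"
proof
 assume 0: "emeasure \<mu> D = 0"
 show "ALL n. ALL f:F n. emeasure P {w. pt n f w : D} = 0"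
 proof (intro allI ballI)
  fix n f assume f: "f : F n"
  have "emeasure \<mu> (D Int cyl n f) <= emeasure \<mu> D" using assms by (intro emeasure_mono) auto
  hence "emeasure \<mu> (D Int cyl n f) = 0" using 0 by simp
  hence "ennreal (\<nu>w n f) * emeasure P {w. pt n f w : D Int cyl n f} = 0"
   using emeasure_\<mu>_cyl[OF f, of "D Int cyl n f"] assms f by simp
  thus "emeasure P {w. pt n f w : D} = 0" using \<nu>w_pos[of n f] by (simp add: ennreal_eq_0_iff)
 qed
next
 assume "ALL n. ALL f:F n. emeasure P {w. pt n f w : D} = 0"
 thus "emeasure \<mu> D = 0" unfolding emeasure_\<mu>[OF assms] lvl_def mc_def by simp
qed

text \<open>Each coordinate from \<open>N\<close> on costs a factor 1/2. With \<open>b\<close> held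
  fixed this shows that \<open>a i ~= b i\<close> infinitely often.\<close>

lemma PA_tail_eq_null: "emeasure PA {a. ALL i>=N. a i = b i} = 0"
proof -
 let ?S = "%N. {a. ALL i>=N. a i = b i}"
 have S: "?S N : sets PA" for N
 proof -
  have "{a\<in>space PA. ALL i. i >= N --> a i = b i} : sets PA" by measurable
  thus ?thesis by simp
 qed
 have step: "emeasure PA (?S N) = ennreal (1 / 2) * emeasure PA (?S (Suc N))" for N
 proof -
  have pf: "pmf (fair i) x = 1 / 2" for i x by (cases x) (simp_all add: fair_def)
  have eq: "{a. a(N := d) : ?S N} = (if d = b N then ?S (Suc N) else {})" for d
   by (auto simp: Suc_le_eq)
  have "emeasure PA (?S N) = (\<Sum>d\<in>UNIV. ennreal (pmf (fair N) d) * emeasure PA {a. a(N := d) : ?S N})"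
   by (rule bern_resample[OF S])
  also have "... = (\<Sum>d\<in>UNIV. if d = b N then ennreal (1 / 2) * emeasure PA (?S (Suc N)) else 0)"
   unfolding eq pf by (intro sum.cong refl) simp
  finally show ?thesis by simp
 qed
 have le: "emeasure PA (?S N) <= ennreal ((1 / 2) ^ k)" for N k
 proof (induction k arbitrary: N)
  case 0 show ?case using PA.emeasure_le_1[of "?S N"] by simp
 next
  case (Suc k)
  have "emeasure PA (?S N) <= ennreal (1 / 2) * ennreal ((1 / 2) ^ k)"
   unfolding step[of N] by (intro mult_left_mono Suc) simp
  also have "... = ennreal ((1 / 2) ^ Suc k)" by (subst ennreal_mult[symmetric]) auto
  finally show ?case .
 qed
 have "emeasure PA (?S N) <= ennreal 0"
 proof (rule LIMSEQ_le_const)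
  have "(%k. (1 / 2 :: real) ^ k) \<longlonglongrightarrow> 0" by (intro LIMSEQ_realpow_zero) auto
  thus "(%k. ennreal ((1 / 2) ^ k)) \<longlonglongrightarrow> ennreal 0" by (intro tendsto_ennrealI)
 qed (use le in blast)
 thus ?thesis by simp
qed

text \<open>A stage \<open>i\<close> with differing bits and \<open>h i\<close> at least the
  absolute value of \<open>g\<close> places the point in an inner copy, from which \<open>g\<close>
  does not lead out.\<close>

lemma pt_in_G:
 assumes "f : F n" "\<exists>\<^sub>\<infinity>i. fst w i ~= snd w i" shows "pt n f w : G"
 unfolding pt_in_G_iff[OF assms(1)]
proof
 fix g :: int
 obtain i where i: "i >= max n (nat \<bar>g\<bar>)" "fst w i ~= snd w i" using assms(2) unfolding INFM_nat_le by blast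
 have "\<bar>g\<bar> <= h i" using h_ge[of i] i(1) by linarith
 hence "g + ((f + dsum n i w) + dg i (fst w i) (snd w i)) : F (Suc i)"
  using i by (intro dg_middle dsum_F assms) auto
 thus "EX m>=n. g + (f + dsum n m w) : F m"
  using i(1) by (intro exI[of _ "Suc i"]) (simp add: dsum_Suc add.assoc)
qed

lemma AE_pt_in_G: "AE w in P. ALL n. ALL f:F n. pt n f w : G"
proof -
 let ?D = "%N. {w. ALL i. i >= N --> fst w i = snd w i}"
 have 1: "Measurable.pred P (%w. fst w i)" "Measurable.pred P (%w. snd w i)" for i
  using measurable_compose[OF measurable_fst measurable_bern_component] measurable_compose[OF measurable_snd measurable_bern_component] by auto
 have D: "?D N : sets P" for N
 proof -
  have "{w\<in>space P. ALL i. i >= N --> fst w i = snd w i} : sets P" using 1 by measurable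
  thus ?thesis by (simp add: space_P)
 qed
 have "emeasure P (?D N) = 0" for N
  unfolding P_null_iff[OF D] using PA_tail_eq_null[of N] by simp
 hence "?D N : null_sets P" for N using D by (intro null_setsI)
 hence "AE w in P. ALL N. w ~: ?D N" by (simp only: AE_all_countable) (intro allI AE_not_in)
 thus ?thesis
 proof eventually_elim
  case (elim w)
  hence "\<exists>\<^sub>\<infinity>i. fst w i ~= snd w i" unfolding INFM_nat_le by auto
  thus ?case using pt_in_G by blast
 qed
qed

lemma G_conull: "X - G : null_sets \<mu>"
proof (rule null_setsI)
 show D: "X - G : sets \<mu>" using sets.top[of XB] by (auto intro: sets.Diff)
 have "emeasure P {w. pt n f w : X - G} = 0" if f: "f : F n" for n f
 proof -
  have "AE w in P. pt n f w ~: X - G" using AE_pt_in_G by (rule AE_mp) (use f in \<open>auto intro!: AE_I2\<close>)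
  hence "AE w in P. w ~: {w. pt n f w : X - G}" by simp
  hence "{w. pt n f w : X - G} : null_sets P"
   using AE_iff_null_sets[OF pt_vimage[OF f, of "X - G"]] D by simp
  thus ?thesis by (rule null_setsD1)
 qed
 thus "emeasure \<mu> (X - G) = 0" using \<mu>_null_iff[of "X - G"] D by simp
qed

section \<open>The nonsingular system on the points with a full orbit\<close>

abbreviation M :: "cf_rep set measure" where "M \<equiv> cf_system F C \<mu>"

lemma sets_M: "sets M = sets (restrict_space XB G)"
 by (simp add: cf_system_def sets_restrict_space)

lemma space_M [simp]: "space M = G"
 using G_space by (auto simp: cf_system_def space_restrict_space)

lemma sets_M_iff: "D : sets M \<longleftrightarrow> D : sets XB & D \<subseteq> G"
 unfolding sets_M using G_sets G_space by (subst sets_restrict_space_iff) (auto simp: Int_absorb2)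

lemma emeasure_M: "D \<subseteq> G ==> emeasure M D = emeasure \<mu> D"
 unfolding cf_system_def using G_space by (intro emeasure_restrict_space) (auto simp: Int_absorb2)

lemma cyl_M [measurable]: "f : F n ==> cyl n f Int G : sets M"
 unfolding sets_M_iff by auto

lemma M_XB: assumes "q : measurable XB N" shows "q : measurable M N"
proof -
 have "q : measurable (restrict_space XB G) N" using assms by (rule measurable_restrict_space1)
 thus ?thesis by (simp only: measurable_cong_sets[OF sets_M refl])
qed

lemma T_measurable_M [measurable]: "T g : measurable M M"
 by (rule T_measurable[OF sets_M])

lemma M_null_iff:
 assumes "D : sets M"
 shows "D : null_sets M \<longleftrightarrow> (ALL n. ALL f:F n. emeasure P {w. pt n f w : D} = 0)"
 using assms \<mu>_null_iff[of D] emeasure_M[of D] by (auto simp: sets_M_iff null_sets_def)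

lemma T_image: assumes "D \<subseteq> G" shows "T g ` D = T (- g) -` D Int G"
proof (intro equalityI subsetI)
 fix y assume "y : T g ` D"
 then obtain x where "x : D" "y = T g x" by auto
 thus "y : T (- g) -` D Int G" using T_G T_inv(1) assms by auto
next
 fix y assume y: "y : T (- g) -` D Int G"
 hence "y = T g (T (- g) y)" using T_inv(2) by simp
 thus "y : T g ` D" using y by blast
qed

lemma T_image_sets: "D : sets M ==> T g ` D : sets M"
 using T_image[of D g] measurable_sets[OF T_measurable_M, of D "- g"] by (simp add: sets_M_iff)

text \<open>On one cylinder \<open>T g\<close> only changes the level, so it rescales the measure by
  the quotient of the two weights.\<close>

lemma emeasure_T_image:
 assumes f: "f : F n" "g + f : F n" and D: "D : sets M" "D \<subseteq> cyl n f"
 shows "emeasure M (T g ` D) = ennreal (\<nu>w n (g + f) / \<nu>w n f) * emeasure M D"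
proof -
 have DG: "D \<subseteq> G" "D : sets XB" using D(1) by (auto simp: sets_M_iff)
 have sub: "T g ` D \<subseteq> cyl n (g + f)"
 proof
  fix y assume "y : T g ` D"
  then obtain x where x: "x : cyl n f" "y = T g x" using D(2) by auto
  obtain w where "x = pt n f w" using x(1) unfolding cyl_eq by (rule rangeE)
  thus "y : cyl n (g + f)" using T_pt[OF f] x(2) by simp
 qed
 have TD: "T g ` D : sets XB" "T g ` D \<subseteq> G" using T_image_sets[OF D(1)] by (auto simp: sets_M_iff)
 have "pt n (g + f) w : T g ` D \<longleftrightarrow> pt n f w : D" for w
 proof
  assume "pt n (g + f) w : T g ` D"
  hence "T (- g) (pt n (g + f) w) : D" using T_image[OF DG(1)] by simp
  thus "pt n f w : D" using T_pt[of "g + f" n "- g" w] f by simp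
 next
  assume "pt n f w : D"
  thus "pt n (g + f) w : T g ` D" using T_pt[OF f, of w] by (metis imageI)
 qed
 hence "emeasure M (T g ` D) = ennreal (\<nu>w n (g + f)) * emeasure P {w. pt n f w : D}"
  using emeasure_\<mu>_cyl[OF f(2) TD(1) sub] emeasure_M[OF TD(2)] by simp
 also have "... = ennreal (\<nu>w n (g + f) / \<nu>w n f * \<nu>w n f) * emeasure P {w. pt n f w : D}"
  using \<nu>w_pos[of n f] by simp
 also have "... = ennreal (\<nu>w n (g + f) / \<nu>w n f) * emeasure M D"
  using \<nu>w_pos[of n f] \<nu>w_pos[of n "g + f"] emeasure_\<mu>_cyl[OF f(1) DG(2) D(2)] emeasure_M[OF DG(1)]
  by (simp add: ennreal_mult[symmetric] mult.assoc[symmetric] less_imp_le flip: times_divide_eq_left)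
 finally show ?thesis .
qed

text \<open>The shift keeps the bits \<open>w\<close> and changes stage and level only, so the
  preimage is covered by countably many null sets of \<open>w\<close>.\<close>

lemma M_null_T:
 assumes A: "A : null_sets M" shows "T g -` A Int G : null_sets M"
proof -
 have As: "A : sets M" using A by auto
 have m: "T g -` A Int G : sets M" using measurable_sets[OF T_measurable_M As] by simp
 have "emeasure P {w. pt n f w : T g -` A Int G} = 0" if f: "f : F n" for n f
 proof -
  have sub: "{w. pt n f w : T g -` A Int G} \<subseteq> (\<Union>m. \<Union>f'\<in>F m. {w. pt m f' w : A})"
  proof clarify
   fix a b assume w: "T g (pt n f (a, b)) : A" "pt n f (a, b) : G"
   let ?w = "(a, b)"
   obtain m where m: "m >= n" "g + (f + dsum n m ?w) : F m" using w(2) unfolding pt_in_G_iff[OF f] by blast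
   have "T g (pt n f ?w) = pt m (g + (f + dsum n m ?w)) ?w"
    using pt_lift[OF f m(1), of ?w] T_pt[OF dsum_F[OF f m(1)] m(2)] by simp
   thus "?w : (\<Union>m. \<Union>f'\<in>F m. {w. pt m f' w : A})" using w(1) m(2) by auto
  qed
  have "{w. pt m f' w : A} : null_sets P" if "f' : F m" for m f'
   using A M_null_iff[OF As] that pt_vimage[OF that] As by (intro null_setsI) (auto simp: sets_M_iff)
  hence N: "(\<Union>m. \<Union>f'\<in>F m. {w. pt m f' w : A}) : null_sets P"
   by (intro null_sets_UN'[OF countableI_type] null_sets_UN'[OF countable_finite[OF finite_F]])
  have "{w. pt n f w : T g -` A Int G} : sets P" using pt_vimage[OF f, of "T g -` A Int G"] m unfolding sets_M_iff by blast
  hence "{w. pt n f w : T g -` A Int G} : null_sets P" using null_sets_subset[OF N _ sub] by blast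
  thus ?thesis by (rule null_setsD1)
 qed
 thus ?thesis unfolding M_null_iff[OF m] by blast
qed

lemma nonsingular_M: "nonsingular_action M T"
 unfolding nonsingular_action_def
proof (intro conjI allI ballI)
 show "T g : measurable M M" for g by simp
 show "T 0 x = x" if "x : space M" for x using that T_0 by simp
 show "T (g + h) x = T g (T h x)" if "x : space M" for g h x using that T_add by simp
 fix g A assume A: "A : sets M"
 have m: "T g -` A Int G : sets M" using measurable_sets[OF T_measurable_M A] by simp
 have AG: "A \<subseteq> G" using A by (simp add: sets_M_iff)
 have eq: "T (- g) -` (T g -` A Int G) Int G = A"
 proof (intro equalityI subsetI)
  fix x assume "x : T (- g) -` (T g -` A Int G) Int G"
  thus "x : A" using T_inv(2)[of x g] by auto
 next
  fix x assume "x : A"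
  thus "x : T (- g) -` (T g -` A Int G) Int G" using T_inv(2)[of x g] T_G[of x "- g"] AG by auto
 qed
 have "T g -` A Int G : null_sets M \<longleftrightarrow> A : null_sets M"
  using M_null_T[of A g] M_null_T[of "T g -` A Int G" "- g"] eq by auto
 thus "(emeasure M (T g -` A Int space M) = 0) = (emeasure M A = 0)"
  using A m by (simp add: null_sets_def)
qed

abbreviation e :: "bits => cf_rep set" where "e \<equiv> pt 0 0"

lemma e_vimage: "D : sets M ==> {w. e w : D} : sets P"
 using pt_vimage[of 0 0 D] by (simp add: sets_M_iff zero_F)

lemma AE_e_G: "AE w in P. e w : G"
 using AE_pt_in_G by eventually_elim (use zero_F in blast)

text \<open>The bottom of the \<open>n\<close>-th tower is the part of \<open>X_0\<close> whose
  first \<open>n\<close> digits are 0.\<close>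

lemma cyl_0_sub: "cyl n 0 \<subseteq> cyl 0 0"
proof
 fix x assume "x : cyl n 0"
 then obtain w where w: "x = pt n 0 w" unfolding cyl_eq by (rule rangeE)
 define v :: bits where "v = ((%i. i >= n & fst w i), (%i. i >= n & snd w i))"
 have "dsum 0 n v = 0" unfolding dsum_def by (rule sum.neutral) (auto simp: v_def dg_def)
 moreover have "agree n v w" by (auto simp: agree_def v_def)
 ultimately have "e v = pt n 0 w" using pt_eq_iff[of 0 n 0 0 v w] zero_F by simp
 thus "x : cyl 0 0" using w by (metis pt_cyl)
qed

text \<open>Every orbit meets \<open>X\<^sub>0\<close>, which \<open>e\<close> identifies with the product space.\<close>

lemma inv_null_iff:
 assumes D: "D : sets M" and inv: "!!x g. x : D ==> T g x : D"
 shows "D : null_sets M \<longleftrightarrow> emeasure P {w. e w : D} = 0"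
proof
 assume "D : null_sets M"
 thus "emeasure P {w. e w : D} = 0" using M_null_iff[OF D] zero_F by blast
next
 assume 0: "emeasure P {w. e w : D} = 0"
 have DX: "D : sets XB" "D \<subseteq> G" using D by (auto simp: sets_M_iff)
 have "emeasure P {w. pt n f w : D} = 0" if f: "f : F n" for n f
 proof -
  \<comment> \<open>\<open>X_0\<close> contains the bottom of every tower, where \<open>D\<close> is
    therefore null; invariance lifts this to the other levels.\<close>
  have "emeasure \<mu> (D Int cyl n 0) <= emeasure \<mu> (D Int cyl 0 0)"
   using cyl_0_sub DX zero_F by (intro emeasure_mono) auto
  also have "... = 0" using 0 emeasure_\<mu>_cyl[of 0 0 "D Int cyl 0 0"] DX zero_F by simp
  finally have "emeasure \<mu> (D Int cyl n 0) = 0" by simp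
  hence "ennreal (\<nu>w n 0) * emeasure P {w. pt n 0 w : D} = 0"
   using emeasure_\<mu>_cyl[of 0 n "D Int cyl n 0"] DX zero_F by simp
  hence 1: "emeasure P {w. pt n 0 w : D} = 0" using \<nu>w_pos[of n 0] by (simp add: ennreal_eq_0_iff)
  have "pt n f w : D \<longleftrightarrow> pt n 0 w : D" for w
   using inv[of "pt n f w" "- f"] inv[of "pt n 0 w" f] T_pt[of f n "- f" w] T_pt[of 0 n f w] f zero_F by auto
  thus ?thesis using 1 by simp
 qed
 thus "D : null_sets M" unfolding M_null_iff[OF D] by blast
qed

lemma AE_M_inv:
 assumes Q: "{x\<in>G. Q x} : sets M" and inv: "!!x g. x : G ==> Q x ==> Q (T g x)"
 shows "(AE x in M. Q x) \<longleftrightarrow> (AE w in P. Q (e w))"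
proof -
 have S: "{x\<in>G. \<not> Q x} : sets M"
 proof -
  have "{x\<in>G. \<not> Q x} = space M - {x\<in>G. Q x}" by auto
  thus ?thesis using sets.compl_sets[OF Q] by simp
 qed
 have "(AE x in M. Q x) \<longleftrightarrow> {x\<in>G. \<not> Q x} : null_sets M"
  using AE_iff_null[of M Q] S by simp
 also have "... \<longleftrightarrow> emeasure P {w. e w : {x\<in>G. \<not> Q x}} = 0"
 proof (rule inv_null_iff[OF S])
  fix x g assume "x : {x\<in>G. \<not> Q x}"
  thus "T g x : {x\<in>G. \<not> Q x}"
   using inv[of "T g x" "- g"] T_inv(1)[of x g] T_G[of x g] by auto
 qed
 also have "... \<longleftrightarrow> (AE w in P. e w ~: {x\<in>G. \<not> Q x})"
  using AE_iff_null_sets[OF e_vimage[OF S]] e_vimage[OF S] by (auto simp: null_sets_def)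
 also have "... \<longleftrightarrow> (AE w in P. Q (e w))"
 proof
  assume "AE w in P. e w ~: {x\<in>G. \<not> Q x}"
  with AE_e_G show "AE w in P. Q (e w)" by eventually_elim auto
 qed (auto elim: AE_mp)
 finally show ?thesis .
qed

lemma AE_M_e:
 assumes "AE x in M. Q x" shows "AE w in P. Q (e w)"
proof -
 obtain N where N: "N : null_sets M" "{x\<in>G. \<not> Q x} \<subseteq> N"
  using assms by (auto elim!: AE_E simp: null_sets_def)
 have "{w. e w : N} : null_sets P"
  using N(1) M_null_iff[of N] e_vimage[of N] zero_F by (intro null_setsI) auto
 hence "AE w in P. w ~: {w. e w : N}" by (rule AE_not_in)
 with AE_e_G show ?thesis by eventually_elim (use N(2) in auto)
qed

lemma sigma_finite_M: "sigma_finite_measure M"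
proof
 let ?A = "(%A. A Int G) ` cyls"
 show "EX A. countable A & A \<subseteq> sets M & \<Union>A = space M & (ALL a:A. emeasure M a ~= \<infinity>)"
 proof (intro exI[of _ ?A] conjI ballI)
  show "countable ?A" using countable_cyls by simp
  show "?A \<subseteq> sets M" using cyl_M by (auto simp: cyls_def)
  show "\<Union>?A = space M"
  proof (intro equalityI subsetI)
   fix x assume x: "x : space M"
   have "x : X" using x G_space by auto
   then obtain n f w where "x = pt n f w" "f : F n" by (rule cf_space_cases)
   thus "x : \<Union>?A" using x by (intro UnionI[of "cyl n f Int G"]) (auto simp: cyls_def)
  qed auto
  fix a assume "a : ?A"
  then obtain n f where a: "a = cyl n f Int G" "f : F n" by (auto simp: cyls_def)
  have "emeasure M a <= emeasure \<mu> (cyl n f)" using a emeasure_M[of a] by (auto intro!: emeasure_mono)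
  thus "emeasure M a ~= \<infinity>" using emeasure_\<mu>_cylinder[OF a(2)] by (auto simp: top_unique)
 qed
qed

text \<open>The fair bits alone give every level of stage \<open>n\<close> mass at most
  \<open>(1 / 2) ^ n\<close>, and the levels of late stages still cover \<open>G\<close>.\<close>

lemma nonatomic_M: "nonatomic M"
proof (rule nonatomicI)
 fix \<epsilon> :: real assume e: "\<epsilon> > 0"
 obtain n0 where n0: "(1 / 2 :: real) ^ n0 < \<epsilon>" using real_arch_pow_inv[OF e, of "1/2"] by auto
 let ?A = "insert {} {cyl n f Int G | n f. f : F n & n >= n0}"
 have "?A \<subseteq> insert {} ((%A. A Int G) ` cyls)" by (auto simp: cyls_def)
 hence c: "countable ?A" using countable_cyls by (rule countable_subset[OF _ countable_insert[OF countable_image]])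
 have r: "range (from_nat_into ?A) = ?A" using c by (intro range_from_nat_into) auto
 have 1: "range (from_nat_into ?A) \<subseteq> sets M" unfolding r using cyl_M by auto
 have 2: "space M \<subseteq> (\<Union>i. from_nat_into ?A i)" unfolding r
 proof
  fix x assume x: "x : space M"
  have "x : X" using x G_space by auto
  then obtain n f w where xw: "x = pt n f w" "f : F n" by (rule cf_space_cases)
  let ?m = "max n n0"
  have "x = pt ?m (f + dsum n ?m w) w" "f + dsum n ?m w : F ?m" using pt_lift[OF xw(2), of ?m w] xw(1) dsum_F[OF xw(2), of ?m w] by auto
  hence "x : cyl ?m (f + dsum n ?m w) Int G" "f + dsum n ?m w : F ?m" using x pt_cyl by (metis IntI space_M, simp)
  note xm = this
  have "cyl ?m (f + dsum n ?m w) Int G : ?A"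
   by (intro insertI2 CollectI exI[of _ ?m] exI[of _ "f + dsum n ?m w"] conjI refl xm(2)) simp
  thus "x : \<Union>?A" using xm(1) by (rule UnionI)
 qed
 have 3: "emeasure M (from_nat_into ?A i) < ennreal \<epsilon>" for i
 proof -
  have "from_nat_into ?A i : range (from_nat_into ?A)" by (rule rangeI)
  hence "from_nat_into ?A i : ?A" by (simp only: r)
  then consider "from_nat_into ?A i = {}" | n f where "from_nat_into ?A i = cyl n f Int G" "f : F n" "n >= n0" by auto
  thus ?thesis
  proof cases
   case 1 show ?thesis unfolding 1 using e by simp
  next
   case (2 n f)
   have "emeasure M (cyl n f Int G) <= emeasure \<mu> (cyl n f)" using 2(2) emeasure_M[of "cyl n f Int G"] by (auto intro!: emeasure_mono)
   also have "... = ennreal (\<nu>w n f)" by (rule emeasure_\<mu>_cylinder[OF 2(2)])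
   also have "... < ennreal \<epsilon>"
   proof (rule ennreal_lessI[OF e])
    have "\<nu>w n f <= (1 / 2) ^ n" by (rule \<nu>w_le)
    also have "... <= (1 / 2) ^ n0" using 2(3) by (intro power_decreasing) auto
    finally show "\<nu>w n f < \<epsilon>" using n0 by simp
   qed
   finally show ?thesis unfolding 2(1) .
  qed
 qed
 show "EX A :: nat => cf_rep set set. range A \<subseteq> sets M & space M \<subseteq> (\<Union>i. A i) & (ALL i. emeasure M (A i) < ennreal \<epsilon>)"
  by (rule exI[of _ "from_nat_into ?A"], rule conjI, rule 1, rule conjI, rule 2, rule allI, rule 3)
qed

lemma cf_measure_\<mu>: "cf_measure F C \<mu>"
proof -
 \<comment> \<open>The index is shifted by one as in \<open>cc\<close>, and the threshold decodes
   the bit \<open>y\<close>. The fair factor keeps all values at most 1/2, so the products of maxima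
   tend to 0.\<close>
 define \<kappa> :: "nat => int => real" where "\<kappa> n c = pmf (\<alpha> (n - 1)) (c >= 2 * h (n - 1)) / 2" for n c
 have \<kappa>_dg: "\<kappa> (Suc n) (dg n x y) = pmf (\<alpha> n) y / 2" for n x y by (simp add: \<kappa>_def dg_bit)
 have C_sum: "(\<Sum>c\<in>C (Suc n). \<kappa> (Suc n) c) = 1" for n
 proof -
  have inj: "inj (%(x, y). dg n x y)" by (auto intro!: injI simp: dg_inj)
  have U: "(UNIV :: (bool \<times> bool) set) = UNIV \<times> UNIV" by simp
  have "(\<Sum>c\<in>C (Suc n). \<kappa> (Suc n) c) = (\<Sum>(x, y)\<in>UNIV \<times> UNIV. \<kappa> (Suc n) (dg n x y))"
   unfolding C_dg by (subst sum.reindex[OF inj]) (simp add: split_def)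
  also have "... = (\<Sum>x\<in>(UNIV :: bool set). \<Sum>y\<in>(UNIV :: bool set). pmf (\<alpha> n) y / 2)"
   by (simp only: sum.cartesian_product[symmetric] \<kappa>_dg)
  also have "... = (\<Sum>y\<in>(UNIV :: bool set). pmf (\<alpha> n) y)" by (simp add: UNIV_bool)
  also have "... = 1" by (rule sum_pmf_eq_1) auto
  finally show ?thesis .
 qed
 have lim: "(%N. \<Prod>n=1..N. Max (\<kappa> n ` C n)) \<longlonglongrightarrow> 0"
 proof (rule tendsto_sandwich[where f = "%_. 0" and h = "%N. (1 / 2 :: real) ^ N"])
  have fin: "finite (\<kappa> n ` C n)" "\<kappa> n ` C n ~= {}" if "n >= 1" for n
   using that C_Suc[of "n - 1"] by auto
  have "0 <= Max (\<kappa> n ` C n) & Max (\<kappa> n ` C n) <= 1 / 2" if "n >= 1" for n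
  proof -
   have b: "0 <= \<kappa> n c & \<kappa> n c <= 1 / 2" for c by (simp add: \<kappa>_def pmf_le_1)
   have "Max (\<kappa> n ` C n) : \<kappa> n ` C n" using fin[OF that] by (rule Max_in)
   then obtain c where "Max (\<kappa> n ` C n) = \<kappa> n c" by (rule imageE)
   thus ?thesis using b[of c] by simp
  qed
  hence "0 <= (\<Prod>n=1..N. Max (\<kappa> n ` C n)) & (\<Prod>n=1..N. Max (\<kappa> n ` C n)) <= (\<Prod>n=1..N. 1 / 2)" for N
   by (intro conjI prod_nonneg prod_mono) auto
  thus "\<forall>\<^sub>F N in sequentially. 0 <= (\<Prod>n=1..N. Max (\<kappa> n ` C n))"
   "\<forall>\<^sub>F N in sequentially. (\<Prod>n=1..N. Max (\<kappa> n ` C n)) <= (1 / 2) ^ N" by simp_all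
  show "(%N. (1 / 2 :: real) ^ N) \<longlonglongrightarrow> 0" by (intro LIMSEQ_realpow_zero) auto
 qed simp
 show ?thesis unfolding cf_measure_def
 proof (rule conjI[OF sets_\<mu>], rule exI[of _ \<nu>w], rule exI[of _ \<kappa>], intro conjI allI ballI impI)
  show "\<nu>w 0 0 = 1" by (rule \<nu>w_0)
  show "0 < \<nu>w n f" for n f by (rule \<nu>w_pos)
  show "0 < \<kappa> n c" for n c by (simp add: \<kappa>_def pmf_\<alpha>_pos)
  show "(\<Sum>c\<in>C n. \<kappa> n c) = 1" if "n >= 1" for n using C_sum[of "n - 1"] that by simp
  show "\<nu>w (Suc n) (f + c) = \<nu>w n f * \<kappa> (Suc n) c" if fF: "f : F n" and cC: "c : C (Suc n)" for n f c
  proof -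
   obtain x y where c: "c = dg n x y" using cC unfolding C_dg by auto
   show ?thesis unfolding c \<nu>w_Suc[OF fF] \<kappa>_dg ..
  qed
  show "(%N. \<Prod>n=1..N. Max (\<kappa> n ` C n)) \<longlonglongrightarrow> 0" by (rule lim)
  show "emeasure \<mu> (cyl n f) = ennreal (\<nu>w n f)" if "f : F n" for n f by (rule emeasure_\<mu>_cylinder[OF that])
 qed
qed

lemma cf_quasi_invariant_\<mu>: "cf_quasi_invariant F C \<mu>"
 unfolding cf_quasi_invariant_def using G_conull nonsingular_M by simp

end

section \<open>The tail relation and its cocycle\<close>

lemma tail_iff: "(b, b') : tail_relation \<longleftrightarrow> (EX N. ALL i>=N. b i = b' i)"
 by (simp add: tail_relation_def)

lemma tail_sym: "(b, b') : tail_relation ==> (b', b) : tail_relation"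
proof -
 assume "(b, b') : tail_relation"
 then obtain N where "ALL i>=N. b i = b' i" unfolding tail_iff by (elim exE)
 thus "(b', b) : tail_relation" unfolding tail_iff by (intro exI[of _ N]) simp
qed

lemma tail_trans: "(b, b') : tail_relation ==> (b', b'') : tail_relation ==> (b, b'') : tail_relation"
proof -
 assume "(b, b') : tail_relation" "(b', b'') : tail_relation"
 then obtain N N' where "ALL i>=N. b i = b' i" "ALL i>=N'. b' i = b'' i" unfolding tail_iff by (elim exE)
 thus "(b, b'') : tail_relation" unfolding tail_iff by (intro exI[of _ "max N N'"]) simp
qed

lemma equiv_tail: "equiv UNIV tail_relation"
proof (rule equivI)
 show "refl_on UNIV tail_relation" unfolding refl_on_def tail_iff by simp
 show "sym tail_relation" by (rule symI) (rule tail_sym)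
 show "trans tail_relation" by (rule transI) (rule tail_trans)
qed simp

text \<open>The Radon-Nikodym cocycle of a product measure over its tail relation: a formal quotient
  of two infinite products, in which equal bits cancel.\<close>

definition tail_ratio :: "(nat => bool pmf) => (nat => bool) => (nat => bool) => real" where
 "tail_ratio \<alpha> b b' = (\<Prod>i | b i ~= b' i. pmf (\<alpha> i) (b i) / pmf (\<alpha> i) (b' i))"

text \<open>The truncation with a fixed index set. It is visibly measurable and multiplicative, and
  equals \<open>tail_ratio\<close> once \<open>n\<close> has passed the last difference.\<close>

definition part_ratio :: "(nat => bool pmf) => nat => (nat => bool) => (nat => bool) => real" where
 "part_ratio \<alpha> n b b' = (\<Prod>i<n. pmf (\<alpha> i) (b i) / pmf (\<alpha> i) (b' i))"

lemma flip_invol [simp]: "flip i (flip i b) = b"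
 by (rule ext) (simp add: flip_def)

text \<open>For finite \<open>S\<close> these maps form a countable group that generates the tail
  relation.\<close>

definition flips :: "nat set => (nat => bool) => nat => bool" where
 "flips S b i \<longleftrightarrow> (if i : S then \<not> b i else b i)"

lemma flips_invol [simp]: "flips S (flips S b) = b"
 by (rule ext) (simp add: flips_def)

lemma flips_empty: "flips {} = (%b. b)"
 by (rule ext, rule ext) (simp add: flips_def)

lemma flips_insert: "i ~: S ==> flips (insert i S) = (%b. flip i (flips S b))"
 by (rule ext, rule ext) (auto simp: flips_def flip_def)

lemma flips_flip: "i ~: S ==> flips S (flip i b) = flips (insert i S) b"
 by (rule ext) (auto simp: flips_def flip_def)

lemma measurable_flips [measurable]: "flips S : measurable (bern \<alpha>) (bern \<beta>)"
proof (rule measurable_bernI)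
 show "(%b. flips S b i) : measurable (bern \<alpha>) (count_space UNIV)" for i
  unfolding flips_def by (cases "i : S") auto
qed

lemma flips_tail: assumes "finite S" shows "(flips S b, b) : tail_relation"
proof -
 obtain N where "ALL i:S. i < N" using finite_nat_set_iff_bounded[THEN iffD1, OF assms] by (elim exE)
 thus ?thesis unfolding tail_iff by (intro exI[of _ N]) (auto simp: flips_def)
qed

lemma the_inv_flips: "the_inv_into UNIV (flips S) = flips S"
proof
 fix b
 have "inj (flips S)" by (rule injI) (metis flips_invol)
 from the_inv_into_f_f[OF this, of "flips S b"] show "the_inv_into UNIV (flips S) b = flips S b" by simp
qed

lemma flips_full_group: assumes "finite S" shows "flips S : full_group (bern \<alpha>) tail_relation"
proof -
 have "bij_betw (flips S) UNIV UNIV" by (rule bij_betwI[of _ _ _ "flips S"]) auto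
 thus ?thesis unfolding full_group_def using flips_tail[OF assms] by (simp add: the_inv_flips)
qed

lemma tail_flips: assumes "(b, b') : tail_relation" shows "EX S. finite S & b = flips S b'"
proof -
 obtain N where N: "ALL i>=N. b i = b' i" using assms unfolding tail_iff by (elim exE)
 let ?S = "{i. b i ~= b' i}"
 have "?S \<subseteq> {..<N}" using N by (auto simp: not_le[symmetric])
 hence "finite ?S" by (rule finite_subset) simp
 moreover have "b = flips ?S b'" by (rule ext) (simp add: flips_def)
 ultimately show ?thesis by (intro exI[of _ ?S] conjI)
qed

locale full_bern =
 fixes \<alpha> :: "nat => bool pmf"
 assumes full: "!!n. set_pmf (\<alpha> n) = UNIV"
begin

lemma pmf_pos: "pmf (\<alpha> n) b > 0"
 using full[of n] by (simp add: pmf_positive_iff)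

lemma tail_ratio_eq: assumes "!!i. i >= n ==> b i = b' i" shows "tail_ratio \<alpha> b b' = part_ratio \<alpha> n b b'"
 unfolding tail_ratio_def part_ratio_def
proof (rule prod.mono_neutral_left)
 show "{i. b i ~= b' i} \<subseteq> {..<n}" using assms by (auto simp: not_le[symmetric])
 show "\<forall>i\<in>{..<n} - {i. b i ~= b' i}. pmf (\<alpha> i) (b i) / pmf (\<alpha> i) (b' i) = 1"
  using pmf_pos by (auto simp: less_imp_neq[symmetric])
qed simp

lemma part_ratio_pos: "part_ratio \<alpha> n b b' > 0"
 unfolding part_ratio_def by (intro prod_pos) (simp add: pmf_pos)

lemma part_ratio_mult: "part_ratio \<alpha> n b b' * part_ratio \<alpha> n b' b'' = part_ratio \<alpha> n b b''"
 unfolding part_ratio_def prod.distrib[symmetric] using pmf_pos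
 by (intro prod.cong refl) (simp add: less_imp_neq[symmetric])

lemma pos_cocycle_tail_ratio: "pos_cocycle tail_relation (tail_ratio \<alpha>)"
 unfolding pos_cocycle_def
proof (intro conjI allI impI ballI)
 fix p assume "p : (tail_relation :: ((nat => bool) \<times> (nat => bool)) set)"
 then obtain b b' N where "p = (b, b')" "ALL i>=N. b i = b' i" by (auto simp: tail_relation_def)
 thus "case p of (x, y) => 0 < tail_ratio \<alpha> x y" using tail_ratio_eq[of N b b'] part_ratio_pos by simp
next
 fix b b' b'' :: "nat => bool" assume "(b, b') : tail_relation" "(b', b'') : tail_relation"
 then obtain N N' where N: "ALL i>=N. b i = b' i" "ALL i>=N'. b' i = b'' i" unfolding tail_iff by (elim exE)
 let ?N = "max N N'"
 show "tail_ratio \<alpha> b b'' = tail_ratio \<alpha> b b' * tail_ratio \<alpha> b' b''"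
  using tail_ratio_eq[of ?N b b'] tail_ratio_eq[of ?N b' b''] tail_ratio_eq[of ?N b b''] N
  by (simp add: part_ratio_mult)
qed

text \<open>The index set of \<open>tail_ratio\<close> varies with the pair; as a limit of
  truncations it becomes measurable.\<close>

lemma tail_ratio_lim: assumes "(b, b') : tail_relation" shows "lim (%n. part_ratio \<alpha> n b b') = tail_ratio \<alpha> b b'"
proof -
 obtain N where N: "ALL i>=N. b i = b' i" using assms unfolding tail_iff by (elim exE)
 have "\<forall>\<^sub>F n in sequentially. part_ratio \<alpha> n b b' = tail_ratio \<alpha> b b'"
  using eventually_ge_at_top[of N]
 proof eventually_elim
  case (elim n)
  thus ?case using tail_ratio_eq[of n b b'] N by simp
 qed
 hence "(%n. part_ratio \<alpha> n b b') \<longlonglongrightarrow> tail_ratio \<alpha> b b'" by (rule tendsto_eventually)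
 thus ?thesis by (rule limI)
qed

lemma lim_part_ratio_measurable:
 assumes "p : measurable N (bern \<alpha>)" "q : measurable N (bern \<alpha>)"
 shows "(%x. lim (%n. part_ratio \<alpha> n (p x) (q x))) : borel_measurable N"
proof (rule borel_measurable_lim_metric)
 fix n
 have m: "(%x. pmf (\<alpha> i) (r x i)) : borel_measurable N" if "r : measurable N (bern \<alpha>)" for i r
 proof -
  have "(%x. r x i) : measurable N (count_space UNIV)"
   using measurable_compose[OF that measurable_bern_component] .
  thus ?thesis by (rule measurable_compose) simp
 qed
 show "(%x. part_ratio \<alpha> n (p x) (q x)) : borel_measurable N"
  unfolding part_ratio_def by (intro borel_measurable_prod borel_measurable_divide m assms)
qed

lemma tail_ratio_measurable:
 assumes p: "p : measurable N (bern \<alpha>)" and q: "q : measurable N (bern \<alpha>)"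
  and t: "!!x. x : space N ==> (p x, q x) : tail_relation"
 shows "(%x. tail_ratio \<alpha> (p x) (q x)) : borel_measurable N"
proof (rule measurable_cong[THEN iffD1, OF _ lim_part_ratio_measurable[OF p q]])
 fix x assume "x : space N"
 thus "lim (%n. part_ratio \<alpha> n (p x) (q x)) = tail_ratio \<alpha> (p x) (q x)" by (rule tail_ratio_lim[OF t])
qed

text \<open>Split by the value of bit \<open>i\<close>: the flip exchanges the two halves, so the
  density is the quotient of the two weights.\<close>

lemma distr_flip: "distr (bern \<alpha>) (bern \<alpha>) (flip i) = density (bern \<alpha>) (%b. ennreal (tail_ratio \<alpha> (flip i b) b))"
proof (rule measure_eqI)
 fix A assume "A : sets (distr (bern \<alpha>) (bern \<alpha>) (flip i))"
 hence A: "A : sets (bern \<alpha>)" by simp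
 let ?A = "%d. A Int {b. b i = d}"
 have tr: "tail_ratio \<alpha> (flip i b) b = pmf (\<alpha> i) (\<not> b i) / pmf (\<alpha> i) (b i)" for b
 proof -
  have "{j. flip i b j ~= b j} = {i}" by (auto simp: flip_def)
  thus ?thesis by (simp add: tail_ratio_def flip_def)
 qed
 have cy: "{b. b i = d} : sets (bern \<alpha>)" for d
  by (rule dep_sets[of "Suc i"]) (simp add: dep_def)
 have Ad: "emeasure (bern \<alpha>) (?A d) = ennreal (pmf (\<alpha> i) d) * emeasure (bern \<alpha>) {b. b(i := d) : A}" for d
 proof -
  have "{b. b(i := d') : ?A d} = (if d' = d then {b. b(i := d) : A} else {})" for d' by auto
  note eq = this
  have "emeasure (bern \<alpha>) (?A d) = (\<Sum>d'\<in>UNIV. ennreal (pmf (\<alpha> i) d') * emeasure (bern \<alpha>) {b. b(i := d') : ?A d})"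
   using A cy by (intro bern_resample) auto
  also have "... = (\<Sum>d'\<in>UNIV. if d' = d then ennreal (pmf (\<alpha> i) d) * emeasure (bern \<alpha>) {b. b(i := d) : A} else 0)"
   unfolding eq by (intro sum.cong refl) simp
  finally show ?thesis by simp
 qed
 have sb: "(\<Sum>d\<in>(UNIV :: bool set). f d) = f False + f True" for f :: "bool => ennreal"
  by (simp add: UNIV_bool)
 have mA: "?A d : sets (bern \<alpha>)" for d using A cy by auto
 have fA: "{b. b(i := d) : {b. flip i b : A}} = {b. b(i := \<not> d) : A}" for d by (auto simp: flip_def)
 have "emeasure (distr (bern \<alpha>) (bern \<alpha>) (flip i)) A = emeasure (bern \<alpha>) {b. flip i b : A}"
  using A by (subst emeasure_distr) (auto simp: vimage_def)
 also have "... = (\<Sum>d\<in>UNIV. ennreal (pmf (\<alpha> i) d) * emeasure (bern \<alpha>) {b. b(i := \<not> d) : A})"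
  unfolding fA[symmetric] by (rule bern_resample[OF flip_sets[OF A]])
 also have "... = (\<Sum>d\<in>UNIV. ennreal (pmf (\<alpha> i) (\<not> d)) * emeasure (bern \<alpha>) {b. b(i := d) : A})"
  by (simp add: UNIV_bool add.commute)
 also have "... = (\<Sum>d\<in>UNIV. ennreal (pmf (\<alpha> i) (\<not> d) / pmf (\<alpha> i) d) * emeasure (bern \<alpha>) (?A d))"
 proof (intro sum.cong refl)
  fix d
  have "ennreal (pmf (\<alpha> i) (\<not> d) / pmf (\<alpha> i) d) * ennreal (pmf (\<alpha> i) d) = ennreal (pmf (\<alpha> i) (\<not> d))"
   using pmf_pos[of i d] by (subst ennreal_mult[symmetric]) auto
  thus "ennreal (pmf (\<alpha> i) (\<not> d)) * emeasure (bern \<alpha>) {b. b(i := d) : A} =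
    ennreal (pmf (\<alpha> i) (\<not> d) / pmf (\<alpha> i) d) * emeasure (bern \<alpha>) (?A d)"
   unfolding Ad by (simp add: mult.assoc[symmetric])
 qed
 also have "... = (\<Sum>d\<in>UNIV. \<integral>\<^sup>+b. ennreal (pmf (\<alpha> i) (\<not> d) / pmf (\<alpha> i) d) * indicator (?A d) b \<partial>bern \<alpha>)"
  using mA by (simp add: nn_integral_cmult_indicator)
 also have "... = (\<integral>\<^sup>+b. (\<Sum>d\<in>UNIV. ennreal (pmf (\<alpha> i) (\<not> d) / pmf (\<alpha> i) d) * indicator (?A d) b) \<partial>bern \<alpha>)"
  using mA by (subst nn_integral_sum) auto
 also have "... = (\<integral>\<^sup>+b. ennreal (tail_ratio \<alpha> (flip i b) b) * indicator A b \<partial>bern \<alpha>)"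
 proof (rule nn_integral_cong)
  fix b
  show "(\<Sum>d\<in>UNIV. ennreal (pmf (\<alpha> i) (\<not> d) / pmf (\<alpha> i) d) * indicator (?A d) b) =
    ennreal (tail_ratio \<alpha> (flip i b) b) * indicator A b"
   unfolding tr sb by (cases "b i"; cases "b : A") (simp_all add: indicator_def)
 qed
 also have "... = emeasure (density (bern \<alpha>) (%b. ennreal (tail_ratio \<alpha> (flip i b) b))) A"
 proof (rule emeasure_density[symmetric, OF _ A])
  have "(flip i b, b) : tail_relation" for b
   unfolding tail_iff by (intro exI[of _ "Suc i"]) (auto simp: flip_def)
  hence "(%b. tail_ratio \<alpha> (flip i b) b) : borel_measurable (bern \<alpha>)"
   by (intro tail_ratio_measurable measurable_flip measurable_ident_sets[OF refl])
  thus "(%b. ennreal (tail_ratio \<alpha> (flip i b) b)) : borel_measurable (bern \<alpha>)" by simp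
 qed
 finally show "emeasure (distr (bern \<alpha>) (bern \<alpha>) (flip i)) A = emeasure (density (bern \<alpha>) (%b. ennreal (tail_ratio \<alpha> (flip i b) b))) A" .
qed simp

lemma tail_ratio_flips_measurable:
 "finite S ==> (%b. tail_ratio \<alpha> (flips S b) b) : borel_measurable (bern \<alpha>)"
 by (intro tail_ratio_measurable measurable_flips measurable_ident_sets[OF refl] flips_tail)

lemma flip_tail: "(flip i b, b) : tail_relation"
 unfolding tail_iff by (intro exI[of _ "Suc i"]) (auto simp: flip_def)

text \<open>The chain rule for densities, one flip at a time, matched with the cocycle
  identity.\<close>

lemma distr_flips:
 "finite S ==> distr (bern \<alpha>) (bern \<alpha>) (flips S) = density (bern \<alpha>) (%b. ennreal (tail_ratio \<alpha> (flips S b) b))"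
proof (induction S rule: finite_induct)
 case empty
 have "tail_ratio \<alpha> b b = 1" for b by (simp add: tail_ratio_def)
 thus ?case unfolding flips_empty by (simp add: density_1 distr_id2 one_ennreal_def[symmetric])
next
 case (insert i S)
 let ?r = "%b. ennreal (tail_ratio \<alpha> (flips S b) b)" and ?s = "%b. ennreal (tail_ratio \<alpha> (flip i b) b)"
 have r: "?r : borel_measurable (bern \<alpha>)" using tail_ratio_flips_measurable[OF insert(1)] by simp
 have s: "?s : borel_measurable (bern \<alpha>)"
  using tail_ratio_measurable[OF measurable_flip measurable_ident_sets[OF refl] flip_tail] by simp
 have inv: "flip i -` (flip i -` A) = A" for A by (auto simp: vimage_def)
 have "distr (bern \<alpha>) (bern \<alpha>) (flips (insert i S)) = distr (distr (bern \<alpha>) (bern \<alpha>) (flips S)) (bern \<alpha>) (flip i)"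
  unfolding flips_insert[OF insert(2)] by (subst distr_distr) (auto simp: comp_def)
 also have "... = distr (density (bern \<alpha>) ?r) (bern \<alpha>) (flip i)" using insert(3) by simp
 also have "... = density (distr (bern \<alpha>) (bern \<alpha>) (flip i)) (%b. ?r (flip i b))"
 proof (rule measure_eqI)
  fix A assume "A : sets (distr (density (bern \<alpha>) ?r) (bern \<alpha>) (flip i))"
  hence A: "A : sets (bern \<alpha>)" by simp
  have m: "(%b. ?r (flip i b)) : borel_measurable (bern \<alpha>)" using measurable_compose[OF measurable_flip r] .
  have fA: "flip i -` A Int space (bern \<alpha>) : sets (bern \<alpha>)" by (rule measurable_sets[OF measurable_flip A])
  have "emeasure (distr (density (bern \<alpha>) ?r) (bern \<alpha>) (flip i)) A = (\<integral>\<^sup>+b. ?r b * indicator (flip i -` A Int space (bern \<alpha>)) b \<partial>bern \<alpha>)"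
   using A fA r by (subst emeasure_distr) (auto simp: emeasure_density)
  also have "... = (\<integral>\<^sup>+b. ?r (flip i (flip i b)) * indicator A (flip i b) \<partial>bern \<alpha>)"
   by (intro nn_integral_cong) (simp add: indicator_def)
  also have "... = (\<integral>\<^sup>+b. ?r (flip i b) * indicator A b \<partial>distr (bern \<alpha>) (bern \<alpha>) (flip i))"
   using A m by (subst nn_integral_distr) auto
  also have "... = emeasure (density (distr (bern \<alpha>) (bern \<alpha>) (flip i)) (%b. ?r (flip i b))) A"
   using A m by (subst emeasure_density) auto
  finally show "emeasure (distr (density (bern \<alpha>) ?r) (bern \<alpha>) (flip i)) A =
   emeasure (density (distr (bern \<alpha>) (bern \<alpha>) (flip i)) (%b. ?r (flip i b))) A" .
 qed simp
 also have "... = density (density (bern \<alpha>) ?s) (%b. ?r (flip i b))" unfolding distr_flip ..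
 also have "... = density (bern \<alpha>) (%b. ?s b * ?r (flip i b))"
  using s measurable_compose[OF measurable_flip r] by (intro density_density_eq) auto
 also have "... = density (bern \<alpha>) (%b. ennreal (tail_ratio \<alpha> (flips (insert i S) b) b))"
 proof (rule arg_cong[where f = "density (bern \<alpha>)"], rule ext)
  fix b
  note c = pos_cocycle_tail_ratio
  have t: "(flips S (flip i b), flip i b) : tail_relation" by (rule flips_tail[OF insert(1)])
  show "?s b * ?r (flip i b) = ennreal (tail_ratio \<alpha> (flips (insert i S) b) b)"
   using pos_cocycleD(2)[OF c t flip_tail[of i b]] pos_cocycleD(1)[OF c t] pos_cocycleD(1)[OF c flip_tail[of i b]]
   by (simp add: ennreal_mult[symmetric] flips_flip[OF insert(2)] mult.commute less_imp_le)
 qed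
 finally show ?case .
qed

definition flip_seq :: "nat => (nat => bool) => nat => bool" where
 "flip_seq k = flips (from_nat_into {S. finite S} k)"

lemma flip_seq_cases: obtains S where "finite S" "flip_seq k = flips S"
proof -
 have "from_nat_into {S :: nat set. finite S} k : {S. finite S}" by (rule from_nat_into) auto
 thus ?thesis using that by (simp add: flip_seq_def)
qed

lemma flip_seq_gen: assumes "(b, b') : tail_relation" shows "EX k. b = flip_seq k b'"
proof -
 obtain S where S: "finite S" "b = flips S b'" using tail_flips[OF assms] by (elim exE conjE)
 have c: "countable {S :: nat set. finite S}" by (rule countable_Collect_finite)
 have "S : {S. finite S}" using S(1) by simp
 hence "from_nat_into {S. finite S} (to_nat_on {S. finite S} S) = S" using c by (intro from_nat_into_to_nat_on)
 thus ?thesis using S(2) by (intro exI[of _ "to_nat_on {S. finite S} S"]) (simp add: flip_seq_def)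
qed

sublocale bern: prob_space "bern \<alpha>" by (rule prob_space_bern)

lemma sigma_finite_bern: "sigma_finite_measure (bern \<alpha>)" ..

lemma RN_flip_seq:
 "AE b in bern \<alpha>. RN_deriv (bern \<alpha>) (distr (bern \<alpha>) (bern \<alpha>) (the_inv_into (space (bern \<alpha>)) (flip_seq k))) b = ennreal (tail_ratio \<alpha> (flip_seq k b) b)"
proof -
 obtain S where S: "finite S" "flip_seq k = flips S" by (rule flip_seq_cases)
 have "AE b in bern \<alpha>. ennreal (tail_ratio \<alpha> (flips S b) b) = RN_deriv (bern \<alpha>) (distr (bern \<alpha>) (bern \<alpha>) (flips S)) b"
  using tail_ratio_flips_measurable[OF S(1)] distr_flips[OF S(1)] by (intro bern.RN_deriv_unique) auto
 thus ?thesis unfolding S(2) space_bern the_inv_flips by (rule AE_mp) (auto intro!: AE_I2)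
qed

lemma equiv_tail_bern: "equiv (space (bern \<alpha>)) tail_relation"
 using equiv_tail by simp

lemma tail_ratio_measurable_restrict:
 "(%(x, y). tail_ratio \<alpha> x y) : borel_measurable (restrict_space (bern \<alpha> \<Otimes>\<^sub>M bern \<alpha>) tail_relation)"
 unfolding split_def
proof (rule tail_ratio_measurable)
 show "fst : measurable (restrict_space (bern \<alpha> \<Otimes>\<^sub>M bern \<alpha>) tail_relation) (bern \<alpha>)"
  "snd : measurable (restrict_space (bern \<alpha> \<Otimes>\<^sub>M bern \<alpha>) tail_relation) (bern \<alpha>)"
  by (rule measurable_restrict_space1, simp)+
qed (auto simp: space_restrict_space)

text \<open>\<open>is_associated_flow\<close> only offers some Radon-Nikodym cocycle; this replaces
  it by the explicit one.\<close>

lemma skew_tail_cocycles: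
 assumes "rn_cocycle (bern \<alpha>) tail_relation \<rho>"
 shows "isomorphic_flows (skew_invariant_space (bern \<alpha>) tail_relation (tail_ratio \<alpha>)) shift_flow
   (skew_invariant_space (bern \<alpha>) tail_relation \<rho>) shift_flow"
proof (rule rn_cocycles_isomorphic[where \<theta> = flip_seq])
 have fg: "flip_seq k : full_group (bern \<alpha>) tail_relation" for k
 proof -
  obtain S where "finite S" "flip_seq k = flips S" by (rule flip_seq_cases)
  thus ?thesis using flips_full_group by simp
 qed
 show "flip_seq k : full_group (bern \<alpha>) tail_relation" for k by (rule fg)
 show "AE z in bern \<alpha>. RN_deriv (bern \<alpha>) (distr (bern \<alpha>) (bern \<alpha>) (the_inv_into (space (bern \<alpha>)) (flip_seq k))) z = ennreal (\<rho> (flip_seq k z) z)" for k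
 proof -
  have "ALL \<theta>:full_group (bern \<alpha>) tail_relation. AE z in bern \<alpha>. RN_deriv (bern \<alpha>) (distr (bern \<alpha>) (bern \<alpha>) (the_inv_into (space (bern \<alpha>)) \<theta>)) z = ennreal (\<rho> (\<theta> z) z)"
   using assms unfolding rn_cocycle_def by (elim conjE)
  thus ?thesis using fg[of k] by (rule bspec)
 qed
 show "(%(x, y). \<rho> x y) : borel_measurable (restrict_space (bern \<alpha> \<Otimes>\<^sub>M bern \<alpha>) tail_relation)"
  using assms unfolding rn_cocycle_def by (elim conjE)
qed (use flip_seq_gen rn_pos_cocycle[OF assms] pos_cocycle_tail_ratio RN_flip_seq equiv_tail_bern sigma_finite_bern tail_ratio_measurable_restrict in auto)

end

section \<open>The orbit relation and the rank-one structure\<close>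

context cf_bern
begin

sublocale fb: full_bern \<alpha> by unfold_locales (rule \<alpha>_full)

abbreviation R :: "(cf_rep set \<times> cf_rep set) set" where "R \<equiv> orbit_relation M T"

lemma R_iff: "(x, y) : R \<longleftrightarrow> x : G & (EX g. y = T g x)"
 using T_G by (auto simp: orbit_relation_def)

lemma equiv_R: "equiv G R"
proof (rule equivI)
 show "R \<subseteq> G \<times> G" by (auto simp: orbit_relation_def)
 show "refl_on G R" unfolding refl_on_def R_iff using T_0 by metis
 show "sym R" using T_G T_inv(1) by (intro symI) (unfold R_iff, metis)
 show "trans R" using T_add by (intro transI) (unfold R_iff, metis)
qed

lemma equiv_R_M: "equiv (space M) R" using equiv_R by simp

text \<open>At a common late stage two points of one orbit differ in the level alone.\<close>

lemma R_rep:
 assumes "(x, y) : R" obtains n f f' w where "f : F n" "f' : F n" "x = pt n f w" "y = pt n f' w"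
proof -
 obtain g where g: "x : G" "y = T g x" using assms R_iff by blast
 obtain n f w where x: "x = pt n f w" "!!g'. \<bar>g'\<bar> <= \<bar>g\<bar> ==> g' + f : F n"
  using G_rep[OF g(1), of 0 "\<bar>g\<bar>"] by blast
 have f: "f : F n" "g + f : F n" using x(2)[of 0] x(2)[of g] by simp_all
 show ?thesis using that[OF f x(1)] g(2) T_pt[OF f, of w] x(1) by simp
qed

lemma R_pt: assumes "f : F n" "f' : F n" "pt n f w : G" shows "(pt n f w, pt n f' w) : R"
 unfolding R_iff using assms T_pt[of f n "f' - f" w] by (intro conjI exI[of _ "f' - f"]) simp_all

lemma bt_tail: assumes "(x, y) : R" shows "(bt x, bt y) : tail_relation"
proof -
 obtain n f f' w where "f : F n" "f' : F n" "x = pt n f w" "y = pt n f' w" using R_rep[OF assms] .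
 thus ?thesis unfolding tail_iff by (intro exI[of _ n]) (simp add: bt_pt)
qed

text \<open>The tail cocycle of \<alpha> pulled back by \<open>bt\<close>. It is the Radon-Nikodym
  cocycle of the system because the weights of levels are products over these bits.\<close>

definition rhoX :: "cf_rep set => cf_rep set => real" where "rhoX x y = tail_ratio \<alpha> (bt x) (bt y)"

lemma rhoX_pt:
 assumes "f : F n" "f' : F n" shows "rhoX (pt n f w) (pt n f' w) = \<nu>w n f / \<nu>w n f'"
proof -
 have "rhoX (pt n f w) (pt n f' w) = part_ratio \<alpha> n (bt (pt n f w)) (bt (pt n f' w))"
  unfolding rhoX_def by (rule fb.tail_ratio_eq) (simp add: bt_pt assms)
 also have "... = \<nu>w n f / \<nu>w n f'"
  unfolding part_ratio_def \<nu>w_eq[OF assms(1), of w] \<nu>w_eq[OF assms(2), of w] prod_dividef[symmetric]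
  by (intro prod.cong refl) simp
 finally show ?thesis .
qed

lemma pos_cocycle_rhoX: "pos_cocycle R rhoX"
 unfolding pos_cocycle_def rhoX_def
proof (intro conjI allI impI ballI)
 note c = fb.pos_cocycle_tail_ratio
 show "case p of (x, y) => 0 < tail_ratio \<alpha> (bt x) (bt y)" if "p : R" for p
  using that pos_cocycleD(1)[OF c bt_tail] by (cases p) simp
 show "tail_ratio \<alpha> (bt x) (bt z) = tail_ratio \<alpha> (bt x) (bt y) * tail_ratio \<alpha> (bt y) (bt z)"
  if "(x, y) : R" "(y, z) : R" for x y z
  using pos_cocycleD(2)[OF c bt_tail[OF that(1)] bt_tail[OF that(2)]] .
qed

lemma bt_M [measurable]: "bt : measurable M PB" by (rule M_XB) (rule bt_measurable)

lemma lev_M [measurable]: "(%x. real_of_int (lev n x)) : borel_measurable M"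
 by (rule M_XB) (rule lev_real_measurable)

lemma rhoX_measurable:
 assumes "p : measurable N M" "q : measurable N M" "!!x. x : space N ==> (p x, q x) : R"
 shows "(%x. rhoX (p x) (q x)) : borel_measurable N"
 unfolding rhoX_def
 by (intro fb.tail_ratio_measurable measurable_compose[OF assms(1) bt_M] measurable_compose[OF assms(2) bt_M] bt_tail assms(3))

lemma T_R: "x : G ==> (T g x, x) : R"
 using equiv_R T_G by (meson R_iff equivE symD)

lemma rhoX_T_measurable: "(%x. rhoX (T g x) x) : borel_measurable M"
 by (intro rhoX_measurable T_measurable_M measurable_ident_sets T_R) auto

lemma emeasure_density_const:
 assumes "f : borel_measurable N" "A : sets N" "!!x. x : A ==> f x = c"
 shows "emeasure (density N f) A = c * emeasure N A"
proof -
 have "emeasure (density N f) A = (\<integral>\<^sup>+x. f x * indicator A x \<partial>N)" using assms by (intro emeasure_density) auto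
 also have "... = (\<integral>\<^sup>+x. c * indicator A x \<partial>N)" using assms(3) by (intro nn_integral_cong) (auto simp: indicator_def)
 also have "... = c * emeasure N A" using assms(2) by (rule nn_integral_cmult_indicator)
 finally show ?thesis .
qed

text \<open>Checked on the countably many cylinders that \<open>T g\<close> shifts as a whole; the
  density is constant on each of them.\<close>

lemma distr_T: "distr M M (T (- g)) = density M (%x. ennreal (rhoX (T g x) x))"
proof (rule measure_eqI_countable_cover[where I = "{(n, f). f : F n & g + f : F n}" and A = "%(n, f). cyl n f Int G"])
 fix i assume i: "i : {(n, f). f : F n & g + f : F n}"
 then obtain n f where nf: "i = (n, f)" "f : F n" "g + f : F n" by auto
 show "(case i of (n, f) => cyl n f Int G) : sets (distr M M (T (- g)))" using nf by simp
 fix B assume B: "B : sets (distr M M (T (- g)))" "B \<subseteq> (case i of (n, f) => cyl n f Int G)"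
 hence B': "B : sets M" "B \<subseteq> cyl n f" "B \<subseteq> G" using nf by auto
 have "emeasure (distr M M (T (- g))) B = emeasure M (T g ` B)"
  using B' by (subst emeasure_distr) (auto simp: T_image)
 also have "... = ennreal (\<nu>w n (g + f) / \<nu>w n f) * emeasure M B"
  by (rule emeasure_T_image[OF nf(2,3) B'(1,2)])
 also have "... = emeasure (density M (%x. ennreal (rhoX (T g x) x))) B"
 proof (rule emeasure_density_const[symmetric, OF _ B'(1)])
  show "(%x. ennreal (rhoX (T g x) x)) : borel_measurable M" using rhoX_T_measurable by simp
  fix x assume "x : B"
  hence "x : cyl n f" using B'(2) by auto
  then obtain w where w: "x = pt n f w" unfolding cyl_eq by (rule rangeE)
  thus "ennreal (rhoX (T g x) x) = ennreal (\<nu>w n (g + f) / \<nu>w n f)"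
   using T_pt[OF nf(2,3), of w] rhoX_pt[OF nf(3,2), of w] by simp
 qed
 finally show "emeasure (distr M M (T (- g))) B = emeasure (density M (%x. ennreal (rhoX (T g x) x))) B" .
next
 show "space (distr M M (T (- g))) \<subseteq> (\<Union>i\<in>{(n, f). f : F n & g + f : F n}. case i of (n, f) => cyl n f Int G)"
 proof
  fix x assume "x : space (distr M M (T (- g)))"
  hence xG: "x : G" by simp
  obtain n f w where x: "x = pt n f w" "!!g'. \<bar>g'\<bar> <= \<bar>g\<bar> ==> g' + f : F n"
   using G_rep[OF xG, of 0 "\<bar>g\<bar>"] by blast
  have f: "f : F n" "g + f : F n" using x(2)[of 0] x(2)[of g] by simp_all
  show "x : (\<Union>i\<in>{(n, f). f : F n & g + f : F n}. case i of (n, f) => cyl n f Int G)"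
   using f x(1) xG by (intro UN_I[of "(n, f)"]) auto
 qed
qed auto

lemma eq_iff_lev: "x : X ==> y : X ==> x = y \<longleftrightarrow> (ALL n. real_of_int (lev n x) = real_of_int (lev n y))"
 using inj_onD[OF levr_inj, of x y] by (auto simp: levr_def fun_eq_iff)

lemma eq_sets_M:
 assumes p: "p : measurable N M" and q: "q : measurable N M"
 shows "{x\<in>space N. p x = q x} : sets N"
proof -
 have "p x : G & q x : G" if "x : space N" for x
  using measurable_space[OF p that] measurable_space[OF q that] by simp
 hence pq: "p x = q x \<longleftrightarrow> (ALL n. real_of_int (lev n (p x)) = real_of_int (lev n (q x)))" if "x : space N" for x
  using eq_iff_lev[of "p x" "q x"] that G_space by blast
 have "(%x. real_of_int (lev n (p x))) : borel_measurable N" "(%x. real_of_int (lev n (q x))) : borel_measurable N" for n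
  using measurable_compose[OF p lev_M] measurable_compose[OF q lev_M] by auto
 hence "{x\<in>space N. ALL n. real_of_int (lev n (p x)) = real_of_int (lev n (q x))} : sets N" by measurable
 moreover have "{x\<in>space N. p x = q x} = {x\<in>space N. ALL n. real_of_int (lev n (p x)) = real_of_int (lev n (q x))}"
  using pq by (intro Collect_cong conj_cong refl)
 ultimately show ?thesis by simp
qed

text \<open>On the countably many pieces \<open>E g\<close> the map coincides with some
  \<open>T g\<close>, whose derivative is known.\<close>

lemma distr_full_group:
 assumes \<theta>: "\<theta> : full_group M R"
 shows "distr M M (the_inv_into (space M) \<theta>) = density M (%z. ennreal (rhoX (\<theta> z) z))"
proof -
 let ?\<theta>' = "the_inv_into G \<theta>"
 have bij: "bij_betw \<theta> G G" and m: "\<theta> : measurable M M" "?\<theta>' : measurable M M" and r: "!!z. z : G ==> (\<theta> z, z) : R"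
  using \<theta> by (auto simp: full_group_def)
 have inj: "inj_on \<theta> G" using bij by (rule bij_betw_imp_inj_on)
 have rm: "(%z. ennreal (rhoX (\<theta> z) z)) : borel_measurable M"
  using rhoX_measurable[OF m(1) measurable_ident_sets[OF refl]] r by simp
 define E where "E g = {z\<in>space M. \<theta> z = T g z}" for g
 have E: "E g : sets M" for g unfolding E_def by (intro eq_sets_M m T_measurable_M)
 have "distr M M ?\<theta>' = density M (%z. ennreal (rhoX (\<theta> z) z))"
 proof (rule measure_eqI_countable_cover[where I = UNIV and A = E])
  show "space (distr M M ?\<theta>') \<subseteq> (\<Union>g. E g)"
  proof
   fix z assume "z : space (distr M M ?\<theta>')"
   hence z: "z : G" by simp
   have "(z, \<theta> z) : R" using equiv_R r[OF z] by (meson equivE symD)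
   then obtain g where "\<theta> z = T g z" using R_iff by blast
   thus "z : (\<Union>g. E g)" using z by (auto simp: E_def)
  qed
  fix g B assume B: "B : sets (distr M M ?\<theta>')" "B \<subseteq> E g"
  hence B': "B : sets M" "B \<subseteq> G" by (auto simp: E_def)
  have im: "?\<theta>' -` B Int G = \<theta> ` B"
  proof (intro equalityI subsetI)
   fix y assume y: "y : ?\<theta>' -` B Int G"
   hence "\<theta> (?\<theta>' y) = y" using f_the_inv_into_f_bij_betw[OF bij] by simp
   thus "y : \<theta> ` B" using y by (metis IntD1 imageI vimageD)
  next
   fix y assume "y : \<theta> ` B"
   then obtain z where z: "z : B" "y = \<theta> z" by auto
   hence "?\<theta>' y = z" using the_inv_into_f_f[OF inj] B'(2) by auto
   moreover have "y : G" using z B'(2) bij by (auto simp: bij_betw_def)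
   ultimately show "y : ?\<theta>' -` B Int G" using z by simp
  qed
  have "emeasure (distr M M ?\<theta>') B = emeasure M (\<theta> ` B)"
   using B' m im by (subst emeasure_distr) auto
  also have "\<theta> ` B = T g ` B" using B(2) by (auto simp: E_def intro!: image_cong)
  also have "emeasure M (T g ` B) = emeasure (distr M M (T (- g))) B"
   using B' by (subst emeasure_distr) (auto simp: T_image)
  also have "... = (\<integral>\<^sup>+z. ennreal (rhoX (T g z) z) * indicator B z \<partial>M)"
   unfolding distr_T using B' rhoX_T_measurable by (intro emeasure_density) auto
  also have "... = (\<integral>\<^sup>+z. ennreal (rhoX (\<theta> z) z) * indicator B z \<partial>M)"
   using B(2) by (intro nn_integral_cong) (auto simp: E_def indicator_def)
  also have "... = emeasure (density M (%z. ennreal (rhoX (\<theta> z) z))) B"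
   using B' rm by (intro emeasure_density[symmetric]) auto
  finally show "emeasure (distr M M ?\<theta>') B = emeasure (density M (%z. ennreal (rhoX (\<theta> z) z))) B" .
 qed (use E in auto)
 thus ?thesis by simp
qed

sublocale Msf: sigma_finite_measure M by (rule sigma_finite_M)

lemma RN_full_group:
 assumes "\<theta> : full_group M R"
 shows "AE z in M. RN_deriv M (distr M M (the_inv_into (space M) \<theta>)) z = ennreal (rhoX (\<theta> z) z)"
proof -
 have m: "\<theta> : measurable M M" and r: "!!z. z : G ==> (\<theta> z, z) : R" using assms by (auto simp: full_group_def)
 have rm: "(%z. ennreal (rhoX (\<theta> z) z)) : borel_measurable M"
  using rhoX_measurable[OF m measurable_ident_sets[OF refl]] r by simp
 have "AE z in M. ennreal (rhoX (\<theta> z) z) = RN_deriv M (distr M M (the_inv_into (space M) \<theta>)) z"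
  using distr_full_group[OF assms] by (intro Msf.RN_deriv_unique[OF rm]) simp
 thus ?thesis by (rule AE_mp) (auto intro!: AE_I2)
qed

lemma rhoX_measurable_restrict: "(%(x, y). rhoX x y) : borel_measurable (restrict_space (M \<Otimes>\<^sub>M M) R)"
 unfolding split_def
proof (rule rhoX_measurable)
 show "fst : measurable (restrict_space (M \<Otimes>\<^sub>M M) R) M" "snd : measurable (restrict_space (M \<Otimes>\<^sub>M M) R) M"
  by (rule measurable_restrict_space1, simp)+
qed (auto simp: space_restrict_space)

lemma rn_cocycle_rhoX: "rn_cocycle M R rhoX"
 using rhoX_measurable_restrict pos_cocycle_rhoX RN_full_group
 unfolding rn_cocycle_def pos_cocycle_def by (intro conjI) auto

lemma T_full_group: "T g : full_group M R"
proof -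
 have bij: "bij_betw (T g) G G"
  by (rule bij_betwI[where g = "T (- g)"]) (auto simp: T_G T_inv)
 have "the_inv_into G (T g) x = T (- g) x" if "x : G" for x
  using the_inv_into_f_f[OF bij_betw_imp_inj_on[OF bij], of "T (- g) x"] that T_G T_inv by simp
 hence "the_inv_into G (T g) : measurable M M"
  using measurable_cong[of M "the_inv_into G (T g)" "T (- g)" M] by simp
 thus ?thesis unfolding full_group_def using bij T_R by simp
qed

lemma skew_M_cocycles:
 assumes "rn_cocycle M R \<rho>"
 shows "isomorphic_flows (skew_invariant_space M R rhoX) shift_flow (skew_invariant_space M R \<rho>) shift_flow"
proof (rule rn_cocycles_isomorphic[where \<theta> = "%k. T (from_nat_into UNIV k)"])
 show "EX k. x = T (from_nat_into UNIV k) y" if "(x, y) : R" for x y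
 proof -
  have "(y, x) : R" using equiv_R that by (meson equivE symD)
  then obtain g where "x = T g y" using R_iff by blast
  thus ?thesis by (intro exI[of _ "to_nat_on UNIV g"]) simp
 qed
 show "AE z in M. RN_deriv M (distr M M (the_inv_into (space M) (T (from_nat_into UNIV k)))) z = ennreal (\<rho> (T (from_nat_into UNIV k) z) z)" for k
 proof -
  have "ALL \<theta>:full_group M R. AE z in M. RN_deriv M (distr M M (the_inv_into (space M) \<theta>)) z = ennreal (\<rho> (\<theta> z) z)"
   using assms unfolding rn_cocycle_def by (elim conjE)
  thus ?thesis using T_full_group by (rule bspec)
 qed
 show "(%(x, y). \<rho> x y) : borel_measurable (restrict_space (M \<Otimes>\<^sub>M M) R)"
  using assms unfolding rn_cocycle_def by (elim conjE)
qed (use T_full_group rn_pos_cocycle[OF assms] pos_cocycle_rhoX RN_full_group[OF T_full_group] equiv_R_M sigma_finite_M rhoX_measurable_restrict in auto)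

lemma e_tail:
 assumes "agree N w w'" "e w : G" shows "(e w, e w') : R"
proof -
 have f: "dsum 0 N v : F N" for v using dsum_F[of 0 0 N v] zero_F by simp
 have 1: "e v = pt N (dsum 0 N v) v" for v using pt_lift[of 0 0 N v] zero_F by simp
 have "pt N (dsum 0 N w') w' = pt N (dsum 0 N w') w" using pt_eq_same[OF f f] agree_sym[OF assms(1)] by simp
 thus ?thesis using R_pt[OF f f, of w w w'] 1 assms(2) by metis
qed

lemma R_sets: "R : sets (M \<Otimes>\<^sub>M M)"
proof -
 have "{p\<in>space (M \<Otimes>\<^sub>M M). snd p = T g (fst p)} : sets (M \<Otimes>\<^sub>M M)" for g
  using measurable_compose[OF measurable_fst T_measurable_M] by (intro eq_sets_M measurable_snd)
 hence "(\<Union>g. {p\<in>space (M \<Otimes>\<^sub>M M). snd p = T g (fst p)}) : sets (M \<Otimes>\<^sub>M M)" by auto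
 moreover have "R = (\<Union>g. {p\<in>space (M \<Otimes>\<^sub>M M). snd p = T g (fst p)})"
  by (auto simp: orbit_relation_def space_pair_measure)
 ultimately show ?thesis by simp
qed

text \<open>Two zero-one laws in succession: in the fair bits for each fixed \<open>b\<close>, then
  for the set of those \<open>b\<close> whose section is null.\<close>

lemma P_zero_one:
 assumes D: "D : sets P" and inv: "!!w w' N. agree N w w' ==> w : D ==> w' : D"
 shows "emeasure P D = 0 \<or> emeasure P (UNIV - D) = 0"
proof -
 let ?S = "%b. {a. (a, b) : D}"
 have S: "?S b : sets PA" for b by (rule P_section_sets(2)[OF D])
 have 01: "measure PA (?S b) = 0 \<or> measure PA (?S b) = 1" for b
 proof (rule bern_zero_one[OF S])
  fix a a' assume "(a, a') : tail_relation" "a : ?S b"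
  then obtain N where "ALL i>=N. a i = a' i" unfolding tail_iff by (elim exE)
  hence "agree N (a, b) (a', b)" by (simp add: agree_def)
  thus "a' : ?S b" using inv \<open>a : ?S b\<close> by simp
 qed
 have same: "?S b = ?S b'" if t: "(b, b') : tail_relation" for b b'
 proof -
  obtain N where N: "ALL i>=N. b i = b' i" using t unfolding tail_iff by (elim exE)
  have "agree N (a, b) (a, b')" "agree N (a, b') (a, b)" for a using N by (simp_all add: agree_def)
  thus ?thesis using inv by blast
 qed
 let ?B = "{b\<in>space PB. emeasure PA (?S b) = 0}"
 have "(%b. emeasure PA (?S b)) : borel_measurable PB"
  using P.measurable_emeasure_Pair2[OF D] by (simp add: vimage_def)
 hence B: "?B : sets PB" by measurable
 have "measure PB ?B = 0 \<or> measure PB ?B = 1"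
 proof (rule bern_zero_one[OF B])
  fix b b' assume "(b, b') : tail_relation" "b : ?B"
  thus "b' : ?B" using same[of b b'] by simp
 qed
 thus ?thesis
 proof
  assume "measure PB ?B = 1"
  hence "AE b in PB. b : ?B" by (intro PB.AE_prob_1)
  hence "AE b in PB. emeasure PA (?S b) = 0" by eventually_elim simp
  thus ?thesis using P_null_iff[OF D] by simp
 next
  assume "measure PB ?B = 0"
  hence "?B : null_sets PB" using B by (simp add: PB.emeasure_eq_measure null_sets_def)
  hence "AE b in PB. b ~: ?B" by (rule AE_not_in)
  hence ae: "AE b in PB. emeasure PA {a. (a, b) : UNIV - D} = 0"
  proof eventually_elim
   case (elim b)
   hence "emeasure PA (?S b) ~= 0" by simp
   hence "measure PA (?S b) = 1" using 01[of b] by (auto simp: PA.emeasure_eq_measure)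
   hence "measure PA (space PA - ?S b) = 0" using PA.prob_compl[OF S[of b]] by simp
   moreover have "space PA - ?S b = {a. (a, b) : UNIV - D}" by auto
   ultimately show ?case by (simp add: PA.emeasure_eq_measure)
  qed
  have "UNIV - D : sets P" using sets.compl_sets[OF D] by (simp add: space_P)
  thus ?thesis using P_null_iff[of "UNIV - D"] ae by simp
 qed
qed

lemma ergodic_M:
 assumes A: "A : sets M" and inv: "!!x g. x : A ==> T g x : A"
 shows "emeasure M A = 0 \<or> emeasure M (G - A) = 0"
proof -
 have AG: "A \<subseteq> G" using A by (simp add: sets_M_iff)
 have GA: "G - A : sets M" using sets.compl_sets[OF A] by simp
 have inv': "T g x : G - A" if "x : G - A" for x g
  using that inv[of "T g x" "- g"] T_inv(1)[of x g] T_G[of x g] by auto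
 have "emeasure P {w. e w : A} = 0 \<or> emeasure P (UNIV - {w. e w : A}) = 0"
 proof (rule P_zero_one[OF e_vimage[OF A]])
  fix w w' N assume "agree N w w'" "w : {w. e w : A}"
  hence "e w : A" "(e w, e w') : R" using e_tail[of N w w'] AG by auto
  thus "w' : {w. e w : A}" using inv R_iff by auto
 qed
 thus ?thesis
 proof
  assume "emeasure P {w. e w : A} = 0"
  thus ?thesis using inv_null_iff[OF A inv] by auto
 next
  assume 0: "emeasure P (UNIV - {w. e w : A}) = 0"
  have "UNIV - {w. e w : A} : sets P" using sets.compl_sets[OF e_vimage[OF A]] by (simp add: space_P)
  hence "emeasure P {w. e w : G - A} <= emeasure P (UNIV - {w. e w : A})"
   by (intro emeasure_mono) auto
  hence "emeasure P {w. e w : G - A} = 0" using 0 by simp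
  thus ?thesis using inv_null_iff[OF GA inv'] by auto
 qed
qed

lemma ergodic_nonsingular_relation_R: "ergodic_nonsingular_relation M R"
 unfolding ergodic_nonsingular_relation_def
proof (intro conjI ballI impI)
 show "standard_borel M" by (rule standard_borel_G[OF sets_M])
 show "sigma_finite_measure M" by (rule sigma_finite_M)
 show "equiv (space M) R" by (rule equiv_R_M)
 show "R : sets (M \<Otimes>\<^sub>M M)" by (rule R_sets)
 show "countable (R `` {z})" for z
 proof (rule countable_subset)
  show "R `` {z} \<subseteq> range (%g. T g z)" using R_iff by auto
 qed simp
 show "R `` A : null_sets M" if A: "A : null_sets M" for A
 proof -
  have AG: "A \<subseteq> G" using A sets_M_iff by auto
  have "R `` A = (\<Union>g. T g ` A)" using AG R_iff by (auto simp: Image_def)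
  hence "R `` A = (\<Union>g. T (- g) -` A Int G)" by (simp only: T_image[OF AG])
  moreover have "(\<Union>g. T (- g) -` A Int G) : null_sets M" by (intro null_sets_UN M_null_T A)
  ultimately show ?thesis by simp
 qed
 show "emeasure M A = 0 \<or> emeasure M (space M - A) = 0" if A: "A : sets M" "R `` A \<subseteq> A" for A
 proof -
  have AG: "A \<subseteq> G" using A sets_M_iff by auto
  have "T g x : A" if "x : A" for x g
  proof -
   have "(x, T g x) : R" using that AG R_iff by blast
   thus ?thesis using A(2) that by blast
  qed
  thus ?thesis using ergodic_M[OF A(1)] by simp
 qed
qed

lemma T_cyl: assumes f: "f : F n" shows "T f ` (cyl n 0 Int G) = cyl n f Int G"
proof (intro equalityI subsetI)
 fix y assume "y : T f ` (cyl n 0 Int G)"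
 then obtain x where x: "x : cyl n 0" "x : G" "y = T f x" by auto
 obtain w where "x = pt n 0 w" using x(1) unfolding cyl_eq by (rule rangeE)
 hence "y = pt n f w" using T_pt[of 0 n f w] zero_F f x(3) by simp
 moreover have "y : G" using T_G[OF x(2), of f] x(3) by simp
 ultimately show "y : cyl n f Int G" using pt_cyl by auto
next
 fix y assume y: "y : cyl n f Int G"
 then obtain w where w: "y = pt n f w" unfolding cyl_eq by (elim IntE rangeE)
 hence "T (- f) y = pt n 0 w" using T_pt[of f n "- f" w] zero_F f by simp
 hence "T (- f) y : cyl n 0 Int G" using T_G[of y "- f"] y pt_cyl by auto
 moreover have "y = T f (T (- f) y)" using T_inv(2) y by simp
 ultimately show "y : T f ` (cyl n 0 Int G)" by blast
qed

text \<open>The towers are those of the construction, with bases \<open>cyl n 0\<close> inside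
  \<open>G\<close>. The derivatives are constant on a base because quotients of weights depend on
  the levels only.\<close>

lemma rank_one_M: "rank_one M T"
 unfolding rank_one_def
proof (intro conjI)
 show "standard_borel M" by (rule standard_borel_G[OF sets_M])
 show "sigma_finite_measure M" by (rule sigma_finite_M)
 show "nonatomic M" by (rule nonatomic_M)
 show "nonsingular_action M T" by (rule nonsingular_M)
 show "free_action M T" unfolding free_action_def using T_free by (intro AE_I2) auto
 let ?B = "%n. cyl n 0 Int G"
 have TB: "T f ` ?B n = cyl n f Int G" if "f : F n" for n f using T_cyl[OF that] .
 have 1: "ALL n. finite (F n) & F n \<subseteq> F (Suc n)" using finite_F F_mono by simp
 have 2: "ALL n. ?B n : sets M & ?B (Suc n) \<subseteq> ?B n & 0 < emeasure M (?B n) & emeasure M (?B n) < \<infinity>"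
 proof
  fix n
  have a: "?B n : sets M" using zero_F by simp
  have "cyl (Suc n) 0 \<subseteq> cyl n 0"
   using cyl_Suc[OF zero_F[of n]] by (auto simp: dg_def intro!: exI[of _ False])
  hence b: "?B (Suc n) \<subseteq> ?B n" by auto
  have "emeasure \<mu> (cyl n 0) = emeasure \<mu> (?B n Un (cyl n 0 - G))" by (rule arg_cong[where f = "emeasure \<mu>"]) auto
  also have "... = emeasure \<mu> (?B n)"
  proof (rule emeasure_Un_null_set)
   show "?B n : sets \<mu>" using zero_F by auto
   have "cyl n 0 - G \<subseteq> X - G" using cyl_space[OF zero_F] by auto
   thus "cyl n 0 - G : null_sets \<mu>" using null_sets_subset[OF G_conull] zero_F by auto
  qed
  finally have "emeasure M (?B n) = ennreal (\<nu>w n 0)" using emeasure_\<mu>_cylinder[OF zero_F] emeasure_M[of "?B n"] by simp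
  thus "?B n : sets M & ?B (Suc n) \<subseteq> ?B n & 0 < emeasure M (?B n) & emeasure M (?B n) < \<infinity>"
   using a b \<nu>w_pos[of n 0] by simp
 qed
 have 3: "ALL n. disjoint_family_on (%f. T f ` ?B n) (F n)"
  unfolding disjoint_family_on_def using TB cyl_disj by (intro allI ballI impI) auto
 have 4: "ALL n. ALL f:F n. EX r. AE x in M. x : ?B n --> action_deriv M T f x = r"
 proof (intro allI ballI)
  fix n f assume f: "f : F n"
  have "AE x in M. ennreal (rhoX (T f x) x) = RN_deriv M (distr M M (T (- f))) x"
   using rhoX_T_measurable distr_T[of f] by (intro Msf.RN_deriv_unique) auto
  hence "AE x in M. x : ?B n --> action_deriv M T f x = ennreal (\<nu>w n f / \<nu>w n 0)"
  proof eventually_elim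
   case (elim x)
   show ?case
   proof
    assume "x : ?B n"
    then obtain w where w: "x = pt n 0 w" unfolding cyl_eq by (elim IntE rangeE)
    have "f + 0 : F n" using f by simp
    hence "rhoX (T f x) x = \<nu>w n f / \<nu>w n 0"
     using T_pt[of 0 n f w] rhoX_pt[OF f zero_F, of w] w f zero_F by simp
    thus "action_deriv M T f x = ennreal (\<nu>w n f / \<nu>w n 0)" using elim by (simp add: action_deriv_def)
   qed
  qed
  thus "EX r. AE x in M. x : ?B n --> action_deriv M T f x = r" by blast
 qed
 have 5: "ALL n. ALL f:F n. \<exists>S\<subseteq>F (Suc n). T f ` ?B n = (\<Union>s\<in>S. T s ` ?B (Suc n))"
 proof (intro allI ballI)
  fix n f assume f: "f : F n"
  let ?S = "range (%(x, y). f + dg n x y)"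
  have S: "?S \<subseteq> F (Suc n)" using dg_F[OF f] by auto
  have "(\<Union>s\<in>?S. T s ` ?B (Suc n)) = (\<Union>s\<in>?S. cyl (Suc n) s Int G)"
   using S TB by (intro SUP_cong refl) blast
  also have "... = cyl n f Int G" unfolding cyl_Suc[OF f] by (auto, blast)
  finally show "\<exists>S\<subseteq>F (Suc n). T f ` ?B n = (\<Union>s\<in>S. T s ` ?B (Suc n))"
   using S TB[OF f] by (intro exI[of _ ?S] conjI) simp_all
 qed
 have 6: "EX N:null_sets M. ALL x:space M - N. ALL y:space M - N. x ~= y --> (EX n. EX f:F n. x : T f ` ?B n & y ~: T f ` ?B n)"
 proof (intro bexI[of _ "{}"] ballI impI)
  fix x y assume xy: "x : space M - {}" "y : space M - {}" "x ~= y"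
  hence G: "x : G" "y : G" and XX: "x : X" "y : X" using G_space by auto
  obtain n where n: "lev n x ~= lev n y" using eq_iff_lev[OF XX] xy(3) by auto
  \<comment> \<open>At stage \<open>n\<close> the point \<open>x\<close> may still be outside the
    tower. A later stage that contains it also separates, since its level determines the earlier
    ones.\<close>
  have *: "EX m>=k. lev m z : F m" if zX: "z : X" for z k
  proof -
   obtain n' f w where z: "z = pt n' f w" "f : F n'" using cf_space_cases[OF zX] .
   show ?thesis using lev_pt[OF z(2), of "max k n'" w] dsum_F[OF z(2), of "max k n'" w] z(1) by (intro exI[of _ "max k n'"]) simp
  qed
  obtain m where m: "m >= n" "lev m x : F m" using *[OF XX(1)] by blast
  have "lev m x ~= lev m y"
  proof
   assume eq: "lev m x = lev m y"
   have "x : cyl m (lev m x)" "y : cyl m (lev m x)" using lev_cyl[OF m(2)] eq by simp_all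
   then obtain w w' where "x = pt m (lev m x) w" "y = pt m (lev m x) w'" unfolding cyl_eq by (elim rangeE)
   hence "lev n x = lev n y" using lev_pt_indep[OF m(2,1)] by metis
   thus False using n by simp
  qed
  thus "EX n. EX f:F n. x : T f ` ?B n & y ~: T f ` ?B n"
   using m(2) TB[OF m(2)] lev_cyl[OF m(2)] G by (intro exI[of _ m] bexI[of _ "lev m x"]) auto
 qed simp
 have 7: "AE x in M. range (%g. T g x) = (\<Union>n. \<Union>f\<in>{f\<in>F n. x : T f ` ?B n}. (%g. T (g - f) x) ` F n)"
 proof (rule AE_I2)
  fix x assume "x : space M"
  hence xG: "x : G" by simp
  show "range (%g. T g x) = (\<Union>n. \<Union>f\<in>{f\<in>F n. x : T f ` ?B n}. (%g. T (g - f) x) ` F n)"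
  proof (intro equalityI subsetI)
   fix y assume "y : range (%g. T g x)"
   then obtain g where g: "y = T g x" by auto
   obtain n f w where x: "x = pt n f w" "!!g'. \<bar>g'\<bar> <= \<bar>g\<bar> ==> g' + f : F n"
    using G_rep[OF xG, of 0 "\<bar>g\<bar>"] by blast
   have f: "f : F n" "g + f : F n" using x(2)[of 0] x(2)[of g] by simp_all
   have "x : T f ` ?B n" using TB[OF f(1)] xG x(1) by simp
   thus "y : (\<Union>n. \<Union>f\<in>{f\<in>F n. x : T f ` ?B n}. (%g. T (g - f) x) ` F n)"
    using f g by (intro UN_I[of n UNIV] UN_I[of f] image_eqI[of _ _ "g + f"]) auto
  qed auto
 qed
 show "EX (F :: nat => int set) B. F 0 = {0} & (ALL n. finite (F n) & F n \<subseteq> F (Suc n)) &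
   (ALL n. B n : sets M & B (Suc n) \<subseteq> B n & 0 < emeasure M (B n) & emeasure M (B n) < \<infinity>) &
   (ALL n. disjoint_family_on (%f. T f ` B n) (F n)) &
   (ALL n. ALL f:F n. EX r. AE x in M. x : B n --> action_deriv M T f x = r) &
   (ALL n. ALL f:F n. \<exists>S\<subseteq>F (Suc n). T f ` B n = (\<Union>s\<in>S. T s ` B (Suc n))) &
   (EX N:null_sets M. ALL x:space M - N. ALL y:space M - N. x ~= y --> (EX n. EX f:F n. x : T f ` B n & y ~: T f ` B n)) &
   (AE x in M. range (%g. T g x) = (\<Union>n. \<Union>f\<in>{f\<in>F n. x : T f ` B n}. (%g. T (g - f) x) ` F n))"
  by (rule exI[of _ F], rule exI[of _ ?B], intro conjI F_0 1 2 3 4 5 6 7)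
qed

end

lemma null_by_sections:
 assumes "sigma_finite_measure N" "D : sets (N \<Otimes>\<^sub>M lborel)"
 shows "D : null_sets (N \<Otimes>\<^sub>M lborel) \<longleftrightarrow> (AE x in N. emeasure lborel {t. (x, t) : D} = 0)"
proof -
 have m: "(%x. emeasure lborel (Pair x -` D)) : borel_measurable N"
  using lborel.measurable_emeasure_Pair[OF assms(2)] .
 have "emeasure (N \<Otimes>\<^sub>M lborel) D = (\<integral>\<^sup>+x. emeasure lborel (Pair x -` D) \<partial>N)"
  by (rule lborel.emeasure_pair_measure_alt[OF assms(2)])
 hence "D : null_sets (N \<Otimes>\<^sub>M lborel) \<longleftrightarrow> (AE x in N. emeasure lborel (Pair x -` D) = 0)"
  using nn_integral_0_iff_AE[OF m] assms(2) by (simp add: null_sets_def)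
 thus ?thesis unfolding vimage_def .
qed

lemma section_sets: "D : sets (N \<Otimes>\<^sub>M lborel) ==> {t. (x, t) : D} : sets lborel"
 using sets_Pair1[of D N lborel x] unfolding vimage_def .

lemma emeasure_lborel_translate:
 assumes "A : sets (lborel :: real measure)" shows "emeasure lborel {t. t + c : A} = emeasure lborel A"
proof -
 have "emeasure (distr lborel borel ((+) c)) A = emeasure lborel A" by (simp only: lborel_distr_plus)
 moreover have "emeasure (distr lborel borel ((+) c)) A = emeasure lborel {t. t + c : A}"
  using assms by (subst emeasure_distr) (auto simp: vimage_def add.commute)
 ultimately show ?thesis by simp
qed

section \<open>The associated flow\<close>

context cf_bern
begin

abbreviation SM :: "(cf_rep set \<times> real) measure" where "SM \<equiv> skew_invariant_space M R rhoX"
abbreviation SB :: "((nat => bool) \<times> real) measure" where "SB \<equiv> skew_invariant_space PB tail_relation (tail_ratio \<alpha>)"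

lemmas SM_facts = skew_space[OF equiv_R_M pos_cocycle_rhoX] sets_skew[OF equiv_R_M pos_cocycle_rhoX] null_sets_skew[OF equiv_R_M pos_cocycle_rhoX]
lemmas SB_facts = skew_space[OF fb.equiv_tail_bern fb.pos_cocycle_tail_ratio] sets_skew[OF fb.equiv_tail_bern fb.pos_cocycle_tail_ratio]
 null_sets_skew[OF fb.equiv_tail_bern fb.pos_cocycle_tail_ratio]

lemma skew_invD:
 assumes "skew_relation S \<rho> `` A \<subseteq> A" "(z, t) : A" "(z, z') : S" shows "(z', t - ln (\<rho> z z')) : A"
proof -
 have "((z, t), (z', t - ln (\<rho> z z'))) : skew_relation S \<rho>" using assms(3) by (simp add: skew_relation_def)
 thus ?thesis using assms(1,2) by blast
qed

lemma skew_invI: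
 assumes "!!z t z'. (z, t) : A ==> (z, z') : S ==> (z', t - ln (\<rho> z z')) : A"
 shows "skew_relation S \<rho> `` A \<subseteq> A"
proof
 fix p' assume "p' : skew_relation S \<rho> `` A"
 then obtain p where p: "p : A" "(p, p') : skew_relation S \<rho>" by (elim ImageE)
 obtain z t z' t' where "p = (z, t)" "p' = (z', t')" by (cases p, cases p')
 thus "p' : A" using p assms[of z t z'] by (simp add: skew_relation_def)
qed

text \<open>Along an orbit the section is translated by the logarithm of the cocycle, so its
  Lebesgue measure does not change.\<close>

lemma sections_T:
 assumes D: "D : sets (M \<Otimes>\<^sub>M lborel)" "skew_relation R rhoX `` D \<subseteq> D" and x: "x : G"
 shows "emeasure lborel {t. (T g x, t) : D} = emeasure lborel {t. (x, t) : D}"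
proof -
 let ?c = "ln (rhoX x (T g x))"
 have r: "(x, T g x) : R" "(T g x, x) : R" using x R_iff T_R by auto
 have "ln (rhoX (T g x) x) = - ?c"
  using pos_cocycle_inverse[OF pos_cocycle_rhoX r] pos_cocycleD(1)[OF pos_cocycle_rhoX r(1)] equiv_R x
  by (simp add: ln_div equiv_def refl_on_def)
 hence eq: "(T g x, t) : D \<longleftrightarrow> (x, t + ?c) : D" for t
  using skew_invD[OF D(2) _ r(1), of "t + ?c"] skew_invD[OF D(2) _ r(2), of t] by auto
 have "emeasure lborel {t. (T g x, t) : D} = emeasure lborel {t. t + ?c : {t. (x, t) : D}}" by (simp add: eq)
 also have "... = emeasure lborel {t. (x, t) : D}" by (rule emeasure_lborel_translate[OF section_sets[OF D(1)]])
 finally show ?thesis .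
qed

lemma SM_null_iff:
 assumes D: "D : sets (M \<Otimes>\<^sub>M lborel)" "skew_relation R rhoX `` D \<subseteq> D"
 shows "D : null_sets (M \<Otimes>\<^sub>M lborel) \<longleftrightarrow> (AE w in P. emeasure lborel {t. (e w, t) : D} = 0)"
proof -
 have m: "(%x. emeasure lborel {t. (x, t) : D}) : borel_measurable M"
  using lborel.measurable_emeasure_Pair[OF D(1)] unfolding vimage_def .
 have "{x\<in>space M. emeasure lborel {t. (x, t) : D} = 0} : sets M" using m by measurable
 hence "{x\<in>G. emeasure lborel {t. (x, t) : D} = 0} : sets M" by simp
 hence "(AE x in M. emeasure lborel {t. (x, t) : D} = 0) \<longleftrightarrow> (AE w in P. emeasure lborel {t. (e w, t) : D} = 0)"
  by (rule AE_M_inv) (simp add: sections_T[OF D])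
 thus ?thesis using null_by_sections[OF sigma_finite_M D(1)] by simp
qed

text \<open>The projection to the skew product over the tail relation of \<alpha>, which forgets the
  fair bits.\<close>

definition Q :: "cf_rep set \<times> real => (nat => bool) \<times> real" where "Q = (%(x, t). (bt x, t))"

lemma Q_pullback:
 assumes A: "A : sets SB"
 shows "Q -` A Int (G \<times> UNIV) : sets SM"
proof -
 have A': "A : sets (PB \<Otimes>\<^sub>M lborel)" "skew_relation tail_relation (tail_ratio \<alpha>) `` A \<subseteq> A" using A by (auto simp: SB_facts)
 have "Q : measurable (M \<Otimes>\<^sub>M lborel) (PB \<Otimes>\<^sub>M lborel)"
  unfolding Q_def split_def using measurable_compose[OF measurable_fst bt_M] by (intro measurable_Pair) auto
 from measurable_sets[OF this A'(1)] have "Q -` A Int (G \<times> UNIV) : sets (M \<Otimes>\<^sub>M lborel)" by (simp add: space_pair_measure)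
 moreover have "skew_relation R rhoX `` (Q -` A Int (G \<times> UNIV)) \<subseteq> Q -` A Int (G \<times> UNIV)"
 proof (rule skew_invI)
  fix x t y assume xt: "(x, t) : Q -` A Int (G \<times> UNIV)" "(x, y) : R"
  hence "(bt x, t) : A" by (simp add: Q_def)
  hence "(bt y, t - ln (rhoX x y)) : A" unfolding rhoX_def by (rule skew_invD[OF A'(2) _ bt_tail[OF xt(2)]])
  thus "(y, t - ln (rhoX x y)) : Q -` A Int (G \<times> UNIV)" using xt by (auto simp: Q_def orbit_relation_def)
 qed
 ultimately show ?thesis by (simp add: SM_facts)
qed

lemma bt_e: "bt (e w) = snd w"
 using bt_pt[of 0 0 _ w] zero_F by (intro ext) simp

lemma AE_snd:
 assumes "AE w in P. S (snd w)" shows "AE b in PB. S b"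
proof -
 have "AE w in PB \<Otimes>\<^sub>M PA. S (fst w)"
  using assms P.AE_commute
  by (subst (asm) P.distr_pair_swap) (auto dest!: AE_distrD[rotated] simp: split_def)
 hence "AE b in PB. AE a in PA. S b"
  using pair_sigma_finite.AE_pair[of PB PA "%w. S (fst w)"] P.pair_sigma_finite_axioms PA.sigma_finite_measure_axioms PB.sigma_finite_measure_axioms
  by (simp add: pair_sigma_finite_def)
 thus ?thesis by (simp add: PA.AE_const)
qed

lemma AE_snd_iff: "(AE w in P. S (snd w)) \<longleftrightarrow> (AE b in PB. S b)"
proof
 assume "AE b in PB. S b"
 then obtain N where N: "{b\<in>space PB. \<not> S b} \<subseteq> N" "emeasure PB N = 0" "N : sets PB" by (rule AE_E)
 have "emeasure P (UNIV \<times> N) = emeasure PA UNIV * emeasure PB N"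
  using N(3) sets.top[of PA] by (intro PB.emeasure_pair_measure_Times) auto
 hence "UNIV \<times> N : null_sets P" using N(2,3) sets.top[of PA] by (intro null_setsI) auto
 hence "AE w in P. w ~: UNIV \<times> N" by (rule AE_not_in)
 thus "AE w in P. S (snd w)" by eventually_elim (use N(1) in auto)
qed (rule AE_snd)

lemma Q_null_iff:
 assumes A: "A : sets SB"
 shows "Q -` A Int (G \<times> UNIV) : null_sets SM \<longleftrightarrow> A : null_sets SB"
proof -
 let ?D = "Q -` A Int (G \<times> UNIV)"
 have A': "A : sets (PB \<Otimes>\<^sub>M lborel)" "skew_relation tail_relation (tail_ratio \<alpha>) `` A \<subseteq> A" using A by (auto simp: SB_facts)
 have D: "?D : sets (M \<Otimes>\<^sub>M lborel)" "skew_relation R rhoX `` ?D \<subseteq> ?D" using Q_pullback[OF A] by (auto simp: SM_facts)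
 have "?D : null_sets SM \<longleftrightarrow> (AE w in P. emeasure lborel {t. (e w, t) : ?D} = 0)"
  using SM_null_iff[OF D] D(2) by (simp add: SM_facts)
 also have "... \<longleftrightarrow> (AE w in P. emeasure lborel {t. (snd w, t) : A} = 0)"
 proof -
  have seq: "{t. (e w, t) : ?D} = {t. (snd w, t) : A}" if "e w : G" for w using that by (auto simp: Q_def bt_e)
  have "AE w in P. emeasure lborel {t. (e w, t) : ?D} = emeasure lborel {t. (snd w, t) : A}"
   using AE_e_G
  proof eventually_elim
   case (elim w)
   show ?case by (simp only: seq[OF elim])
  qed
  thus ?thesis by (intro iffI; elim AE_mp) (auto elim!: AE_mp intro!: AE_I2)
 qed
 also have "... \<longleftrightarrow> (AE b in PB. emeasure lborel {t. (b, t) : A} = 0)"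
  by (rule AE_snd_iff[of "%b. emeasure lborel {t. (b, t) : A} = 0"])
 also have "... \<longleftrightarrow> A : null_sets SB"
  using null_by_sections[OF fb.sigma_finite_bern A'(1)] A'(2) by (simp add: SB_facts)
 finally show ?thesis .
qed

text \<open>An invariant set of the skew product over \<open>M\<close> is, over \<open>X\<^sub>0\<close>, invariant under changes of the
 fair bits; the zero-one law makes it independent of them.\<close>

lemma Q_surj:
 assumes D: "D : sets SM"
 shows "EX A:sets SB. eq_mod_null SM (Q -` A Int (G \<times> UNIV)) D"
proof -
 have D': "D : sets (M \<Otimes>\<^sub>M lborel)" "skew_relation R rhoX `` D \<subseteq> D" using D by (auto simp: SM_facts)
 have DG: "x : G" if "(x, t) : D" for x t using sets.sets_into_space[OF D'(1)] that by (auto simp: space_pair_measure)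
 \<comment> \<open>The fair bits come last, so that sections over \<open>(b, t)\<close> are events
   for \<open>PA\<close>.\<close>
 let ?W = "(PB \<Otimes>\<^sub>M lborel) \<Otimes>\<^sub>M PA"
 have spW: "space ?W = UNIV" by (simp add: space_pair_measure)
 let ?E = "{p. (e (snd p, fst (fst p)), snd (fst p)) : D}"
 have Em: "?E : sets ?W"
 proof -
  have G': "G \<times> (UNIV :: real set) : sets (XB \<Otimes>\<^sub>M lborel)" by simp
  \<comment> \<open>\<open>M\<close> lives on \<open>G\<close> while \<open>e\<close> takes values
    in \<open>X\<close>, so \<open>D\<close> has to be placed among the measurable sets over
    \<open>X\<close> first.\<close>
  have "D : sets (restrict_space (XB \<Otimes>\<^sub>M lborel) (G \<times> UNIV))"
  proof -
   have "(%p. p) : measurable (restrict_space (XB \<Otimes>\<^sub>M lborel) (G \<times> UNIV)) (M \<Otimes>\<^sub>M lborel)"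
   proof -
    have "fst : measurable (restrict_space (XB \<Otimes>\<^sub>M lborel) (G \<times> UNIV)) (restrict_space XB G)"
     by (intro measurable_restrict_space2 measurable_restrict_space1 measurable_fst) (auto simp: space_restrict_space)
    hence 1: "fst : measurable (restrict_space (XB \<Otimes>\<^sub>M lborel) (G \<times> UNIV)) M"
     using measurable_cong_sets[OF refl sets_M] by blast
    have 2: "snd : measurable (restrict_space (XB \<Otimes>\<^sub>M lborel) (G \<times> UNIV)) lborel"
     by (intro measurable_restrict_space1 measurable_snd)
    from measurable_Pair[OF 1 2] show ?thesis by simp
   qed
   from measurable_sets[OF this D'(1)] have "(%p. p) -` D Int space (restrict_space (XB \<Otimes>\<^sub>M lborel) (G \<times> UNIV)) : sets (restrict_space (XB \<Otimes>\<^sub>M lborel) (G \<times> UNIV))" .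
   moreover have "(%p. p) -` D Int space (restrict_space (XB \<Otimes>\<^sub>M lborel) (G \<times> UNIV)) = D"
    using DG G_space by (auto simp: space_restrict_space space_pair_measure)
   ultimately show ?thesis by simp
  qed
  hence DX: "D : sets (XB \<Otimes>\<^sub>M lborel)" using G' by (auto simp: sets_restrict_space)
  have e1: "(%p. (snd p, fst (fst p))) : measurable ?W P"
   using measurable_compose[OF measurable_fst measurable_fst] by (intro measurable_Pair measurable_snd)
  have e2: "(%p. e (snd p, fst (fst p))) : measurable ?W XB"
   using measurable_compose[OF e1 pt_measurable[OF zero_F[of 0]]] .
  have e3: "(%p. snd (fst p)) : measurable ?W lborel"
   using measurable_compose[OF measurable_fst measurable_snd] .
  from measurable_sets[OF measurable_Pair[OF e2 e3] DX] show ?thesis unfolding spW vimage_def by simp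
 qed
 let ?S = "%b t. {a. (e (a, b), t) : D}"
 have S: "?S b t : sets PA" for b t
  using sets_Pair1[OF Em, of "(b, t)"] by (simp add: vimage_def)
 have 01: "measure PA (?S b t) = 0 \<or> measure PA (?S b t) = 1" for b t
 proof (rule bern_zero_one[OF S])
  fix a a' assume t: "(a, a') : tail_relation" "a : ?S b t"
  then obtain N where "ALL i>=N. a i = a' i" unfolding tail_iff by (elim exE)
  hence "agree N (a, b) (a', b)" by (simp add: agree_def)
  hence r: "(e (a, b), e (a', b)) : R" using e_tail DG t(2) by blast
  have "rhoX (e (a, b)) (e (a', b)) = 1" by (simp add: rhoX_def bt_e tail_ratio_def)
  thus "a' : ?S b t" using skew_invD[OF D'(2) _ r, of t] t(2) by simp
 qed
 \<comment> \<open>By the zero-one law the sections over \<open>A\<close> have full measure and all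
   others are null.\<close>
 define A where "A = {p. emeasure PA (?S (fst p) (snd p)) ~= 0}"
 have Am: "A : sets (PB \<Otimes>\<^sub>M lborel)"
 proof -
  have "(%p. emeasure PA (Pair p -` ?E)) : borel_measurable (PB \<Otimes>\<^sub>M lborel)"
   by (rule PA.measurable_emeasure_Pair[OF Em])
  hence "(%p. emeasure PA (?S (fst p) (snd p))) : borel_measurable (PB \<Otimes>\<^sub>M lborel)" by (simp add: vimage_def)
  hence "{p\<in>space (PB \<Otimes>\<^sub>M lborel). emeasure PA (?S (fst p) (snd p)) ~= 0} : sets (PB \<Otimes>\<^sub>M lborel)" by measurable
  thus ?thesis by (simp add: A_def space_pair_measure)
 qed
 have Ainv: "skew_relation tail_relation (tail_ratio \<alpha>) `` A \<subseteq> A"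
 proof (rule skew_invI)
  fix b t b' assume A: "(b, t) : A" and bb: "(b, b') : tail_relation"
  obtain N where N: "ALL i>=N. b i = b' i" using bb unfolding tail_iff by (elim exE)
  have sub: "?S b t \<subseteq> ?S b' (t - ln (tail_ratio \<alpha> b b'))"
  proof
   fix a assume a: "a : ?S b t"
   have "agree N (a, b) (a, b')" using N by (simp add: agree_def)
   hence r: "(e (a, b), e (a, b')) : R" using e_tail DG a by blast
   have "rhoX (e (a, b)) (e (a, b')) = tail_ratio \<alpha> b b'" by (simp add: rhoX_def bt_e)
   thus "a : ?S b' (t - ln (tail_ratio \<alpha> b b'))" using skew_invD[OF D'(2) _ r, of t] a by simp
  qed
  have "emeasure PA (?S b t) <= emeasure PA (?S b' (t - ln (tail_ratio \<alpha> b b')))" using sub S by (rule emeasure_mono)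
  thus "(b', t - ln (tail_ratio \<alpha> b b')) : A" using A by (auto simp: A_def)
 qed
 have A: "A : sets SB" using Am Ainv by (simp add: SB_facts)
 let ?A' = "Q -` A Int (G \<times> UNIV)"
 have A': "?A' : sets SM" by (rule Q_pullback[OF A])
 let ?\<Delta> = "(?A' - D) Un (D - ?A')"
 have \<Delta>: "?\<Delta> : sets SM" using A' D by auto
 hence \<Delta>': "?\<Delta> : sets (M \<Otimes>\<^sub>M lborel)" "skew_relation R rhoX `` ?\<Delta> \<subseteq> ?\<Delta>" by (auto simp: SM_facts)
 have "AE w in P. emeasure lborel {t. (e w, t) : ?\<Delta>} = 0"
 proof -
  \<comment> \<open>The set where membership in \<open>A\<close> and in \<open>?E\<close> differ;
    each of its sections in the fair bits is null.\<close>
  let ?F = "{p. ((snd p, fst (fst p)) : UNIV & (fst p : A \<longleftrightarrow> p ~: ?E))}"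
  have Fm: "?F : sets ?W"
  proof -
   have "A \<times> UNIV : sets ?W" using Am sets.top[of PA] by (intro pair_measureI) auto
   moreover have "?F = (A \<times> UNIV - ?E) Un (?E - A \<times> UNIV)" by auto
   ultimately show ?thesis using Em by auto
  qed
  have F0: "emeasure PA {a. (p, a) : ?F} = 0" for p
  proof (cases "p : A")
   case True
   hence "emeasure PA (?S (fst p) (snd p)) ~= 0" by (simp add: A_def)
   hence "measure PA (?S (fst p) (snd p)) = 1" using 01[of "fst p" "snd p"] by (auto simp: PA.emeasure_eq_measure)
   hence "measure PA (space PA - ?S (fst p) (snd p)) = 0" using PA.prob_compl[OF S] by simp
   moreover have "{a. (p, a) : ?F} = space PA - ?S (fst p) (snd p)" using True by auto
   ultimately show ?thesis by (simp add: PA.emeasure_eq_measure)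
  next
   case False
   hence "{a. (p, a) : ?F} = ?S (fst p) (snd p)" by auto
   thus ?thesis using False by (simp add: A_def)
  qed
  let ?H = "{q. ((snd (fst q), snd q), fst (fst q)) : ?F}"
  have hm: "(%q. ((snd (fst q), snd q), fst (fst q))) : measurable (P \<Otimes>\<^sub>M lborel) ?W"
   by (intro measurable_Pair measurable_compose[OF measurable_fst measurable_snd] measurable_compose[OF measurable_fst measurable_fst] measurable_snd)
  have Hm: "?H : sets (P \<Otimes>\<^sub>M lborel)"
   using measurable_sets[OF hm Fm] by (simp add: vimage_def space_pair_measure)
  have "AE w in P. emeasure lborel {t. (w, t) : ?H} = 0"
  proof -
   have Psf: "sigma_finite_measure P" ..
   interpret K: pair_sigma_finite P lborel using Psf by (simp add: pair_sigma_finite_def lborel.sigma_finite_measure_axioms)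
   have "emeasure (P \<Otimes>\<^sub>M lborel) ?H = (\<integral>\<^sup>+t. emeasure P ((%w. (w, t)) -` ?H) \<partial>lborel)"
    by (rule K.emeasure_pair_measure_alt2[OF Hm])
   also have "... = (\<integral>\<^sup>+t. 0 \<partial>(lborel :: real measure))"
   proof (rule nn_integral_cong)
    fix t
    have s: "(%w. (w, t)) -` ?H : sets P" by (rule sets_Pair2[OF Hm])
    have "emeasure PA {a. (a, b) : (%w. (w, t)) -` ?H} = 0" for b using F0[of "(b, t)"] by simp
    thus "emeasure P ((%w. (w, t)) -` ?H) = 0" unfolding P_null_iff[OF s] by simp
   qed
   finally have "?H : null_sets (P \<Otimes>\<^sub>M lborel)" using Hm by (simp add: null_sets_def)
   thus ?thesis using null_by_sections[OF Psf Hm] by simp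
  qed
  thus ?thesis
   using AE_e_G
  proof eventually_elim
   case (elim w)
   have "{t. (e w, t) : ?\<Delta>} = {t. (w, t) : ?H}" using elim(2) by (cases w) (auto simp: Q_def bt_e)
   thus ?case using elim(1) by simp
  qed
 qed
 hence "?\<Delta> : null_sets (M \<Otimes>\<^sub>M lborel)" using SM_null_iff[OF \<Delta>'] by simp
 hence "eq_mod_null SM ?A' D" unfolding eq_mod_null_def using \<Delta>'(2) by (simp add: SM_facts)
 thus ?thesis using A by blast
qed

lemma skew_M_iso: "isomorphic_flows SB shift_flow SM shift_flow"
proof (rule isomorphic_flows_pullback[where q = Q and G = "G \<times> UNIV"])
 have sub: "skew_relation R rhoX `` (G \<times> UNIV) \<subseteq> G \<times> UNIV"
  by (rule skew_invI) (auto simp: orbit_relation_def)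
 show "G \<times> UNIV : sets SM" using sub sets.top[of M] by (auto simp: SM_facts)
 show "space SM - G \<times> UNIV : null_sets SM" by (simp add: SM_facts)
 show "A : sets SB ==> Q -` A Int G \<times> UNIV : sets SM" for A by (rule Q_pullback)
 show "A : sets SB ==> (Q -` A Int G \<times> UNIV : null_sets SM) = (A : null_sets SB)" for A by (rule Q_null_iff)
 show "!!x. x : G \<times> UNIV ==> Q x : space SB" by (simp add: SB_facts)
 show "!!D. D : sets SM ==> EX A:sets SB. eq_mod_null SM (Q -` A Int G \<times> UNIV) D" by (rule Q_surj)
qed (auto simp: Q_def)

lemma SB_flow_ok: "flow_ok SB shift_flow"
 by (rule skew_flow_ok[OF fb.equiv_tail_bern fb.pos_cocycle_tail_ratio fb.sigma_finite_bern])

lemma SM_flow_ok: "flow_ok SM shift_flow"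
 by (rule skew_flow_ok[OF equiv_R_M pos_cocycle_rhoX sigma_finite_M])

lemma associated_flow_M:
 assumes "isomorphic_flows SB shift_flow W V"
 shows "is_associated_flow M R W V"
 unfolding is_associated_flow_def
 using ergodic_nonsingular_relation_R rn_cocycle_rhoX
  isomorphic_flows_trans[OF isomorphic_flows_sym[OF skew_M_iso SB_flow_ok SM_flow_ok] assms SM_flow_ok SB_flow_ok]
 by blast

lemma associated_flow_M_of_tail:
 assumes "is_associated_flow PB tail_relation W V"
 shows "is_associated_flow M R W V"
proof -
 obtain \<rho> where \<rho>: "rn_cocycle PB tail_relation \<rho>"
  "isomorphic_flows (skew_invariant_space PB tail_relation \<rho>) shift_flow W V"
  using assms unfolding is_associated_flow_def by (elim conjE exE)
 have ok: "flow_ok (skew_invariant_space PB tail_relation \<rho>) shift_flow"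
  by (rule skew_flow_ok[OF fb.equiv_tail_bern rn_pos_cocycle[OF \<rho>(1)] fb.sigma_finite_bern])
 show ?thesis
  by (rule associated_flow_M[OF isomorphic_flows_trans[OF fb.skew_tail_cocycles[OF \<rho>(1)] \<rho>(2) SB_flow_ok ok]])
qed

text \<open>Excluding a type requires control over every flow associated with the system, not just
  over one of them.\<close>

lemma associated_flow_M_converse:
 assumes "is_associated_flow M R W V"
 shows "isomorphic_flows SB shift_flow W V"
proof -
 obtain \<rho> where \<rho>: "rn_cocycle M R \<rho>" "isomorphic_flows (skew_invariant_space M R \<rho>) shift_flow W V"
  using assms unfolding is_associated_flow_def by (elim conjE exE)
 have ok: "flow_ok (skew_invariant_space M R \<rho>) shift_flow"
  by (rule skew_flow_ok[OF equiv_R_M rn_pos_cocycle[OF \<rho>(1)] sigma_finite_M])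
 have "isomorphic_flows SM shift_flow W V"
  by (rule isomorphic_flows_trans[OF skew_M_cocycles[OF \<rho>(1)] \<rho>(2) SM_flow_ok ok])
 thus ?thesis by (rule isomorphic_flows_trans[OF skew_M_iso _ SB_flow_ok SM_flow_ok])
qed

end

section \<open>The odometer factor\<close>

lemma integer_coset:
 assumes "subgroup H integer_group" shows "H #>\<^bsub>integer_group\<^esub> z = {v. v - z : H}"
 unfolding r_coset_def
proof (intro equalityI subsetI)
 fix v assume "v : {v. v - z : H}"
 thus "v : (\<Union>h\<in>H. {h \<otimes>\<^bsub>integer_group\<^esub> z})" by (intro UN_I[of "v - z"]) auto
qed auto

lemma integer_subgroupD:
 assumes "subgroup H integer_group"
 shows "0 : H" "x : H ==> y : H ==> x + y : H" "x : H ==> - x : H" "x : H ==> y : H ==> x - y : H"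
proof -
 show 0: "0 : H" using subgroup.one_closed[OF assms] by simp
 show a: "x + y : H" if "x : H" "y : H" for x y using subgroup.m_closed[OF assms that] by simp
 have m: "- x : H" if "x : H" for x
  using subgroup.m_inv_closed[OF assms that] by (simp add: inv_integer_group)
 show "x : H ==> - x : H" by (rule m)
 show "x : H ==> y : H ==> x - y : H" using a[of x "- y"] m[of y] by simp
qed

lemma integer_coset_eq_iff:
 assumes H: "subgroup H integer_group"
 shows "H #>\<^bsub>integer_group\<^esub> z = H #>\<^bsub>integer_group\<^esub> z' \<longleftrightarrow> z - z' : H"
 unfolding integer_coset[OF H]
proof
 assume "{v. v - z : H} = {v. v - z' : H}"
 moreover have "z : {v. v - z : H}" using integer_subgroupD(1)[OF H] by simp
 ultimately have "z : {v. v - z' : H}" by (simp only:)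
 thus "z - z' : H" by simp
next
 assume d: "z - z' : H"
 have "v - z : H \<longleftrightarrow> v - z' : H" for v
  using integer_subgroupD(2)[OF H _ d, of "v - z"] integer_subgroupD(4)[OF H _ d, of "v - z'"] by auto
 thus "{v. v - z : H} = {v. v - z' : H}" by simp
qed

lemma integer_coset_add:
 assumes H: "subgroup H integer_group" and K: "subgroup K integer_group" "K \<subseteq> H"
 shows "(H #>\<^bsub>integer_group\<^esub> g) <#>\<^bsub>integer_group\<^esub> (K #>\<^bsub>integer_group\<^esub> f) = H #>\<^bsub>integer_group\<^esub> (g + f)"
proof (intro equalityI subsetI)
 fix v assume "v : (H #>\<^bsub>integer_group\<^esub> g) <#>\<^bsub>integer_group\<^esub> (K #>\<^bsub>integer_group\<^esub> f)"
 then obtain p q where pq: "v = p + q" "p - g : H" "q - f : K"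
  by (auto simp: set_mult_def integer_coset[OF H] integer_coset[OF K(1)])
 hence "(p - g) + (q - f) : H" using integer_subgroupD(2)[OF H] K(2) by blast
 thus "v : H #>\<^bsub>integer_group\<^esub> (g + f)" using pq(1) by (simp add: integer_coset[OF H] algebra_simps)
next
 fix v assume "v : H #>\<^bsub>integer_group\<^esub> (g + f)"
 hence "v - f : H #>\<^bsub>integer_group\<^esub> g" "f : K #>\<^bsub>integer_group\<^esub> f"
  using integer_subgroupD(1)[OF K(1)] by (simp_all add: integer_coset[OF H] integer_coset[OF K(1)] algebra_simps)
 thus "v : (H #>\<^bsub>integer_group\<^esub> g) <#>\<^bsub>integer_group\<^esub> (K #>\<^bsub>integer_group\<^esub> f)"
  unfolding set_mult_def by (intro UN_I[of "v - f"] UN_I[of f]) simp_all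
qed

lemma odometer_spaceD:
 assumes "y : odometer_space \<Delta>"
 shows "EX z. y n = \<Delta> n #>\<^bsub>integer_group\<^esub> z" "y (Suc n) \<subseteq> y n"
proof -
 have "y n : rcosets\<^bsub>integer_group\<^esub> \<Delta> n" using assms by (simp add: odometer_space_def)
 thus "EX z. y n = \<Delta> n #>\<^bsub>integer_group\<^esub> z" unfolding RCOSETS_def by auto
 show "y (Suc n) \<subseteq> y n" using assms by (simp add: odometer_space_def)
qed

lemma space_odometer_borel: "space (odometer_borel \<Delta>) = odometer_space \<Delta>"
 unfolding odometer_borel_def space_restrict_space space_PiM
 by (auto simp: odometer_space_def PiE_UNIV_domain)

lemma measurable_odometerI:
 assumes sets: "sets N = sets (odometer_borel \<Delta>)"
  and sp: "!!x. x : space M ==> f x : odometer_space \<Delta>"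
  and m: "!!k z. {x\<in>space M. f x k = \<Delta> k #>\<^bsub>integer_group\<^esub> z} : sets M"
 shows "f : measurable M N"
proof -
 have "f : measurable M (odometer_borel \<Delta>)"
  unfolding odometer_borel_def
 proof (rule measurable_restrict_space2)
  show "f : space M \<rightarrow> odometer_space \<Delta>" using sp by simp
  show "f : measurable M (\<Pi>\<^sub>M n\<in>UNIV. count_space (rcosets\<^bsub>integer_group\<^esub> \<Delta> n))"
  proof (rule measurable_PiM_single')
   have r: "f x k : rcosets\<^bsub>integer_group\<^esub> \<Delta> k" if "x : space M" for x k
    using sp[OF that] by (simp add: odometer_space_def)
   thus "f : space M \<rightarrow> (\<Pi>\<^sub>E i\<in>UNIV. space (count_space (rcosets\<^bsub>integer_group\<^esub> \<Delta> i)))"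
    by (auto simp: PiE_UNIV_domain)
   fix k
   have c: "rcosets\<^bsub>integer_group\<^esub> \<Delta> k = range (%z. \<Delta> k #>\<^bsub>integer_group\<^esub> z)" by (auto simp: RCOSETS_def)
   have "countable (rcosets\<^bsub>integer_group\<^esub> \<Delta> k)" unfolding c by simp
   thus "(%x. f x k) : measurable M (count_space (rcosets\<^bsub>integer_group\<^esub> \<Delta> k))"
    unfolding measurable_count_space_eq_countable[OF \<open>countable (rcosets\<^bsub>integer_group\<^esub> \<Delta> k)\<close>]
   proof (intro conjI ballI)
    show "(%x. f x k) : space M \<rightarrow> rcosets\<^bsub>integer_group\<^esub> \<Delta> k" using r by simp
    fix a assume "a : rcosets\<^bsub>integer_group\<^esub> \<Delta> k"
    then obtain z where "a = \<Delta> k #>\<^bsub>integer_group\<^esub> z" unfolding c by (rule rangeE)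
    moreover have "(%x. f x k) -` {a} Int space M = {x\<in>space M. f x k = a}" by auto
    ultimately show "(%x. f x k) -` {a} Int space M : sets M" using m[of k z] by simp
   qed
  qed
 qed
 thus ?thesis by (simp only: measurable_cong_sets[OF refl sets])
qed

lemma odometer_coord_sets:
 assumes sets: "sets N = sets (odometer_borel \<Delta>)"
 shows "{y\<in>odometer_space \<Delta>. y k = a} : sets N"
proof (cases "a : rcosets\<^bsub>integer_group\<^esub> \<Delta> k")
 case True
 have "(%y. y k) : measurable (odometer_borel \<Delta>) (count_space (rcosets\<^bsub>integer_group\<^esub> \<Delta> k))"
  unfolding odometer_borel_def by (intro measurable_restrict_space1 measurable_component_singleton) simp
 from measurable_sets[OF this, of "{a}"] True
 have "(%y. y k) -` {a} Int odometer_space \<Delta> : sets N" by (simp add: sets space_odometer_borel)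
 moreover have "(%y. y k) -` {a} Int odometer_space \<Delta> = {y\<in>odometer_space \<Delta>. y k = a}" by auto
 ultimately show ?thesis by simp
next
 case False
 hence eq: "{y\<in>odometer_space \<Delta>. y k = a} = {}" by (auto simp: odometer_space_def)
 show ?thesis unfolding eq by (rule sets.empty_sets)
qed

locale cf_haar = cf_bern +
 fixes \<nu> :: "(nat => int set) measure"
 assumes haar: "haar_measure \<Gamma> \<nu>"
begin

abbreviation Y :: "(nat => int set) set" where "Y \<equiv> odometer_space \<Gamma>"
abbreviation Od :: "int => (nat => int set) => nat => int set" where "Od \<equiv> odometer_act \<Gamma>"

lemma sets_\<nu>: "sets \<nu> = sets (odometer_borel \<Gamma>)" using haar by (simp add: haar_measure_def)

lemma space_\<nu> [simp]: "space \<nu> = Y"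
 using sets_eq_imp_space_eq[OF sets_\<nu>] by (simp add: space_odometer_borel)

sublocale \<nu>: prob_space \<nu> using haar by (simp add: haar_measure_def)

lemma subgroup_\<Gamma>: "subgroup (\<Gamma> k) integer_group"
proof (rule group.subgroupI[OF group_integer_group])
 show "\<Gamma> k ~= {}" by (simp add: \<Gamma>_eq)
 show "inv\<^bsub>integer_group\<^esub> a : \<Gamma> k" if a: "a : \<Gamma> k" for a
 proof -
  from a obtain z where "a = 2 ^ k * z" unfolding \<Gamma>_eq by (rule rangeE)
  hence "- a = 2 ^ k * (- z)" by simp
  thus ?thesis unfolding inv_integer_group \<Gamma>_eq by (rule range_eqI)
 qed
 show "a \<otimes>\<^bsub>integer_group\<^esub> b : \<Gamma> k" if ab: "a : \<Gamma> k" "b : \<Gamma> k" for a b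
 proof -
  from ab obtain z z' where "a = 2 ^ k * z" "b = 2 ^ k * z'" unfolding \<Gamma>_eq by (elim rangeE)
  hence "a + b = 2 ^ k * (z + z')" by (simp add: algebra_simps)
  thus ?thesis by (auto simp: \<Gamma>_eq)
 qed
qed simp

lemma mem_\<Gamma>: "z : \<Gamma> k \<longleftrightarrow> 2 ^ k dvd z" by (auto simp: \<Gamma>_eq dvd_def)

lemma Y_lift:
 assumes "y : Y" "k <= m" "y m = co m z" shows "y k = co k z"
proof -
 have "y m \<subseteq> y k" using assms(2)
 proof (induction m rule: dec_induct)
  case (step n)
  thus ?case using odometer_spaceD(2)[OF assms(1), of n] by blast
 qed simp
 moreover have "z : y m" using assms(3) by (simp add: co_eq)
 ultimately have "z : y k" by blast
 moreover obtain z' where z': "y k = co k z'" using odometer_spaceD(1)[OF assms(1)] by blast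
 ultimately have "2 ^ k dvd z - z'" by (simp add: co_eq)
 hence "co k z = co k z'" by (simp only: co_eq_iff)
 thus ?thesis using z' by simp
qed

lemma co_nested: "k <= m ==> co m z \<subseteq> co k z"
 unfolding co_eq by (auto intro: dvd_trans[OF le_imp_power_dvd])

lemma int_Y: "(%n. co n g) : Y"
 unfolding odometer_space_def rcosets_\<Gamma> using co_nested by auto

lemma O_eq: assumes "y k = co k z" shows "Od g y k = co k (g + z)"
 using assms by (simp add: odometer_act_def odometer_add_def co_add)

lemma O_Y: assumes "y : Y" shows "Od g y : Y"
proof -
 have "EX z. Od g y k = co k z & y k = co k (z - g)" for k
 proof -
  obtain z where "y k = co k z" using odometer_spaceD(1)[OF assms] by blast
  thus ?thesis using O_eq[of y k z g] by (intro exI[of _ "g + z"]) simp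
 qed
 moreover have "Od g y (Suc k) \<subseteq> Od g y k" for k
 proof -
  obtain z where z: "y (Suc k) = co (Suc k) z" using odometer_spaceD(1)[OF assms] by blast
  hence "y k = co k z" using Y_lift[OF assms, of k "Suc k"] by simp
  thus ?thesis using O_eq[of y "Suc k" z g, OF z] O_eq[of y k z g] co_nested[of k "Suc k"] by simp
 qed
 ultimately show ?thesis unfolding odometer_space_def rcosets_\<Gamma> by blast
qed

lemma O_add: assumes "y : Y" shows "Od (g + g') y = Od g (Od g' y)"
proof
 fix k
 obtain z where z: "y k = co k z" using odometer_spaceD(1)[OF assms] by blast
 show "Od (g + g') y k = Od g (Od g' y) k" using O_eq[of "Od g' y" k "g' + z" g, OF O_eq[of y k z g', OF z]] O_eq[of y k z "g + g'", OF z] by (simp add: add.assoc)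
qed

lemma O_0: assumes "y : Y" shows "Od 0 y = y"
proof
 fix k
 obtain z where z: "y k = co k z" using odometer_spaceD(1)[OF assms] by blast
 show "Od 0 y k = y k" using O_eq[of y k z 0, OF z] z by simp
qed

lemma O_inv: "y : Y ==> Od g (Od (- g) y) = y" "y : Y ==> Od (- g) (Od g y) = y"
 using O_add[of y g "- g"] O_add[of y "- g" g] O_0 by simp_all

lemma coord_sets [measurable]: "{y\<in>Y. y k = a} : sets \<nu>"
 by (rule odometer_coord_sets[OF sets_\<nu>])

lemma O_measurable [measurable]: "Od g : measurable \<nu> \<nu>"
proof (rule measurable_odometerI[OF sets_\<nu>])
 show "Od g y : Y" if "y : space \<nu>" for y using that O_Y by simp
 fix k z
 have "Od g y k = co k z \<longleftrightarrow> y k = co k (z - g)" if "y : Y" for y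
 proof -
  obtain z' where z': "y k = co k z'" using odometer_spaceD(1)[OF \<open>y : Y\<close>] by blast
  have "g + z' - z = z' - (z - g)" by simp
  thus ?thesis unfolding O_eq[of y k z' g, OF z'] z' co_eq_iff by (simp only:)
 qed
 hence "{y\<in>space \<nu>. Od g y k = co k z} = {y\<in>Y. y k = co k (z - g)}" by auto
 thus "{y\<in>space \<nu>. Od g y k = co k z} : sets \<nu>" by simp
qed

lemma \<nu>_O: "distr \<nu> \<nu> (Od g) = \<nu>"
proof -
 have "Od g = odometer_add (%n. co n g)" by (simp add: odometer_act_def fun_eq_iff)
 thus ?thesis using haar int_Y by (simp add: haar_measure_def)
qed

lemma \<nu>_O_emeasure: assumes "A : sets \<nu>" shows "emeasure \<nu> (Od g -` A Int Y) = emeasure \<nu> A"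
 using emeasure_distr[OF O_measurable assms, of g] by (simp add: \<nu>_O)

lemma AE_\<nu>_O:
 assumes "AE y in \<nu>. S y" shows "AE y in \<nu>. S (Od g y)"
proof -
 have "AE y in distr \<nu> \<nu> (Od g). S y" using assms by (simp only: \<nu>_O)
 thus ?thesis by (rule AE_distrD[OF O_measurable])
qed

text \<open>Integer translations permute the \<open>2 ^ k\<close> cosets transitively, so they have
  equal mass.\<close>

lemma measure_\<nu>_coord: "measure \<nu> {y\<in>Y. y k = co k z} = (1 / 2) ^ k"
proof -
 have same: "measure \<nu> {y\<in>Y. y k = co k z} = measure \<nu> {y\<in>Y. y k = co k 0}" for z
 proof -
  have "Od z -` {y\<in>Y. y k = co k z} Int Y = {y\<in>Y. y k = co k 0}"
  proof -
   have "Od z y k = co k z \<longleftrightarrow> y k = co k 0" if "y : Y" for y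
   proof -
    obtain z' where z': "y k = co k z'" using odometer_spaceD(1)[OF \<open>y : Y\<close>] by blast
    show ?thesis unfolding O_eq[of y k z' z, OF z'] z' co_eq_iff by simp
   qed
   thus ?thesis using O_Y by auto
  qed
  thus ?thesis using \<nu>_O_emeasure[OF coord_sets, of z k "co k z"] by (simp add: measure_def)
 qed
 have "Y = (\<Union>z\<in>{0..<2 ^ k}. {y\<in>Y. y k = co k z})"
 proof (intro equalityI subsetI)
  fix y assume y: "y : Y"
  obtain z where z: "y k = co k z" using odometer_spaceD(1)[OF y] by blast
  have "co k z = co k (z mod 2 ^ k)" unfolding co_eq_iff by (simp add: minus_mod_eq_mult_div)
  thus "y : (\<Union>z\<in>{0..<2 ^ k}. {y\<in>Y. y k = co k z})"
   using y z by (intro UN_I[of "z mod 2 ^ k"]) auto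
 qed auto
 hence "measure \<nu> Y = measure \<nu> (\<Union>z\<in>{0..<2 ^ k :: int}. {y\<in>Y. y k = co k z})" by simp
 also have "... = (\<Sum>z\<in>{0..<2 ^ k :: int}. measure \<nu> {y\<in>Y. y k = co k z})"
 proof (rule \<nu>.finite_measure_finite_Union)
  show "disjoint_family_on (%z. {y\<in>Y. y k = co k z}) {0..<2 ^ k :: int}"
   unfolding disjoint_family_on_def
  proof (intro ballI impI)
   fix z z' :: int assume z: "z : {0..<2 ^ k}" "z' : {0..<2 ^ k}" "z ~= z'"
   have "co k z ~= co k z'"
   proof
    assume "co k z = co k z'"
    hence "2 ^ k dvd z - z'" by (simp only: co_eq_iff)
    hence "z mod 2 ^ k = z' mod 2 ^ k" by (simp add: mod_eq_dvd_iff)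
    thus False using z by simp
   qed
   thus "{y\<in>Y. y k = co k z} Int {y\<in>Y. y k = co k z'} = {}" by auto
  qed
 qed (use coord_sets in auto)
 also have "... = (\<Sum>z\<in>{0..<2 ^ k :: int}. measure \<nu> {y\<in>Y. y k = co k 0})" by (intro sum.cong refl same)
 also have "... = 2 ^ k * measure \<nu> {y\<in>Y. y k = co k 0}" by simp
 finally have "1 = 2 ^ k * measure \<nu> {y\<in>Y. y k = co k 0}" using \<nu>.prob_space by simp
 thus ?thesis using same[of z] by (simp add: field_simps power_divide)
qed

subsection \<open>Recovering the fair bits from the odometer point\<close>

text \<open>\<open>2 * h n + 2 ^ (n + 1)\<close> equals \<open>4 ^ (n + 1)\<close>, and
  \<open>h n - 2 ^ n\<close> equals \<open>2 ^ (n + 1) * (2 ^ n - 1)\<close>; so modulo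
  \<open>2 ^ (n + 1)\<close> the digit shows \<open>x\<close> and hides \<open>y\<close>.\<close>

lemma h_mod: "2 ^ Suc n dvd dg n False y" "2 ^ Suc n dvd dg n True y - 2 ^ n" "\<not> 2 ^ Suc n dvd (2 :: int) ^ n"
proof -
 have 1: "(2 :: int) ^ Suc n dvd 2 * h n + 2 ^ (n + 1)"
 proof -
  have "2 * h n + 2 ^ (n + 1) = 2 ^ Suc n * (2 ^ (n + 1))" by (simp add: h_eq algebra_simps)
  thus ?thesis by simp
 qed
 thus d: "2 ^ Suc n dvd dg n False y" by (simp add: dg_def)
 have "h n - 2 ^ n = 2 ^ Suc n * (2 ^ n - 1)" by (simp add: h_eq algebra_simps)
 hence "2 ^ Suc n dvd h n - 2 ^ n" by simp
 hence "2 ^ Suc n dvd (h n - 2 ^ n) + dg n False y" using d by (rule dvd_add)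
 moreover have "(h n - 2 ^ n) + dg n False y = dg n True y - 2 ^ n" by (simp add: dg_def)
 ultimately show "2 ^ Suc n dvd dg n True y - 2 ^ n" by simp
 show "\<not> 2 ^ Suc n dvd (2 :: int) ^ n"
 proof
  assume "2 ^ Suc n dvd (2 :: int) ^ n"
  hence "(2 :: int) ^ Suc n <= 2 ^ n" by (rule zdvd_imp_le) simp
  thus False by simp
 qed
qed

text \<open>The greedy expansion of the odometer point \<open>y\<close> with the bits
  \<open>b\<close> prescribed: the next fair bit is set iff the digit without it misses
  \<open>y\<close> modulo \<open>2 ^ (n + 1)\<close>. The recursion spells out this test, which
  \<open>dig\<close> names afterwards.\<close>

fun digsum :: "(nat => int set) => (nat => bool) => nat => int" where
 "digsum y b 0 = 0"
| "digsum y b (Suc n) = digsum y b n + dg n (y (Suc n) ~= co (Suc n) (digsum y b n + dg n False (b n))) (b n)"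

definition dig :: "(nat => int set) => (nat => bool) => nat => bool" where
 "dig y b n \<longleftrightarrow> y (Suc n) ~= co (Suc n) (digsum y b n + dg n False (b n))"

lemma digsum_dsum: "digsum y b n = dsum 0 n (dig y b, b)"
 by (induction n) (simp_all add: dsum_Suc dig_def)

lemma dig_eq: assumes y: "y : Y" shows "y n = co n (dsum 0 n (dig y b, b))"
proof (induction n)
 case 0
 obtain z where "y 0 = co 0 z" using odometer_spaceD(1)[OF y] by blast
 thus ?case by (simp add: co_eq_iff)
next
 case (Suc n)
 let ?s = "dsum 0 n (dig y b, b)"
 obtain z where z: "y (Suc n) = co (Suc n) z" using odometer_spaceD(1)[OF y] by blast
 hence "y n = co n z" using Y_lift[OF y, of n "Suc n"] by simp
 hence "co n z = co n ?s" using Suc by (simp only:)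
 hence "2 ^ n dvd z - ?s" by (simp only: co_eq_iff)
 then obtain c where c: "z - ?s = 2 ^ n * c" by (elim dvdE)
 show ?case
 proof (cases "dig y b n")
  case False
  have "dsum 0 (Suc n) (dig y b, b) = ?s + dg n (dig y b n) (b n)" by (simp add: dsum_Suc)
  moreover have "y (Suc n) = co (Suc n) (?s + dg n False (b n))" using False by (simp only: dig_def not_not) (simp only: digsum_dsum)
  ultimately show ?thesis using False by simp
 next
  case True
  hence "\<not> 2 ^ Suc n dvd z - (?s + dg n False (b n))" by (simp add: dig_def digsum_dsum z co_eq_iff)
  hence "\<not> 2 ^ Suc n dvd z - ?s" using dvd_diff[OF _ h_mod(1)[of n "b n"], of "z - ?s"] by (auto simp: algebra_simps)
  \<comment> \<open>\<open>y\<close> and the sum so far differ by \<open>2 ^ n * c\<close>. A failed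
    test means that \<open>c\<close> is odd, and the summand \<open>2 ^ n\<close> of the true digit
    repairs this.\<close>
  hence "odd c" unfolding c by (auto simp: mult.commute)
  hence "2 dvd c - 1" by simp
  hence "2 ^ n * 2 dvd 2 ^ n * (c - 1)" by (rule mult_dvd_mono[OF dvd_refl])
  hence "2 ^ Suc n dvd z - ?s - 2 ^ n" unfolding c by (simp add: algebra_simps)
  hence "2 ^ Suc n dvd (z - ?s - 2 ^ n) - (dg n True (b n) - 2 ^ n)" using h_mod(2)[of n "b n"] by (rule dvd_diff)
  hence "2 ^ Suc n dvd z - (?s + dg n True (b n))" by (simp add: algebra_simps)
  thus ?thesis using True by (simp add: z co_eq_iff dsum_Suc)
 qed
qed

text \<open>With \<open>b\<close> prescribed, the sums would differ by \<open>2 ^ i\<close> modulo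
  \<open>2 ^ (i + 1)\<close> at the first index \<open>i\<close> where the fair bits differ.\<close>

lemma dsum_mod_unique:
 "2 ^ n dvd dsum 0 n (a, b) - dsum 0 n (a', b) ==> i < n ==> a i = a' i"
proof (induction n arbitrary: i)
 case (Suc n)
 let ?d = "dsum 0 n (a, b) - dsum 0 n (a', b)" and ?e = "dg n (a n) (b n) - dg n (a' n) (b n)"
 have S: "2 ^ Suc n dvd ?d + ?e" using Suc.prems(1) by (simp add: dsum_Suc algebra_simps)
 hence "2 ^ n dvd ?d + ?e" by (rule dvd_trans[OF le_imp_power_dvd, rotated]) simp
 moreover have "2 ^ n dvd ?e" using dg_dvd[of n n] by (intro dvd_diff) auto
 ultimately have "2 ^ n dvd ?d" using dvd_add_left_iff by blast
 hence IH: "a i = a' i" if "i < n" for i using Suc.IH that by blast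
 hence "?d = 0" using dsum_cong[of 0 n "(a, b)" "(a', b)"] by simp
 hence e: "2 ^ Suc n dvd ?e" using S by (simp only: add_0)
 have "a n = a' n"
 proof (rule ccontr)
  assume "a n ~= a' n"
  hence "?e = dg n True (b n) - dg n False (b n) \<or> ?e = - (dg n True (b n) - dg n False (b n))" by (cases "a n") auto
  hence "2 ^ Suc n dvd dg n True (b n) - dg n False (b n)" using e dvd_minus_iff by metis
  hence "2 ^ Suc n dvd (dg n True (b n) - dg n False (b n)) + dg n False (b n)" using h_mod(1) by (rule dvd_add)
  hence "2 ^ Suc n dvd dg n True (b n)" by simp
  hence "2 ^ Suc n dvd dg n True (b n) - (dg n True (b n) - 2 ^ n)" using h_mod(2) by (rule dvd_diff)
  thus False using h_mod(3)[of n] by simp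
 qed
 thus ?case using IH Suc.prems(2) by (cases "i = n") auto
qed simp

lemma \<pi>_e_dig: assumes y: "y : Y" shows "\<pi> (e (dig y b, b)) = y"
proof
 fix k
 show "\<pi> (e (dig y b, b)) k = y k"
  using \<pi>_pt'[of 0 0 k k "(dig y b, b)"] zero_F dig_eq[OF y, of k b] by simp
qed

text \<open>A joint induction: the partial sum at \<open>n\<close> gives the bit at
  \<open>n\<close>, which gives the partial sum at \<open>n + 1\<close>.\<close>

lemma dig_measurable: "(%(y, b). (dig y b, b)) : measurable (\<nu> \<Otimes>\<^sub>M PB) P"
proof -
 let ?N = "\<nu> \<Otimes>\<^sub>M PB"
 have yk: "{p\<in>space ?N. fst p k = a} : sets ?N" for k a
 proof -
  have "{p\<in>space ?N. fst p k = a} = fst -` {y\<in>Y. y k = a} Int space ?N" by (auto simp: space_pair_measure)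
  thus ?thesis using measurable_sets[OF measurable_fst coord_sets] by metis
 qed
 have bn: "Measurable.pred ?N (%p. snd p n)" for n
  using measurable_compose[OF measurable_snd measurable_bern_component] .
 have d: "Measurable.pred ?N (%p. dig (fst p) (snd p) n)"
  if s: "(%p. real_of_int (digsum (fst p) (snd p) n)) : borel_measurable ?N" for n
 proof -
  have "(%p. real_of_int (digsum (fst p) (snd p) n) + (if snd p n then real_of_int (dg n False True) else real_of_int (dg n False False))) : borel_measurable ?N"
   using s bn by measurable
  moreover have "(%p. real_of_int (digsum (fst p) (snd p) n) + (if snd p n then real_of_int (dg n False True) else real_of_int (dg n False False))) =
    (%p. real_of_int (digsum (fst p) (snd p) n + dg n False (snd p n)))" by (rule ext) auto
  ultimately have m: "(%p. real_of_int (digsum (fst p) (snd p) n + dg n False (snd p n))) : borel_measurable ?N" by (simp only:)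
  have "{p\<in>space ?N. fst p (Suc n) = co (Suc n) z & real_of_int (digsum (fst p) (snd p) n + dg n False (snd p n)) = real_of_int z} : sets ?N" for z
  proof -
   have "{p\<in>space ?N. real_of_int (digsum (fst p) (snd p) n + dg n False (snd p n)) = real_of_int z} : sets ?N" using m by measurable
   hence "{p\<in>space ?N. fst p (Suc n) = co (Suc n) z} Int {p\<in>space ?N. real_of_int (digsum (fst p) (snd p) n + dg n False (snd p n)) = real_of_int z} : sets ?N"
    using yk[of "Suc n" "co (Suc n) z"] by (intro sets.Int)
   moreover have "{p\<in>space ?N. fst p (Suc n) = co (Suc n) z} Int {p\<in>space ?N. real_of_int (digsum (fst p) (snd p) n + dg n False (snd p n)) = real_of_int z} =
    {p\<in>space ?N. fst p (Suc n) = co (Suc n) z & real_of_int (digsum (fst p) (snd p) n + dg n False (snd p n)) = real_of_int z}" by (simp only: Int_def mem_Collect_eq) (iprover intro: Collect_cong)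
   ultimately show ?thesis by (simp only:)
  qed
  hence "{p\<in>space ?N. EX z. fst p (Suc n) = co (Suc n) z & real_of_int (digsum (fst p) (snd p) n + dg n False (snd p n)) = real_of_int z} : sets ?N"
   by (intro sets.sets_Collect_countable_Ex)
  hence "{p\<in>space ?N. \<not> (EX z. fst p (Suc n) = co (Suc n) z & real_of_int (digsum (fst p) (snd p) n + dg n False (snd p n)) = real_of_int z)} : sets ?N"
   by (rule sets.sets_Collect_neg)
  moreover have "dig (fst p) (snd p) n \<longleftrightarrow> \<not> (EX z. fst p (Suc n) = co (Suc n) z & real_of_int (digsum (fst p) (snd p) n + dg n False (snd p n)) = real_of_int z)" for p
   unfolding dig_def of_int_eq_iff by metis
  ultimately show ?thesis unfolding pred_def by (simp only:)
 qed
 have gen: "(%p. f p + (if g p then (if k p then A else B) else (if k p then C else D))) : borel_measurable ?N"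
  if [measurable]: "f : borel_measurable ?N" "Measurable.pred ?N g" "Measurable.pred ?N k" for f g k and A B C D :: real
  by measurable
 have s: "(%p. real_of_int (digsum (fst p) (snd p) n)) : borel_measurable ?N" for n
 proof (induction n)
  case (Suc n)
  have "real_of_int (digsum (fst p) (snd p) (Suc n)) = real_of_int (digsum (fst p) (snd p) n) +
    (if dig (fst p) (snd p) n then (if snd p n then real_of_int (dg n True True) else real_of_int (dg n True False))
    else (if snd p n then real_of_int (dg n False True) else real_of_int (dg n False False)))" for p
   by (simp add: dig_def)
  thus ?case using gen[OF Suc d[OF Suc] bn[of n]] by (simp only:)
 qed simp
 have "(%p. dig (fst p) (snd p)) : measurable ?N PA"
  by (rule measurable_bernI) (rule d[OF s])
 hence "(%p. (dig (fst p) (snd p), snd p)) : measurable ?N P" by (intro measurable_Pair measurable_snd)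
 thus ?thesis by (simp only: split_def)
qed

lemma dig_measurable1: "(%y. dig y b) : measurable \<nu> PA"
proof -
 have "(%y. (%(y, b). (dig y b, b)) (y, b)) : measurable \<nu> P"
  by (rule measurable_compose[OF _ dig_measurable]) simp
 from measurable_compose[OF this measurable_fst] show ?thesis by simp
qed

text \<open>For fixed \<open>b\<close> a cylinder of \<open>n\<close> fair bits corresponds to one
  coset modulo \<open>2 ^ n\<close>; both have mass \<open>(1 / 2) ^ n\<close>. The cylinders and
  the empty set are closed under intersection and generate.\<close>

lemma distr_dig: "distr \<nu> PA (%y. dig y b) = PA"
proof (rule measure_eqI_generator_eq[where \<Omega> = UNIV and E = "insert {} (range (%(n, a). {a'. ALL i<n. a' i = a i}))" and A = "%_. UNIV"])
 let ?E = "insert {} (range (%(n, a). {a'. ALL i<n. a' i = (a :: nat => bool) i}))"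
 have Edep: "EX n. dep n A" if "A : ?E" for A using that by (auto simp: dep_def)
 show "Int_stable ?E"
 proof (rule Int_stableI)
  fix A B assume AB: "A : ?E" "B : ?E"
  show "A Int B : ?E"
  proof (cases "A Int B = {}")
   case False
   then obtain c where c: "c : A" "c : B" by blast
   obtain n a where A: "A = {a'. ALL i<n. a' i = a i}" using AB(1) c(1) by (elim insertE) (simp, elim rangeE, simp split: prod.splits)
   obtain m a' where B: "B = {x. ALL i<m. x i = a' i}" using AB(2) c(2) by (elim insertE) (simp, elim rangeE, simp split: prod.splits)
   have "A Int B = (%(n, a). {a'. ALL i<n. a' i = (a :: nat => bool) i}) (max n m, c)" using c unfolding A B by (auto simp: less_max_iff_disj)
   thus ?thesis by (intro insertI2) (rule image_eqI, assumption, simp)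
  qed simp
 qed
 show "sets PA = sigma_sets UNIV ?E"
 proof (intro equalityI)
  show "sigma_sets UNIV ?E \<subseteq> sets PA"
   using sets.sigma_sets_subset[of ?E PA] Edep dep_sets by auto
  have cyl_range: "{b'. ALL i<n. b' i = b i} : range (%(n, a). {a'. ALL i<n. a' i = (a :: nat => bool) i})" for n b
   by (rule image_eqI[where x = "(n, b)"]) simp_all
  have "A : sigma_sets UNIV ?E" if A: "dep n A" for n A
  proof -
   have "A = \<Union>((%b. {b'. ALL i<n. b' i = b i}) ` A)"
   proof (intro equalityI subsetI)
    fix x assume "x : \<Union>((%b. {b'. ALL i<n. b' i = b i}) ` A)"
    then obtain b where "b : A" "ALL i<n. x i = b i" by (elim UnionE imageE) simp
    thus "x : A" using depD[OF A, of x b] by simp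
   qed auto
   moreover have "countable ((%b. {b'. ALL i<n. b' i = b i}) ` A)"
    using finite_cylinders[of n] by (intro countable_finite) (rule finite_subset[OF image_mono[OF subset_UNIV]])
   hence "\<Union>((%b. {b'. ALL i<n. b' i = b i}) ` A) : sigma_sets UNIV ?E"
    by (rule sigma_sets_UNION) (elim imageE, simp only:, rule sigma_sets.Basic, rule insertI2, rule cyl_range)
   ultimately show ?thesis by simp
  qed
  thus "sets PA \<subseteq> sigma_sets UNIV ?E" unfolding sets_bern_dep by (intro sigma_sets_mono) auto
 qed
 thus "sets (distr \<nu> PA (%y. dig y b)) = sigma_sets UNIV ?E" by simp
 show "emeasure (distr \<nu> PA (%y. dig y b)) A = emeasure PA A" if A: "A : ?E" for A
 proof (cases "A = {}")
  case False
  then obtain n a where Aeq: "A = {a'. ALL i<n. a' i = (a :: nat => bool) i}" using A by auto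
  have As: "A : sets PA" using Edep[OF A] dep_sets by blast
  have "(%y. dig y b) -` A Int Y = {y\<in>Y. y n = co n (dsum 0 n (a, b))}"
  proof (intro equalityI subsetI)
   fix y assume y: "y : (%y. dig y b) -` A Int Y"
   hence "dsum 0 n (dig y b, b) = dsum 0 n (a, b)" by (intro dsum_cong) (simp add: Aeq)
   thus "y : {y\<in>Y. y n = co n (dsum 0 n (a, b))}" using dig_eq[of y n b] y by simp
  next
   fix y assume y: "y : {y\<in>Y. y n = co n (dsum 0 n (a, b))}"
   hence "co n (dsum 0 n (dig y b, b)) = co n (dsum 0 n (a, b))" using dig_eq[of y n b] by simp
   hence "2 ^ n dvd dsum 0 n (dig y b, b) - dsum 0 n (a, b)" by (simp only: co_eq_iff)
   hence "ALL i<n. dig y b i = a i" using dsum_mod_unique by blast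
   thus "y : (%y. dig y b) -` A Int Y" using y by (simp add: Aeq)
  qed
  hence "emeasure (distr \<nu> PA (%y. dig y b)) A = ennreal ((1 / 2) ^ n)"
   using As dig_measurable1 measure_\<nu>_coord by (subst emeasure_distr) (simp_all add: \<nu>.emeasure_eq_measure)
  also have "... = emeasure PA A"
  proof -
   have half_ge: "(0 :: real) <= 1 / 2" by simp
   have "pmf (fair i) x = 1 / 2" for i x by (cases x) (simp_all add: fair_def)
   thus ?thesis unfolding Aeq bern_cylinder by (simp only: prod_constant card_lessThan ennreal_power half_ge)
  qed
  finally show ?thesis .
 qed simp
 show "range (%_. UNIV) \<subseteq> ?E" by (auto intro!: image_eqI[of _ _ "(0, %_. False)"])
 interpret D: prob_space "distr \<nu> PA (%y. dig y b)" using dig_measurable1 by (rule \<nu>.prob_space_distr)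
 show "!!i. emeasure (distr \<nu> PA (%y. dig y b)) UNIV ~= \<infinity>" by simp
qed auto

sublocale \<nu>B: pair_prob_space \<nu> PB ..

text \<open>Fubini over \<open>b\<close>. In the coordinates \<open>(y, b)\<close> the law is a
  product: the odometer point is independent of \<open>b\<close>.\<close>

lemma P_eq_distr: "distr (\<nu> \<Otimes>\<^sub>M PB) P (%(y, b). (dig y b, b)) = P"
proof (rule measure_eqI)
 fix D assume "D : sets (distr (\<nu> \<Otimes>\<^sub>M PB) P (%(y, b). (dig y b, b)))"
 hence D: "D : sets P" by simp
 let ?D = "(%(y, b). (dig y b, b)) -` D Int space (\<nu> \<Otimes>\<^sub>M PB)"
 have m: "?D : sets (\<nu> \<Otimes>\<^sub>M PB)" by (rule measurable_sets[OF dig_measurable D])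
 have "emeasure (distr (\<nu> \<Otimes>\<^sub>M PB) P (%(y, b). (dig y b, b))) D = emeasure (\<nu> \<Otimes>\<^sub>M PB) ?D"
  using dig_measurable D by (rule emeasure_distr)
 also have "... = (\<integral>\<^sup>+b. emeasure \<nu> ((%y. (y, b)) -` ?D) \<partial>PB)" by (rule \<nu>B.emeasure_pair_measure_alt2[OF m])
 also have "... = (\<integral>\<^sup>+b. emeasure PA {a. (a, b) : D} \<partial>PB)"
 proof (rule nn_integral_cong)
  fix b
  have "emeasure PA {a. (a, b) : D} = emeasure (distr \<nu> PA (%y. dig y b)) {a. (a, b) : D}" by (simp only: distr_dig)
  also have "... = emeasure \<nu> ((%y. dig y b) -` {a. (a, b) : D} Int space \<nu>)"
   by (rule emeasure_distr[OF dig_measurable1 P_section_sets(2)[OF D]])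
  also have "(%y. dig y b) -` {a. (a, b) : D} Int space \<nu> = (%y. (y, b)) -` ?D" by (auto simp: space_pair_measure)
  finally show "emeasure \<nu> ((%y. (y, b)) -` ?D) = emeasure PA {a. (a, b) : D}" by simp
 qed
 also have "... = emeasure P D" by (rule P_sections(2)[OF D, symmetric])
 finally show "emeasure (distr (\<nu> \<Otimes>\<^sub>M PB) P (%(y, b). (dig y b, b))) D = emeasure P D" .
qed simp

lemma AE_P_iff:
 assumes "{w. S w} : sets P"
 shows "(AE w in P. S w) \<longleftrightarrow> (AE y in \<nu>. AE b in PB. S (dig y b, b))"
proof -
 have S: "{w\<in>space P. S w} : sets P" using assms by (simp add: space_P)
 have "(AE w in P. S w) \<longleftrightarrow> (AE w in distr (\<nu> \<Otimes>\<^sub>M PB) P (%(y, b). (dig y b, b)). S w)" by (simp only: P_eq_distr)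
 also have "... \<longleftrightarrow> (AE p in \<nu> \<Otimes>\<^sub>M PB. S ((%(y, b). (dig y b, b)) p))" by (rule AE_distr_iff[OF dig_measurable S])
 also have "... \<longleftrightarrow> (AE p in \<nu> \<Otimes>\<^sub>M PB. S (dig (fst p) (snd p), snd p))" by (simp only: split_def)
 also have "... \<longleftrightarrow> (AE y in \<nu>. AE b in PB. S (dig y b, b))"
 proof (rule \<nu>B.AE_pair_iff[symmetric])
  show "{x : space (\<nu> \<Otimes>\<^sub>M PB). S (dig (fst x) (snd x), snd x)} : sets (\<nu> \<Otimes>\<^sub>M PB)"
   using measurable_sets[OF dig_measurable assms] by (simp add: vimage_def split_def Int_def conj_commute)
 qed
 finally show ?thesis .
qed

lemma \<pi>_\<nu> [measurable]: "\<pi> : measurable XB \<nu>"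
 using \<pi>_measurable by (simp only: measurable_cong_sets[OF refl sets_\<nu>])

lemma \<pi>_M [measurable]: "\<pi> : measurable M \<nu>" by (rule M_XB) (rule \<pi>_\<nu>)

lemma law_\<pi>: assumes A: "A : sets \<nu>" shows "(AE w in P. \<pi> (e w) ~: A) \<longleftrightarrow> A : null_sets \<nu>"
proof -
 have "(%w. \<pi> (e w)) : measurable P \<nu>" using measurable_compose[OF pt_measurable[OF zero_F] \<pi>_\<nu>] .
 hence "(%w. \<pi> (e w)) -` (Y - A) Int space P : sets P" by (rule measurable_sets) (use sets.compl_sets[OF A] in simp)
 moreover have "(%w. \<pi> (e w)) -` (Y - A) Int space P = {w. \<pi> (e w) ~: A}"
  using \<pi>_space[OF pt_space[OF zero_F]] by (auto simp: space_P)
 ultimately have m: "{w. \<pi> (e w) ~: A} : sets P" by simp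
 have "(AE w in P. \<pi> (e w) ~: A) \<longleftrightarrow> (AE y in \<nu>. AE b in PB. \<pi> (e (dig y b, b)) ~: A)" by (rule AE_P_iff[OF m])
 also have "... \<longleftrightarrow> (AE y in \<nu>. y ~: A)"
  by (rule AE_cong) (simp add: \<pi>_e_dig PB.AE_const)
 also have "... \<longleftrightarrow> A : null_sets \<nu>" using AE_iff_null_sets[OF A] by simp
 finally show ?thesis .
qed

text \<open>On \<open>X_0\<close> the law of \<pi> is Haar measure; invariance extends the
  comparison of null sets to \<open>G\<close>.\<close>

lemma \<pi>_null_iff:
 assumes A: "A : sets \<nu>" shows "\<pi> -` A Int G : null_sets M \<longleftrightarrow> A : null_sets \<nu>"
proof
 have DA: "\<pi> -` A Int G : sets M" using measurable_sets[OF \<pi>_M A] by simp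
 assume "\<pi> -` A Int G : null_sets M"
 hence "AE x in M. x ~: \<pi> -` A Int G" by (rule AE_not_in)
 hence "AE w in P. e w ~: \<pi> -` A Int G" by (rule AE_M_e)
 hence "AE w in P. \<pi> (e w) ~: A" using AE_e_G by eventually_elim simp
 thus "A : null_sets \<nu>" by (simp only: law_\<pi>[OF A])
next
 assume A0: "A : null_sets \<nu>"
 \<comment> \<open>The saturation of \<open>A\<close> under the odometer. Its preimage is invariant
   under \<open>T\<close>, so that it can be tested on \<open>X_0\<close>.\<close>
 let ?A = "\<Union>g. Od g -` A Int Y"
 have "Od g -` A Int Y : null_sets \<nu>" for g
  using \<nu>_O_emeasure[OF A, of g] A0 measurable_sets[OF O_measurable A, of g] by (intro null_setsI) auto
 hence A': "?A : null_sets \<nu>" by blast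
 hence As: "?A : sets \<nu>" by auto
 let ?D = "\<pi> -` ?A Int G"
 have D: "?D : sets M" using measurable_sets[OF \<pi>_M As] by simp
 have inv: "T g x : ?D" if x: "x : ?D" for x g
 proof -
  have xG: "x : G" using x by simp
  have pY: "\<pi> x : Y" using \<pi>_space xG G_space by blast
  obtain g' where "Od g' (\<pi> x) : A" using x by auto
  hence "Od (g' - g) (Od g (\<pi> x)) : A" using O_add[OF pY, of "g' - g" g] by simp
  hence "Od (g' - g) (\<pi> (T g x)) : A" using \<pi>_T[OF xG] by simp
  moreover have "\<pi> (T g x) : Y" using \<pi>_T[OF xG] O_Y[OF pY] by simp
  ultimately show ?thesis using T_G[OF xG] by auto
 qed
 have "AE w in P. \<pi> (e w) ~: ?A" using law_\<pi>[OF As] A' by blast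
 hence "AE w in P. w ~: {w. e w : ?D}" by eventually_elim (unfold mem_Collect_eq Int_iff vimage_eq, iprover)
 hence "emeasure P {w. e w : ?D} = 0" using AE_iff_null_sets[OF e_vimage[OF D]] by (simp add: null_sets_def)
 hence "?D : null_sets M" using inv_null_iff[OF D inv] by simp
 moreover have "\<pi> -` A Int G \<subseteq> ?D"
 proof
  fix x assume x: "x : \<pi> -` A Int G"
  hence pY: "\<pi> x : Y" using \<pi>_space G_space by blast
  hence "Od 0 (\<pi> x) : A" using x O_0 by simp
  thus "x : ?D" using x pY by blast
 qed
 moreover have "\<pi> -` A Int G : sets M" using measurable_sets[OF \<pi>_M A] by simp
 ultimately show "\<pi> -` A Int G : null_sets M" using null_sets_subset by blast
qed

lemma null_distr_iff:
 assumes "f : measurable N L" "A : sets L"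
 shows "A : null_sets (distr N L f) \<longleftrightarrow> f -` A Int space N : null_sets N"
 using assms measurable_sets[OF assms] by (simp add: null_sets_def emeasure_distr)

lemma equiv_distr_M: "measure_equivalent (distr M \<nu> \<pi>) \<nu>"
proof -
 have "A : null_sets (distr M \<nu> \<pi>) \<longleftrightarrow> A : null_sets \<nu>" for A
 proof (cases "A : sets \<nu>")
  case True
  thus ?thesis using null_distr_iff[OF \<pi>_M True] \<pi>_null_iff[OF True] by simp
 next
  case False
  thus ?thesis by (metis null_setsD2 sets_distr)
 qed
 thus ?thesis unfolding measure_equivalent_def by auto
qed

lemma equiv_distr_\<mu>: "measure_equivalent (distr \<mu> \<nu> \<pi>) \<nu>"
proof -
 have m: "\<pi> : measurable \<mu> \<nu>" using \<pi>_\<nu> by (simp only: measurable_cong_sets[OF sets_\<mu> refl])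
 have "A : null_sets (distr \<mu> \<nu> \<pi>) \<longleftrightarrow> A : null_sets \<nu>" for A
 proof (cases "A : sets \<nu>")
  case True
  have V: "\<pi> -` A Int X : sets XB" using measurable_sets[OF \<pi>_\<nu> True] by simp
  have VG: "\<pi> -` A Int G : sets M" using measurable_sets[OF \<pi>_M True] by simp
  have "emeasure \<mu> (\<pi> -` A Int X) = emeasure \<mu> ((\<pi> -` A Int G) Un (\<pi> -` A Int X Int (X - G)))"
   using G_space by (intro arg_cong[where f = "emeasure \<mu>"]) auto
  also have "... = emeasure \<mu> (\<pi> -` A Int G)"
   using VG V null_set_Int1[OF G_conull, of "\<pi> -` A Int X"] by (intro emeasure_Un_null_set) (auto simp: sets_M_iff)
  also have "... = emeasure M (\<pi> -` A Int G)" using emeasure_M[of "\<pi> -` A Int G"] by simp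
  finally have eq: "emeasure \<mu> (\<pi> -` A Int X) = emeasure M (\<pi> -` A Int G)" .
  have "A : null_sets (distr \<mu> \<nu> \<pi>) \<longleftrightarrow> \<pi> -` A Int X : null_sets \<mu>" using null_distr_iff[OF m True] by simp
  also have "... \<longleftrightarrow> \<pi> -` A Int G : null_sets M" using eq V VG by (simp add: null_sets_def)
  finally show ?thesis using \<pi>_null_iff[OF True] by simp
 next
  case False
  thus ?thesis by (metis null_setsD2 sets_distr)
 qed
 thus ?thesis unfolding measure_equivalent_def by auto
qed

lemma factor_map_\<pi>: "factor_map M T \<nu> Od \<pi>"
 unfolding factor_map_def using equiv_distr_M \<pi>_T by (auto intro!: AE_I2)

lemma nonsingular_odometer_\<nu>: "nonsingular_odometer \<Gamma> \<nu>"
 unfolding nonsingular_odometer_def odometer_seq_def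
proof (intro conjI allI)
 show "subgroup (\<Gamma> n) integer_group" for n by (rule subgroup_\<Gamma>)
 show "finite (rcosets\<^bsub>integer_group\<^esub> \<Gamma> n)" for n
 proof -
  have "range (co n) \<subseteq> co n ` {0..<2 ^ n}"
  proof
   fix a assume "a : range (co n)"
   then obtain z where "a = co n z" by (rule rangeE)
   moreover have "co n z = co n (z mod 2 ^ n)" unfolding co_eq_iff by (simp add: minus_mod_eq_mult_div)
   ultimately show "a : co n ` {0..<2 ^ n}" by (intro image_eqI[of _ _ "z mod 2 ^ n"]) auto
  qed
  thus ?thesis unfolding rcosets_\<Gamma> by (rule finite_subset) simp
 qed
 show "\<Gamma> (Suc n) \<subset> \<Gamma> n" for n
 proof (rule psubsetI)
  show "\<Gamma> (Suc n) \<subseteq> \<Gamma> n" using dvd_trans[OF le_imp_power_dvd[of n "Suc n" "2 :: int"]] by (auto simp: mem_\<Gamma>)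
  have "2 ^ n : \<Gamma> n" "2 ^ n ~: \<Gamma> (Suc n)" using h_mod(3)[of n] by (simp_all add: mem_\<Gamma>)
  thus "\<Gamma> (Suc n) ~= \<Gamma> n" by blast
 qed
 show "(\<Inter>n. \<Gamma> n) = {0}"
 proof (intro equalityI subsetI)
  fix z assume z: "z : (\<Inter>n. \<Gamma> n)"
  have "z = 0"
  proof (rule ccontr)
   assume nz: "z ~= 0"
   have "2 ^ nat \<bar>z\<bar> dvd z" using z by (auto simp: mem_\<Gamma>)
   hence "\<bar>2 ^ nat \<bar>z\<bar>\<bar> <= \<bar>z\<bar>" using nz by (intro dvd_imp_le_int)
   moreover have "nat \<bar>z\<bar> < 2 ^ nat \<bar>z\<bar>" by (rule less_exp)
   hence "\<bar>z\<bar> < 2 ^ nat \<bar>z\<bar>" by (metis abs_ge_zero nat_less_numeral_power_cancel_iff nat_less_iff of_nat_numeral of_nat_power)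
   ultimately show False by simp
  qed
  thus "z : {0}" by simp
 qed (auto simp: mem_\<Gamma>)
 show "sets \<nu> = sets (odometer_borel \<Gamma>)" by (rule sets_\<nu>)
 show "sigma_finite_measure \<nu>" by (rule \<nu>.sigma_finite_measure_axioms)
 show "nonsingular_action \<nu> Od"
  unfolding nonsingular_action_def using O_0 O_add \<nu>_O_emeasure by auto
qed

end

section \<open>Arbitrary odometer factors of the system\<close>

abbreviation ico :: "int set => int => int set" where "ico H z \<equiv> H #>\<^bsub>integer_group\<^esub> z"

lemma AE_cong_iff:
 assumes "AE x in N. S x \<longleftrightarrow> S' x" shows "(AE x in N. S x) \<longleftrightarrow> (AE x in N. S' x)"
proof
 assume "AE x in N. S x"
 with assms show "AE x in N. S' x" by eventually_elim simp
next
 assume "AE x in N. S' x"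
 with assms show "AE x in N. S x" by eventually_elim simp
qed

lemma odometer_act_coset:
 assumes "subgroup (\<Delta> n) integer_group" "y n = ico (\<Delta> n) z"
 shows "odometer_act \<Delta> g y n = ico (\<Delta> n) (g + z)"
 using integer_coset_add[OF assms(1) assms(1), of g z] assms(2) by (simp add: odometer_act_def odometer_add_def)

context cf_haar
begin

text \<open>The flip changes the \<open>i\<close>-th digit by \<open>h i\<close> up to sign, which
  is a move along the orbit by that time.\<close>

lemma e_flip:
 assumes "e (a, b) : G" shows "EX s:{h i, - h i}. e (flip i a, b) = T s (e (a, b))"
proof -
 have l: "e w = pt (Suc i) (dsum 0 (Suc i) w) w" for w using pt_lift[OF zero_F, of 0 "Suc i" w] by simp
 have F: "dsum 0 (Suc i) w : F (Suc i)" for w using dsum_F[OF zero_F, of 0 "Suc i" w] by simp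
 define s where "s = (if a i then - h i else h i)"
 have d: "dsum 0 i (flip i a, b) = dsum 0 i (a, b)" by (rule dsum_cong) (simp add: flip_def)
 have "dsum 0 (Suc i) (flip i a, b) = s + dsum 0 (Suc i) (a, b)"
  by (simp add: dsum_Suc d s_def dg_def) (simp add: flip_def)
 hence "e (flip i a, b) = pt (Suc i) (s + dsum 0 (Suc i) (a, b)) (flip i a, b)" using l[of "(flip i a, b)"] by simp
 also have "... = pt (Suc i) (s + dsum 0 (Suc i) (a, b)) (a, b)"
  using F[of "(flip i a, b)"] \<open>dsum 0 (Suc i) (flip i a, b) = _\<close> by (subst pt_eq_same) (auto simp: agree_def flip_def)
 also have "... = T s (e (a, b))"
  using T_pt[OF F[of "(a, b)"], of s "(a, b)"] F[of "(flip i a, b)"] \<open>dsum 0 (Suc i) (flip i a, b) = _\<close> l[of "(a, b)"] by simp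
 finally show ?thesis by (auto simp: s_def split: if_splits)
qed

lemma space_M_not_null: "G ~: null_sets M"
proof
 assume "G : null_sets M"
 hence "AE x in M. x ~: G" by (rule AE_not_in)
 hence "AE w in P. e w ~: G" by (rule AE_M_e)
 with AE_e_G have "AE w in P. False" by eventually_elim simp
 thus False using P.AE_const by simp
qed

lemma AE_M_const: assumes "AE x in M. S" shows S
proof (rule ccontr)
 assume "\<not> S"
 with assms have "AE x in M. x ~: G" by (auto elim: eventually_mono)
 thus False using space_M_not_null AE_iff_null_sets[of G M] sets.top[of M] by simp
qed

context
 fixes \<Delta> :: "nat => int set" and \<eta> :: "(nat => int set) measure" and q :: "cf_rep set => nat => int set"
 assumes od: "nonsingular_odometer \<Delta> \<eta>" and fm: "factor_map M T \<eta> (odometer_act \<Delta>) q"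
begin

lemma sets_\<eta>: "sets \<eta> = sets (odometer_borel \<Delta>)" using od by (simp add: nonsingular_odometer_def)

lemma space_\<eta>: "space \<eta> = odometer_space \<Delta>"
 using sets_eq_imp_space_eq[OF sets_\<eta>] by (simp add: space_odometer_borel)

lemma subgroup_\<Delta>: "subgroup (\<Delta> n) integer_group" and \<Delta>_Suc: "\<Delta> (Suc n) \<subseteq> \<Delta> n"
 using od by (auto simp: nonsingular_odometer_def odometer_seq_def)

lemma q_measurable [measurable]: "q : measurable M \<eta>" using fm by (simp add: factor_map_def)

lemma q_space: "x : G ==> q x : odometer_space \<Delta>"
 using measurable_space[OF q_measurable] by (simp add: space_\<eta>)

lemma q_coset: assumes "x : G" obtains z where "q x n = ico (\<Delta> n) z"
 using odometer_spaceD(1)[OF q_space[OF assms], of n] by (elim exE)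

lemma q_sets: "{x\<in>G. q x n = a} : sets M"
proof -
 have "{x\<in>G. q x n = a} = q -` {y\<in>odometer_space \<Delta>. y n = a} Int space M" using q_space by auto
 thus ?thesis using measurable_sets[OF q_measurable odometer_coord_sets[OF sets_\<eta>]] by (simp only:)
qed

lemma q_T: "AE x in M. ALL n g z. q x n = ico (\<Delta> n) z --> q (T g x) n = ico (\<Delta> n) (g + z)"
proof -
 have "AE x in M. ALL g. q (T g x) = odometer_act \<Delta> g (q x)" using fm by (simp add: factor_map_def)
 thus ?thesis by eventually_elim (simp add: odometer_act_coset[OF subgroup_\<Delta>])
qed

lemma power_in_\<Delta>: "EX k. 2 ^ k : \<Delta> n"
proof -
 have H: "subgroup (\<Delta> n) integer_group" by (rule subgroup_\<Delta>)
 have "\<not> (\<exists>\<^sub>\<infinity>i. h i ~: \<Delta> n)"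
 proof
  assume inf: "\<exists>\<^sub>\<infinity>i. h i ~: \<Delta> n"
  have "AE w in P. (ALL g z. q (e w) n = ico (\<Delta> n) z --> q (T g (e w)) n = ico (\<Delta> n) (g + z)) & e w : G"
   using AE_M_e[OF q_T] AE_e_G by eventually_elim blast
  \<comment> \<open>One null set serves for all cosets and all times; the flips are then studied
    over those \<open>b\<close> for which the section of \<open>N\<close> is null.\<close>
  then obtain N where N: "{w\<in>space P. \<not> ((ALL g z. q (e w) n = ico (\<Delta> n) z --> q (T g (e w)) n = ico (\<Delta> n) (g + z)) & e w : G)} \<subseteq> N"
   "emeasure P N = 0" "N : sets P" by (rule AE_E)
  have good: "e w : G & (q (e w) n = ico (\<Delta> n) z --> q (T g (e w)) n = ico (\<Delta> n) (g + z))" if "w ~: N" for w g z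
   using N(1) that by (auto simp: space_P)
  have null: "emeasure P {w. e w : {x\<in>G. q x n = ico (\<Delta> n) z}} = 0" for z
  proof -
   let ?D = "{w. e w : {x\<in>G. q x n = ico (\<Delta> n) z}}"
   have D: "?D : sets P" by (rule e_vimage) (rule q_sets)
   have "AE b in PB. emeasure PA {a. (a, b) : N} = 0" using P_null_iff[OF N(3)] N(2) by simp
   hence "AE b in PB. emeasure PA {a. (a, b) : ?D} = 0"
   proof eventually_elim
    case (elim b)
    let ?Db = "{a. (a, b) : ?D}"
    have Db: "?Db : sets PA" by (rule P_section_sets(2)[OF D])
    have "measure PA (?Db Int {a. flip i a : ?Db}) = 0" if i: "h i ~: \<Delta> n" for i
    proof -
     have "?Db Int {a. flip i a : ?Db} \<subseteq> {a. (a, b) : N}"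
     proof
      fix a assume a: "a : ?Db Int {a. flip i a : ?Db}"
      show "a : {a. (a, b) : N}"
      proof (rule ccontr)
       assume "a ~: {a. (a, b) : N}"
       hence w: "(a, b) ~: N" by simp
       have q1: "q (e (a, b)) n = ico (\<Delta> n) z" "q (e (flip i a, b)) n = ico (\<Delta> n) z" using a by simp_all
       obtain s where s: "s : {h i, - h i}" "e (flip i a, b) = T s (e (a, b))"
        using e_flip[of a b i] good[OF w] by blast
       have "ico (\<Delta> n) (s + z) = ico (\<Delta> n) z" using good[OF w, of z s] q1 s(2) by simp
       hence "s : \<Delta> n" using integer_coset_eq_iff[OF H] by simp
       thus False using s(1) i integer_subgroupD(3)[OF H, of "- h i"] by auto
      qed
     qed
     hence "emeasure PA (?Db Int {a. flip i a : ?Db}) <= emeasure PA {a. (a, b) : N}"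
      by (rule emeasure_mono) (rule P_section_sets(2)[OF N(3)])
     thus ?thesis unfolding elim by (simp add: measure_def)
    qed
    hence "measure PA ?Db = 0" using inf by (intro fair_flip_null[OF Db]) (auto elim!: INFM_mono)
    thus ?case by (simp add: PA.emeasure_eq_measure)
   qed
   thus ?thesis using P_null_iff[OF D] by simp
  qed
  have "AE w in P. ALL z. w ~: {w. e w : {x\<in>G. q x n = ico (\<Delta> n) z}}"
   unfolding AE_all_countable using null e_vimage[OF q_sets] by (intro allI AE_not_in null_setsI)
  with AE_e_G have "AE w in P. False"
  proof eventually_elim
   case (elim w)
   obtain z where "q (e w) n = ico (\<Delta> n) z" by (rule q_coset[OF elim(1)])
   thus ?case using elim by simp blast
  qed
  thus False using P.AE_const by simp
 qed
 then obtain N where N: "!!i. i >= N ==> h i : \<Delta> n" by (auto simp: INFM_nat_le)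
 \<comment> \<open>Four times \<open>h N\<close> taken from \<open>h (N + 1)\<close> leaves
   \<open>2 ^ (N + 1)\<close>, the number of spacers.\<close>
 have "h N + h N + (h N + h N) : \<Delta> n" by (intro integer_subgroupD(2)[OF H] N order_refl)
 hence "h (Suc N) - (h N + h N + (h N + h N)) : \<Delta> n" by (intro integer_subgroupD(4)[OF H] N le_SucI order_refl)
 moreover have "h (Suc N) - (h N + h N + (h N + h N)) = 2 ^ (N + 1)" by (simp only: h_Suc)
 ultimately show ?thesis by metis
qed

text \<open>A depth at which the dyadic coset determines the coset modulo
  \<open>\<Delta> n\<close>.\<close>

definition \<Delta>_level :: "nat => nat" where "\<Delta>_level n = (SOME k. 2 ^ k : \<Delta> n)"

lemma \<Gamma>_sub_\<Delta>: assumes "z : \<Gamma> (\<Delta>_level n)" shows "z : \<Delta> n"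
proof -
 have k: "2 ^ \<Delta>_level n : \<Delta> n" unfolding \<Delta>_level_def using power_in_\<Delta> by (rule someI_ex)
 have nat: "int m * 2 ^ \<Delta>_level n : \<Delta> n" for m
  using k integer_subgroupD(1,2)[OF subgroup_\<Delta>[of n]] by (induction m) (simp_all add: algebra_simps)
 obtain c where c: "z = 2 ^ \<Delta>_level n * c" using assms unfolding \<Gamma>_eq by (rule rangeE)
 show ?thesis
 proof (cases "c >= 0")
  case True
  thus ?thesis using nat[of "nat c"] by (simp add: c mult.commute)
 next
  case False
  thus ?thesis using integer_subgroupD(3)[OF subgroup_\<Delta> nat[of "nat (- c)"]] by (simp add: c mult.commute)
 qed
qed

lemma ico_level:
 assumes "co (\<Delta>_level n) z = co (\<Delta>_level n) z'" shows "ico (\<Delta> n) (j + z) = ico (\<Delta> n) (j + z')"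
proof -
 have "z - z' : \<Gamma> (\<Delta>_level n)" using assms by (simp only: co_eq_iff mem_\<Gamma>)
 hence "(j + z) - (j + z') : \<Delta> n" using \<Gamma>_sub_\<Delta> by simp
 thus ?thesis by (simp only: integer_coset_eq_iff[OF subgroup_\<Delta>])
qed

text \<open>The difference between \<open>q\<close> and the dyadic point, read modulo
  \<open>\<Delta> n\<close>, does not change along orbits; ergodicity makes it constant.\<close>

lemma q_translate:
 "EX j. AE x in M. ALL z. \<pi> x (\<Delta>_level n) = co (\<Delta>_level n) z --> q x n = ico (\<Delta> n) (j + z)"
proof -
 let ?K = "\<Delta>_level n"
 \<comment> \<open>All times \<open>g\<close> are required at once, which makes \<open>A j\<close>
   invariant everywhere and not merely almost everywhere.\<close>
 define A where "A j = {x\<in>G. ALL g. EX z. \<pi> x ?K = co ?K z & q (T g x) n = ico (\<Delta> n) (g + j + z)}" for j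
 have \<pi>co: "EX z. \<pi> x ?K = co ?K z" if "x : G" for x
  using odometer_spaceD(1)[of "\<pi> x" \<Gamma> ?K] \<pi>_space that G_space by blast
 have \<pi>s: "{x\<in>G. \<pi> x k = a} : sets M" for k a
 proof -
  have "{x\<in>G. \<pi> x k = a} = \<pi> -` {y\<in>Y. y k = a} Int space M" using \<pi>_space G_space by auto
  thus ?thesis using measurable_sets[OF \<pi>_M coord_sets] by (simp only:)
 qed
 have As: "A j : sets M" for j
 proof -
  have "{x\<in>space M. \<pi> x ?K = co ?K z & q (T g x) n = ico (\<Delta> n) (g + j + z)} : sets M" for g z
  proof -
   have "{x\<in>space M. \<pi> x ?K = co ?K z & q (T g x) n = ico (\<Delta> n) (g + j + z)} =
    {x\<in>G. \<pi> x ?K = co ?K z} Int (T g -` {x\<in>G. q x n = ico (\<Delta> n) (g + j + z)} Int space M)" using T_G by auto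
   thus ?thesis using \<pi>s measurable_sets[OF T_measurable_M q_sets] by simp
  qed
  hence "{x\<in>space M. ALL g. EX z. \<pi> x ?K = co ?K z & q (T g x) n = ico (\<Delta> n) (g + j + z)} : sets M"
   by (intro sets.sets_Collect_countable_All sets.sets_Collect_countable_Ex)
  thus ?thesis by (simp add: A_def)
 qed
 have inv: "T g x : A j" if x: "x : A j" for x g j
 proof -
  have xG: "x : G" using x by (simp add: A_def)
  have "EX z. \<pi> (T g x) ?K = co ?K z & q (T g' (T g x)) n = ico (\<Delta> n) (g' + j + z)" for g'
  proof -
   obtain z where z: "\<pi> x ?K = co ?K z" "q (T (g' + g) x) n = ico (\<Delta> n) (g' + g + j + z)"
    using x unfolding A_def by blast
   have "\<pi> (T g x) ?K = co ?K (g + z)" unfolding \<pi>_T[OF xG] by (rule O_eq) (rule z(1))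
   moreover have "q (T g' (T g x)) n = ico (\<Delta> n) (g' + j + (g + z))"
    using z(2) T_add[OF xG, of g' g] by (simp add: algebra_simps)
   ultimately show ?thesis by blast
  qed
  thus ?thesis using T_G[OF xG] by (simp add: A_def)
 qed
 have "EX j. A j ~: null_sets M"
 proof (rule ccontr)
  assume "\<nexists>j. A j ~: null_sets M"
  hence "AE x in M. ALL j. x ~: A j" unfolding AE_all_countable by (intro allI AE_not_in) blast
  with q_T have "AE x in M. x ~: G"
  proof eventually_elim
   case (elim x)
   show "x ~: G"
   proof
    assume xG: "x : G"
    obtain c where c: "q x n = ico (\<Delta> n) c" by (rule q_coset[OF xG])
    obtain z where z: "\<pi> x ?K = co ?K z" using \<pi>co[OF xG] by blast
    have "q (T g x) n = ico (\<Delta> n) (g + (c - z) + z)" for g using elim(1) c by simp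
    hence "x : A (c - z)" using xG z unfolding A_def by blast
    thus False using elim(2) by blast
   qed
  qed
  thus False using space_M_not_null AE_iff_null_sets[of G M] sets.top[of M] by simp
 qed
 then obtain j where "A j ~: null_sets M" ..
 hence "emeasure M (A j) ~= 0" using As by (simp add: null_sets_def)
 hence "emeasure M (G - A j) = 0" using ergodic_M[OF As inv, of j] by blast
 moreover have "G - A j : sets M" using sets.compl_sets[OF As, of j] by simp
 ultimately have "G - A j : null_sets M" by (rule null_setsI)
 hence "AE x in M. x ~: G - A j" by (rule AE_not_in)
 hence "AE x in M. x : A j" using AE_space by eventually_elim simp
 hence "AE x in M. ALL z. \<pi> x ?K = co ?K z --> q x n = ico (\<Delta> n) (j + z)"
 proof eventually_elim
  case (elim x)
  hence xG: "x : G" by (simp add: A_def)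
  obtain z' where z': "\<pi> x ?K = co ?K z'" "q (T 0 x) n = ico (\<Delta> n) (0 + j + z')" using elim unfolding A_def by blast
  have "q x n = ico (\<Delta> n) (j + z)" if z: "\<pi> x ?K = co ?K z" for z
  proof -
   have "co ?K z' = co ?K z" using z z'(1) by (simp only:)
   hence "ico (\<Delta> n) (j + z') = ico (\<Delta> n) (j + z)" by (rule ico_level)
   thus ?thesis using z'(2) T_0[OF xG] by simp
  qed
  thus ?case by blast
 qed
 thus ?thesis by blast
qed

text \<open>\<open>r\<close> reads the dyadic point, moved by the constants of
  \<open>q_translate\<close>, modulo each \<open>\<Delta> n\<close>. It is given at every point of
  the odometer and needs no exceptional set there.\<close>

lemma factor_through:
 obtains r where "r : measurable \<nu> \<eta>" "AE x in M. q x = r (\<pi> x)" "factor_map \<nu> Od \<eta> (odometer_act \<Delta>) r"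
proof -
 have "ALL n. EX j. AE x in M. ALL z. \<pi> x (\<Delta>_level n) = co (\<Delta>_level n) z --> q x n = ico (\<Delta> n) (j + z)"
  using q_translate by (rule allI)
 from choice[OF this] obtain j where j: "ALL n. AE x in M. ALL z. \<pi> x (\<Delta>_level n) = co (\<Delta>_level n) z --> q x n = ico (\<Delta> n) (j n + z)"
  by (elim exE)
 hence AEj: "AE x in M. ALL n. ALL z. \<pi> x (\<Delta>_level n) = co (\<Delta>_level n) z --> q x n = ico (\<Delta> n) (j n + z)"
  by (subst AE_all_countable)
 define r where "r y n = ico (\<Delta> n) (j n + (SOME z. y (\<Delta>_level n) = co (\<Delta>_level n) z))" for y n
 have r: "r y n = ico (\<Delta> n) (j n + z)" if z: "y (\<Delta>_level n) = co (\<Delta>_level n) z" for y n z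
 proof -
  have "y (\<Delta>_level n) = co (\<Delta>_level n) (SOME z. y (\<Delta>_level n) = co (\<Delta>_level n) z)" using z by (rule someI)
  hence "co (\<Delta>_level n) (SOME z. y (\<Delta>_level n) = co (\<Delta>_level n) z) = co (\<Delta>_level n) z" using z by (simp only:)
  thus ?thesis unfolding r_def by (rule ico_level)
 qed
 have AEr: "AE x in M. q x = r (\<pi> x)"
  using AEj AE_space
 proof eventually_elim
  case (elim x)
  have pY: "\<pi> x : Y" using \<pi>_space elim(2) G_space by auto
  show ?case
  proof
   fix n
   obtain z where z: "\<pi> x (\<Delta>_level n) = co (\<Delta>_level n) z" using odometer_spaceD(1)[OF pY] by blast
   thus "q x n = r (\<pi> x) n" using r[of "\<pi> x", OF z] elim(1) by simp
  qed
 qed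
 \<comment> \<open>Compatibility of the constants does not involve \<open>x\<close>, so one good
   point proves it.\<close>
 have js: "j (Suc n) - j n : \<Delta> n" for n
 proof -
  have "AE x in M. j (Suc n) - j n : \<Delta> n"
   using AEj AE_space
  proof eventually_elim
   case (elim x)
   have pY: "\<pi> x : Y" using \<pi>_space elim(2) G_space by auto
   let ?k = "max (\<Delta>_level n) (\<Delta>_level (Suc n))"
   obtain z where "\<pi> x ?k = co ?k z" using odometer_spaceD(1)[OF pY] by blast
   hence z: "\<pi> x (\<Delta>_level n) = co (\<Delta>_level n) z" "\<pi> x (\<Delta>_level (Suc n)) = co (\<Delta>_level (Suc n)) z"
    using Y_lift[OF pY, of _ ?k z] by simp_all
   have qz: "q x n = ico (\<Delta> n) (j n + z)" "q x (Suc n) = ico (\<Delta> (Suc n)) (j (Suc n) + z)" using elim(1) z by simp_all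
   have "q x (Suc n) \<subseteq> q x n" using odometer_spaceD(2)[OF q_space] elim(2) by simp
   moreover have "j (Suc n) + z : q x (Suc n)"
    using integer_subgroupD(1)[OF subgroup_\<Delta>[of "Suc n"]] by (simp add: qz(2) integer_coset[OF subgroup_\<Delta>])
   ultimately have "j (Suc n) + z : q x n" by blast
   thus ?case by (simp add: qz(1) integer_coset[OF subgroup_\<Delta>])
  qed
  thus ?thesis by (rule AE_M_const)
 qed
 have rsp: "r y : odometer_space \<Delta>" if y: "y : Y" for y
 proof -
  have "r y (Suc n) \<subseteq> r y n" for n
  proof -
   let ?k = "max (\<Delta>_level n) (\<Delta>_level (Suc n))"
   obtain z where "y ?k = co ?k z" using odometer_spaceD(1)[OF y] by blast
   hence z: "y (\<Delta>_level n) = co (\<Delta>_level n) z" "y (\<Delta>_level (Suc n)) = co (\<Delta>_level (Suc n)) z"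
    using Y_lift[OF y, of _ ?k z] by simp_all
   show ?thesis unfolding r[of y, OF z(1)] r[of y, OF z(2)] integer_coset[OF subgroup_\<Delta>]
   proof
    fix v assume "v : {v. v - (j (Suc n) + z) : \<Delta> (Suc n)}"
    hence "v - (j (Suc n) + z) : \<Delta> n" using \<Delta>_Suc by blast
    from integer_subgroupD(2)[OF subgroup_\<Delta> this js] show "v : {v. v - (j n + z) : \<Delta> n}" by (simp add: algebra_simps)
   qed
  qed
  moreover have "r y n : rcosets\<^bsub>integer_group\<^esub> (\<Delta> n)" for n unfolding r_def RCOSETS_def by auto
  ultimately show ?thesis by (simp add: odometer_space_def)
 qed
 have rm: "r : measurable \<nu> \<eta>"
 proof (rule measurable_odometerI[OF sets_\<eta>])
  show "r y : odometer_space \<Delta>" if "y : space \<nu>" for y using rsp that by simp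
  fix k z
  have "{y\<in>space \<nu>. r y k = ico (\<Delta> k) z} = (\<Union>z'\<in>{z'. ico (\<Delta> k) (j k + z') = ico (\<Delta> k) z}. {y\<in>Y. y (\<Delta>_level k) = co (\<Delta>_level k) z'})"
   (is "?L = ?R")
  proof (intro equalityI subsetI)
   fix y assume y: "y : ?L"
   then obtain z' where z': "y (\<Delta>_level k) = co (\<Delta>_level k) z'" using odometer_spaceD(1)[of y \<Gamma> "\<Delta>_level k"] by auto
   thus "y : ?R" using y r[of y, OF z'] by (intro UN_I[of z']) simp_all
  next
   fix y assume "y : ?R"
   thus "y : ?L" using r[of y k] by auto
  qed
  moreover have "?R : sets \<nu>" using coord_sets by (intro sets.countable_UN') auto
  ultimately show "?L : sets \<nu>" by (simp only:)
 qed
 have "factor_map \<nu> Od \<eta> (odometer_act \<Delta>) r"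
  unfolding factor_map_def
 proof (intro conjI rm)
  have "r (Od g y) = odometer_act \<Delta> g (r y)" if y: "y : Y" for g y
  proof
   fix n
   obtain z where z: "y (\<Delta>_level n) = co (\<Delta>_level n) z" using odometer_spaceD(1)[OF y] by blast
   have "r (Od g y) n = ico (\<Delta> n) (j n + (g + z))" by (rule r) (rule O_eq[of y, OF z])
   also have "... = odometer_act \<Delta> g (r y) n"
    using odometer_act_coset[where \<Delta> = \<Delta> and n = n and y = "r y" and z = "j n + z" and g = g, OF subgroup_\<Delta>[of n]] r[of y, OF z] by (simp add: algebra_simps)
   finally show "r (Od g y) n = odometer_act \<Delta> g (r y) n" .
  qed
  thus "AE y in \<nu>. ALL g. r (Od g y) = odometer_act \<Delta> g (r y)" by (intro AE_I2) simp
  have "null_sets (distr \<nu> \<eta> r) = null_sets \<eta>"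
  proof (rule Set.set_eqI)
   fix A
   have "A : null_sets (distr \<nu> \<eta> r) \<longleftrightarrow> A : null_sets \<eta>" if A: "A : sets \<eta>"
   proof -
    have ra: "r -` A Int Y : sets \<nu>" using measurable_sets[OF rm A] by simp
    have "A : null_sets (distr \<nu> \<eta> r) \<longleftrightarrow> r -` A Int Y : null_sets \<nu>" using null_distr_iff[OF rm A] by simp
    also have "... \<longleftrightarrow> \<pi> -` (r -` A Int Y) Int G : null_sets M" using \<pi>_null_iff[OF ra] by simp
    also have "... \<longleftrightarrow> (AE x in M. x ~: \<pi> -` (r -` A Int Y) Int G)"
     by (rule AE_iff_null_sets) (rule measurable_sets[OF \<pi>_M ra, unfolded space_M])
    also have "... \<longleftrightarrow> (AE x in M. x ~: q -` A Int G)"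
    proof -
     have "AE x in M. (x ~: \<pi> -` (r -` A Int Y) Int G) \<longleftrightarrow> (x ~: q -` A Int G)"
      using AEr AE_space
     proof eventually_elim
      case (elim x)
      have "\<pi> x : Y" using \<pi>_space elim(2) G_space by auto
      thus ?case using elim(1) by simp
     qed
     thus ?thesis by (rule AE_cong_iff)
    qed
    also have "... \<longleftrightarrow> q -` A Int G : null_sets M" by (rule AE_iff_null_sets[symmetric]) (rule measurable_sets[OF q_measurable A, unfolded space_M])
    also have "... \<longleftrightarrow> A : null_sets (distr M \<eta> q)" using null_distr_iff[OF q_measurable A] by simp
    also have "... \<longleftrightarrow> A : null_sets \<eta>" using fm by (simp add: factor_map_def measure_equivalent_def)
    finally show ?thesis .
   qed
   thus "A : null_sets (distr \<nu> \<eta> r) \<longleftrightarrow> A : null_sets \<eta>" by (auto simp: null_sets_def)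
  qed
  thus "measure_equivalent (distr \<nu> \<eta> r) \<eta>" by (simp add: measure_equivalent_def)
 qed
 with rm AEr show ?thesis by (rule that)
qed

end

lemma maximal_\<nu>: "maximal_odometer_factor M T \<Gamma> \<nu>"
 unfolding maximal_odometer_factor_def
proof (intro conjI allI impI)
 show "nonsingular_odometer \<Gamma> \<nu>" by (rule nonsingular_odometer_\<nu>)
 show "is_factor M T \<nu> Od" using factor_map_\<pi> by (auto simp: is_factor_def)
 fix \<Delta> \<eta> assume od: "nonsingular_odometer \<Delta> \<eta>" and "is_factor M T \<eta> (odometer_act \<Delta>)"
 then obtain q where q: "factor_map M T \<eta> (odometer_act \<Delta>) q" by (auto simp: is_factor_def)
 obtain r where "factor_map \<nu> Od \<eta> (odometer_act \<Delta>) r" by (rule factor_through[OF od q])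
 thus "is_factor \<nu> Od \<eta> (odometer_act \<Delta>)" by (auto simp: is_factor_def)
qed

end

section \<open>The fibres of the odometer map\<close>

context cf_haar
begin

text \<open>A law of full support on the times, here a geometric law along an enumeration of the
  integers. It spreads the probability on \<open>X_0\<close> over whole orbits.\<close>

definition wt :: "int pmf" where "wt = map_pmf from_nat (geometric_pmf (1 / 2))"

lemma set_wt: "set_pmf wt = UNIV"
 by (simp add: wt_def set_pmf_geometric surj_from_nat)

text \<open>Corrects \<open>e\<close> on the null set where it leaves \<open>G\<close>, so that it
  takes values in the space of \<open>M\<close> everywhere.\<close>

definition e' :: "bits => cf_rep set" where "e' w = (if e w : G then e w else (SOME x. x : G))"

lemma e'_G: "e' w : G"
proof -
 have "EX x. x : G"
 proof (rule ccontr)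
  assume "\<not> (EX x. x : G)"
  hence "G : null_sets M" by (auto simp: ex_in_conv)
  thus False using space_M_not_null by blast
 qed
 thus ?thesis using someI_ex[of "%x. x : G"] by (simp add: e'_def)
qed

lemma e'_measurable: "e' : measurable P M"
proof (rule measurableI)
 show "e' w : space M" for w using e'_G by simp
 fix A assume A: "A : sets M"
 have "e' -` A Int space P = {w. e w : A} Un (if (SOME x. x : G) : A then space P - {w. e w : G} else {})"
  using sets.sets_into_space[OF A] by (auto simp: e'_def space_P split: if_splits)
 moreover have "{w. e w : G} : sets P" using e_vimage sets.top[of M] by simp
 ultimately show "e' -` A Int space P : sets P" using e_vimage[OF A] by auto
qed

text \<open>The fibre of \<open>\<pi>\<close> over \<open>y\<close> is parametrized by the bits \<open>b\<close> of a point of the base together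
 with the time \<open>g\<close> at which it is reached.\<close>

definition fib :: "(nat => int set) => int \<times> (nat => bool) => cf_rep set" where
 "fib y gb = T (fst gb) (e' (dig (Od (- fst gb) y) (snd gb), snd gb))"

abbreviation WB :: "(int \<times> (nat => bool)) measure" where "WB \<equiv> measure_pmf wt \<Otimes>\<^sub>M PB"

sublocale WB: prob_space WB
proof -
 interpret W: pair_prob_space "measure_pmf wt" PB ..
 show "prob_space WB" by (rule W.prob_space_axioms)
qed

sublocale \<nu>W: pair_prob_space \<nu> WB ..

lemma fib_measurable: "(%(y, gb). fib y gb) : measurable (\<nu> \<Otimes>\<^sub>M WB) M"
proof -
 have "(%p. T g (e' (dig (Od (- g) (fst p)) (snd (snd p)), snd (snd p)))) : measurable (\<nu> \<Otimes>\<^sub>M WB) M" for g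
 proof -
  have "(%p. (Od (- g) (fst p), snd (snd p))) : measurable (\<nu> \<Otimes>\<^sub>M WB) (\<nu> \<Otimes>\<^sub>M PB)"
   by (intro measurable_Pair measurable_compose[OF measurable_fst O_measurable] measurable_compose[OF measurable_snd measurable_snd])
  from measurable_compose[OF this dig_measurable]
  have "(%p. (dig (Od (- g) (fst p)) (snd (snd p)), snd (snd p))) : measurable (\<nu> \<Otimes>\<^sub>M WB) P" by (simp only: split_def fst_conv snd_conv)
  from measurable_compose[OF measurable_compose[OF this e'_measurable] T_measurable_M] show ?thesis .
 qed
 moreover have "(%p. fst (snd p)) : measurable (\<nu> \<Otimes>\<^sub>M WB) (count_space UNIV)"
  using measurable_compose[OF measurable_snd measurable_fst, of \<nu> "measure_pmf wt" PB] by (simp only: measurable_pmf_measure2)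
 ultimately have "(%p. T (fst (snd p)) (e' (dig (Od (- fst (snd p)) (fst p)) (snd (snd p)), snd (snd p)))) : measurable (\<nu> \<Otimes>\<^sub>M WB) M"
  by (rule measurable_compose_countable)
 thus ?thesis by (simp only: fib_def split_def)
qed

lemma fib_measurable1: "y : Y ==> fib y : measurable WB M"
 using measurable_compose[OF measurable_Pair1' fib_measurable, of y] by simp

text \<open>The probability in the class of \<open>M\<close> that is disintegrated;
  \<open>Kf y\<close> becomes its conditional measure over \<open>y\<close>.\<close>

definition Pm :: "cf_rep set measure" where "Pm = distr (\<nu> \<Otimes>\<^sub>M WB) M (%(y, gb). fib y gb)"
definition Kf :: "(nat => int set) => cf_rep set measure" where "Kf y = distr WB M (fib y)"

lemma sets_Pm [simp]: "sets Pm = sets M" and space_Pm [simp]: "space Pm = G" by (simp_all add: Pm_def)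
lemma sets_Kf [simp]: "sets (Kf y) = sets M" and space_Kf [simp]: "space (Kf y) = G" by (simp_all add: Kf_def)

lemma prob_Pm: "prob_space Pm" unfolding Pm_def by (rule \<nu>W.prob_space_distr[OF fib_measurable])

lemma fib_sets:
 assumes y: "y : Y" and A: "A : sets M" shows "{b. fib y (g, b) : A} : sets PB"
proof -
 have "(%b. fib y (g, b)) : measurable PB M"
  by (rule measurable_compose[OF measurable_Pair1' fib_measurable1[OF y]]) simp
 from measurable_sets[OF this A] show ?thesis by (simp add: vimage_def)
qed

lemma Kf_null_iff:
 assumes y: "y : Y" and A: "A : sets M"
 shows "emeasure (Kf y) A = 0 \<longleftrightarrow> (ALL g. emeasure PB {b. fib y (g, b) : A} = 0)"
proof -
 let ?X = "fib y -` A Int space WB"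
 have X: "?X : sets WB" by (rule measurable_sets[OF fib_measurable1[OF y] A])
 have "Pair g -` ?X = {b. fib y (g, b) : A}" for g by (auto simp: space_pair_measure)
 hence "emeasure (Kf y) A = (\<integral>\<^sup>+g. emeasure PB {b. fib y (g, b) : A} \<partial>measure_pmf wt)"
  unfolding Kf_def emeasure_distr[OF fib_measurable1[OF y] A] PB.emeasure_pair_measure_alt[OF X] by simp
 thus ?thesis by (simp add: nn_integral_0_iff_AE AE_measure_pmf_iff set_wt)
qed

lemma emeasure_Pm:
 assumes A: "A : sets M" shows "emeasure Pm A = (\<integral>\<^sup>+y. emeasure (Kf y) A \<partial>\<nu>)"
  and "(%y. emeasure (Kf y) A) : borel_measurable \<nu>"
proof -
 let ?X = "(%(y, gb). fib y gb) -` A Int space (\<nu> \<Otimes>\<^sub>M WB)"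
 have X: "?X : sets (\<nu> \<Otimes>\<^sub>M WB)" by (rule measurable_sets[OF fib_measurable A])
 have s: "emeasure WB (Pair y -` ?X) = emeasure (Kf y) A" if "y : space \<nu>" for y
 proof -
  have "Pair y -` ?X = fib y -` A Int space WB" using that by (auto simp: space_pair_measure)
  thus ?thesis using emeasure_distr[OF fib_measurable1 A, of y] that by (simp add: Kf_def)
 qed
 show "emeasure Pm A = (\<integral>\<^sup>+y. emeasure (Kf y) A \<partial>\<nu>)"
  unfolding Pm_def emeasure_distr[OF fib_measurable A] WB.emeasure_pair_measure_alt[OF X]
  by (rule nn_integral_cong) (rule s)
 show "(%y. emeasure (Kf y) A) : borel_measurable \<nu>"
  using WB.measurable_emeasure_Pair[OF X] by (rule measurable_cong[THEN iffD1, rotated]) (rule s)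
qed

lemma Pm_null_iff:
 assumes A: "A : sets M" shows "emeasure Pm A = 0 \<longleftrightarrow> (AE y in \<nu>. emeasure (Kf y) A = 0)"
 unfolding emeasure_Pm(1)[OF A] by (rule nn_integral_0_iff_AE) (rule emeasure_Pm(2)[OF A])

text \<open>One conull condition on \<open>y\<close>, translated by countably many times; invariance
  of \<nu> keeps the translates conull.\<close>

lemma AE_good: "AE y in \<nu>. ALL g. AE b in PB. e (dig (Od (- g) y) b, b) : G"
proof -
 have "{w. e w : G} : sets P" using e_vimage sets.top[of M] by simp
 hence "AE y in \<nu>. AE b in PB. e (dig y b, b) : G" using AE_P_iff[of "%w. e w : G"] AE_e_G by simp
 thus ?thesis unfolding AE_all_countable by (intro allI AE_\<nu>_O)
qed

lemma fib_good: "e (dig (Od (- g) y) b, b) : G ==> fib y (g, b) = T g (e (dig (Od (- g) y) b, b))"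
 by (simp add: fib_def e'_def)

text \<open>The time \<open>g\<close> in \<open>fib\<close> undoes the shift of the odometer point
  by \<open>- g\<close>.\<close>

lemma \<pi>_fib: assumes "y : Y" "e (dig (Od (- g) y) b, b) : G" shows "\<pi> (fib y (g, b)) = y"
 using \<pi>_T[OF assms(2), of g] \<pi>_e_dig[OF O_Y[OF assms(1), of "- g"], of b] O_inv(1)[OF assms(1)] fib_good[OF assms(2)] by simp

text \<open>Both measures vanish on \<open>A\<close> iff its saturation \<open>D\<close> is null on
  \<open>X_0\<close>: for \<open>M\<close> by invariance, for \<open>Pm\<close> because every time
  has positive weight.\<close>

lemma Pm_null_iff_M: assumes A: "A : sets M" shows "emeasure Pm A = 0 \<longleftrightarrow> emeasure M A = 0"
proof -
 define D where "D = (\<Union>g. T g -` A Int G)"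
 have TA: "T g -` A Int G : sets M" for g using measurable_sets[OF T_measurable_M A, of g] by simp
 have D: "D : sets M" unfolding D_def using TA by (intro sets.countable_UN') auto
 have inv: "T g x : D" if x: "x : D" for x g
 proof -
  obtain g' where g': "T g' x : A" and xG: "x : G" using x by (auto simp: D_def)
  have "T (g' - g) (T g x) = T g' x" using T_add[OF xG, of "g' - g" g] by simp
  hence "T (g' - g) (T g x) : A" using g' by simp
  thus ?thesis unfolding D_def using T_G[OF xG] by (intro UN_I[of "g' - g"]) simp_all
 qed
 have "emeasure Pm A = 0 \<longleftrightarrow> (AE y in \<nu>. ALL g. AE b in PB. e (dig (Od (- g) y) b, b) ~: T g -` A Int G)"
  unfolding Pm_null_iff[OF A]
 proof (rule AE_cong_iff)
  show "AE y in \<nu>. (emeasure (Kf y) A = 0) = (ALL g. AE b in PB. e (dig (Od (- g) y) b, b) ~: T g -` A Int G)"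
   using AE_good AE_space
  proof eventually_elim
   case (elim y)
   hence y: "y : Y" by simp
   have "emeasure PB {b. fib y (g, b) : A} = 0 \<longleftrightarrow> (AE b in PB. e (dig (Od (- g) y) b, b) ~: T g -` A Int G)" for g
   proof -
    have "emeasure PB {b. fib y (g, b) : A} = 0 \<longleftrightarrow> {b. fib y (g, b) : A} : null_sets PB"
     using fib_sets[OF y A, of g] by (simp add: null_sets_def)
    also have "... \<longleftrightarrow> (AE b in PB. b ~: {b. fib y (g, b) : A})"
     using AE_iff_null_sets[OF fib_sets[OF y A, of g]] .
    also have "... \<longleftrightarrow> (AE b in PB. e (dig (Od (- g) y) b, b) ~: T g -` A Int G)"
    proof (rule AE_cong_iff)
     have "AE b in PB. e (dig (Od (- g) y) b, b) : G" by (rule elim(1)[rule_format])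
     thus "AE b in PB. (b ~: {b. fib y (g, b) : A}) = (e (dig (Od (- g) y) b, b) ~: T g -` A Int G)"
      by eventually_elim (simp add: fib_good)
    qed
    finally show ?thesis .
   qed
   thus ?case by (simp add: Kf_null_iff[OF y A])
  qed
 qed
 also have "... \<longleftrightarrow> (ALL g. AE y in \<nu>. AE b in PB. e (dig (Od (- g) y) b, b) ~: T g -` A Int G)" by (rule AE_all_countable)
 \<comment> \<open>Invariance of \<nu> absorbs the shift by \<open>- g\<close>, for each
   \<open>g\<close> separately.\<close>
 also have "... \<longleftrightarrow> (ALL g. AE y in \<nu>. AE b in PB. e (dig y b, b) ~: T g -` A Int G)"
 proof (intro iff_allI iffI)
  fix g assume "AE y in \<nu>. AE b in PB. e (dig (Od (- g) y) b, b) ~: T g -` A Int G"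
  hence "AE y in \<nu>. AE b in PB. e (dig (Od (- g) (Od g y)) b, b) ~: T g -` A Int G" by (rule AE_\<nu>_O)
  thus "AE y in \<nu>. AE b in PB. e (dig y b, b) ~: T g -` A Int G" using AE_space
   by eventually_elim (simp only: space_\<nu> O_inv(2))
 next
  fix g assume "AE y in \<nu>. AE b in PB. e (dig y b, b) ~: T g -` A Int G"
  thus "AE y in \<nu>. AE b in PB. e (dig (Od (- g) y) b, b) ~: T g -` A Int G" by (rule AE_\<nu>_O)
 qed
 also have "... \<longleftrightarrow> (ALL g. AE w in P. e w ~: T g -` A Int G)"
 proof (rule iff_allI)
  fix g
  have "UNIV - {w. e w : T g -` A Int G} : sets P" using sets.compl_sets[OF e_vimage[OF TA[of g]]] by (simp add: space_P)
  moreover have "UNIV - {w. e w : T g -` A Int G} = {w. e w ~: T g -` A Int G}" by blast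
  ultimately show "(AE y in \<nu>. AE b in PB. e (dig y b, b) ~: T g -` A Int G) = (AE w in P. e w ~: T g -` A Int G)"
   using AE_P_iff[of "%w. e w ~: T g -` A Int G"] by (simp only:)
 qed
 also have "... \<longleftrightarrow> (AE w in P. ALL g. e w ~: T g -` A Int G)" by (rule AE_all_countable[symmetric])
 also have "... \<longleftrightarrow> (AE w in P. w ~: {w. e w : D})" by (rule AE_cong_iff, rule AE_I2) (simp add: D_def, blast)
 also have "... \<longleftrightarrow> emeasure P {w. e w : D} = 0" using AE_iff_null_sets[OF e_vimage[OF D]] e_vimage[OF D] by (simp add: null_sets_def)
 also have "... \<longleftrightarrow> D : null_sets M" by (rule inv_null_iff[OF D inv, symmetric])
 also have "... \<longleftrightarrow> A : null_sets M"
 proof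
  assume D0: "D : null_sets M"
  have "A \<subseteq> D" using sets.sets_into_space[OF A] T_0 by (auto simp: D_def intro!: UN_I[of 0])
  thus "A : null_sets M" using D0 A null_sets_subset by blast
 next
  assume "A : null_sets M"
  thus "D : null_sets M" unfolding D_def using M_null_T by (intro null_sets_UN') auto
 qed
 finally show ?thesis using A by (simp add: null_sets_def)
qed

lemma Kf_fibre: "AE y in \<nu>. AE x in Kf y. \<pi> x = y"
 using AE_good AE_space
proof eventually_elim
 case (elim y)
 hence y: "y : Y" by simp
 have \<pi>s: "{x\<in>G. \<pi> x k = y k} : sets M" for k
 proof -
  have "{x\<in>G. \<pi> x k = y k} = \<pi> -` {z\<in>Y. z k = y k} Int space M" using \<pi>_space G_space by auto
  thus ?thesis using measurable_sets[OF \<pi>_M coord_sets] by (simp only:)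
 qed
 have "G - {x\<in>G. \<pi> x k = y k} : sets M" for k using sets.compl_sets[OF \<pi>s[of k]] by (simp only: space_M)
 hence N: "(\<Union>k. G - {x\<in>G. \<pi> x k = y k}) : sets M" (is "?N : _") by (intro sets.countable_UN) blast
 have "emeasure PB {b. fib y (g, b) : ?N} = 0" for g
 proof -
  have "AE b in PB. b ~: {b. fib y (g, b) : ?N}"
  proof -
   have "AE b in PB. e (dig (Od (- g) y) b, b) : G" by (rule elim(1)[rule_format])
   thus ?thesis
   proof eventually_elim
    case (elim b)
    show ?case using \<pi>_fib[OF y elim] by simp
   qed
  qed
  thus ?thesis using AE_iff_null_sets[OF fib_sets[OF y N, of g]] by (simp add: null_sets_def)
 qed
 hence "emeasure (Kf y) ?N = 0" by (simp only: Kf_null_iff[OF y N] simp_thms)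
 hence "?N : null_sets (Kf y)" using N by (simp add: null_sets_def)
 hence "AE x in Kf y. x ~: ?N" by (rule AE_not_in)
 thus ?case using AE_space
 proof eventually_elim
  case (elim x)
  thus ?case by (intro ext) simp
 qed
qed

text \<open>By \<open>Kf_fibre\<close> the conditional measure of a preimage under \<pi> is 0 or
  1.\<close>

lemma distr_Pm_\<pi>: "distr Pm \<nu> \<pi> = \<nu>"
proof (rule measure_eqI)
 fix B assume "B : sets (distr Pm \<nu> \<pi>)"
 hence B: "B : sets \<nu>" by simp
 have pB: "\<pi> -` B Int G : sets M" using measurable_sets[OF \<pi>_M B] by simp
 have \<pi>Pm: "\<pi> : measurable Pm \<nu>" using \<pi>_M by (simp only: measurable_cong_sets[OF sets_Pm refl])
 have "emeasure (distr Pm \<nu> \<pi>) B = emeasure Pm (\<pi> -` B Int G)" using emeasure_distr[OF \<pi>Pm B] by simp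
 also have "... = (\<integral>\<^sup>+y. emeasure (Kf y) (\<pi> -` B Int G) \<partial>\<nu>)" by (rule emeasure_Pm(1)[OF pB])
 also have "... = (\<integral>\<^sup>+y. indicator B y \<partial>\<nu>)"
 proof (rule nn_integral_cong_AE)
  show "AE y in \<nu>. emeasure (Kf y) (\<pi> -` B Int G) = indicator B y" using Kf_fibre AE_space
  proof eventually_elim
   case (elim y)
   hence "prob_space (Kf y)" unfolding Kf_def by (intro WB.prob_space_distr fib_measurable1) simp
   then interpret K: prob_space "Kf y" .
   have "emeasure (Kf y) (\<pi> -` B Int G) = emeasure (Kf y) (if y : B then G else {})"
   proof (rule emeasure_eq_AE)
    show "AE x in Kf y. (x : \<pi> -` B Int G) = (x : (if y : B then G else {}))"
     using elim(1) AE_space by eventually_elim simp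
   qed (use pB sets.top[of M] in auto)
   thus ?case using K.emeasure_space_1 by (simp split: split_indicator)
  qed
 qed
 also have "... = emeasure \<nu> B" by (rule nn_integral_indicator[OF B])
 finally show "emeasure (distr Pm \<nu> \<pi>) B = emeasure \<nu> B" .
qed simp

text \<open>For fixed time \<open>g\<close> the map from \<open>b\<close> to the fibre has the
  inverse \<open>bt\<close> after \<open>T (- g)\<close>, so a splitting of a set of
  \<open>b\<close> by non-atomicity of \<open>PB\<close> is carried over to the fibre.\<close>

lemma nonatomic_Kf: "AE y in \<nu>. nonatomic (Kf y)"
 using AE_good AE_space
proof eventually_elim
 case (elim y)
 hence y: "y : Y" by simp
 show "nonatomic (Kf y)"
  unfolding nonatomic_def
 proof (intro ballI impI)
  fix A assume "A : sets (Kf y)" and pos: "emeasure (Kf y) A > 0"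
  hence A: "A : sets M" by simp
  obtain g where "emeasure PB {b. fib y (g, b) : A} ~= 0" using pos Kf_null_iff[OF y A] by auto
  hence "emeasure PB {b. fib y (g, b) : A} > 0" by (simp add: zero_less_iff_neq_zero)
  then obtain D where D: "D : sets PB" "D \<subseteq> {b. fib y (g, b) : A}" "emeasure PB D > 0"
   "emeasure PB ({b. fib y (g, b) : A} - D) > 0"
   using \<alpha>_nonatomic fib_sets[OF y A, of g] unfolding nonatomic_def by blast
  define A' where "A' = {x\<in>A. bt (T (- g) x) : D}"
  have "A' = A Int ((%x. bt (T (- g) x)) -` D Int space M)" using sets.sets_into_space[OF A] by (auto simp: A'_def)
  hence A': "A' : sets M" using A measurable_sets[OF measurable_compose[OF T_measurable_M bt_M] D(1)] by simp
  have "AE b in PB. e (dig (Od (- g) y) b, b) : G" by (rule elim(1)[rule_format])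
  hence bt: "AE b in PB. bt (T (- g) (fib y (g, b))) = b"
   by eventually_elim (simp add: fib_good T_inv bt_e)
  have pos': "emeasure (Kf y) B > 0" if B: "B : sets M" and D': "D' : sets PB" "emeasure PB D' > 0"
   and sub: "!!b. bt (T (- g) (fib y (g, b))) = b ==> b : D' ==> fib y (g, b) : B" for B D'
  proof -
   have "AE b in PB. b : D' --> b : {b. fib y (g, b) : B}" using bt by eventually_elim (simp add: sub)
   hence "emeasure PB D' <= emeasure PB {b. fib y (g, b) : B}"
    by (rule emeasure_mono_AE) (rule fib_sets[OF y B])
   hence "emeasure PB {b. fib y (g, b) : B} ~= 0" using D'(2) by auto
   hence "emeasure (Kf y) B ~= 0" using Kf_null_iff[OF y B] by blast
   thus ?thesis by (simp add: zero_less_iff_neq_zero)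
  qed
  show "EX B:sets (Kf y). B \<subseteq> A & 0 < emeasure (Kf y) B & 0 < emeasure (Kf y) (A - B)"
  proof (intro bexI[of _ A'] conjI)
   show "A' \<subseteq> A" by (auto simp: A'_def)
   show "0 < emeasure (Kf y) A'" by (rule pos'[OF A' D(1,3)]) (use D(2) in \<open>simp add: A'_def subset_iff\<close>)
   show "0 < emeasure (Kf y) (A - A')"
    by (rule pos'[OF sets.Diff[OF A A'] sets.Diff[OF fib_sets[OF y A] D(1)] D(4)]) (simp add: A'_def)
  qed (use A' in simp)
 qed
qed

lemma uncountable_to_one_\<pi>: "uncountable_to_one M \<nu> \<pi>"
 unfolding uncountable_to_one_def
proof (intro exI conjI)
 show "prob_space Pm" by (rule prob_Pm)
 show "measure_equivalent Pm M"
  unfolding measure_equivalent_def using Pm_null_iff_M by (auto simp: null_sets_def)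
 show "disintegration Pm \<nu> \<pi> Kf"
  unfolding disintegration_def distr_Pm_\<pi>
 proof (intro conjI ballI Kf_fibre)
  have "Kf : measurable \<nu> (prob_algebra M)"
   unfolding Kf_def
  proof (rule measurable_distr_prob_space2[OF _ fib_measurable])
   show "(%x. WB) : measurable \<nu> (prob_algebra WB)"
    by (rule measurable_const) (simp add: space_prob_algebra WB.prob_space_axioms)
  qed
  moreover have "prob_algebra Pm = prob_algebra M" by (simp add: prob_algebra_def subprob_algebra_cong[OF sets_Pm])
  ultimately show "Kf : measurable \<nu> (prob_algebra Pm)" by simp
  fix A assume "A : sets Pm"
  thus "emeasure Pm A = (\<integral>\<^sup>+y. emeasure (Kf y) A \<partial>\<nu>)" using emeasure_Pm(1) by simp
 qed
 show "AE y in distr Pm \<nu> \<pi>. nonatomic (Kf y)" unfolding distr_Pm_\<pi> by (rule nonatomic_Kf)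
qed

text \<open>An isomorphism with an odometer would factor through \<pi>, so almost every conditional
  measure would sit at one point, against its non-atomicity.\<close>

lemma not_odometer: "\<not> is_odometer M T"
proof
 assume "is_odometer M T"
 then obtain \<Delta> \<eta> p q where od: "nonsingular_odometer \<Delta> \<eta>" and p: "factor_map M T \<eta> (odometer_act \<Delta>) p"
  and q: "factor_map \<eta> (odometer_act \<Delta>) M T q" and qp: "AE x in M. q (p x) = x"
  unfolding is_odometer_def isomorphic_systems_def by (elim exE conjE) (rule that; assumption)
 obtain r where r: "r : measurable \<nu> \<eta>" "AE x in M. p x = r (\<pi> x)" by (rule factor_through[OF od p])
 define s where "s y = q (r y)" for y
 have q': "q : measurable \<eta> M" using q by (simp add: factor_map_def)
 have s: "(%x. s (\<pi> x)) : measurable M M"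
  unfolding s_def by (rule measurable_compose[OF measurable_compose[OF \<pi>_M r(1)] q'])
 define N where "N = G - {x\<in>space M. s (\<pi> x) = x}"
 have N: "N : sets M" unfolding N_def using sets.compl_sets[OF eq_sets_M[OF s measurable_ident_sets[OF refl]]] by simp
 have "AE x in M. s (\<pi> x) = x" using qp r(2) by eventually_elim (simp add: s_def)
 hence "AE x in M. x ~: N" using AE_space by eventually_elim (simp add: N_def)
 hence "emeasure M N = 0" using AE_iff_null_sets[OF N] by (simp add: null_sets_def)
 hence "emeasure Pm N = 0" using Pm_null_iff_M[OF N] by simp
 hence "AE y in \<nu>. emeasure (Kf y) N = 0" using Pm_null_iff[OF N] by simp
 with Kf_fibre nonatomic_Kf AE_space have "AE y in \<nu>. False"
 proof eventually_elim
  case (elim y)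
  have "prob_space (Kf y)" unfolding Kf_def using elim(3) by (intro WB.prob_space_distr fib_measurable1) simp
  then interpret K: prob_space "Kf y" .
  have "AE x in Kf y. x ~: N" using elim(4) N by (intro AE_not_in) (simp add: null_sets_def)
  hence pt: "AE x in Kf y. x = s y" using elim(1) AE_space by eventually_elim (simp add: N_def)
  have null: "emeasure (Kf y) B = 0" if "B : sets (Kf y)" "s y ~: B" for B
  proof -
   have "AE x in Kf y. x ~: B" using pt by eventually_elim (use that(2) in auto)
   thus ?thesis using AE_iff_null_sets[OF that(1)] by (simp add: null_sets_def)
  qed
  have "emeasure (Kf y) (space (Kf y)) > 0" using K.emeasure_space_1 by simp
  then obtain B where B: "B : sets (Kf y)" "0 < emeasure (Kf y) B" "0 < emeasure (Kf y) (space (Kf y) - B)"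
   using elim(2) sets.top[of "Kf y"] unfolding nonatomic_def by blast
  show ?case
  proof (cases "s y : B")
   case True
   thus ?thesis using null[OF sets.compl_sets[OF B(1)]] B(3) by simp
  next
   case False
   thus ?thesis using null[of B] B by simp
  qed
 qed
 thus False using \<nu>.AE_const by simp
qed

end

section \<open>Krieger types\<close>

lemma null_by_sections_snd:
 assumes "sigma_finite_measure N" "D : sets (N \<Otimes>\<^sub>M lborel)" "!!t. emeasure N {x. (x, t) : D} = 0"
 shows "D : null_sets (N \<Otimes>\<^sub>M (lborel :: real measure))"
proof -
 interpret N: sigma_finite_measure N by fact
 interpret pair_sigma_finite N lborel ..
 have "emeasure (N \<Otimes>\<^sub>M lborel) D = (\<integral>\<^sup>+t. emeasure N ((%x. (x, t)) -` D) \<partial>lborel)"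
  by (rule emeasure_pair_measure_alt2[OF assms(2)])
 also have "... = 0" using assms(3) by (simp add: vimage_def)
 finally show ?thesis using assms(2) by (simp add: null_sets_def)
qed

subsection \<open>Sets of reals with a dense group of periods\<close>

text \<open>The mass of \<open>E\<close> in a window of given length varies continuously with the
  position and is periodic, hence constant. It is then additive in the length, so proportional to
  it, and Lebesgue measure on \<open>E\<close> is a multiple of Lebesgue measure.\<close>

lemma dense_periods_zero_one:
 fixes E :: "real set"
 assumes E: "E : sets borel" and per: "!!c t. c : \<Lambda> ==> (t + c : E) = (t : E)"
  and dense: "!!x e. e > 0 ==> EX c:\<Lambda>. \<bar>x - c\<bar> < e"
 shows "emeasure lborel E = 0 \<or> emeasure lborel (- E) = 0"
proof -
 define G where "G a x = measure lborel (E Int {a..<a + x})" for a x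
 have Es: "E Int {a..<b} : sets lborel" for a b using E by simp
 have fin: "emeasure lborel (E Int {a..<b}) ~= \<infinity>" for a b
 proof -
  have "emeasure lborel (E Int {a..<b}) <= emeasure lborel {a..b}" by (intro emeasure_mono) auto
  thus ?thesis by (metis emeasure_lborel_Icc_eq ennreal_neq_top infinity_ennreal_def neq_top_trans)
 qed
 have fm: "E Int {a..<b} : fmeasurable lborel" for a b using Es fin by (simp add: fmeasurable_def top.not_eq_extremum)
 have im: "{a..<b} : fmeasurable lborel" "measure lborel {a..<b} = (if a <= b then b - a else 0)" for a b :: real
  by (cases "a <= b"; simp add: fmeasurable_def measure_def)+
 have G0: "G a x >= 0" for a x by (simp add: G_def)
 have Gle: "G a x <= x" if "x >= 0" for a x
  using measure_mono_fmeasurable[OF _ Es im(1), of a "a + x" a "a + x"] that by (simp add: G_def im(2))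
 have G\<Lambda>: "G c x = G 0 x" if "c : \<Lambda>" for c x
 proof -
  have "emeasure lborel {t. t + c : E Int {c..<c + x}} = emeasure lborel (E Int {c..<c + x})"
   by (rule emeasure_lborel_translate[OF Es])
  moreover have "{t. t + c : E Int {c..<c + x}} = E Int {0..<0 + x}" using per[OF that] by auto
  ultimately show ?thesis by (simp add: G_def measure_def)
 qed
 \<comment> \<open>The windows at \<open>a\<close> and at \<open>c\<close> differ by at most two
   intervals of length \<open>\<bar>a - c\<bar>\<close>.\<close>
 have near: "G a x <= G c x + 2 * \<bar>a - c\<bar>" for a c x
 proof -
  let ?I = "{min a c..<max a c}" and ?J = "{min a c + x..<max a c + x}"
  have "G a x <= measure lborel (E Int {c..<c + x} Un (?I Un ?J))"
   unfolding G_def by (rule measure_mono_fmeasurable[OF _ Es]) (auto intro!: fmeasurable.Un fm im(1))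
  also have "... <= G c x + measure lborel (?I Un ?J)"
   unfolding G_def by (rule measure_Un_le) (use Es in auto)
  also have "measure lborel (?I Un ?J) <= measure lborel ?I + measure lborel ?J" by (rule measure_Un_le) auto
  also have "... = 2 * \<bar>a - c\<bar>" by (simp add: im(2) max_def min_def abs_if)
  finally show ?thesis by simp
 qed
 have Ga: "G a x = G 0 x" for a x
 proof -
  have "\<bar>G a x - G 0 x\<bar> <= e" if e: "e > 0" for e
  proof -
   obtain c where c: "c : \<Lambda>" "\<bar>a - c\<bar> < e / 2" using dense[of "e / 2" a] e by auto
   thus ?thesis using near[of a x c] near[of c x a] G\<Lambda>[OF c(1), of x] by (simp add: abs_minus_commute abs_le_iff)
  qed
  hence "\<bar>G a x - G 0 x\<bar> <= 0" using field_le_epsilon[of "\<bar>G a x - G 0 x\<bar>" 0] by simp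
  thus ?thesis by simp
 qed
 have add: "G 0 (x + y) = G 0 x + G 0 y" if "x >= 0" "y >= 0" for x y
 proof -
  have "E Int {0..<x + y} = (E Int {0..<x}) Un (E Int {x..<x + y})" using that by auto
  hence "measure lborel (E Int {0..<x + y}) = measure lborel (E Int {0..<x}) + measure lborel (E Int {x..<x + y})"
   using measure_Un2[OF fm fm, of 0 x x "x + y"] by (simp add: Int_Diff_disjoint Diff_triv disjoint_iff)
  thus ?thesis using Ga[of x y] by (simp add: G_def)
 qed
 have mult: "G 0 (of_nat n * x) = of_nat n * G 0 x" if "x >= 0" for n x
 proof (induction n)
  case 0
  thus ?case by (simp add: G_def)
 next
  case (Suc n)
  have "G 0 (of_nat (Suc n) * x) = G 0 (of_nat n * x + x)" by (simp add: algebra_simps)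
  also have "... = G 0 (of_nat n * x) + G 0 x" using that by (intro add) simp_all
  finally show ?case using Suc by (simp add: algebra_simps)
 qed
 define c where "c = G 0 1"
 have c01: "0 <= c" "c <= 1" using G0 Gle[of 1 0] by (simp_all add: c_def)
 have lin: "G 0 x = c * x" if x: "x >= 0" for x
 proof -
  \<comment> \<open>Compare at length \<open>n * x\<close>: the integral part contributes the same
    to both functions, and the remainder at most 1 to the difference.\<close>
  have n: "of_nat n * \<bar>G 0 x - c * x\<bar> <= 1" for n
  proof -
   define N where "N = nat \<lfloor>of_nat n * x\<rfloor>"
   have N: "of_nat N <= of_nat n * x" "of_nat n * x - of_nat N <= 1" using x by (simp_all add: N_def) (use real_of_int_floor_add_one_ge[of "real n * x"] in linarith)
   let ?y = "of_nat n * x - of_nat N"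
   have "of_nat n * G 0 x = G 0 (of_nat N * 1 + ?y)" using mult[OF x, of n] by simp
   also have "... = G 0 (of_nat N * 1) + G 0 ?y" using N(1) by (intro add) simp_all
   also have "G 0 (of_nat N * 1) = of_nat N * c" using mult[of 1 N] by (simp only: c_def)
   finally have "of_nat n * G 0 x - of_nat n * x * c = G 0 ?y - ?y * c" by (simp add: algebra_simps)
   moreover have "0 <= ?y * c" "?y * c <= 1" using N c01 by (simp_all add: mult_le_one)
   moreover have "0 <= G 0 ?y" "G 0 ?y <= 1" using G0 Gle[of ?y 0] N by simp_all
   ultimately have "\<bar>of_nat n * G 0 x - of_nat n * x * c\<bar> <= 1" by linarith
   moreover have "of_nat n * G 0 x - of_nat n * x * c = of_nat n * (G 0 x - c * x)" by (simp add: algebra_simps)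
   ultimately show ?thesis by (simp add: abs_mult)
  qed
  show ?thesis
  proof (rule ccontr)
   assume "G 0 x ~= c * x"
   hence "\<bar>G 0 x - c * x\<bar> > 0" by simp
   from reals_Archimedean3[OF this] obtain m :: nat where "1 < of_nat m * \<bar>G 0 x - c * x\<bar>" by blast
   thus False using n[of m] by simp
  qed
 qed
 have Em: "emeasure lborel (E Int {l..<u}) = ennreal (c * (u - l))" if "l <= u" for l u
  using Ga[of l "u - l"] lin[of "u - l"] that emeasure_eq_measure2[OF fm[of l u]]
  by (simp add: G_def)
 show ?thesis
 proof (cases "c = 0")
  case True
  have "emeasure lborel (E Int {- of_nat n..<of_nat n}) = 0" for n using Em[of "- of_nat n" "of_nat n"] True by simp
  hence "(\<Union>n. E Int {- of_nat n..<of_nat n}) : null_sets lborel" using Es by (intro null_sets_UN') (auto intro: null_setsI)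
  moreover have "E \<subseteq> (\<Union>n. E Int {- of_nat n..<of_nat n})"
  proof
   fix t assume t: "t : E"
   obtain n where "\<bar>t\<bar> < of_nat n" using reals_Archimedean2 by blast
   thus "t : (\<Union>n. E Int {- of_nat n..<of_nat n})" using t by (intro UN_I[of n]) auto
  qed
  ultimately have "E : null_sets lborel" using null_sets_subset[of _ lborel E] E by simp
  thus ?thesis by auto
 next
  case False
  \<comment> \<open>Lebesgue measure on \<open>E\<close> divided by \<open>c\<close> gives every
    interval its length, hence is Lebesgue measure, which therefore does not charge the complement
    of \<open>E\<close>.\<close>
  let ?N = "scale_measure (ennreal (1 / c)) (density lborel (indicator E))"
  have N: "emeasure ?N A = ennreal (1 / c) * emeasure lborel (E Int A)" if "A : sets borel" for A
   using that E by (simp add: emeasure_density nn_integral_indicator flip: indicator_inter_arith)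
  have "lborel = ?N"
  proof (rule lborel_eqI)
   fix l u :: real assume "!!b. b : Basis ==> l \<bullet> b <= u \<bullet> b"
   hence lu: "l <= u" by simp
   have "emeasure lborel (E Int {l<..<u}) = emeasure lborel (E Int {l..<u})"
   proof (rule emeasure_eq_AE)
    show "AE x in lborel. (x : E Int {l<..<u}) = (x : E Int {l..<u})"
     using AE_lborel_singleton[of l] by eventually_elim auto
   qed (use E in auto)
   hence "emeasure ?N (box l u) = ennreal (1 / c) * ennreal (c * (u - l))" using Em[OF lu] N[of "{l<..<u}"] by (simp add: box_real)
   also have "... = ennreal (u - l)" using False c01(1) lu by (simp flip: ennreal_mult)
   finally show "emeasure ?N (box l u) = ennreal (\<Prod>b\<in>Basis. (u - l) \<bullet> b)" by simp
  qed simp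
  hence "emeasure lborel (- E) = emeasure ?N (- E)" by (rule arg_cong)
  also have "... = 0" using N[OF borel_comp[OF E]] by simp
  finally show ?thesis ..
 qed
qed

text \<open>Powers of \<open>sqrt 2 - 1\<close> belong to the group generated by 1 and
  \<open>sqrt 2\<close> and tend to 0.\<close>

lemma sqrt2_dense:
 fixes x e :: real
 assumes e: "e > 0"
 shows "EX k l :: int. \<bar>x - (of_int k + of_int l * sqrt 2)\<bar> < e"
proof -
 have "EX p q :: int. (sqrt 2 - 1) ^ n = of_int p + of_int q * sqrt 2" for n
 proof (induction n)
  case 0
  show ?case by (intro exI[of _ 1] exI[of _ 0]) simp
 next
  case (Suc n)
  then obtain p q :: int where "(sqrt 2 - 1) ^ n = of_int p + of_int q * sqrt 2" by blast
  hence "(sqrt 2 - 1) ^ Suc n = of_int (2 * q - p) + of_int (p - q) * sqrt 2" by (simp add: algebra_simps)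
  thus ?case by blast
 qed
 moreover have s: "0 < sqrt 2 - (1 :: real)" "sqrt 2 - (1 :: real) < 1" using real_sqrt_less_iff[of 2 4] by simp_all
 then obtain n where n: "(sqrt 2 - 1) ^ n < e" using real_arch_pow_inv[OF e, of "sqrt 2 - 1"] by blast
 ultimately obtain p q :: int where pq: "(sqrt 2 - 1) ^ n = of_int p + of_int q * sqrt 2" by blast
 define d where "d = (sqrt 2 - 1 :: real) ^ n"
 have d: "d > 0" using s by (simp add: d_def)
 define m where "m = \<lfloor>x / d\<rfloor>"
 have "of_int m <= x / d" "x / d < of_int m + 1" by (simp_all add: m_def)
 hence "of_int m * d <= x" "x < (of_int m + 1) * d" using d by (simp_all add: field_simps)
 hence "\<bar>x - of_int m * d\<bar> < e" using n by (simp add: d_def algebra_simps)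
 moreover have "of_int m * d = of_int (m * p) + of_int (m * q) * sqrt 2" by (simp add: d_def pq algebra_simps)
 ultimately show ?thesis by metis
qed

section \<open>The logarithmic cocycle and the exchange of blocks\<close>

text \<open>\<open>x\<close> is the odds of True, so its logarithm is the step of the logarithmic
  cocycle at this bit.\<close>

lemma ln_bernoulli_ratio:
 assumes "x > 0"
 shows "pmf (bernoulli_pmf (x / (1 + x))) True = x / (1 + x)" "pmf (bernoulli_pmf (x / (1 + x))) False = 1 / (1 + x)"
  "ln (pmf (bernoulli_pmf (x / (1 + x))) True / pmf (bernoulli_pmf (x / (1 + x))) False) = ln x"
  "set_pmf (bernoulli_pmf (x / (1 + x))) = UNIV"
proof -
 have *: "0 < x / (1 + x)" "x / (1 + x) < 1" "1 - x / (1 + x) = 1 / (1 + x)" using assms by (simp_all add: field_simps)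
 thus 1: "pmf (bernoulli_pmf (x / (1 + x))) True = x / (1 + x)" "pmf (bernoulli_pmf (x / (1 + x))) False = 1 / (1 + x)"
  by simp_all
 show "ln (pmf (bernoulli_pmf (x / (1 + x))) True / pmf (bernoulli_pmf (x / (1 + x))) False) = ln x"
  unfolding 1 using assms by simp
 show "set_pmf (bernoulli_pmf (x / (1 + x))) = UNIV" using * by (intro set_pmf_bernoulli) simp_all
qed

context full_bern
begin

lemma ln_part_ratio:
 assumes "!!i. ln (pmf (\<alpha> i) True / pmf (\<alpha> i) False) = c * of_int (x i)"
 shows "ln (part_ratio \<alpha> n b b') = c * of_int ((\<Sum>i<n. if b i then x i else 0) - (\<Sum>i<n. if b' i then x i else 0))"
proof (induction n)
 case (Suc n)
 have pos: "pmf (\<alpha> n) (b n) / pmf (\<alpha> n) (b' n) > 0" using pmf_pos by simp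
 have "ln (pmf (\<alpha> n) (b n) / pmf (\<alpha> n) (b' n)) = c * of_int ((if b n then x n else 0) - (if b' n then x n else 0))"
 proof (cases "b n = b' n")
  case True
  thus ?thesis using pmf_pos[of n "b' n"] by simp
 next
  case False
  then consider "b n" "\<not> b' n" | "\<not> b n" "b' n" by blast
  thus ?thesis
  proof cases
   case 1
   thus ?thesis using assms[of n] by simp
  next
   case 2
   have "ln (pmf (\<alpha> n) False / pmf (\<alpha> n) True) = - ln (pmf (\<alpha> n) True / pmf (\<alpha> n) False)"
    using pmf_pos[of n] by (simp add: ln_div)
   thus ?thesis using 2 assms[of n] by simp
  qed
 qed
 thus ?case using Suc ln_mult_pos[OF part_ratio_pos[of n b b'] pos]
  by (simp add: part_ratio_def algebra_simps)
qed (simp add: part_ratio_def)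

end

text \<open>Moving the first block onto the second makes an event of the first \<open>N\<close> bits
  independent of its image.\<close>

definition swap :: "nat => nat => nat" where
 "swap N i = (if i < N then i + N else if i < 2 * N then i - N else i)"

lemma swap_swap: "swap N (swap N i) = i" by (auto simp: swap_def)

lemma bij_swap: "bij (swap N)"
 by (rule o_bij[of "swap N"]) (simp_all add: fun_eq_iff swap_swap)

lemma swap_lt: "swap N i < 2 * N \<longleftrightarrow> i < 2 * N" by (auto simp: swap_def)

context full_bern
begin

context
 fixes N :: nat
 assumes per: "!!i. \<alpha> (i + N) = \<alpha> i"
begin

lemma \<alpha>_swap: "\<alpha> (swap N i) = \<alpha> i"
 using per[of i] per[of "i - N"] by (auto simp: swap_def)

lemma distr_swap: "distr (bern \<alpha>) (bern \<alpha>) (%b i. b (swap N i)) = bern \<alpha>"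
 using distr_PiM_reindex[of UNIV "%n. measure_pmf (\<alpha> n)" "swap N" UNIV, OF prob_space_measure_pmf bij_is_inj[OF bij_swap]]
 by (simp add: bern_def \<alpha>_swap restrict_UNIV)

lemma swap_measurable: "(%b i. b (swap N i)) : measurable (bern \<alpha>) (bern \<alpha>)"
 by (rule measurable_bernI) simp

text \<open>Exchanged bits have the same law, so the two products of weights are rearrangements of
  each other.\<close>

lemma tail_ratio_swap: "((%i. b (swap N i)), b) : tail_relation" "tail_ratio \<alpha> b (%i. b (swap N i)) = 1"
proof -
 have eq: "b i = b (swap N i)" if "i >= 2 * N" for i using that by (simp add: swap_def)
 show "((%i. b (swap N i)), b) : tail_relation" unfolding tail_iff using eq by (intro exI[of _ "2 * N"]) simp
 have "tail_ratio \<alpha> b (%i. b (swap N i)) = part_ratio \<alpha> (2 * N) b (%i. b (swap N i))" by (rule tail_ratio_eq) (rule eq)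
 also have "... = (\<Prod>i<2 * N. pmf (\<alpha> i) (b i)) / (\<Prod>i<2 * N. pmf (\<alpha> i) (b (swap N i)))"
  by (simp add: part_ratio_def prod_dividef)
 also have "(\<Prod>i<2 * N. pmf (\<alpha> i) (b (swap N i))) = (\<Prod>i<2 * N. pmf (\<alpha> (swap N i)) (b (swap N i)))"
  by (simp add: \<alpha>_swap)
 also have "... = (\<Prod>i<2 * N. pmf (\<alpha> i) (b i))"
  by (rule prod.reindex_bij_witness[of _ "swap N" "swap N"]) (simp_all add: swap_swap swap_lt)
 finally show "tail_ratio \<alpha> b (%i. b (swap N i)) = 1" using pmf_pos by (simp add: prod_pos less_imp_neq[symmetric])
qed

text \<open>\<open>A\<close> and its image under the exchange depend on disjoint blocks, hence are
  independent, and both approximate \<open>D\<close>.\<close>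

lemma swap_approx:
 assumes D: "D : sets (bern \<alpha>)" and inv: "!!b b'. (b, b') : tail_relation ==> tail_ratio \<alpha> b b' = 1 ==> b : D ==> b' : D"
  and A: "dep N A"
 shows "\<bar>measure (bern \<alpha>) D - measure (bern \<alpha>) D * measure (bern \<alpha>) D\<bar> <= 4 * measure (bern \<alpha>) ((D - A) Un (A - D))"
proof -
 let ?m = "measure (bern \<alpha>)" and ?s = "%b i. b (swap N i)"
 have As: "A : sets (bern \<alpha>)" by (rule dep_sets[OF A])
 let ?A' = "{b. ?s b : A}"
 have meas: "{b. ?s b : B} : sets (bern \<alpha>)" "?m {b. ?s b : B} = ?m B" if B: "B : sets (bern \<alpha>)" for B
 proof -
  have eq: "?s -` B Int space (bern \<alpha>) = {b. ?s b : B}" by auto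
  show "{b. ?s b : B} : sets (bern \<alpha>)" using measurable_sets[OF swap_measurable B] unfolding eq .
  have "?m B = measure (distr (bern \<alpha>) (bern \<alpha>) ?s) B" by (simp only: distr_swap)
  also have "... = ?m {b. ?s b : B}" using measure_distr[OF swap_measurable B] unfolding eq .
  finally show "?m {b. ?s b : B} = ?m B" by simp
 qed
 have Dinv: "?s b : D \<longleftrightarrow> b : D" for b
 proof
  assume b: "?s b : D"
  have "?s (?s b) = b" by (simp add: swap_swap)
  thus "b : D" using inv[OF tail_sym[OF tail_ratio_swap(1)[of "?s b"]] tail_ratio_swap(2)[of "?s b"] b] by (simp only:)
 next
  assume "b : D" thus "?s b : D" by (rule inv[OF tail_sym[OF tail_ratio_swap(1)] tail_ratio_swap(2)])
 qed
 have d': "?m ((D - ?A') Un (?A' - D)) = ?m ((D - A) Un (A - D))"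
 proof -
  have "(D - ?A') Un (?A' - D) = {b. ?s b : (D - A) Un (A - D)}" by (auto simp: Dinv)
  thus ?thesis using meas(2)[of "(D - A) Un (A - D)"] D As by simp
 qed
 have "indif N ?A'"
  unfolding indif_def
 proof (intro allI impI)
  fix b b' :: "nat => bool" assume "ALL i>=N. b i = b' i" "b : ?A'"
  moreover from this have "?s b : A \<longleftrightarrow> ?s b' : A" by (intro depD[OF A]) (simp add: swap_def)
  ultimately show "b' : ?A'" by simp
 qed
 hence ind: "?m (A Int ?A') = ?m A * ?m A"
  using bern_dep_indif_measure[OF meas(1)[OF As] _ A] meas(2)[OF As] by simp
 have DA: "(D - A) Un (A - D) : sets (bern \<alpha>)" "(D - ?A') Un (?A' - D) : sets (bern \<alpha>)" using D As meas(1)[OF As] by auto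
 have "(D - A Int ?A') Un (A Int ?A' - D) \<subseteq> ((D - A) Un (A - D)) Un ((D - ?A') Un (?A' - D))" by blast
 hence "?m ((D - A Int ?A') Un (A Int ?A' - D)) <= ?m (((D - A) Un (A - D)) Un ((D - ?A') Un (?A' - D)))"
  using DA by (intro bern.finite_measure_mono) auto
 also have "... <= ?m ((D - A) Un (A - D)) + ?m ((D - ?A') Un (?A' - D))" by (rule measure_Un_le[OF DA])
 finally have 1: "\<bar>?m D - ?m A * ?m A\<bar> <= 2 * ?m ((D - A) Un (A - D))"
  using bern_measure_diff_le[OF D, of "A Int ?A'"] As meas(1)[OF As] ind d' by simp
 have h1: "\<bar>?m A - ?m D\<bar> <= ?m ((D - A) Un (A - D))" using bern_measure_diff_le[OF D As] by (simp add: abs_minus_commute)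
 have "?m A * ?m A - ?m D * ?m D = (?m A - ?m D) * (?m A + ?m D)" by (simp add: algebra_simps)
 hence "\<bar>?m A * ?m A - ?m D * ?m D\<bar> = \<bar>?m A - ?m D\<bar> * (?m A + ?m D)" by (simp add: abs_mult)
 also have "... <= \<bar>?m A - ?m D\<bar> * 2"
  using add_mono[OF bern.prob_le_1[of A] bern.prob_le_1[of D]] by (intro mult_left_mono) simp_all
 also have "... <= ?m ((D - A) Un (A - D)) * 2" using h1 by (rule mult_right_mono) simp
 finally have "\<bar>?m A * ?m A - ?m D * ?m D\<bar> <= ?m ((D - A) Un (A - D)) * 2" .
 thus ?thesis using 1 by linarith
qed

end

text \<open>The Hewitt--Savage argument: exchanging two adjacent long blocks of coordinates preserves the
 measure and the cocycle.\<close>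

lemma exchange_zero_one:
 assumes per: "!!i. \<alpha> (i + 2) = \<alpha> i" and D: "D : sets (bern \<alpha>)"
  and inv: "!!b b'. (b, b') : tail_relation ==> tail_ratio \<alpha> b b' = 1 ==> b : D ==> b' : D"
 shows "measure (bern \<alpha>) D = 0 \<or> measure (bern \<alpha>) D = 1"
proof (rule square_approx_zero_one[where c = 4])
 fix e :: real assume "e > 0"
 then obtain n A where A: "dep n A" "measure (bern \<alpha>) ((D - A) Un (A - D)) < e" by (rule bern_approx[OF D])
 \<comment> \<open>Period 2 admits exchanges over an even distance, hence the block length
   \<open>2 * n\<close>.\<close>
 have "\<alpha> (i + 2 * m) = \<alpha> i" for i m
  using per by (induction m) (simp_all flip: add.assoc)
 moreover have "dep (2 * n) A" by (rule dep_mono[OF A(1)]) simp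
 ultimately have "\<bar>measure (bern \<alpha>) D - measure (bern \<alpha>) D * measure (bern \<alpha>) D\<bar> <= 4 * measure (bern \<alpha>) ((D - A) Un (A - D))"
  by (intro swap_approx[OF _ D inv])
 thus "\<bar>measure (bern \<alpha>) D - measure (bern \<alpha>) D * measure (bern \<alpha>) D\<bar> <= 4 * e" using A(2) by linarith
qed simp

end

section \<open>Invariant sets for periodic laws: types III_1 and III_l with
  \<open>0 < l < 1\<close>\<close>

context cf_bern
begin

lemma SB_D:
 assumes "B : sets SB"
 shows "B : sets (PB \<Otimes>\<^sub>M lborel)"
  and "(b, b') : tail_relation ==> (b, t) : B ==> (b', t - ln (tail_ratio \<alpha> b b')) : B"
 using assms skew_invD[of tail_relation "tail_ratio \<alpha>" B b t b'] by (auto simp: SB_facts)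

lemma SB_I:
 assumes "B : sets (PB \<Otimes>\<^sub>M lborel)"
  and "!!b b' t. (b, b') : tail_relation ==> (b, t) : B ==> (b', t - ln (tail_ratio \<alpha> b b')) : B"
 shows "B : sets SB"
 using assms(1) skew_invI[of B tail_relation "tail_ratio \<alpha>"] assms(2) by (simp add: SB_facts)

abbreviation r :: "nat => real" where "r i \<equiv> ln (pmf (\<alpha> i) True / pmf (\<alpha> i) False)"

lemma tail_ratio_flip1: "tail_ratio \<alpha> (b(i := True)) (b(i := False)) = pmf (\<alpha> i) True / pmf (\<alpha> i) False"
 "tail_ratio \<alpha> (b(i := False)) (b(i := True)) = pmf (\<alpha> i) False / pmf (\<alpha> i) True"
proof -
 have "{j. (b(i := True)) j ~= (b(i := False)) j} = {i}" "{j. (b(i := False)) j ~= (b(i := True)) j} = {i}" by auto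
 thus "tail_ratio \<alpha> (b(i := True)) (b(i := False)) = pmf (\<alpha> i) True / pmf (\<alpha> i) False"
  "tail_ratio \<alpha> (b(i := False)) (b(i := True)) = pmf (\<alpha> i) False / pmf (\<alpha> i) True"
  unfolding tail_ratio_def by simp_all
qed

lemma r_flip: assumes B: "B : sets SB"
 shows "(b(i := True), t) : B \<longleftrightarrow> (b(i := False), t - r i) : B"
proof
 have tl: "(b(i := True), b(i := False)) : tail_relation" unfolding tail_iff by (intro exI[of _ "Suc i"]) simp
 show "(b(i := False), t - r i) : B" if "(b(i := True), t) : B"
  using SB_D(2)[OF B tl that] by (simp only: tail_ratio_flip1)
 have "ln (pmf (\<alpha> i) False / pmf (\<alpha> i) True) = - r i" using pmf_\<alpha>_pos by (simp add: ln_div)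
 thus "(b(i := True), t) : B" if "(b(i := False), t - r i) : B"
  using SB_D(2)[OF B tail_sym[OF tl] that] by (simp only: tail_ratio_flip1) simp
qed

text \<open>The section of \<open>B\<close> at time \<open>t\<close> is invariant under tail moves
  of cocycle 1, so it is null or full; \<open>E\<close> collects the times of the full ones.
  Flipping bit \<open>i\<close> relates the sections at \<open>t\<close> and \<open>t - r i\<close>,
  which makes every \<open>r i\<close> a period.\<close>

lemma exchange_section:
 assumes per: "!!i. \<alpha> (i + 2) = \<alpha> i" and B: "B : sets SB"
 obtains E :: "real set" where "E : sets borel" "!!t i. t - r i : E \<longleftrightarrow> t : E"
  "(UNIV \<times> E - B) Un (B - UNIV \<times> E) : null_sets (PB \<Otimes>\<^sub>M lborel)"
proof
 interpret S: pair_sigma_finite PB lborel by unfold_locales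
 have Bs: "B : sets (PB \<Otimes>\<^sub>M lborel)" by (rule SB_D(1)[OF B])
 define E where "E = {t. emeasure PB {b. (b, t) : B} = 1}"
 have sec: "{b. (b, t) : B} : sets PB" for t
  using sets_Pair2[OF Bs, of t] by (simp add: vimage_def)
 have "(%t. emeasure PB {b. (b, t) : B}) : borel_measurable lborel"
  using S.measurable_emeasure_Pair2[OF Bs] by (simp add: vimage_def)
 from measurable_sets[OF this, of "{1}"] show E: "E : sets borel" by (simp add: E_def vimage_def)
 have zo: "emeasure PB {b. (b, t) : B} = 0 \<or> emeasure PB {b. (b, t) : B} = 1" for t
 proof -
  have "measure PB {b. (b, t) : B} = 0 \<or> measure PB {b. (b, t) : B} = 1"
  proof (rule fb.exchange_zero_one[OF per sec])
   fix b b' assume "(b, b') : tail_relation" "tail_ratio \<alpha> b b' = 1" "b : {b. (b, t) : B}"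
   thus "b' : {b. (b, t) : B}" using SB_D(2)[OF B, of b b' t] by simp
  qed
  thus ?thesis by (auto simp: PB.emeasure_eq_measure)
 qed
 have upd: "emeasure PB {b. b(i := d) : D} = 0" if "D : sets PB" "emeasure PB D = 0" for D i d
  by (rule bern_upd_null[OF that(1) \<alpha>_full that(2)])
 have upd1: "emeasure PB {b. b(i := d) : D} = 1" if D: "D : sets PB" "emeasure PB D = 1" for D i d
 proof -
  have "emeasure PB (space PB - D) = 0" using emeasure_compl[OF D(1)] D(2) PB.emeasure_space_1 by simp
  hence "emeasure PB {b. b(i := d) : space PB - D} = 0" by (rule upd[OF sets.compl_sets[OF D(1)]])
  moreover have "{b. b(i := d) : space PB - D} = space PB - {b. b(i := d) : D}" by auto
  ultimately have "1 - emeasure PB {b. b(i := d) : D} = 0"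
   using emeasure_compl[OF bern_sets_upd[OF D(1)], of i d] PB.emeasure_space_1 by simp
  thus ?thesis using PB.emeasure_le_1[of "{b. b(i := d) : D}"] by (simp add: ennreal_minus_eq_0 order_antisym)
 qed
 have fl: "{b. b(i := False) : {b. (b, t - r i) : B}} = {b. b(i := True) : {b. (b, t) : B}}" for t i
  using r_flip[OF B] by simp
 show "t - r i : E \<longleftrightarrow> t : E" for t i
 proof
  assume "t - r i : E"
  hence "emeasure PB {b. b(i := True) : {b. (b, t) : B}} = 1"
   unfolding E_def fl[symmetric] by (intro upd1 sec) simp
  hence "emeasure PB {b. (b, t) : B} ~= 0" using upd[OF sec] by fastforce
  thus "t : E" using zo[of t] by (simp add: E_def)
 next
  assume "t : E"
  hence "emeasure PB {b. b(i := False) : {b. (b, t - r i) : B}} = 1"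
   unfolding E_def fl by (intro upd1 sec) simp
  hence "emeasure PB {b. (b, t - r i) : B} ~= 0" using upd[OF sec] by fastforce
  thus "t - r i : E" using zo[of "t - r i"] by (simp add: E_def)
 qed
 show "(UNIV \<times> E - B) Un (B - UNIV \<times> E) : null_sets (PB \<Otimes>\<^sub>M lborel)"
 proof (rule null_by_sections_snd)
  have "(UNIV :: (nat => bool) set) : sets PB" using sets.top[of PB] by simp
  hence "UNIV \<times> E : sets (PB \<Otimes>\<^sub>M lborel)" using E by (intro pair_measureI) simp_all
  thus "(UNIV \<times> E - B) Un (B - UNIV \<times> E) : sets (PB \<Otimes>\<^sub>M lborel)" using Bs by auto
  fix t
  show "emeasure PB {b. (b, t) : (UNIV \<times> E - B) Un (B - UNIV \<times> E)} = 0"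
  proof (cases "t : E")
   case True
   hence "{b. (b, t) : (UNIV \<times> E - B) Un (B - UNIV \<times> E)} = space PB - {b. (b, t) : B}" by auto
   thus ?thesis using True emeasure_compl[OF sec, of t] PB.emeasure_space_1 by (simp add: E_def)
  next
   case False
   hence "{b. (b, t) : (UNIV \<times> E - B) Un (B - UNIV \<times> E)} = {b. (b, t) : B}" by auto
   thus ?thesis using False zo[of t] by (simp add: E_def)
  qed
 qed (rule fb.sigma_finite_bern)
qed

text \<open>With a dense group of periods only trivial invariant sets remain, so the flow is
  realized on one point.\<close>

lemma type_III_one_M:
 assumes per: "!!i. \<alpha> (i + 2) = \<alpha> i" and dense: "!!x e. e > 0 ==> EX k l :: int. \<bar>x - (of_int k * r 0 + of_int l * r 1)\<bar> < e"
 shows "type_III_one M R"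
proof -
 let ?W = "count_space {0 :: real}" and ?V = "%(t :: real) (x :: real). x"
 have V: "nonsingular_flow ?W ?V"
  unfolding nonsingular_flow_def
 proof (intro conjI)
  show "standard_borel ?W"
  proof (rule standard_borelI[where f = "%x. x"])
   show "gdelta_in euclidean ((%x. x) ` space ?W)"
    by (intro closed_imp_gdelta_in[OF metrizable_space_euclidean]) simp
   show "sets ?W = {(%x. x) -` B Int space ?W |B. B : sets borel}"
   proof (intro equalityI subsetI)
    fix A assume "A : sets ?W"
    hence "A = {} \<or> A = {0}" by auto
    thus "A : {(%x. x) -` B Int space ?W |B. B : sets borel}"
     by (elim disjE) (force intro: exI[of _ "{}"], force intro: exI[of _ "{0}"])
   qed auto
  qed simp
  show "sigma_finite_measure ?W" by (intro sigma_finite_measure_count_space_finite) simp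
  show "(%(t, x). ?V t x) : measurable (borel \<Otimes>\<^sub>M ?W) ?W" by simp
  show "ALL t. ALL A:sets ?W. (emeasure ?W (?V t -` A Int space ?W) = 0) = (emeasure ?W A = 0)"
  proof (intro allI ballI)
   fix A assume "A : sets ?W"
   hence "?V t -` A Int space ?W = A" for t by auto
   thus "(emeasure ?W (?V t -` A Int space ?W) = 0) = (emeasure ?W A = 0)" for t by (simp only:)
  qed
 qed simp_all
 have "isomorphic_flows ?W ?V SB shift_flow"
 proof (rule isomorphic_flows_pullback[where G = UNIV and q = "%_. 0"])
  show "(UNIV :: ((nat => bool) \<times> real) set) : sets SB" using sets.top[of SB] by (simp add: SB_facts)
  show "space SB - UNIV : null_sets SB" by simp
  have all: "A = {} \<or> A = {0}" if "A : sets ?W" for A using that by auto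
  have nonnull: "UNIV ~: null_sets SB"
  proof
   assume "UNIV : null_sets SB"
   hence "UNIV : null_sets (PB \<Otimes>\<^sub>M (lborel :: real measure))" unfolding SB_facts mem_Collect_eq by (rule conjunct1)
   hence "emeasure (PB \<Otimes>\<^sub>M (lborel :: real measure)) (UNIV \<times> UNIV) = 0" by (simp add: null_sets_def)
   moreover have "emeasure (PB \<Otimes>\<^sub>M (lborel :: real measure)) (UNIV \<times> UNIV) = emeasure PB UNIV * emeasure (lborel :: real measure) UNIV"
    using sets.top[of PB] by (intro lborel.emeasure_pair_measure_Times) simp_all
   ultimately show False using PB.emeasure_space_1 by simp
  qed
  fix A assume A: "A : sets ?W"
  show "(%_. 0) -` A Int UNIV : sets SB" using all[OF A] sets.top[of SB] by (auto simp: SB_facts)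
  show "(%_. 0) -` A Int UNIV : null_sets SB \<longleftrightarrow> A : null_sets ?W"
   using all[OF A] nonnull by (auto simp: null_sets_count_space)
 next
  fix B assume B: "B : sets SB"
  obtain E :: "real set" where E: "E : sets borel" "!!t i. t - r i : E \<longleftrightarrow> t : E"
   "(UNIV \<times> E - B) Un (B - UNIV \<times> E) : null_sets (PB \<Otimes>\<^sub>M lborel)"
   by (rule exchange_section[OF per B], rule that, assumption, simp, assumption)
  have n: "t + of_nat k * r i : E \<longleftrightarrow> t : E" for t k i
  proof (induction k)
   case (Suc k)
   have "t + of_nat (Suc k) * r i - r i = t + of_nat k * r i" by (simp add: algebra_simps)
   thus ?case using E(2)[of "t + of_nat (Suc k) * r i" i] Suc by (simp only:)
  qed simp
  have z: "t + of_int k * r i : E \<longleftrightarrow> t : E" for t k i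
  proof (cases "k >= 0")
   case True
   thus ?thesis using n[of t "nat k" i] by simp
  next
   case False
   thus ?thesis using n[of "t + of_int k * r i" "nat (- k)" i] by simp
  qed
  have "emeasure lborel E = 0 \<or> emeasure lborel (- E) = 0"
  proof (rule dense_periods_zero_one[OF E(1), where \<Lambda> = "{of_int k * r 0 + of_int l * r 1 | k l :: int. True}"])
   fix t c assume "c : {of_int k * r 0 + of_int l * r 1 | k l :: int. True}"
   then obtain k l :: int where "c = of_int k * r 0 + of_int l * r 1" by blast
   hence "t + c = (t + of_int k * r 0) + of_int l * r 1" by simp
   thus "t + c : E \<longleftrightarrow> t : E" by (simp only: z)
  next
   fix x e :: real assume "e > 0"
   thus "EX c:{of_int k * r 0 + of_int l * r 1 | k l :: int. True}. \<bar>x - c\<bar> < e" using dense[of e x] by blast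
  qed
  moreover have prod0: "UNIV \<times> S : null_sets (PB \<Otimes>\<^sub>M lborel)" if "emeasure lborel S = 0" "S : sets borel" for S :: "real set"
   using that sets.top[of PB] lborel.emeasure_pair_measure_Times[of UNIV PB S] by (intro null_setsI) (simp_all add: pair_measureI)
  ultimately consider "UNIV \<times> E : null_sets (PB \<Otimes>\<^sub>M lborel)" | "UNIV \<times> (- E) : null_sets (PB \<Otimes>\<^sub>M lborel)"
   using E(1) by (metis borel_comp)
  thus "EX A:sets ?W. eq_mod_null SB ((%_. 0) -` A Int UNIV) B"
  proof cases
   case 1
   have "B \<subseteq> UNIV \<times> E Un ((UNIV \<times> E - B) Un (B - UNIV \<times> E))" by blast
   hence "B : null_sets (PB \<Otimes>\<^sub>M lborel)" using null_sets_subset[OF null_sets.Un[OF 1 E(3)] SB_D(1)[OF B]] by blast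
   hence "B : null_sets SB" using B by (simp add: SB_facts)
   thus ?thesis by (intro bexI[of _ "{}"]) (simp_all add: eq_mod_null_def)
  next
   case 2
   have C: "space SB - B : sets SB" using B by auto
   have "space SB - B \<subseteq> UNIV \<times> (- E) Un ((UNIV \<times> E - B) Un (B - UNIV \<times> E))" by auto
   hence "space SB - B : null_sets (PB \<Otimes>\<^sub>M lborel)" using null_sets_subset[OF null_sets.Un[OF 2 E(3)] SB_D(1)[OF C]] by blast
   hence "space SB - B : null_sets SB" using C by (simp add: SB_facts)
   thus ?thesis by (intro bexI[of _ "{0}"]) (simp_all add: eq_mod_null_def SB_facts)
  qed
 qed (auto simp: SB_facts)
 hence "isomorphic_flows SB shift_flow ?W ?V"
  by (rule isomorphic_flows_sym[OF _ nonsingular_flow_ok[OF V] SB_flow_ok])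
 hence "is_associated_flow M R ?W ?V" by (rule associated_flow_M)
 thus ?thesis unfolding type_III_one_def using V by (intro exI[of _ ?W] exI[of _ ?V]) simp
qed

text \<open>All steps equal \<open>ln l\<close>, so up to null sets the invariant sets are those
  with period \<open>- ln l\<close>, and the flow is the rotation of an interval of that
  length.\<close>

lemma type_III_proper_M:
 assumes l: "0 < l" "l < 1" and \<alpha>: "!!i. \<alpha> i = bernoulli_pmf (l / (1 + l))"
 shows "type_III_proper M R l"
proof -
 define L where "L = - ln l"
 have L: "L > 0" using l by (simp add: L_def)
 have ri: "r i = - L * of_int 1" for i
 proof -
  have "l / (1 + l) <= 1" "0 <= l / (1 + l)" "1 - l / (1 + l) = 1 / (1 + l)" using l by (simp_all add: field_simps)
  hence "pmf (\<alpha> i) True / pmf (\<alpha> i) False = l" using l by (simp add: \<alpha>)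
  thus ?thesis by (simp add: L_def)
 qed
 define cut :: "real => real" where "cut t = L * frac (t / L)" for t
 have cut_range: "0 <= cut t" "cut t < L" for t using L frac_lt_1[of "t / L"] by (simp_all add: cut_def)
 have cut_id: "cut t = t" if "0 <= t" "t < L" for t using that L by (simp add: cut_def frac_eq)
 have cut_eq: "cut t = cut s" if "t = s + L * of_int k" for t s k
 proof -
  have "t / L = s / L + of_int k" using that L by (simp add: field_simps)
  thus ?thesis by (simp add: cut_def)
 qed
 have cut_diff: "EX k :: int. t = cut t + L * of_int k" for t
  using L by (intro exI[of _ "\<lfloor>t / L\<rfloor>"]) (simp add: cut_def frac_def algebra_simps)
 have cut_add: "cut (cut t + s) = cut (t + s)" for t s
 proof -
  obtain k :: int where "t = cut t + L * of_int k" using cut_diff by blast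
  hence "t + s = (cut t + s) + L * of_int k" by simp
  thus ?thesis using cut_eq by metis
 qed
 have cut_meas [measurable]: "cut : borel_measurable borel"
  unfolding cut_def frac_def by measurable
 define W where "W = restrict_space lborel {0..<L}"
 define V where "V s t = cut (t + s)" for s t
 have spW: "space W = {0..<L}" by (simp add: W_def space_restrict_space)
 have setsW: "A : sets W \<longleftrightarrow> A : sets borel & A \<subseteq> {0..<L}" for A by (auto simp: W_def sets_restrict_space_iff)
 have emW: "emeasure W A = emeasure lborel A" if "A \<subseteq> {0..<L}" for A using that by (simp add: W_def emeasure_restrict_space)
 have cut_W: "cut t : space W" for t using cut_range[of t] by (simp add: spW)
 have null_cut: "emeasure lborel (cut -` A) = 0 \<longleftrightarrow> emeasure lborel A = 0" if A: "A : sets borel" "A \<subseteq> {0..<L}" for A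
 proof
  assume "emeasure lborel (cut -` A) = 0"
  moreover have "A \<subseteq> cut -` A" using A(2) cut_id by (auto simp: subset_iff)
  moreover have "cut -` A : sets borel" using measurable_sets[OF cut_meas A(1)] by simp
  ultimately show "emeasure lborel A = 0" using emeasure_mono[of A "cut -` A" lborel] by simp
 next
  assume A0: "emeasure lborel A = 0"
  have "emeasure lborel {t. t + L * of_int k : A} = 0" for k :: int using emeasure_lborel_translate[of A] A A0 by simp
  moreover have "{t. t + L * of_int k : A} : sets lborel" for k :: int
   using measurable_sets[of "%t. t + L * of_int k" borel borel A] A by (simp add: vimage_def)
  ultimately have "(\<Union>k::int. {t. t + L * of_int k : A}) : null_sets lborel" by (intro null_sets_UN') (auto intro: null_setsI)
  moreover have "cut -` A \<subseteq> (\<Union>k::int. {t. t + L * of_int k : A})"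
  proof
   fix t assume "t : cut -` A"
   moreover obtain k :: int where "t = cut t + L * of_int k" using cut_diff by blast
   hence "t + L * of_int (- k) = cut t" by simp
   ultimately have "t + L * of_int (- k) : A" by (simp only: vimage_eq)
   thus "t : (\<Union>k::int. {t. t + L * of_int k : A})" by blast
  qed
  moreover have "cut -` A : sets lborel" using measurable_sets[OF cut_meas A(1)] by simp
  ultimately have "cut -` A : null_sets lborel" using null_sets_subset by blast
  thus "emeasure lborel (cut -` A) = 0" by (simp add: null_sets_def)
 qed
 have nV: "nonsingular_flow W V"
  unfolding nonsingular_flow_def
 proof (intro conjI allI ballI)
  show "standard_borel W"
  proof (rule standard_borelI[where f = "%x. x"])
   have "gdelta_in euclidean ({0..} Int {..<L})"
    by (intro gdelta_in_Int closed_imp_gdelta_in[OF metrizable_space_euclidean] open_imp_gdelta_in) simp_all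
   moreover have "{0..} Int {..<L} = (%x. x) ` space W" by (auto simp: spW)
   ultimately show "gdelta_in euclidean ((%x. x) ` space W)" by simp
   show "sets W = {(%x. x) -` B Int space W |B. B : sets borel}" by (auto simp: W_def sets_restrict_space space_restrict_space)
  qed simp
  show "sigma_finite_measure W" unfolding W_def by (rule sigma_finite_measure_restrict_space) (simp_all add: lborel.sigma_finite_measure_axioms)
  have "(%x. x) : borel_measurable W" unfolding W_def by (intro measurable_restrict_space1) simp
  from measurable_compose[OF measurable_snd this] have "(%p. snd p) : borel_measurable (borel \<Otimes>\<^sub>M W)" .
  hence "(%p. cut (snd p + fst p)) : borel_measurable (borel \<Otimes>\<^sub>M W)"
   by (intro measurable_compose[OF _ cut_meas] borel_measurable_add measurable_fst)
  hence "(%(t, x). cut (x + t)) : borel_measurable (borel \<Otimes>\<^sub>M W)" by (simp only: split_def)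
  thus "(%(t, x). V t x) : measurable (borel \<Otimes>\<^sub>M W) W"
   unfolding V_def using cut_range by (subst W_def, intro measurable_restrict_space2) auto
  show "V 0 x = x" if "x : space W" for x using that cut_id by (simp add: V_def spW)
  show "V (s + t) x = V s (V t x)" for s t x by (simp only: V_def cut_add) (simp add: ac_simps)
  fix t A assume A: "A : sets W"
  have imp: "emeasure W (V t -` A Int space W) = 0" if A: "A : sets W" and A0: "emeasure W A = 0" for t A
  proof -
   have "emeasure lborel (cut -` A) = 0" using null_cut A A0 emW by (simp add: setsW)
   moreover have c: "cut -` A : sets lborel" using measurable_sets[OF cut_meas] A by (simp add: setsW)
   ultimately have f1: "emeasure lborel {x. x + t : cut -` A} = 0" using emeasure_lborel_translate[OF c] by simp
   have f2: "V t -` A Int space W \<subseteq> {x. x + t : cut -` A}" by (auto simp: V_def)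
   have f3: "{x. x + t : cut -` A} : sets lborel"
    using measurable_sets[of "%x. x + t" borel borel "cut -` A"] c by (simp add: vimage_def)
   have "emeasure lborel (V t -` A Int space W) = 0" using emeasure_mono[OF f2 f3] unfolding f1 by simp
   thus ?thesis by (subst emW) (auto simp: spW)
  qed
  have Vm: "V t -` A Int space W : sets W"
  proof -
   have "(%x. cut (x + t)) -` A : sets borel" using measurable_sets[of "%x. cut (x + t)" borel borel A] A by (simp add: setsW)
   thus ?thesis by (simp add: setsW spW V_def[abs_def])
  qed
  show "(emeasure W (V t -` A Int space W) = 0) = (emeasure W A = 0)"
  proof
   assume "emeasure W (V t -` A Int space W) = 0"
   hence "emeasure W (V (- t) -` (V t -` A Int space W) Int space W) = 0" by (rule imp[OF Vm])
   moreover have "V (- t) -` (V t -` A Int space W) Int space W = A"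
   proof -
    have "V t (V (- t) x) = x" "V (- t) x : space W" if "x : space W" for x
     using that cut_add[of "x - t" t] cut_id[of x] cut_W by (auto simp: V_def spW)
    thus ?thesis using sets.sets_into_space[OF A] by auto
   qed
   ultimately show "emeasure W A = 0" by simp
  qed (rule imp[OF A])
 qed
 have "isomorphic_flows W V SB shift_flow"
 proof (rule isomorphic_flows_pullback[where G = UNIV and q = "%(b, t). cut t"])
  show "(UNIV :: ((nat => bool) \<times> real) set) : sets SB" using sets.top[of SB] by (simp add: SB_facts)
  show "space SB - UNIV : null_sets SB" by simp
  have Q: "(%(b :: nat => bool, t). cut t) -` A Int UNIV = UNIV \<times> cut -` A" for A by auto
  have cs: "cut -` A : sets borel" if "A : sets W" for A using measurable_sets[OF cut_meas] that by (simp add: setsW)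
  have QSB: "UNIV \<times> cut -` A : sets SB" if A: "A : sets W" for A
  proof (rule SB_I)
   show "UNIV \<times> cut -` A : sets (PB \<Otimes>\<^sub>M lborel)" using cs[OF A] sets.top[of PB] by (intro pair_measureI) simp_all
   fix b b' :: "nat => bool" and t assume bb: "(b, b') : tail_relation" and t: "(b, t) : UNIV \<times> cut -` A"
   obtain n where "!!i. i >= n ==> b i = b' i" using bb by (auto simp: tail_iff)
   hence "EX k :: int. ln (tail_ratio \<alpha> b b') = - L * of_int k"
    using fb.tail_ratio_eq[of n b b'] fb.ln_part_ratio[of "- L" "%_. 1", OF ri] by metis
   then obtain k :: int where "ln (tail_ratio \<alpha> b b') = - L * of_int k" ..
   hence "cut (t - ln (tail_ratio \<alpha> b b')) = cut t" by (intro cut_eq[of _ _ k]) simp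
   thus "(b', t - ln (tail_ratio \<alpha> b b')) : UNIV \<times> cut -` A" using t by simp
  qed
  show "(%(b, t). cut t) -` A Int UNIV : sets SB" if "A : sets W" for A unfolding Q by (rule QSB[OF that])
  show "(%(b, t). cut t) -` A Int UNIV : null_sets SB \<longleftrightarrow> A : null_sets W" if A: "A : sets W" for A
  proof -
   have "UNIV \<times> cut -` A : null_sets SB \<longleftrightarrow> emeasure (PB \<Otimes>\<^sub>M lborel) (UNIV \<times> cut -` A) = 0"
   proof -
    have "UNIV \<times> cut -` A : null_sets SB \<longleftrightarrow> UNIV \<times> cut -` A : null_sets (PB \<Otimes>\<^sub>M lborel)"
     using QSB[OF A] unfolding SB_facts mem_Collect_eq by blast
    also have "... \<longleftrightarrow> emeasure (PB \<Otimes>\<^sub>M lborel) (UNIV \<times> cut -` A) = 0"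
     using SB_D(1)[OF QSB[OF A]] by (simp add: null_sets_def)
    finally show ?thesis .
   qed
   also have "... \<longleftrightarrow> emeasure lborel (cut -` A) = 0"
    using lborel.emeasure_pair_measure_Times[of UNIV PB "cut -` A"] cs[OF A] sets.top[of PB] PB.emeasure_space_1 by simp
   also have "... \<longleftrightarrow> A : null_sets W" using null_cut[of A] A emW[of A] by (auto simp: setsW null_sets_def)
   finally show ?thesis unfolding Q .
  qed
  show "(case x of (b, t) => cut t) : space W" for x :: "(nat => bool) \<times> real" using cut_W by (simp add: split_def)
  show "(case shift_flow s x of (b, t) => cut t) = V s (case x of (b, t) => cut t)" for s and x :: "(nat => bool) \<times> real"
   by (simp add: split_def V_def cut_add)
  fix B assume B: "B : sets SB"
  have per: "\<alpha> (i + 2) = \<alpha> i" for i by (simp add: \<alpha>)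
  obtain E :: "real set" where E: "E : sets borel" "!!t i. t - r i : E \<longleftrightarrow> t : E"
   "(UNIV \<times> E - B) Un (B - UNIV \<times> E) : null_sets (PB \<Otimes>\<^sub>M lborel)"
   by (rule exchange_section[OF per B], rule that, assumption, simp, assumption)
  have step: "t + L : E \<longleftrightarrow> t : E" for t using E(2)[of t 0] by (simp add: ri)
  have n: "t + L * of_nat k : E \<longleftrightarrow> t : E" for t k
  proof (induction k)
   case (Suc k)
   have "t + L * of_nat (Suc k) = (t + L * of_nat k) + L" by (simp add: algebra_simps)
   thus ?case using step Suc by (simp only:)
  qed simp
  have z: "t + L * of_int k : E \<longleftrightarrow> t : E" for t k
  proof (cases "k >= 0")
   case True
   thus ?thesis using n[of t "nat k"] by simp
  next
   case False
   thus ?thesis using n[of "t + L * of_int k" "nat (- k)"] by simp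
  qed
  have "cut -` (E Int {0..<L}) = E"
  proof -
   have "cut t : E \<longleftrightarrow> t : E" for t using cut_diff[of t] z by metis
   thus ?thesis using cut_range by auto
  qed
  hence "(%(b :: nat => bool, t). cut t) -` (E Int {0..<L}) Int UNIV = UNIV \<times> E" unfolding Q by simp
  moreover have EW: "E Int {0..<L} : sets W" using E(1) by (simp add: setsW)
  moreover have "UNIV \<times> E : sets SB" using QSB[OF EW] \<open>cut -` (E Int {0..<L}) = E\<close> by simp
  hence "(UNIV \<times> E - B) Un (B - UNIV \<times> E) : sets SB" using B by auto
  hence "eq_mod_null SB (UNIV \<times> E) B" using E(3) by (simp add: eq_mod_null_def SB_facts)
  ultimately show "EX A:sets W. eq_mod_null SB ((%(b, t). cut t) -` A Int UNIV) B" by (intro bexI[of _ "E Int {0..<L}"]) simp_all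
 qed simp
 hence "isomorphic_flows SB shift_flow W V"
  by (rule isomorphic_flows_sym[OF _ nonsingular_flow_ok[OF nV] SB_flow_ok])
 hence as: "is_associated_flow M R W V" by (rule associated_flow_M)
 have nonnull: "EX x:space W. S x" if "AE x in W. S x" for S
 proof (rule ccontr)
  assume "\<not> (EX x:space W. S x)"
  with that AE_space have "AE x in W. False" by (auto elim: AE_mp intro: AE_I2)
  hence "space W : null_sets W" using AE_iff_null_sets[of "space W" W] AE_space by (auto elim: eventually_mono)
  thus False using emW[of "space W"] L by (auto simp: spW null_sets_def)
 qed
 have "transitive_flow W V"
  unfolding transitive_flow_def
 proof (intro bexI[of _ 0] AE_I2)
  show "EX t. y = V t 0" if "y : space W" for y using that cut_id by (intro exI[of _ y]) (simp add: V_def spW)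
 qed (simp add: spW L)
 moreover have "V L x = x" if "x : space W" for x using that cut_eq[of "x + L" x 1] cut_id by (simp add: V_def spW)
 hence "flow_period W V L" using L by (auto simp: flow_period_def)
 \<comment> \<open>A period returns some point to itself modulo \<open>L\<close>, so it is a
   multiple of \<open>L\<close>, and being positive it is at least \<open>L\<close>.\<close>
 moreover have "L <= p" if p: "flow_period W V p" for p
 proof -
  obtain x where x: "0 <= x" "x < L" "cut (x + p) = x" using nonnull[of "%x. V p x = x"] p by (auto simp: flow_period_def V_def spW)
  obtain k :: int where "x + p = cut (x + p) + L * of_int k" using cut_diff by blast
  hence pk: "p = L * of_int k" using x by simp
  moreover have "p > 0" using p by (simp add: flow_period_def)
  ultimately have "of_int k > (0 :: real)" using L by (simp add: zero_less_mult_iff)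
  hence "of_int k >= (1 :: real)" by simp
  thus ?thesis using pk L by (simp add: mult_le_cancel_left1)
 qed
 ultimately show ?thesis unfolding type_III_proper_def using l nV as by (fold L_def) blast
qed

end

subsection \<open>Transitive flows\<close>

lemma AE_lborel_translate:
 assumes "AE t in lborel. S t" shows "AE t in lborel. S (t + c :: real)"
proof -
 have "AE t in distr lborel borel ((+) c). S t" using assms by (simp only: lborel_distr_plus)
 hence "AE t in lborel. S (c + t)" by (rule AE_distrD[rotated]) simp
 thus ?thesis by (simp only: add.commute)
qed

text \<open>A transitive flow lives on one orbit, so its measure algebra is carried by the time axis,
 equivariantly under translations.\<close>

lemma transitive_realization:
 assumes iso: "isomorphic_flows N U W V" and V: "nonsingular_flow W V" and tr: "transitive_flow W V"
  and nonnull: "space N ~: null_sets N"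
 shows "EX \<Theta> :: 'a set => real => bool.
  (ALL A:sets N. {t. \<Theta> A t} : sets borel) &
  (ALL A:null_sets N. AE t in lborel. \<not> \<Theta> A t) &
  (ALL A:sets N. AE t in lborel. \<Theta> (space N - A) t \<longleftrightarrow> \<not> \<Theta> A t) &
  (ALL A :: nat => 'a set. range A \<subseteq> sets N --> (AE t in lborel. \<Theta> (\<Union>i. A i) t \<longleftrightarrow> (EX i. \<Theta> (A i) t))) &
  (ALL s. ALL A:sets N. AE t in lborel. \<Theta> (U s -` A Int space N) t \<longleftrightarrow> \<Theta> A (t + s))"
proof -
 obtain \<Phi> where \<Phi>: "flow_iso N U W V \<Phi>" using iso by (auto simp: isomorphic_flows_iff)
 note m = flow_isoD(1)[OF \<Phi>] and i = flow_isoD(2)[OF \<Phi>] and c = flow_isoD(4)[OF \<Phi>]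
  and u = flow_isoD(5)[OF \<Phi>] and e = flow_isoD(6)[OF \<Phi>]
 obtain x0 where x0: "x0 : space W" "AE y in W. EX t. y = V t x0" using tr by (auto simp: transitive_flow_def)
 define orb where "orb t = V t x0" for t
 have Vm: "(%(t, x). V t x) : measurable (borel \<Otimes>\<^sub>M W) W" and Vadd: "!!s t x. x : space W ==> V (s + t) x = V s (V t x)"
  using V by (auto simp: nonsingular_flow_def)
 have om: "orb : measurable borel W"
  using measurable_compose[OF measurable_Pair2'[OF x0(1), of borel] Vm] by (simp add: orb_def[abs_def])
 have osp: "orb t : space W" for t using measurable_space[OF om, of t] by simp
 interpret W: sigma_finite_measure W using V by (simp add: nonsingular_flow_def)
 interpret LW: pair_sigma_finite lborel W by unfold_locales
 have Wnull: "\<not> (AE x in W. False)"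
 proof
  assume "AE x in W. False"
  hence all: "AE x in W. S x" for S by (rule eventually_mono) simp
  have "eq_mod_null W (\<Phi> {}) (\<Phi> (space N))" using m by (subst eq_mod_null_iff_AE) (auto simp: all)
  hence "eq_mod_null N {} (space N)" using i[of "{}" "space N"] by simp
  thus False using nonnull by (simp add: eq_mod_null_def)
 qed
 \<comment> \<open>By Fubini almost every point avoids \<open>Z\<close> at almost all times. Some
   such point lies on the orbit of \<open>x0\<close>, and a translation in time brings the property
   to \<open>x0\<close>.\<close>
 have orb_AE: "AE t in lborel. orb t ~: Z" if Z: "Z : null_sets W" for Z
 proof -
  have Zs: "Z : sets W" using Z by auto
  have ms: "{p : space (lborel \<Otimes>\<^sub>M W). V (fst p) (snd p) ~: Z} : sets (lborel \<Otimes>\<^sub>M W)"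
  proof -
   have "(%(t, x). V t x) : measurable (lborel \<Otimes>\<^sub>M W) W"
    using Vm by (simp cong: measurable_cong_sets add: measurable_cong_sets[OF sets_pair_measure_cong[OF sets_lborel refl] refl])
   from measurable_sets[OF this sets.compl_sets[OF Zs]]
   have "(%(t, x). V t x) -` (space W - Z) Int space (lborel \<Otimes>\<^sub>M W) : sets (lborel \<Otimes>\<^sub>M W)" .
   moreover have "(%(t, x). V t x) -` (space W - Z) Int space (lborel \<Otimes>\<^sub>M W) = {p : space (lborel \<Otimes>\<^sub>M W). V (fst p) (snd p) ~: Z}"
    using measurable_space[OF Vm] by (auto simp: space_pair_measure)
   ultimately show ?thesis by simp
  qed
  have "AE x in W. V t x ~: Z" for t
  proof -
   have "emeasure W (V t -` Z Int space W) = 0" using V Z Zs by (simp add: nonsingular_flow_def null_sets_def)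
   moreover have "V t -` Z Int space W : sets W"
    using measurable_sets[OF measurable_compose[OF measurable_Pair1' Vm] Zs, of t] by simp
   ultimately have "V t -` Z Int space W : null_sets W" by (intro null_setsI)
   hence "AE x in W. x ~: V t -` Z Int space W" by (rule AE_not_in)
   with AE_space show ?thesis by eventually_elim simp
  qed
  hence "AE t in lborel. AE x in W. V t x ~: Z" by simp
  hence "AE x in W. AE t in lborel. V t x ~: Z" using LW.AE_commute[OF ms] by simp
  with x0(2) have "AE x in W. EX s. AE t in lborel. V t (V s x0) ~: Z" by eventually_elim auto
  have "EX s. AE t in lborel. V t (V s x0) ~: Z"
  proof (rule ccontr)
   assume n: "\<nexists>s. AE t in lborel. V t (V s x0) ~: Z"
   from \<open>AE x in W. EX s. AE t in lborel. V t (V s x0) ~: Z\<close> have "AE x in W. False"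
    by (rule eventually_mono) (use n in blast)
   thus False using Wnull by blast
  qed
  then obtain s where "AE t in lborel. V t (V s x0) ~: Z" ..
  hence "AE t in lborel. orb (t + s) ~: Z" by (simp add: orb_def Vadd[OF x0(1)])
  from AE_lborel_translate[OF this, of "- s"] show ?thesis by simp
 qed
 have transfer: "AE t in lborel. orb t : A \<longleftrightarrow> orb t : B" if "eq_mod_null W A B" for A B
 proof -
  have "(A - B) Un (B - A) : null_sets W" using that by (simp only: eq_mod_null_def)
  from orb_AE[OF this] show ?thesis by eventually_elim blast
 qed
 show ?thesis
 proof (intro exI[of _ "%A t. orb t : \<Phi> A"] conjI ballI allI impI)
  show "{t. orb t : \<Phi> A} : sets borel" if "A : sets N" for A
   using measurable_sets[OF om m[OF that]] by (simp add: vimage_def)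
  show C: "AE t in lborel. orb t : \<Phi> (space N - A) \<longleftrightarrow> \<not> orb t : \<Phi> A" if "A : sets N" for A
   using transfer[OF c[OF that]] osp by simp
  show Un: "AE t in lborel. orb t : \<Phi> (\<Union>i. A i) \<longleftrightarrow> (EX i. orb t : \<Phi> (A i))" if "range A \<subseteq> sets N" for A :: "nat => 'a set"
   using transfer[OF u[OF that]] by simp
  show "AE t in lborel. orb t : \<Phi> (U s -` A Int space N) \<longleftrightarrow> orb (t + s) : \<Phi> A" if "A : sets N" for A s
  proof -
   have "orb (t + s) = V s (orb t)" for t using Vadd[OF x0(1), of s t] by (simp add: orb_def add.commute)
   thus ?thesis using transfer[OF e[OF that, of s]] osp by simp
  qed
  show "AE t in lborel. \<not> orb t : \<Phi> A" if A: "A : null_sets N" for A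
  proof -
   have "eq_mod_null N A {}" using A by (simp add: eq_mod_null_def)
   hence h1: "AE t in lborel. orb t : \<Phi> A \<longleftrightarrow> orb t : \<Phi> {}" using i[of A "{}"] A by (intro transfer) auto
   \<comment> \<open>A union of the whole space and empty sets: were \<open>orb t\<close> in
     \<open>\<Phi> {}\<close>, it would be in \<open>\<Phi> (space N)\<close>, against the clause on
     complements.\<close>
   have eq: "(\<Union>i :: nat. if i = 0 then space N else {}) = space N" by (auto split: if_splits)
   have "range (%i :: nat. if i = 0 then space N else {}) \<subseteq> sets N" by auto
   from Un[OF this] have "AE t in lborel. orb t : \<Phi> (space N) \<longleftrightarrow> (EX i :: nat. orb t : \<Phi> (if i = 0 then space N else {}))"
    unfolding eq .
   moreover have "AE t in lborel. orb t : \<Phi> (space N) \<longleftrightarrow> \<not> orb t : \<Phi> {}" using C[of "{}"] by simp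
   ultimately show ?thesis using h1
   proof eventually_elim
    case (elim t)
    show ?case
    proof
     assume "orb t : \<Phi> A"
     hence e: "orb t : \<Phi> {}" using elim(3) by blast
     hence "orb t : \<Phi> (if (1 :: nat) = 0 then space N else {})" by simp
     hence "orb t : \<Phi> (space N)" using elim(1) by blast
     thus False using elim(2) e by blast
    qed
   qed
  qed
 qed
qed

subsection \<open>A sequence of blocks without transitive flow\<close>

text \<open>Block \<open>k\<close> has \<open>2 ^ 2 ^ k\<close> bits with odds
  \<open>blk_ratio k\<close>, so about one of them is True. In units of \<open>ln 2\<close> such a
  bit moves the logarithmic cocycle by \<open>2 ^ k\<close>; blocks from \<open>m\<close> on thus
  move it by multiples of \<open>2 ^ m\<close>.\<close>

fun blk_start :: "nat => nat" where
 "blk_start 0 = 0"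
| "blk_start (Suc k) = blk_start k + 2 ^ 2 ^ k"

definition blk :: "nat => nat" where "blk i = (LEAST k. i < blk_start (Suc k))"

definition blk_ratio :: "nat => real" where "blk_ratio k = (1 / 2) ^ 2 ^ k"

lemma blk_start_mono: "m <= n ==> blk_start m <= blk_start n"
 by (rule lift_Suc_mono_le[of blk_start]) simp_all

lemma blk_start_gt: "i < blk_start (Suc i)"
proof (induction i)
 case (Suc i)
 have "(0 :: nat) < 2 ^ 2 ^ Suc i" by simp
 with Suc show ?case unfolding blk_start.simps(2)[of "Suc i"] by linarith
qed simp

lemma blk_ge: assumes "blk_start m <= i" shows "m <= blk i"
proof (rule ccontr)
 assume "\<not> m <= blk i"
 hence "blk_start (Suc (blk i)) <= blk_start m" by (intro blk_start_mono) simp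
 moreover have "i < blk_start (Suc (blk i))" unfolding blk_def by (rule LeastI) (rule blk_start_gt)
 ultimately show False using assms by simp
qed

lemma blk_eq: assumes "blk_start m <= i" "i < blk_start (Suc m)" shows "blk i = m"
 using blk_ge[OF assms(1)] Least_le[of "%k. i < blk_start (Suc k)" m, OF assms(2)] by (simp add: blk_def)

lemma blk_ratio: "blk_ratio k > 0" "blk_ratio k <= 1" "ln (blk_ratio k) = - ln 2 * of_int (2 ^ k)"
proof -
 show "blk_ratio k > 0" "blk_ratio k <= 1" by (simp_all add: blk_ratio_def power_le_one)
 show "ln (blk_ratio k) = - ln 2 * of_int (2 ^ k)" by (simp add: blk_ratio_def ln_realpow ln_div)
qed

text \<open>Block length times odds is 1, so Bernoulli's inequality bounds the power of the
  denominator below by 2.\<close>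

lemma blk_power_le: "(1 / (1 + blk_ratio k)) ^ (2 ^ 2 ^ k) <= 1 / 2"
proof -
 have "2 = 1 + real (2 ^ 2 ^ k) * blk_ratio k" by (simp add: blk_ratio_def power_divide)
 also have "... <= (1 + blk_ratio k) ^ (2 ^ 2 ^ k)"
  using blk_ratio(1)[of k] by (intro Bernoulli_inequality) simp
 finally have "2 <= (1 + blk_ratio k) ^ (2 ^ 2 ^ k)" .
 thus ?thesis by (simp add: power_divide divide_simps)
qed

definition blk_pmf :: "nat => bool pmf" where
 "blk_pmf i = bernoulli_pmf (blk_ratio (blk i) / (1 + blk_ratio (blk i)))"

text \<open>False is at least as likely as True, and even a block of False bits contributes at most
  1/2 to a cylinder.\<close>

lemma nonatomic_blk: "nonatomic (bern blk_pmf)"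
proof (rule nonatomic_bernI)
 fix e :: real assume e: "e > 0"
 have "(\<Prod>i<blk_start n. pmf (blk_pmf i) (b i)) <= (1 / 2) ^ n" for n b
 proof (induction n)
  case (Suc n)
  have "(\<Prod>i<blk_start (Suc n). pmf (blk_pmf i) (b i)) =
   (\<Prod>i<blk_start n. pmf (blk_pmf i) (b i)) * (\<Prod>i\<in>{blk_start n..<blk_start (Suc n)}. pmf (blk_pmf i) (b i))"
   unfolding lessThan_atLeast0
   using prod.atLeastLessThan_concat[of 0 "blk_start n" "blk_start (Suc n)" "%i. pmf (blk_pmf i) (b i)"] blk_start_mono[of n "Suc n"]
   by (simp del: blk_start.simps)
  also have "... <= (1 / 2) ^ n * (1 / 2)"
  proof (rule mult_mono[OF Suc])
   have "(\<Prod>i\<in>{blk_start n..<blk_start (Suc n)}. pmf (blk_pmf i) (b i)) <= (\<Prod>i\<in>{blk_start n..<blk_start (Suc n)}. 1 / (1 + blk_ratio n))"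
   proof (rule prod_mono)
    fix i assume "i : {blk_start n..<blk_start (Suc n)}"
    hence "blk i = n" by (intro blk_eq) simp_all
    thus "0 <= pmf (blk_pmf i) (b i) & pmf (blk_pmf i) (b i) <= 1 / (1 + blk_ratio n)"
     using ln_bernoulli_ratio(1,2)[OF blk_ratio(1)[of n]] blk_ratio(1,2)[of n]
     by (cases "b i") (simp_all add: blk_pmf_def divide_right_mono)
   qed
   also have "... <= 1 / 2" using blk_power_le[of n] by simp
   finally show "(\<Prod>i\<in>{blk_start n..<blk_start (Suc n)}. pmf (blk_pmf i) (b i)) <= 1 / 2" .
  qed (simp_all add: prod_nonneg)
  finally show ?case by simp
 qed simp
 moreover obtain n where "(1 / 2) ^ n < e" using real_arch_pow_inv[OF e, of "1 / 2"] by auto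
 ultimately show "EX n. ALL b. (\<Prod>i<n. pmf (blk_pmf i) (b i)) < e"
  by (intro exI[of _ "blk_start n"]) (meson order_le_less_trans)
qed

context full_bern
begin

lemma measure_bit: "measure (bern \<alpha>) {b. b i = d} = pmf (\<alpha> i) d"
proof -
 have "{b. b i = d} : sets (bern \<alpha>)"
  using measurable_sets[OF measurable_bern_component[of i \<alpha>], of "{d}"] by (simp add: vimage_def)
 from bern_resample[OF this, where i = i]
 have "emeasure (bern \<alpha>) {b. b i = d} = (\<Sum>x\<in>UNIV. ennreal (pmf (\<alpha> i) x) * emeasure (bern \<alpha>) {b :: nat => bool. x = d})"
  by simp
 also have "... = ennreal (pmf (\<alpha> i) d)"
  using bern.emeasure_space_1 by (cases d) (simp_all add: UNIV_bool)
 finally show ?thesis by (simp add: measure_def)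
qed

text \<open>The left side is the mean of the sign of the parity, which is multiplicative over
  independent bits.\<close>

lemma parity_measure:
 assumes "!!i. s <= i ==> i < s + l ==> pmf (\<alpha> i) True = p"
 shows "2 * measure (bern \<alpha>) {b. even (\<Sum>i\<in>{s..<s + l}. if b i then 1 else 0 :: int)} - 1 = (1 - 2 * p) ^ l"
 using assms
proof (induction l)
 case 0
 thus ?case using bern.prob_space by simp
next
 case (Suc l)
 let ?N = "%b :: nat => bool. \<Sum>i\<in>{s..<s + l}. if b i then 1 else 0 :: int"
 let ?A = "{b. even (?N b)}" and ?B = "{b :: nat => bool. b (s + l) = False}" and ?C = "{b :: nat => bool. b (s + l) = True}"
 have A: "dep (s + l) ?A" "dep (s + l) (UNIV - ?A)"
 proof -
  have eq: "?N b = ?N b'" if "ALL i<s + l. b i = b' i" for b b' by (rule sum.cong) (use that in auto)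
  show "dep (s + l) ?A" unfolding dep_def by (intro allI impI, drule eq, simp)
  show "dep (s + l) (UNIV - ?A)" unfolding dep_def by (intro allI impI, drule eq, simp)
 qed
 have BC: "indif (s + l) ?B" "indif (s + l) ?C" unfolding indif_def by (intro allI impI; simp)+
 have sets: "?A : sets (bern \<alpha>)" "?B : sets (bern \<alpha>)" "?C : sets (bern \<alpha>)"
  using dep_sets[OF A(1)] measurable_sets[OF measurable_bern_component[of "s + l" \<alpha>], of "{True}"]
   measurable_sets[OF measurable_bern_component[of "s + l" \<alpha>], of "{False}"] by (simp_all add: vimage_def)
 have split: "{b. even (\<Sum>i\<in>{s..<s + Suc l}. if b i then 1 else 0 :: int)} = (?A Int ?B) Un ((UNIV - ?A) Int ?C)"
  by (auto simp: sum.op_ivl_Suc)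
 have "measure (bern \<alpha>) {b. even (\<Sum>i\<in>{s..<s + Suc l}. if b i then 1 else 0 :: int)} = measure (bern \<alpha>) (?A Int ?B) + measure (bern \<alpha>) ((UNIV - ?A) Int ?C)"
  unfolding split using sets dep_sets[OF A(2)] by (intro bern.finite_measure_Union) auto
 also have "... = measure (bern \<alpha>) ?A * pmf (\<alpha> (s + l)) False + measure (bern \<alpha>) (UNIV - ?A) * pmf (\<alpha> (s + l)) True"
  by (simp only: bern_dep_indif_measure[OF sets(2) BC(1) A(1)] bern_dep_indif_measure[OF sets(3) BC(2) A(2)] measure_bit)
 also have "measure (bern \<alpha>) (UNIV - ?A) = 1 - measure (bern \<alpha>) ?A" using bern.prob_compl[OF sets(1)] by simp
 also have "pmf (\<alpha> (s + l)) False = 1 - p" using Suc.prems[of "s + l"] pmf_False_conv_True[of "\<alpha> (s + l)"] by simp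
 also have "pmf (\<alpha> (s + l)) True = p" using Suc.prems[of "s + l"] by simp
 finally have "2 * measure (bern \<alpha>) {b. even (\<Sum>i\<in>{s..<s + Suc l}. if b i then 1 else 0 :: int)} - 1 = (2 * measure (bern \<alpha>) ?A - 1) * (1 - 2 * p)"
  by (simp add: algebra_simps)
 also have "2 * measure (bern \<alpha>) ?A - 1 = (1 - 2 * p) ^ l" using Suc by simp
 finally show ?case by simp
qed

end

text \<open>Up to the factor \<open>- ln 2\<close>, the logarithm of the weight of the first
  \<open>n\<close> bits relative to that of False bits.\<close>

definition bsum :: "nat => (nat => bool) => int" where "bsum n b = (\<Sum>i<n. if b i then 2 ^ blk i else 0)"

lemma bsum_split: assumes "blk_start m <= n" shows "EX u. bsum n b = bsum (blk_start m) b + 2 ^ m * u"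
proof -
 have "2 ^ m dvd (\<Sum>i\<in>{blk_start m..<n}. if b i then 2 ^ blk i else 0 :: int)"
  by (rule dvd_sum) (auto intro: le_imp_power_dvd blk_ge)
 then obtain u where "(\<Sum>i\<in>{blk_start m..<n}. if b i then 2 ^ blk i else 0 :: int) = 2 ^ m * u" by (elim dvdE)
 moreover have "bsum n b = bsum (blk_start m) b + (\<Sum>i\<in>{blk_start m..<n}. if b i then 2 ^ blk i else 0)"
  unfolding bsum_def lessThan_atLeast0 using assms by (simp add: sum.atLeastLessThan_concat)
 ultimately show ?thesis by auto
qed

definition blk_ones :: "nat => (nat => bool) => int" where
 "blk_ones n b = (\<Sum>i\<in>{blk_start n..<blk_start n + 2 ^ 2 ^ n}. if b i then 1 else 0)"

lemma bsum_Suc: "bsum (blk_start (Suc n)) b = bsum (blk_start n) b + 2 ^ n * blk_ones n b"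
proof -
 have "bsum (blk_start (Suc n)) b = bsum (blk_start n) b + (\<Sum>i\<in>{blk_start n..<blk_start (Suc n)}. if b i then 2 ^ blk i else 0)"
  unfolding bsum_def lessThan_atLeast0 using blk_start_mono[of n "Suc n"] by (simp add: sum.atLeastLessThan_concat)
 also have "(\<Sum>i\<in>{blk_start n..<blk_start (Suc n)}. if b i then 2 ^ blk i else 0 :: int) = (\<Sum>i\<in>{blk_start n..<blk_start (Suc n)}. 2 ^ n * (if b i then 1 else 0))"
  by (rule sum.cong) (auto simp: blk_eq)
 finally show ?thesis by (simp add: blk_ones_def sum_distrib_left)
qed

lemma dep_bsum: "(!!i. i < n ==> b i = b' i) ==> bsum n b = bsum n b'"
 unfolding bsum_def by (intro sum.cong) auto

context cf_bern
begin

context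
 assumes \<alpha>_blk: "!!i. \<alpha> i = blk_pmf i"
begin

text \<open>Given the bits of the blocks before \<open>n\<close>, the residue of \<open>bsum\<close> modulo \<open>2 ^ (n + 1)\<close>
 determines the parity of the number of ones in block \<open>n\<close>.\<close>

lemma residues_null:
 fixes v :: "nat => int"
 assumes D: "D : sets PB" "!!b m. b : D ==> EX z. bsum (blk_start m) b + 2 ^ m * z : {v m, v m + 1}"
 shows "emeasure PB D = 0"
proof -
 define C where "C n = {b. ALL m. 1 <= m & m <= n --> (EX z. bsum (blk_start m) b + 2 ^ m * z : {v m, v m + 1})}" for n
 have depC: "dep (blk_start n) (C n)" for n
  unfolding dep_def
 proof (intro allI impI)
  fix b b' :: "nat => bool" assume bb: "ALL i<blk_start n. b i = b' i" and b: "b : C n"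
  have "bsum (blk_start m) b = bsum (blk_start m) b'" if "m <= n" for m
   using bb blk_start_mono[OF that] by (intro dep_bsum) simp
  thus "b' : C n" using b by (auto simp: C_def)
 qed
 \<comment> \<open>For \<open>n = 0\<close> the two candidate residues could be adjacent and both
   lie in the window.\<close>
 have step: "measure PB (C (Suc n)) <= 3 / 4 * measure PB (C n)" if n: "n >= 1" for n
 proof -
  \<comment> \<open>The sum before block \<open>n\<close> already hits the window modulo
    \<open>2 ^ (n + 1)\<close>. In this case block \<open>n\<close> must have an even number of ones
    to stay in \<open>C (n + 1)\<close>, otherwise an odd number.\<close>
  define d where "d = {b. EX z. bsum (blk_start n) b + 2 ^ Suc n * z : {v (Suc n), v (Suc n) + 1}}"
  let ?e = "{b. even (blk_ones n b)}"
  have dd: "dep (blk_start n) (C n Int d)" "dep (blk_start n) (C n - d)"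
  proof -
   have d: "b : d \<longleftrightarrow> b' : d" if "ALL i<blk_start n. b i = b' i" for b b'
    using dep_bsum[of "blk_start n" b b'] that by (simp add: d_def)
   show "dep (blk_start n) (C n Int d)" "dep (blk_start n) (C n - d)"
    using depD[OF depC[of n]] d unfolding dep_def by blast+
  qed
  have ed: "dep (blk_start (Suc n)) ?e" "dep (blk_start (Suc n)) (UNIV - ?e)"
  proof -
   have eq: "blk_ones n b = blk_ones n b'" if "ALL i<blk_start (Suc n). b i = b' i" for b b'
    unfolding blk_ones_def by (rule sum.cong) (use that in auto)
   show "dep (blk_start (Suc n)) ?e" unfolding dep_def by (intro allI impI, drule eq, simp)
   show "dep (blk_start (Suc n)) (UNIV - ?e)" unfolding dep_def by (intro allI impI, drule eq, simp)
  qed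
  have ei: "indif (blk_start n) ?e" "indif (blk_start n) (UNIV - ?e)"
  proof -
   have eq: "blk_ones n b = blk_ones n b'" if "ALL i>=blk_start n. b i = b' i" for b b'
    unfolding blk_ones_def by (rule sum.cong) (use that in auto)
   show "indif (blk_start n) ?e" unfolding indif_def by (intro allI impI, drule eq, simp)
   show "indif (blk_start n) (UNIV - ?e)" unfolding indif_def by (intro allI impI, drule eq, simp)
  qed
  have par: "2 * measure PB ?e - 1 = (1 - 2 * (blk_ratio n / (1 + blk_ratio n))) ^ (2 ^ 2 ^ n)"
   unfolding blk_ones_def
  proof (rule fb.parity_measure)
   fix i assume "blk_start n <= i" "i < blk_start n + 2 ^ 2 ^ n"
   hence "blk i = n" by (intro blk_eq) simp_all
   thus "pmf (\<alpha> i) True = blk_ratio n / (1 + blk_ratio n)"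
    using ln_bernoulli_ratio(1)[OF blk_ratio(1)[of n]] by (simp add: \<alpha>_blk blk_pmf_def)
  qed
  have eq: "1 - 2 * (blk_ratio n / (1 + blk_ratio n)) = (1 - blk_ratio n) / (1 + blk_ratio n)"
   using blk_ratio(1)[of n] by (simp add: field_simps)
  have "0 <= (1 - blk_ratio n) / (1 + blk_ratio n)" "(1 - blk_ratio n) / (1 + blk_ratio n) <= 1 / (1 + blk_ratio n)"
   using blk_ratio(1,2)[of n] by (simp_all add: divide_right_mono)
  hence "((1 - blk_ratio n) / (1 + blk_ratio n)) ^ (2 ^ 2 ^ n) <= (1 / (1 + blk_ratio n)) ^ (2 ^ 2 ^ n)" "0 <= ((1 - blk_ratio n) / (1 + blk_ratio n)) ^ (2 ^ 2 ^ n)"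
   by (simp_all add: power_mono)
  \<comment> \<open>The mean sign lies between 0 and 1/2, so either parity has probability at most
    3/4.\<close>
  hence e1: "measure PB ?e <= 3 / 4" "measure PB ?e >= 1 / 2" using par[unfolded eq] blk_power_le[of n] by linarith+
  have e2: "measure PB (UNIV - ?e) <= 3 / 4" using PB.prob_compl[OF dep_sets[OF ed(1)]] e1(2) by simp
  have "C (Suc n) \<subseteq> ((C n Int d) Int ?e) Un ((C n - d) Int (UNIV - ?e))"
  proof
   fix b assume b: "b : C (Suc n)"
   hence bn: "b : C n" by (simp add: C_def)
   have all: "ALL m. 1 <= m & m <= Suc n --> (EX z. bsum (blk_start m) b + 2 ^ m * z : {v m, v m + 1})"
    using b by (simp only: C_def mem_Collect_eq)
   have "1 <= Suc n & Suc n <= Suc n" by simp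
   from mp[OF spec[OF all, of "Suc n"] this]
   obtain z where "bsum (blk_start (Suc n)) b + 2 ^ Suc n * z : {v (Suc n), v (Suc n) + 1}" by (elim exE)
   hence z: "bsum (blk_start n) b + 2 ^ n * blk_ones n b + 2 ^ Suc n * z : {v (Suc n), v (Suc n) + 1}"
    by (simp only: bsum_Suc)
   show "b : ((C n Int d) Int ?e) Un ((C n - d) Int (UNIV - ?e))"
   proof (cases "even (blk_ones n b)")
    case True
    then obtain c where "blk_ones n b = 2 * c" by (elim evenE)
    hence "2 ^ n * blk_ones n b + 2 ^ Suc n * z = 2 ^ Suc n * (c + z)" by (simp add: algebra_simps)
    hence "b : d" using z unfolding d_def add.assoc by (simp only: mem_Collect_eq) blast
    thus ?thesis using bn True by simp
   next
    case False
    then obtain c where c: "blk_ones n b = 2 * c + 1" by (elim oddE)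
    \<comment> \<open>With an odd count the two sums differ by an odd multiple of
      \<open>2 ^ n\<close>, hence by at least 2, and do not fit into one window.\<close>
    have "b ~: d"
    proof
     assume "b : d"
     then obtain z' where "bsum (blk_start n) b + 2 ^ Suc n * z' : {v (Suc n), v (Suc n) + 1}" by (auto simp: d_def)
     hence "\<bar>(bsum (blk_start n) b + 2 ^ n * blk_ones n b + 2 ^ Suc n * z) - (bsum (blk_start n) b + 2 ^ Suc n * z')\<bar> <= 1" using z by auto
     moreover have "(bsum (blk_start n) b + 2 ^ n * blk_ones n b + 2 ^ Suc n * z) - (bsum (blk_start n) b + 2 ^ Suc n * z') = 2 ^ n * (2 * (c + z - z') + 1)"
      by (simp add: c algebra_simps)
     ultimately have "2 ^ n * \<bar>2 * (c + z - z') + 1\<bar> <= (1 :: int)" by (simp add: abs_mult)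
     moreover have "(2 :: int) ^ 1 <= 2 ^ n" using n by (intro power_increasing) simp_all
     moreover have "1 <= \<bar>2 * (c + z - z') + 1\<bar>" by presburger
     ultimately show False using mult_mono[of "2 :: int" "2 ^ n" 1 "\<bar>2 * (c + z - z') + 1\<bar>"] by simp
    qed
    thus ?thesis using bn False by simp
   qed
  qed
  hence "measure PB (C (Suc n)) <= measure PB (((C n Int d) Int ?e) Un ((C n - d) Int (UNIV - ?e)))"
   using dep_sets[OF dd(1)] dep_sets[OF dd(2)] dep_sets[OF ed(1)] dep_sets[OF ed(2)] by (intro PB.finite_measure_mono) auto
  also have "... <= measure PB ((C n Int d) Int ?e) + measure PB ((C n - d) Int (UNIV - ?e))"
   using dep_sets[OF dd(1)] dep_sets[OF dd(2)] dep_sets[OF ed(1)] dep_sets[OF ed(2)] by (intro measure_Un_le) auto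
  also have "... = measure PB (C n Int d) * measure PB ?e + measure PB (C n - d) * measure PB (UNIV - ?e)"
   by (simp only: bern_dep_indif_measure[OF dep_sets[OF ed(1)] ei(1) dd(1)] bern_dep_indif_measure[OF dep_sets[OF ed(2)] ei(2) dd(2)])
  also have "... <= measure PB (C n Int d) * (3 / 4) + measure PB (C n - d) * (3 / 4)"
   using e1(1) e2 by (intro add_mono mult_left_mono) simp_all
  also have "... = 3 / 4 * (measure PB (C n Int d) + measure PB (C n - d))" by (simp add: algebra_simps)
  also have "measure PB (C n Int d) + measure PB (C n - d) = measure PB (C n)"
  proof -
   have "(C n Int d) Int (C n - d) = {}" by blast
   moreover have "(C n Int d) Un (C n - d) = C n" by blast
   ultimately show ?thesis using PB.finite_measure_Union[OF dep_sets[OF dd(1)] dep_sets[OF dd(2)]] by simp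
  qed
  finally show ?thesis .
 qed
 have "measure PB (C (Suc n)) <= (3 / 4) ^ n" for n
 proof (induction n)
  case 0
  thus ?case by simp
 next
  case (Suc n)
  thus ?case using step[of "Suc n"] by simp
 qed
 moreover have "measure PB D <= measure PB (C n)" for n
  using D(2) by (intro PB.finite_measure_mono dep_sets[OF depC]) (auto simp: C_def)
 ultimately have le: "measure PB D <= (3 / 4) ^ n" for n by (meson order_trans)
 have "measure PB D = 0"
 proof (rule ccontr)
  assume "measure PB D ~= 0"
  hence "measure PB D > 0" using measure_nonneg[of PB D] by linarith
  then obtain n where "(3 / 4) ^ n < measure PB D" using real_arch_pow_inv[of "measure PB D" "3 / 4"] by auto
  thus False using le[of n] by simp
 qed
 thus ?thesis by (simp add: PB.emeasure_eq_measure)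
qed

text \<open>Modulo \<open>2 ^ m\<close> the quantity \<open>t / ln 2\<close> plus the sum over the
  blocks before \<open>m\<close> is constant along the skew relation. The flow rotates it on a
  circle of length \<open>2 ^ m * ln 2\<close> in time; the set is an arc of this circle.\<close>

definition Ew :: "nat => int => real => ((nat => bool) \<times> real) set" where
 "Ew m j w = {(b, t). EX z :: int. of_int j <= t / ln 2 + of_int (bsum (blk_start m) b + 2 ^ m * z) &
   t / ln 2 + of_int (bsum (blk_start m) b + 2 ^ m * z) < of_int j + w}"

lemma Ew_SB: "Ew m j w : sets SB"
proof (rule SB_I)
 have s: "(%b. real_of_int (bsum n b)) : borel_measurable PB" for n
 proof -
  have "Measurable.pred PB (%b. b i)" for i using measurable_bern_component[of i \<alpha>] .
  hence "(%b. \<Sum>i<n. if b i then 2 ^ blk i else 0 :: real) : borel_measurable PB" by measurable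
  moreover have "(%b. \<Sum>i<n. if b i then 2 ^ blk i else 0 :: real) = (%b. real_of_int (bsum n b))"
   by (rule ext) (simp add: bsum_def of_int_sum if_distrib cong: if_cong)
  ultimately show ?thesis by (simp only:)
 qed
 have f: "(%p. snd p / ln 2 + (real_of_int (bsum (blk_start m) (fst p)) + 2 ^ m * of_int z)) : borel_measurable (PB \<Otimes>\<^sub>M lborel)" for z :: int
  by (intro borel_measurable_add borel_measurable_divide measurable_compose[OF measurable_fst s] borel_measurable_const)
   (simp add: measurable_snd)
 have "{p\<in>space (PB \<Otimes>\<^sub>M lborel). EX z :: int. of_int j <= snd p / ln 2 + (real_of_int (bsum (blk_start m) (fst p)) + 2 ^ m * of_int z) &
   snd p / ln 2 + (real_of_int (bsum (blk_start m) (fst p)) + 2 ^ m * of_int z) < of_int j + w} : sets (PB \<Otimes>\<^sub>M lborel)"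
 proof (rule sets.sets_Collect_countable_Ex)
  fix z :: int
  let ?F = "%p. snd p / ln 2 + (real_of_int (bsum (blk_start m) (fst p)) + 2 ^ m * of_int z)"
  have bs: "{of_int j..<of_int j + w} : sets borel" by simp
  have "?F -` {of_int j..<of_int j + w} Int space (PB \<Otimes>\<^sub>M lborel) = {p\<in>space (PB \<Otimes>\<^sub>M lborel). of_int j <= ?F p & ?F p < of_int j + w}" by auto
  thus "{p\<in>space (PB \<Otimes>\<^sub>M lborel). of_int j <= ?F p & ?F p < of_int j + w} : sets (PB \<Otimes>\<^sub>M lborel)"
   using measurable_sets[OF f[of z] bs] by (simp only:)
 qed
 moreover have "{p\<in>space (PB \<Otimes>\<^sub>M lborel). EX z :: int. of_int j <= snd p / ln 2 + (real_of_int (bsum (blk_start m) (fst p)) + 2 ^ m * of_int z) &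
   snd p / ln 2 + (real_of_int (bsum (blk_start m) (fst p)) + 2 ^ m * of_int z) < of_int j + w} = Ew m j w"
  by (simp add: Ew_def space_pair_measure split_def)
 ultimately show "Ew m j w : sets (PB \<Otimes>\<^sub>M lborel)" by (simp only:)
 fix b b' :: "nat => bool" and t assume bb: "(b, b') : tail_relation" and "(b, t) : Ew m j w"
 then obtain z :: int where z: "of_int j <= t / ln 2 + of_int (bsum (blk_start m) b + 2 ^ m * z)"
  "t / ln 2 + of_int (bsum (blk_start m) b + 2 ^ m * z) < of_int j + w" by (auto simp: Ew_def)
 obtain n0 where "!!i. i >= n0 ==> b i = b' i" using bb by (auto simp: tail_iff)
 hence n: "tail_ratio \<alpha> b b' = part_ratio \<alpha> (max n0 (blk_start m)) b b'" (is "_ = part_ratio \<alpha> ?n b b'") by (intro fb.tail_ratio_eq) simp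
 have ri: "r i = - ln 2 * of_int (2 ^ blk i)" for i
  using ln_bernoulli_ratio(3)[OF blk_ratio(1)[of "blk i"]] blk_ratio(3)[of "blk i"] by (simp add: \<alpha>_blk blk_pmf_def)
 have l: "ln (tail_ratio \<alpha> b b') = - ln 2 * of_int (bsum ?n b - bsum ?n b')"
  unfolding n bsum_def by (rule fb.ln_part_ratio) (rule ri)
 obtain u u' where u: "bsum ?n b = bsum (blk_start m) b + 2 ^ m * u" "bsum ?n b' = bsum (blk_start m) b' + 2 ^ m * u'"
  using bsum_split[of m ?n b] bsum_split[of m ?n b'] by auto
 have "(t - ln (tail_ratio \<alpha> b b')) / ln 2 = t / ln 2 + of_int (bsum ?n b - bsum ?n b')" unfolding l by (simp add: field_simps)
 hence "(t - ln (tail_ratio \<alpha> b b')) / ln 2 + of_int (bsum (blk_start m) b' + 2 ^ m * (z + u' - u)) = t / ln 2 + of_int (bsum (blk_start m) b + 2 ^ m * z)"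
  by (simp add: u algebra_simps)
 thus "(b', t - ln (tail_ratio \<alpha> b b')) : Ew m j w" unfolding Ew_def using z by (simp only: mem_Collect_eq prod.case) metis
qed

lemma Ew_cover: "EX j. p : Ew m j 1"
proof -
 obtain b t where p: "p = (b, t)" by (cases p)
 let ?x = "t / ln 2 + of_int (bsum (blk_start m) b + 2 ^ m * 0)"
 have "of_int \<lfloor>?x\<rfloor> <= ?x" "?x < of_int \<lfloor>?x\<rfloor> + 1" by linarith+
 hence "p : Ew m \<lfloor>?x\<rfloor> 1" unfolding Ew_def p by blast
 thus ?thesis ..
qed

text \<open>A time below \<open>ln 2\<close> advances the quantity by less than 1, hence the doubled
  width.\<close>

lemma Ew_shift:
 assumes s: "0 <= s" "s < ln 2" shows "Ew m j 1 \<subseteq> shift_flow s -` Ew m j 2 Int space SB"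
proof
 fix p assume "p : Ew m j 1"
 moreover obtain b t where p: "p = (b, t)" by (cases p)
 ultimately obtain z :: int where z: "of_int j <= t / ln 2 + of_int (bsum (blk_start m) b + 2 ^ m * z)"
  "t / ln 2 + of_int (bsum (blk_start m) b + 2 ^ m * z) < of_int j + 1" by (auto simp: Ew_def)
 have "(t + s) / ln 2 = t / ln 2 + s / ln 2" "0 <= s / ln 2" "s / ln 2 < 1" using s by (simp_all add: add_divide_distrib)
 hence "of_int j <= (t + s) / ln 2 + of_int (bsum (blk_start m) b + 2 ^ m * z)"
  "(t + s) / ln 2 + of_int (bsum (blk_start m) b + 2 ^ m * z) < of_int j + 2" using z by linarith+
 hence "(b, t + s) : Ew m j 2" unfolding Ew_def by blast
 thus "p : shift_flow s -` Ew m j 2 Int space SB" by (simp add: p SB_facts)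
qed

text \<open>At a fixed \<open>t\<close> a window of width 2 admits two consecutive integers for each
  \<open>m\<close>, which is the situation of \<open>residues_null\<close>.\<close>

lemma Ew_Inter_null: "(\<Inter>m. Ew m (j m) 2) : null_sets SB"
proof -
 have A: "(\<Inter>m. Ew m (j m) 2) : sets SB" using Ew_SB by (intro sets.countable_INT) auto
 have "(\<Inter>m. Ew m (j m) 2) : null_sets (PB \<Otimes>\<^sub>M lborel)"
 proof (rule null_by_sections_snd[OF fb.sigma_finite_bern SB_D(1)[OF A]])
  fix t
  show "emeasure PB {b. (b, t) : (\<Inter>m. Ew m (j m) 2)} = 0"
  proof (rule residues_null[where v = "%m. \<lceil>of_int (j m) - t / ln 2\<rceil>"])
   show "{b. (b, t) : (\<Inter>m. Ew m (j m) 2)} : sets PB" using sets_Pair2[OF SB_D(1)[OF A], of t] by (simp add: vimage_def)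
   fix b m assume "b : {b. (b, t) : (\<Inter>m. Ew m (j m) 2)}"
   hence "(b, t) : Ew m (j m) 2" by simp
   then obtain z :: int where z: "of_int (j m) <= t / ln 2 + of_int (bsum (blk_start m) b + 2 ^ m * z)"
    "t / ln 2 + of_int (bsum (blk_start m) b + 2 ^ m * z) < of_int (j m) + 2" by (auto simp: Ew_def)
   let ?k = "bsum (blk_start m) b + 2 ^ m * z" and ?v = "\<lceil>of_int (j m) - t / ln 2\<rceil>"
   have "?v <= ?k" using z(1) by (simp add: ceiling_le_iff algebra_simps)
   moreover have "of_int ?k < (of_int ?v + 2 :: real)" using z(2) le_of_int_ceiling[of "of_int (j m) - t / ln 2"] by linarith
   hence "?k < ?v + 2" by linarith
   ultimately have "?k : {?v, ?v + 1}" by auto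
   thus "EX z. bsum (blk_start m) b + 2 ^ m * z : {?v, ?v + 1}" ..
  qed
 qed
 thus ?thesis using A by (simp add: SB_facts)
qed

text \<open>On the time axis of a single orbit, one time selects a window for every
  \<open>m\<close>. During the next \<open>ln 2\<close> units of time the windows of double width
  all contain the orbit, although their intersection is null.\<close>

lemma no_transitive_flow:
 assumes iso: "isomorphic_flows SB shift_flow W V" and V: "nonsingular_flow W V" and tr: "transitive_flow W V"
 shows False
proof -
 have nonnull: "space SB ~: null_sets SB"
 proof
  assume "space SB : null_sets SB"
  hence "space SB : null_sets (PB \<Otimes>\<^sub>M (lborel :: real measure))" unfolding SB_facts mem_Collect_eq by (rule conjunct1)
  hence "emeasure (PB \<Otimes>\<^sub>M (lborel :: real measure)) (UNIV \<times> UNIV) = 0" by (simp add: null_sets_def SB_facts)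
  moreover have "emeasure (PB \<Otimes>\<^sub>M (lborel :: real measure)) (UNIV \<times> UNIV) = emeasure PB UNIV * emeasure (lborel :: real measure) UNIV"
   using sets.top[of PB] by (intro lborel.emeasure_pair_measure_Times) simp_all
  ultimately show False using PB.emeasure_space_1 by simp
 qed
 obtain \<Theta> :: "((nat => bool) \<times> real) set => real => bool" where
  a: "ALL A:sets SB. {t. \<Theta> A t} : sets borel" "ALL A:null_sets SB. AE t in lborel. \<not> \<Theta> A t"
   "ALL A:sets SB. AE t in lborel. \<Theta> (space SB - A) t \<longleftrightarrow> \<not> \<Theta> A t"
   "ALL A :: nat => ((nat => bool) \<times> real) set. range A \<subseteq> sets SB --> (AE t in lborel. \<Theta> (\<Union>i. A i) t \<longleftrightarrow> (EX i. \<Theta> (A i) t))"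
   "ALL s. ALL A:sets SB. AE t in lborel. \<Theta> (shift_flow s -` A Int space SB) t \<longleftrightarrow> \<Theta> A (t + s)"
  using transitive_realization[OF iso V tr nonnull] by (elim exE conjE) (rule that; assumption)
 note \<Theta>m = a(1)[rule_format] and \<Theta>0 = a(2)[rule_format] and \<Theta>c = a(3)[rule_format] and \<Theta>u = a(4)[rule_format] and \<Theta>s = a(5)[rule_format]
 have mono: "AE t in lborel. \<Theta> A t --> \<Theta> B t" if "A : sets SB" "B : sets SB" "A \<subseteq> B" for A B
 proof -
  let ?A = "%i :: nat. if i = 0 then A else B"
  have "(\<Union>i. ?A i) = B" using that(3) by (auto split: if_splits)
  moreover have "AE t in lborel. \<Theta> (\<Union>i. ?A i) t \<longleftrightarrow> (EX i. \<Theta> (?A i) t)" using that by (intro \<Theta>u) auto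
  ultimately have "AE t in lborel. \<Theta> B t \<longleftrightarrow> (EX i. \<Theta> (?A i) t)" by simp
  thus ?thesis
  proof eventually_elim
   case (elim t)
   have "\<Theta> (?A 0) t ==> \<Theta> B t" using elim by blast
   thus ?case by simp
  qed
 qed
 have full: "AE t in lborel. \<Theta> (space SB) t"
  using \<Theta>c[of "{}"] \<Theta>0[of "{}"] by (auto elim: AE_mp)
 have cover: "AE t in lborel. EX j. \<Theta> (Ew m j 1) t" for m
 proof -
  have "(\<Union>i. Ew m (int_decode i) 1) = space SB"
  proof -
   have "p : (\<Union>i. Ew m (int_decode i) 1)" for p
   proof -
    obtain j where "p : Ew m j 1" using Ew_cover by blast
    thus ?thesis by (intro UN_I[of "int_encode j"]) simp_all
   qed
   thus ?thesis by (auto simp: SB_facts)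
  qed
  moreover have "AE t in lborel. \<Theta> (\<Union>i. Ew m (int_decode i) 1) t \<longleftrightarrow> (EX i. \<Theta> (Ew m (int_decode i) 1) t)"
   using Ew_SB by (intro \<Theta>u) auto
  ultimately show ?thesis using full by (auto elim: AE_mp)
 qed
 \<comment> \<open>For each \<open>s\<close> the inclusion holds at almost all \<open>t\<close>;
   Fubini makes one \<open>t\<close> serve for almost all \<open>s\<close>.\<close>
 have fub: "AE t in lborel. AE s in lborel. 0 <= s & s < ln 2 --> \<Theta> (Ew m j 1) t --> \<Theta> (Ew m j 2) (t + s)" for m j
 proof -
  have s0: "AE t in lborel. 0 <= s & s < ln 2 --> \<Theta> (Ew m j 1) t --> \<Theta> (Ew m j 2) (t + s)" for s
  proof (cases "0 <= s & s < ln 2")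
   case True
   have S: "shift_flow s -` Ew m j 2 Int space SB : sets SB" using SB_flow_ok Ew_SB by (simp add: flow_ok_def)
   show ?thesis using mono[OF Ew_SB S Ew_shift] \<Theta>s[OF Ew_SB, of s m j 2] True by (auto elim: AE_mp)
  next
   case False
   thus ?thesis by (intro AE_I2) blast
  qed
  have 1: "AE s in lborel. AE t in lborel. 0 <= s & s < ln 2 --> \<Theta> (Ew m j 1) t --> \<Theta> (Ew m j 2) (t + s)" by (rule AE_I2) (rule s0)
  have [measurable]: "Measurable.pred borel (\<Theta> (Ew m j 1))" "Measurable.pred borel (\<Theta> (Ew m j 2))"
   using \<Theta>m[OF Ew_SB] by (simp_all add: pred_def)
  have "{p : space (lborel \<Otimes>\<^sub>M lborel). 0 <= fst p & fst p < ln 2 --> \<Theta> (Ew m j 1) (snd p) --> \<Theta> (Ew m j 2) (snd p + fst p)} : sets (lborel \<Otimes>\<^sub>M lborel)"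
   by measurable
  from lborel_pair.AE_commute[OF this] 1 show ?thesis by simp
 qed
 have "AE t in lborel. ALL m. EX j. \<Theta> (Ew m j 1) t" using cover by (subst AE_all_countable) blast
 moreover have "AE t in lborel. ALL m j. AE s in lborel. 0 <= s & s < ln 2 --> \<Theta> (Ew m j 1) t --> \<Theta> (Ew m j 2) (t + s)"
  using fub by (simp add: AE_all_countable)
 ultimately have "AE t in lborel. (ALL m. EX j. \<Theta> (Ew m j 1) t) & (ALL m j. AE s in lborel. 0 <= s & s < ln 2 --> \<Theta> (Ew m j 1) t --> \<Theta> (Ew m j 2) (t + s))"
  by (rule AE_conjI)
 moreover have "ae_filter (lborel :: real measure) ~= bot" by (simp add: ae_filter_eq_bot_iff)
 ultimately have "EX t. (ALL m. EX j. \<Theta> (Ew m j 1) t) & (ALL m j. AE s in lborel. 0 <= s & s < ln 2 --> \<Theta> (Ew m j 1) t --> \<Theta> (Ew m j 2) (t + s))"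
  by (rule eventually_happens'[rotated])
 then obtain t where t: "ALL m. EX j. \<Theta> (Ew m j 1) t"
  "ALL m j. AE s in lborel. 0 <= s & s < ln 2 --> \<Theta> (Ew m j 1) t --> \<Theta> (Ew m j 2) (t + s)"
  by (elim exE conjE) (rule that; assumption)
 from choice[OF t(1)] obtain j where j: "ALL m. \<Theta> (Ew m (j m) 1) t" by (elim exE)
 have "AE s in lborel. ALL m. 0 <= s & s < ln 2 --> \<Theta> (Ew m (j m) 2) (t + s)"
  unfolding AE_all_countable
 proof
  fix m
  show "AE s in lborel. 0 <= s & s < ln 2 --> \<Theta> (Ew m (j m) 2) (t + s)"
   using t(2)[rule_format, of m "j m"] j by (auto elim: eventually_mono)
 qed
 moreover have "AE s in lborel. EX m. \<not> \<Theta> (Ew m (j m) 2) (s + t)"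
 proof (rule AE_lborel_translate)
  let ?I = "\<Inter>m. Ew m (j m) 2"
  have I: "?I : sets SB" using Ew_Inter_null by blast
  have "space SB - ?I = (\<Union>m. space SB - Ew m (j m) 2)" by blast
  moreover have "AE s in lborel. \<Theta> (\<Union>m. space SB - Ew m (j m) 2) s \<longleftrightarrow> (EX m. \<Theta> (space SB - Ew m (j m) 2) s)"
   using Ew_SB by (intro \<Theta>u) auto
  ultimately have "AE s in lborel. \<Theta> (space SB - ?I) s \<longleftrightarrow> (EX m. \<Theta> (space SB - Ew m (j m) 2) s)" by (simp only:)
  moreover have "AE s in lborel. ALL m. \<Theta> (space SB - Ew m (j m) 2) s \<longleftrightarrow> \<not> \<Theta> (Ew m (j m) 2) s"
   unfolding AE_all_countable using \<Theta>c[OF Ew_SB] by blast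
  ultimately show "AE s in lborel. EX m. \<not> \<Theta> (Ew m (j m) 2) s"
   using \<Theta>c[OF I] \<Theta>0[OF Ew_Inter_null[of j]]
  proof eventually_elim
   case (elim s)
   thus ?case by (simp only:) blast
  qed
 qed
 ultimately have "AE s in lborel. s ~: {0..<ln 2 :: real}" by eventually_elim (auto simp: add.commute)
 hence "emeasure lborel {0..<ln 2 :: real} = 0" using AE_iff_null_sets[of "{0..<ln 2 :: real}" lborel] by (simp add: null_sets_def)
 thus False by simp
qed

text \<open>Every other type has a transitive associated flow, a flow on one point trivially
  so.\<close>

lemma type_III_zero_M: "type_III_zero M R"
proof -
 have no: "\<not> transitive_flow W V" if "nonsingular_flow W V" "is_associated_flow M R W V" for W :: "real measure" and V
  using no_transitive_flow[OF associated_flow_M_converse[OF that(2)] that(1)] by blast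
 have one: "transitive_flow W V" if "nonsingular_flow W V" "space W = {x}" for W :: "real measure" and V x
 proof -
  have "V 0 x = x" using that by (simp add: nonsingular_flow_def)
  hence "AE y in W. EX t. y = V t x" using that(2) by (intro AE_I2) (auto intro: exI[of _ 0])
  thus ?thesis using that(2) by (auto simp: transitive_flow_def)
 qed
 show ?thesis
  unfolding type_III_zero_def
 proof (intro conjI)
  show "ergodic_nonsingular_relation M R" by (rule ergodic_nonsingular_relation_R)
  show "\<not> type_II M R" using no by (auto simp: type_II_def)
  show "\<nexists>l. type_III_proper M R l" using no by (auto simp: type_III_proper_def)
  show "\<not> type_III_one M R"
  proof
   assume "type_III_one M R"
   then obtain W :: "real measure" and V x where "nonsingular_flow W V" "is_associated_flow M R W V" "space W = {x}"
    unfolding type_III_one_def by (elim exE conjE) (rule that; assumption)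
   thus False using no[of W V] one[of W V x] by simp
  qed
 qed
qed

end

end

section \<open>Choice of the laws and proof of the theorem\<close>

lemma nonatomic_bern_bounded:
 assumes le: "!!i b. pmf (\<alpha> i) b <= \<theta>" and "\<theta> < 1" shows "nonatomic (bern \<alpha>)"
proof (rule nonatomic_bernI)
 fix e :: real assume e: "e > 0"
 have "0 <= pmf (\<alpha> 0) True" by simp
 hence "0 <= \<theta>" using le[of 0 True] by linarith
 obtain n where n: "\<theta> ^ n < e" using real_arch_pow_inv[OF e \<open>\<theta> < 1\<close>] by blast
 have le': "(\<Prod>i<n. pmf (\<alpha> i) (b i)) <= \<theta> ^ n" for b
  using prod_mono[of "{..<n}" "%i. pmf (\<alpha> i) (b i)" "%_. \<theta>"] by (simp add: le)
 have "(\<Prod>i<n. pmf (\<alpha> i) (b i)) < e" for b by (rule order_le_less_trans[OF le' n])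
 thus "EX n. ALL b. (\<Prod>i<n. pmf (\<alpha> i) (b i)) < e" by blast
qed

lemma pmf_bernoulli_ratio_le:
 assumes "0 < c" "c <= x" "x <= 1" shows "pmf (bernoulli_pmf (x / (1 + x))) b <= 1 / (1 + c)"
proof -
 have x: "x > 0" using assms by linarith
 have "x / (1 + x) <= 1 / (1 + x)" using assms x by (simp add: divide_right_mono)
 moreover have "1 / (1 + x) <= 1 / (1 + c)" using assms by (simp add: frac_le)
 ultimately show ?thesis using ln_bernoulli_ratio(1,2)[OF x] by (cases b) simp_all
qed

theorem proposition5p3:
  fixes h :: "nat \<Rightarrow> int"
    and F C \<Gamma> :: "nat \<Rightarrow> int set"
    and \<nu> :: "(nat \<Rightarrow> int set) measure"
  assumes "h 0 = 1"
    and "\<And>n. h (Suc n) = 4 * h n + 2 ^ (n + 1)"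
    and "\<And>n. F n = {0..h n - 1}"
    and "\<And>n. C (Suc n) = {0, h n, 2 * h n + 2 ^ (n + 1), 3 * h n + 2 ^ (n + 1)}"
    and "\<And>k. \<Gamma> k = range (\<lambda>z. 2 ^ k * z)"
    and "haar_measure \<Gamma> \<nu>"
  shows
    "(\<forall>(W :: 'v measure) V. finitary_AT_flow W V \<longrightarrow>
       (\<exists>\<mu>. cf_measure F C \<mu> \<and>
          (cf_quasi_invariant F C \<mu> \<and> rank_one (cf_system F C \<mu>) (cf_act F C)) \<and>
          is_associated_flow (cf_system F C \<mu>)
            (orbit_relation (cf_system F C \<mu>) (cf_act F C)) W V \<and>
          (measure_equivalent (distr \<mu> \<nu> (cf_odometer_map \<Gamma>)) \<nu> \<and>
           factor_map (cf_system F C \<mu>) (cf_act F C) \<nu> (odometer_act \<Gamma>) (cf_odometer_map \<Gamma>)) \<and>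
          maximal_odometer_factor (cf_system F C \<mu>) (cf_act F C) \<Gamma> \<nu> \<and>
          (uncountable_to_one (cf_system F C \<mu>) \<nu> (cf_odometer_map \<Gamma>) \<and>
           \<not> is_odometer (cf_system F C \<mu>) (cf_act F C)))) \<and>
     (\<forall>l :: real. 0 \<le> l \<and> l \<le> 1 \<longrightarrow>
       (\<exists>\<mu>. cf_measure F C \<mu> \<and>
          krieger_type_III (cf_system F C \<mu>) (cf_act F C) l \<and>
          (cf_quasi_invariant F C \<mu> \<and> rank_one (cf_system F C \<mu>) (cf_act F C)) \<and>
          (measure_equivalent (distr \<mu> \<nu> (cf_odometer_map \<Gamma>)) \<nu> \<and>
           factor_map (cf_system F C \<mu>) (cf_act F C) \<nu> (odometer_act \<Gamma>) (cf_odometer_map \<Gamma>)) \<and>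
          maximal_odometer_factor (cf_system F C \<mu>) (cf_act F C) \<Gamma> \<nu> \<and>
          (uncountable_to_one (cf_system F C \<mu>) \<nu> (cf_odometer_map \<Gamma>) \<and>
           \<not> is_odometer (cf_system F C \<mu>) (cf_act F C))))"
proof -
 have loc: "cf_haar h F C \<Gamma> \<alpha> \<nu>" if "!!n. set_pmf (\<alpha> n) = UNIV" "nonatomic (bern \<alpha>)" for \<alpha>
  by (intro cf_haar.intro cf_bern.intro cf_example.intro cf_bern_axioms.intro cf_haar_axioms.intro) (fact assms that)+
 show ?thesis
 proof (intro conjI allI impI)
  fix W :: "'v measure" and V assume "finitary_AT_flow W V"
  then obtain \<alpha> :: "nat => bool pmf" where \<alpha>: "ALL n. set_pmf (\<alpha> n) = UNIV" "nonatomic (bern \<alpha>)"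
   "is_associated_flow (bern \<alpha>) tail_relation W V"
   unfolding finitary_AT_flow_def bern_def[symmetric] by (elim exE conjE) (rule that; assumption)
  interpret cf_haar h F C \<Gamma> \<alpha> \<nu> by (rule loc) (use \<alpha> in simp_all)
  show "EX \<mu>. cf_measure F C \<mu> &
     (cf_quasi_invariant F C \<mu> & rank_one (cf_system F C \<mu>) (cf_act F C)) &
     is_associated_flow (cf_system F C \<mu>)
      (orbit_relation (cf_system F C \<mu>) (cf_act F C)) W V &
     (measure_equivalent (distr \<mu> \<nu> (cf_odometer_map \<Gamma>)) \<nu> &
      factor_map (cf_system F C \<mu>) (cf_act F C) \<nu> (odometer_act \<Gamma>) (cf_odometer_map \<Gamma>)) &
     maximal_odometer_factor (cf_system F C \<mu>) (cf_act F C) \<Gamma> \<nu> &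
     (uncountable_to_one (cf_system F C \<mu>) \<nu> (cf_odometer_map \<Gamma>) &
      \<not> is_odometer (cf_system F C \<mu>) (cf_act F C))"
   by (intro exI[of _ \<mu>] conjI cf_measure_\<mu> cf_quasi_invariant_\<mu> rank_one_M associated_flow_M_of_tail \<alpha>(3)
     equiv_distr_\<mu> factor_map_\<pi> maximal_\<nu> uncountable_to_one_\<pi> not_odometer)
 next
  fix l :: real assume l: "0 <= l & l <= 1"
  have concl: "EX \<mu>. cf_measure F C \<mu> &
     krieger_type_III (cf_system F C \<mu>) (cf_act F C) l &
     (cf_quasi_invariant F C \<mu> & rank_one (cf_system F C \<mu>) (cf_act F C)) &
     (measure_equivalent (distr \<mu> \<nu> (cf_odometer_map \<Gamma>)) \<nu> &
      factor_map (cf_system F C \<mu>) (cf_act F C) \<nu> (odometer_act \<Gamma>) (cf_odometer_map \<Gamma>)) &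
     maximal_odometer_factor (cf_system F C \<mu>) (cf_act F C) \<Gamma> \<nu> &
     (uncountable_to_one (cf_system F C \<mu>) \<nu> (cf_odometer_map \<Gamma>) &
      \<not> is_odometer (cf_system F C \<mu>) (cf_act F C))"
   (is "EX \<mu>. ?Q \<mu>")
   if X: "cf_haar h F C \<Gamma> \<alpha> \<nu>"
    and K: "krieger_type_III (cf_system F C (cf_bern.\<mu> h F C \<alpha>)) (cf_act F C) l" for \<alpha>
  proof -
   interpret cf_haar h F C \<Gamma> \<alpha> \<nu> by (rule X)
   show ?thesis
    by (intro exI[of _ \<mu>] conjI K cf_measure_\<mu> cf_quasi_invariant_\<mu> rank_one_M
      equiv_distr_\<mu> factor_map_\<pi> maximal_\<nu> uncountable_to_one_\<pi> not_odometer)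
  qed
  consider "l = 0" | "l = 1" | "0 < l" "l < 1" using l by linarith
  thus "EX \<mu>. ?Q \<mu>"
  proof cases
   case 1
   have X: "cf_haar h F C \<Gamma> blk_pmf \<nu>"
    by (intro loc nonatomic_blk) (simp add: blk_pmf_def ln_bernoulli_ratio(4)[OF blk_ratio(1)])
   interpret cf_haar h F C \<Gamma> blk_pmf \<nu> by (rule X)
   show ?thesis
    by (rule concl[OF X]) (use nonsingular_M type_III_zero_M[OF refl] 1 in \<open>simp add: krieger_type_III_def\<close>)
  next
   case 2
   \<comment> \<open>The steps of the logarithmic cocycle alternate between \<open>- 1\<close> and
     \<open>- sqrt 2\<close>, which generate a dense group of reals.\<close>
   define x :: "nat => real" where "x i = (if even i then exp (- 1) else exp (- sqrt 2))" for i
   define \<alpha> where "\<alpha> i = bernoulli_pmf (x i / (1 + x i))" for i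
   have x: "x i > 0" for i by (simp add: x_def)
   have "sqrt 2 <= (2 :: real)" by (rule real_le_lsqrt) simp_all
   hence "exp (- 2) <= x i" "x i <= 1" for i by (simp_all add: x_def)
   hence "pmf (\<alpha> i) b <= 1 / (1 + exp (- 2))" for i b unfolding \<alpha>_def by (intro pmf_bernoulli_ratio_le) simp_all
   hence "nonatomic (bern \<alpha>)" by (rule nonatomic_bern_bounded) (simp add: add_pos_pos)
   hence X: "cf_haar h F C \<Gamma> \<alpha> \<nu>" by (intro loc) (simp_all add: \<alpha>_def ln_bernoulli_ratio(4)[OF x])
   interpret cf_haar h F C \<Gamma> \<alpha> \<nu> by (rule X)
   have r: "ln (pmf (\<alpha> 0) True / pmf (\<alpha> 0) False) = - 1" "ln (pmf (\<alpha> 1) True / pmf (\<alpha> 1) False) = - sqrt 2"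
    unfolding \<alpha>_def ln_bernoulli_ratio(3)[OF x] by (simp_all add: x_def)
   have "type_III_one M (orbit_relation M T)"
   proof (rule type_III_one_M)
    show "\<alpha> (i + 2) = \<alpha> i" for i by (simp add: \<alpha>_def x_def)
    fix y e :: real assume "e > 0"
    then obtain k m :: int where "\<bar>y - (of_int k + of_int m * sqrt 2)\<bar> < e" using sqrt2_dense by blast
    hence "\<bar>y - (of_int (- k) * - 1 + of_int (- m) * - sqrt 2)\<bar> < e" by simp
    thus "EX k m :: int. \<bar>y - (of_int k * ln (pmf (\<alpha> 0) True / pmf (\<alpha> 0) False) + of_int m * ln (pmf (\<alpha> 1) True / pmf (\<alpha> 1) False))\<bar> < e"
     unfolding r by blast
   qed
   thus ?thesis
    by (intro concl[OF X]) (use nonsingular_M 2 in \<open>simp add: krieger_type_III_def\<close>)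
  next
   case 3
   define \<alpha> where "\<alpha> i = bernoulli_pmf (l / (1 + l))" for i :: nat
   have "pmf (\<alpha> i) b <= 1 / (1 + l)" for i b unfolding \<alpha>_def using 3 by (intro pmf_bernoulli_ratio_le) simp_all
   hence "nonatomic (bern \<alpha>)" by (rule nonatomic_bern_bounded) (use 3 in simp)
   hence X: "cf_haar h F C \<Gamma> \<alpha> \<nu>" by (intro loc) (simp_all add: \<alpha>_def ln_bernoulli_ratio(4)[OF 3(1)])
   interpret cf_haar h F C \<Gamma> \<alpha> \<nu> by (rule X)
   show ?thesis
    by (rule concl[OF X]) (use nonsingular_M type_III_proper_M[OF 3 \<alpha>_def] 3 in \<open>simp add: krieger_type_III_def\<close>)
  qed
 qed
qed

end
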